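(* Let $\mathcal{O}=\{t_1,\dots,t_\mu\}$ be an order ideal in $\mathbb{T}^n$, and let $\mathcal{H}=(H_0,H_1,\dots)$ be an $(n,\mu)$-admissible Hilbert function which dominates $\mathrm{HF}^a_{\mathcal{O}}$. Let $\{\mathcal{O}'_1,\dots,\mathcal{O}'_\ell\}$ be the set of all order ideals in $\mathbb{T}^n$ with affine Hilbert function $\mathcal{H}$. For $i=1,\dots,\ell$, let $J_{\mathcal{O}'_i}\subseteq K[C'_i]$ be the ideal $\mathrm{SCBLocus}(\mathcal{O}'_i)$, and let $I^{\mathrm{dfb}}_{\mathcal{O}\mathcal{O}'_i}$ and $J_i$ be the ideals of $K[C]$ obtained from $J_{\mathcal{O}'_i}$ by the combination procedure (both $\mathrm{SCBLocus}$ and the combination procedure are defined in the context). Then for the ideal $$I^{\mathrm{NSCB}}_{\mathcal{O}}=\sum_{i=1}^\ell\Bigl(\bigl(I^{\mathrm{dfb}}_{\mathcal{O}\mathcal{O}'_i}+I(\mathbb{B}_{\mathcal{O}}(\overline{\mathcal{H}}))\bigr)\cap\bigl(J_i+I(\mathbb{B}_{\mathcal{O}}(\overline{\mathcal{H}}))\bigr)\Bigr)$$ of $K[C]$, the set $\mathbb{B}_{\mathcal{O}}(\overline{\mathcal{H}})\setminus\mathcal{Z}(I^{\mathrm{NSCB}}_{\mathcal{O}})$ contains precisely the $K$-rational points of $\mathbb{B}_{\mathcal{O}}(\mathcal{H})$ which represent schemes having the strict Cayley-Bacharach property.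
   Context: $K$ is an arbitrary field, $P=K[x_1,\dots,x_n]$, and $\mathbb{T}^n$ is the monoid of terms (power products) in $x_1,\dots,x_n$. An order ideal is a finite set $\mathcal{O}=\{t_1,\dots,t_\mu\}\subset\mathbb{T}^n$ with $\mu\ge 1$ containing every divisor in $\mathbb{T}^n$ of each of its elements; it is always ordered so that $\deg(t_1)\le\cdots\le\deg(t_\mu)$, hence $t_1=1$. Its border is $\partial\mathcal{O}=(x_1\mathcal{O}\cup\cdots\cup x_n\mathcal{O})\setminus\mathcal{O}=\{b_1,\dots,b_\nu\}$, and its affine Hilbert function is $\mathrm{HF}^a_{\mathcal{O}}(i)=\#\{j\mid\deg(t_j)\le i\}$. Let $C=\{c_{ij}\mid 1\le i\le\mu,\ 1\le j\le\nu\}$ be new indeterminates (the coordinates of $\mathbb{B}_{\mathcal{O}}$). The $r$-th generic multiplication matrix $\mathcal{A}_r=(a^{(r)}_{ij})\in\mathrm{Mat}_\mu(K[C])$ has $a^{(r)}_{ij}=\delta_{im}$ (Kronecker delta) if $x_rt_j=t_m$ and $a^{(r)}_{ij}=c_{im}$ if $x_rt_j=b_m$. $I(\mathbb{B}_{\mathcal{O}})\subseteq K[C]$ is generated by the entries of all commutators $\mathcal{A}_r\mathcal{A}_s-\mathcal{A}_s\mathcal{A}_r$, and the border basis scheme $\mathbb{B}_{\mathcal{O}}\subseteq\mathrm{Spec}(K[C])$ is the closed subscheme it defines. For a $K$-rational point $\Gamma=(\gamma_{ij})$ of $\mathbb{B}_{\mathcal{O}}$, let $I_\Gamma\subset P$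 be generated by $b_j-\sum_i\gamma_{ij}t_i$; $\Gamma$ represents the 0-dimensional scheme $\mathbb{X}_\Gamma\subset\mathbb{A}^n_K$ with vanishing ideal $I_\Gamma$, and $R_\Gamma=P/I_\Gamma$. All of this applies likewise to other order ideals $\mathcal{O}'$, with coordinates denoted $C'=\{c'_{\kappa\lambda}\}$. For a term $t=x_1^{\alpha_1}\cdots x_n^{\alpha_n}$, $t(M_1,\dots,M_n)=M_1^{\alpha_1}\cdots M_n^{\alpha_n}$; $\mathrm{adj}$ is the adjugate matrix; $\mathcal{Z}(\cdot)$ is the zero locus. For a 0-dimensional $\mathbb{X}\subset\mathbb{A}^n_K$ with $R_{\mathbb{X}}=P/I_{\mathbb{X}}$, let $F_iR_{\mathbb{X}}$ be the image of the polynomials of degree $\le i$; $\mathrm{HF}^a_{\mathbb{X}}(i)=\mathrm{HF}^a_{R_{\mathbb{X}}}(i)=\dim_K F_iR_{\mathbb{X}}$; $\mathrm{ord}_{\mathcal{F}}(f)=\min\{i\mid f\in F_iR_{\mathbb{X}}\}$ for $f\ne 0$; $\mathrm{ri}(R_{\mathbb{X}})=\min\{i\in\mathbb{Z}\mid F_jR_{\mathbb{X}}=R_{\mathbb{X}}\text{ for all }j\ge i\}$. Cayley-Bacharach property: let $I_{\mathbb{X}}=\mathfrak{Q}_1\cap\cdots\cap\mathfrak{Q}_s$ be the primary decomposition with $\mathfrak{Q}_i$ being $\mathfrak{M}_i$-primary, $\mathfrak{M}_i$ maximal, with image $\mathfrak{m}_i$ in $R_{\mathbb{X}}$. A minimal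 $\mathfrak{Q}_i$-divisor of $I_{\mathbb{X}}$ is an ideal $J=\mathfrak{Q}_1\cap\cdots\cap\mathfrak{Q}'_i\cap\cdots\cap\mathfrak{Q}_s$ with $\mathfrak{Q}_i\subset\mathfrak{Q}'_i\subseteq\mathfrak{M}_i$ (for $\mathfrak{Q}_i=\mathfrak{M}_i$ one takes $\mathfrak{Q}'_i=P$) and $\dim_K(\mathfrak{Q}'_i/\mathfrak{Q}_i)=\dim_K(P/\mathfrak{M}_i)$. Put $\mathrm{ri}(J/I_{\mathbb{X}})=\max\{\mathrm{ord}_{\mathcal{F}}(f)\mid f\in J/I_{\mathbb{X}}\setminus\{0\}\}$, and let $\mathrm{sepdeg}(\mathfrak{m}_i)$ be the minimum of $\mathrm{ri}(J/I_{\mathbb{X}})$ over all minimal $\mathfrak{Q}_i$-divisors $J$. $R_{\mathbb{X}}$ has the Cayley-Bacharach property if $\mathrm{sepdeg}(\mathfrak{m}_i)=\mathrm{ri}(R_{\mathbb{X}})$ for all $i$. $\mathbb{X}$ has the strict Cayley-Bacharach property if the associated graded ring $\bigoplus_iF_iR_{\mathbb{X}}/F_{i-1}R_{\mathbb{X}}\cong P/\mathrm{DF}(I_{\mathbb{X}})$ has the Cayley-Bacharach property, where $\mathrm{DF}(I_{\mathbb{X}})$ is generated by the top-degree homogeneous components of the non-zero elements of $I_{\mathbb{X}}$. A sequence $(H_i)$ dominates $(H'_i)$ if $H_i\ge H'_i$ for all $i\ge 0$ (strictly, if they moreover differ); $\mathcal{H}$ is $(n,\mu)$-admissible if $\mathcal{H}=\mathrm{HF}^a_{\mathbb{X}}$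 for some 0-dimensional $\mathbb{X}\subset\mathbb{A}^n_K$ of length $\mu$. $\mathbb{B}_{\mathcal{O}}(\overline{\mathcal{H}})$ is the closed subscheme of $\mathbb{B}_{\mathcal{O}}$ which is the closure of the set of $K$-rational points $\Gamma$ with $\mathrm{HF}^a_{R_\Gamma}$ dominated by $\mathcal{H}$; $\mathbb{B}_{\mathcal{O}}(\mathcal{H})$ is the complement in it of the closure of the set of those $\Gamma$ with $\mathrm{HF}^a_{R_\Gamma}$ strictly dominated by $\mathcal{H}$ (so its $K$-rational points are the $\Gamma$ with $\mathrm{HF}^a_{R_\Gamma}=\mathcal{H}$). Ideals: for a sequence $\mathcal{G}=(G_0,G_1,\dots)$ dominating $\mathrm{HF}^a_{\mathcal{O}}$ with $\sigma=\min\{i\mid G_i=\mu\}$, $I(\mathbb{B}_{\mathcal{O}}(\overline{\mathcal{G}}))=I(\mathbb{B}_{\mathcal{O}})+\sum_{i=1}^{\sigma-1}D_i$, where $D_i$ is generated by the minors of size $G_i+1$ of the matrix whose columns are the first columns of $u(\mathcal{A}_1,\dots,\mathcal{A}_n)$, $u$ ranging over the terms of degree $\le i$ (minors of size exceeding the matrix contribute the zero ideal). With $\rho=\min\{i\mid H_i=\mu\}$ and $\mathcal{H}'_i$ obtained from $\mathcal{H}$ by replacing $H_i$ with $H_i-1$, $I(Z_{\mathcal{O}}(\overline{\mathcal{H}}))=\bigcap I(\mathbb{B}_{\mathcal{O}}(\overline{\mathcal{H}'_i}))$, where the intersection is over $i\in\{1,\dots,\rho\}$ with $H_i-1\ge\mathrm{HF}^a_{\mathcal{O}}(i)$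 (empty intersection $=\langle 1\rangle$). $\mathrm{SCBLocus}(\mathcal{O}')$ for an order ideal $\mathcal{O}'=\{t'_1,\dots,t'_\mu\}$ with border $\{b'_\lambda\}$ and coordinates $C'=\{c'_{\kappa\lambda}\}$: let $I(\mathbb{B}^{\mathrm{df}}_{\mathcal{O}'})$ be $I(\mathbb{B}_{\mathcal{O}'})$ plus the ideal generated by all $c'_{\kappa\lambda}$ with $\deg(t'_\kappa)>\deg(b'_\lambda)$; let $M^{\mathrm{hom}}_{t'_i}$ be the matrix $t'_i$ evaluated at the generic multiplication matrices for $\mathcal{O}'$ with all $c'_{\kappa\lambda}$ such that $\deg(t'_\kappa)\ne\deg(b'_\lambda)$ set to zero; let $\Delta=\#\{i\mid\deg(t'_i)=\deg(t'_\mu)\}$; for $j=1,\dots,\Delta$ let $V_j$ be the matrix whose $i$-th column is the $(\mu-\Delta+j)$-th column of $(M^{\mathrm{hom}}_{t'_i})^{\mathrm{tr}}$; then $\mathrm{SCBLocus}(\mathcal{O}')$ is $I(\mathbb{B}^{\mathrm{df}}_{\mathcal{O}'})$ plus the ideal of maximal minors of the block column matrix $\mathrm{Col}(V_1,\dots,V_\Delta)$. Combination procedure: for $\mathcal{O}'_i=\{t'_1,\dots,t'_\mu\}$ with border $\{b'_\lambda\}$, coordinates $C'_i=\{c'_{\kappa\lambda}\}$ and $J_{\mathcal{O}'_i}=\langle a_{i1},\dots,a_{ir_i}\rangle$, let $T'\in\mathrm{Mat}_\mu(K[C])$ be the matrix whose $\kappa$-th column is the first column of $t'_\kappa(\mathcal{A}_1,\dots,\mathcal{A}_n)$,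 let $\delta_i=\det(T')$, let $B'_\lambda$ be the first column of $b'_\lambda(\mathcal{A}_1,\dots,\mathcal{A}_n)$, and let $p_{\kappa\lambda}\in K[C]$ be the $\kappa$-th entry of $\mathrm{adj}(T')B'_\lambda$. Let $a^\ast_{ij}\in K[C'_i][z]$ be the homogenization of $a_{ij}$ with respect to a new indeterminate $z$, and $\hat a_{ij}\in K[C]$ the result of substituting $c'_{\kappa\lambda}\mapsto p_{\kappa\lambda}$, $z\mapsto\delta_i$ in it. Then $J_i=\langle\hat a_{i1},\dots,\hat a_{ir_i}\rangle$ and $I^{\mathrm{dfb}}_{\mathcal{O}\mathcal{O}'_i}=I(Z_{\mathcal{O}}(\overline{\mathcal{H}}))\cap\langle\delta_i\rangle$. Conventions: $K$-rational points are to be read as $L$-rational points over field extensions $L\supseteq K$, e.g. $L=\overline{K}$ (in particular closures are formed using $\overline{K}$-rational points); subschemes and their defining ideals are considered up to radical. *)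

theory Defs
  imports
    "HOL-Library.Poly_Mapping"
    "HOL-Algebra.Algebraic_Closure_Type"
    "HOL-Algebra.Embedded_Algebras"
    "HOL-Algebra.QuotRing"
    "Jordan_Normal_Form.Determinant"
    "Jordan_Normal_Form.DL_Submatrix"
begin

section \<open>Polynomial rings\<close>

text \<open>
  A power product is a finitely supported exponent function; the monoid of power products is
  written additively. The indeterminates of \<open>P = K[x\<^sub>1,\<dots>,x\<^sub>n]\<close> are numbered by \<open>0,\<dots>,n-1\<close>.
\<close>

type_synonym 'v pp = "'v \<Rightarrow>\<^sub>0 nat"
type_synonym ('v, 'k) mpoly = "'v pp \<Rightarrow>\<^sub>0 'k"

definition pp_deg :: "'v pp \<Rightarrow> nat" where
  "pp_deg t = (\<Sum>v\<in>Poly_Mapping.keys t. poly_mapping.lookup t v)"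

definition mconst :: "'k \<Rightarrow> ('v, 'k::comm_ring_1) mpoly" where
  "mconst c = Poly_Mapping.single 0 c"

definition mvar :: "'v \<Rightarrow> ('v, 'k::comm_ring_1) mpoly" where
  "mvar v = Poly_Mapping.single (Poly_Mapping.single v 1) 1"

definition mpoly_ring :: "'v set \<Rightarrow> ('v, 'k::comm_ring_1) mpoly ring" where
  "mpoly_ring V =
     ring_of_type_algebra\<lparr>carrier := {p. \<forall>t\<in>Poly_Mapping.keys p. Poly_Mapping.keys t \<subseteq> V}\<rparr>"

abbreviation xring :: "nat \<Rightarrow> (nat, 'k::comm_ring_1) mpoly ring" where
  "xring n \<equiv> mpoly_ring {..<n}"

text \<open>The degree of the zero polynomial is set to \<open>0\<close>.\<close>

definition mdeg :: "('v, 'k::zero) mpoly \<Rightarrow> nat" where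
  "mdeg p = Max (insert 0 (pp_deg ` Poly_Mapping.keys p))"

definition hom_component :: "nat \<Rightarrow> ('v, 'k::comm_ring_1) mpoly \<Rightarrow> ('v, 'k) mpoly" where
  "hom_component d p =
     (\<Sum>t\<in>{t\<in>Poly_Mapping.keys p. pp_deg t = d}. Poly_Mapping.single t (poly_mapping.lookup p t))"

definition mpoly_eval ::
    "('k \<Rightarrow> 'r) \<Rightarrow> ('v \<Rightarrow> 'r) \<Rightarrow> ('v, 'k::comm_ring_1) mpoly \<Rightarrow> 'r::comm_ring_1" where
  "mpoly_eval h s p =
     (\<Sum>t\<in>Poly_Mapping.keys p. h (poly_mapping.lookup p t) * (\<Prod>v\<in>Poly_Mapping.keys t. s v ^ poly_mapping.lookup t v))"

abbreviation mpoly_subst ::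
    "('v \<Rightarrow> ('w, 'k) mpoly) \<Rightarrow> ('v, 'k::comm_ring_1) mpoly \<Rightarrow> ('w, 'k) mpoly" where
  "mpoly_subst \<equiv> mpoly_eval mconst"

text \<open>
  In \<open>homogenize\<close> the new indeterminate \<open>z\<close> is \<open>None\<close> and the old indeterminate \<open>v\<close> is \<open>Some v\<close>.
\<close>

definition homogenize :: "('v, 'k::comm_ring_1) mpoly \<Rightarrow> ('v option, 'k) mpoly" where
  "homogenize p =
     (\<Sum>t\<in>Poly_Mapping.keys p.
        Poly_Mapping.single
          ((\<Sum>v\<in>Poly_Mapping.keys t. Poly_Mapping.single (Some v) (poly_mapping.lookup t v)) +
           Poly_Mapping.single None (mdeg p - pp_deg t))
          (poly_mapping.lookup p t))"


section \<open>Zero-dimensional schemes and the Cayley-Bacharach property\<close>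

definition zero_dim_ideal :: "nat \<Rightarrow> nat \<Rightarrow> (nat, 'k::Fields.field) mpoly set \<Rightarrow> bool" where
  "zero_dim_ideal n \<mu> I \<longleftrightarrow> ideal I (xring n) \<and> \<mu> \<ge> 1 \<and>
     ring.dimension (xring n Quot I) \<mu>
       ((\<lambda>c. I +>\<^bsub>xring n\<^esub> mconst c) ` UNIV) (carrier (xring n Quot I))"

definition deg_filt :: "nat \<Rightarrow> (nat, 'k::Fields.field) mpoly set \<Rightarrow> nat \<Rightarrow> (nat, 'k) mpoly set set"
where
  "deg_filt n I i = {I +>\<^bsub>xring n\<^esub> f | f. f \<in> carrier (xring n) \<and> mdeg f \<le> i}"

definition affine_HF :: "nat \<Rightarrow> (nat, 'k::Fields.field) mpoly set \<Rightarrow> nat \<Rightarrow> nat" where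
  "affine_HF n I i =
     ring.dim (xring n Quot I) ((\<lambda>c. I +>\<^bsub>xring n\<^esub> mconst c) ` UNIV) (deg_filt n I i)"

definition admissible :: "'k::Fields.field itself \<Rightarrow> nat \<Rightarrow> nat \<Rightarrow> (nat \<Rightarrow> nat) \<Rightarrow> bool" where
  "admissible TYPE('k) n \<mu> H \<longleftrightarrow>
     (\<exists>I :: (nat, 'k) mpoly set. zero_dim_ideal n \<mu> I \<and> affine_HF n I = H)"

definition filt_ord ::
    "nat \<Rightarrow> (nat, 'k::Fields.field) mpoly set \<Rightarrow> (nat, 'k) mpoly set \<Rightarrow> nat" where
  "filt_ord n I f = (LEAST i. f \<in> deg_filt n I i)"

text \<open>
  As \<open>P/I \<noteq> 0\<close> and \<open>F\<^sub>i = 0\<close> for \<open>i < 0\<close>, the regularity index is non-negative, so that the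
  minimum may be taken over the natural numbers.
\<close>

definition reg_index :: "nat \<Rightarrow> (nat, 'k::Fields.field) mpoly set \<Rightarrow> nat" where
  "reg_index n I = (LEAST i. \<forall>j\<ge>i. deg_filt n I j = carrier (xring n Quot I))"

definition ideal_radical :: "('a, 'b) ring_scheme \<Rightarrow> 'a set \<Rightarrow> 'a set" where
  "ideal_radical R I = {a \<in> carrier R. \<exists>k::nat. a [^]\<^bsub>R\<^esub> k \<in> I}"

definition primary_ideal :: "('a, 'b) ring_scheme \<Rightarrow> 'a set \<Rightarrow> bool" where
  "primary_ideal R Q \<longleftrightarrow> ideal Q R \<and> Q \<noteq> carrier R \<and>
     (\<forall>a\<in>carrier R. \<forall>b\<in>carrier R. a \<otimes>\<^bsub>R\<^esub> b \<in> Q \<longrightarrow> a \<in> Q \<or> b \<in> ideal_radical R Q)"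

text \<open>
  Since the radicals are maximal and pairwise distinct, such a decomposition is automatically
  irredundant, and it is unique.
\<close>

definition primary_decomposition :: "('a, 'b) ring_scheme \<Rightarrow> 'a set \<Rightarrow> 'a set set \<Rightarrow> bool" where
  "primary_decomposition R I \<Q> \<longleftrightarrow> finite \<Q> \<and> \<Q> \<noteq> {} \<and> I = \<Inter>\<Q> \<and>
     (\<forall>Q\<in>\<Q>. primary_ideal R Q \<and> maximalideal (ideal_radical R Q) R) \<and>
     inj_on (ideal_radical R) \<Q>"

definition minimal_divisors ::
    "nat \<Rightarrow> (nat, 'k::Fields.field) mpoly set set \<Rightarrow> (nat, 'k) mpoly set \<Rightarrow> (nat, 'k) mpoly set set"
where
  "minimal_divisors n \<Q> Q =
     (let P = xring n; M = ideal_radical P Q in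
      {carrier P \<inter> Q' \<inter> \<Inter>(\<Q> - {Q}) | Q'.
         ideal Q' P \<and>
         (if Q = M then Q' = carrier P else Q \<subset> Q' \<and> Q' \<subseteq> M) \<and>
         (\<exists>d. ring.dimension (P Quot Q) d ((\<lambda>c. Q +>\<^bsub>P\<^esub> mconst c) ` UNIV) ((\<lambda>f. Q +>\<^bsub>P\<^esub> f) ` Q') \<and>
              ring.dimension (P Quot M) d ((\<lambda>c. M +>\<^bsub>P\<^esub> mconst c) ` UNIV) (carrier (P Quot M)))})"

definition divisor_ri ::
    "nat \<Rightarrow> (nat, 'k::Fields.field) mpoly set \<Rightarrow> (nat, 'k) mpoly set \<Rightarrow> nat" where
  "divisor_ri n I J =
     Max (filt_ord n I ` (((\<lambda>f. I +>\<^bsub>xring n\<^esub> f) ` J) - {\<zero>\<^bsub>xring n Quot I\<^esub>}))"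

definition sepdeg ::
    "nat \<Rightarrow> (nat, 'k::Fields.field) mpoly set \<Rightarrow> (nat, 'k) mpoly set set \<Rightarrow> (nat, 'k) mpoly set \<Rightarrow> nat"
where
  "sepdeg n I \<Q> Q = Min (divisor_ri n I ` minimal_divisors n \<Q> Q)"

definition cayley_bacharach :: "nat \<Rightarrow> (nat, 'k::Fields.field) mpoly set \<Rightarrow> bool" where
  "cayley_bacharach n I \<longleftrightarrow>
     (\<exists>\<Q>. primary_decomposition (xring n) I \<Q> \<and> (\<forall>Q\<in>\<Q>. sepdeg n I \<Q> Q = reg_index n I))"

definition degree_form_ideal ::
    "nat \<Rightarrow> (nat, 'k::Fields.field) mpoly set \<Rightarrow> (nat, 'k) mpoly set" where
  "degree_form_ideal n I = Idl\<^bsub>xring n\<^esub> {hom_component (mdeg f) f | f. f \<in> I \<and> f \<noteq> 0}"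

definition strict_cayley_bacharach :: "nat \<Rightarrow> (nat, 'k::Fields.field) mpoly set \<Rightarrow> bool" where
  "strict_cayley_bacharach n I \<longleftrightarrow> cayley_bacharach n (degree_form_ideal n I)"


section \<open>Order ideals and border basis schemes\<close>

definition terms :: "nat \<Rightarrow> nat pp set" where
  "terms n = {t. Poly_Mapping.keys t \<subseteq> {..<n}}"

definition order_ideal :: "nat \<Rightarrow> nat pp set \<Rightarrow> bool" where
  "order_ideal n \<O> \<longleftrightarrow> finite \<O> \<and> \<O> \<noteq> {} \<and> \<O> \<subseteq> terms n \<and>
     (\<forall>u\<in>terms n. \<forall>v\<in>terms n. u + v \<in> \<O> \<longrightarrow> u \<in> \<O>)"

definition border :: "nat \<Rightarrow> nat pp set \<Rightarrow> nat pp set" where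
  "border n \<O> = (\<Union>r<n. (\<lambda>t. Poly_Mapping.single r 1 + t) ` \<O>) - \<O>"

definition order_ideal_HF :: "nat pp set \<Rightarrow> nat \<Rightarrow> nat" where
  "order_ideal_HF \<O> i = card {t\<in>\<O>. pp_deg t \<le> i}"

text \<open>
  An order ideal \<open>ts = [t\<^sub>1,\<dots>,t\<^sub>\<mu>]\<close>, ordered by non-decreasing degree, together with an
  enumeration \<open>bs = [b\<^sub>1,\<dots>,b\<^sub>\<nu>]\<close> of its border. All indices start at \<open>0\<close>; the indeterminate
  \<open>c\<^sub>i\<^sub>j\<close> is the pair \<open>(i, j)\<close>.
\<close>

definition enum_order_ideal :: "nat \<Rightarrow> nat pp list \<Rightarrow> nat pp list \<Rightarrow> bool" where
  "enum_order_ideal n ts bs \<longleftrightarrow>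
     order_ideal n (set ts) \<and> distinct ts \<and> sorted (map pp_deg ts) \<and>
     distinct bs \<and> set bs = border n (set ts)"

abbreviation cring_of ::
    "nat pp list \<Rightarrow> nat pp list \<Rightarrow> (nat \<times> nat, 'k::comm_ring_1) mpoly ring" where
  "cring_of ts bs \<equiv> mpoly_ring ({..<length ts} \<times> {..<length bs})"

definition gen_mult_mat ::
    "nat pp list \<Rightarrow> nat pp list \<Rightarrow> nat \<Rightarrow> (nat \<times> nat, 'k::comm_ring_1) mpoly mat" where
  "gen_mult_mat ts bs r = mat (length ts) (length ts) (\<lambda>(i, j).
     let t = Poly_Mapping.single r 1 + ts ! j in
     if t \<in> set ts then (if t = ts ! i then 1 else 0)
     else mvar (i, THE m. m < length bs \<and> bs ! m = t))"

text \<open>\<open>t(M\<^sub>1,\<dots>,M\<^sub>n)\<close>, the factors being multiplied in this order, for \<open>\<mu> \<times> \<mu>\<close>-matrices.\<close>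

definition eval_term :: "nat \<Rightarrow> nat \<Rightarrow> (nat \<Rightarrow> 'r::comm_ring_1 mat) \<Rightarrow> nat pp \<Rightarrow> 'r mat" where
  "eval_term \<mu> n M t = foldr (\<lambda>r N. (M r ^\<^sub>m poly_mapping.lookup t r) * N) [0..<n] (1\<^sub>m \<mu>)"

definition ideal_BO ::
    "nat \<Rightarrow> nat pp list \<Rightarrow> nat pp list \<Rightarrow> (nat \<times> nat, 'k::Fields.field) mpoly set" where
  "ideal_BO n ts bs = Idl\<^bsub>cring_of ts bs\<^esub>
     {(gen_mult_mat ts bs r * gen_mult_mat ts bs s - gen_mult_mat ts bs s * gen_mult_mat ts bs r)
        $$ (i, j) | r s i j. r < n \<and> s < n \<and> i < length ts \<and> j < length ts}"

definition minors :: "nat \<Rightarrow> 'r::comm_ring_1 mat \<Rightarrow> 'r set" where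
  "minors k A = {det (submatrix A I J) | I J.
     I \<subseteq> {..<dim_row A} \<and> J \<subseteq> {..<dim_col A} \<and> card I = k \<and> card J = k}"

definition coord_mat ::
    "nat \<Rightarrow> nat pp list \<Rightarrow> nat pp list \<Rightarrow> nat pp list \<Rightarrow> (nat \<times> nat, 'k::comm_ring_1) mpoly mat"
where
  "coord_mat n ts bs us =
     mat_of_cols (length ts) (map (\<lambda>u. col (eval_term (length ts) n (gen_mult_mat ts bs) u) 0) us)"

text \<open>
  The enumeration of the terms of degree at most \<open>i\<close> only affects the signs of the minors.
\<close>

definition ideal_D ::
    "nat \<Rightarrow> nat pp list \<Rightarrow> nat pp list \<Rightarrow> (nat \<Rightarrow> nat) \<Rightarrow> nat \<Rightarrow>
     (nat \<times> nat, 'k::Fields.field) mpoly set" where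
  "ideal_D n ts bs G i = Idl\<^bsub>cring_of ts bs\<^esub>
     (minors (G i + 1) (coord_mat n ts bs (sorted_list_of_set {u \<in> terms n. pp_deg u \<le> i})))"

text \<open>The sum of a family of ideals is the ideal generated by their union.\<close>

definition ideal_BO_closed ::
    "nat \<Rightarrow> nat pp list \<Rightarrow> nat pp list \<Rightarrow> (nat \<Rightarrow> nat) \<Rightarrow> (nat \<times> nat, 'k::Fields.field) mpoly set"
where
  "ideal_BO_closed n ts bs G =
     (let \<sigma> = (LEAST i. G i = length ts) in
      Idl\<^bsub>cring_of ts bs\<^esub> (ideal_BO n ts bs \<union> (\<Union>i\<in>{1..<\<sigma>}. ideal_D n ts bs G i)))"

definition ideal_ZO ::
    "nat \<Rightarrow> nat pp list \<Rightarrow> nat pp list \<Rightarrow> (nat \<Rightarrow> nat) \<Rightarrow> (nat \<times> nat, 'k::Fields.field) mpoly set"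
where
  "ideal_ZO n ts bs H =
     (let \<rho> = (LEAST i. H i = length ts) in
      carrier (cring_of ts bs) \<inter>
      (\<Inter>i\<in>{i\<in>{1..\<rho>}. order_ideal_HF (set ts) i \<le> H i - 1}.
         ideal_BO_closed n ts bs (H(i := H i - 1))))"


section \<open>Points of border basis schemes\<close>

text \<open>
  For a field extension \<open>\<iota> :: K \<Rightarrow> L\<close>, an \<open>L\<close>-rational point is a \<open>\<mu> \<times> \<nu>\<close>-matrix over \<open>L\<close>.
  \<open>zero_locus\<close> is the set of \<open>L\<close>-rational points of the closed subscheme defined by an ideal
  of \<open>K[C]\<close>, and \<open>closure_ideal\<close> is the defining (radical) ideal in \<open>K[C]\<close> of the Zariski
  closure of a set of points over the algebraic closure of \<open>K\<close>.
\<close>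

definition zero_locus ::
    "('k::Fields.field \<Rightarrow> 'l::Fields.field) \<Rightarrow> nat pp list \<Rightarrow> nat pp list \<Rightarrow>
     (nat \<times> nat, 'k) mpoly set \<Rightarrow> 'l mat set" where
  "zero_locus \<iota> ts bs I =
     {\<Gamma> \<in> carrier_mat (length ts) (length bs). \<forall>f\<in>I. mpoly_eval \<iota> (\<lambda>ij. \<Gamma> $$ ij) f = 0}"

definition closure_ideal ::
    "nat pp list \<Rightarrow> nat pp list \<Rightarrow> 'k::Fields.field alg_closure mat set \<Rightarrow> (nat \<times> nat, 'k) mpoly set"
where
  "closure_ideal ts bs S =
     {f \<in> carrier (cring_of ts bs). \<forall>\<Gamma>\<in>S. mpoly_eval to_ac (\<lambda>ij. \<Gamma> $$ ij) f = 0}"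

definition point_ideal ::
    "nat \<Rightarrow> nat pp list \<Rightarrow> nat pp list \<Rightarrow> 'l::Fields.field mat \<Rightarrow> (nat, 'l) mpoly set" where
  "point_ideal n ts bs \<Gamma> = Idl\<^bsub>xring n\<^esub>
     {Poly_Mapping.single (bs ! j) 1 - (\<Sum>i<length ts. Poly_Mapping.single (ts ! i) (\<Gamma> $$ (i, j)))
        | j. j < length bs}"

definition dominates :: "(nat \<Rightarrow> nat) \<Rightarrow> (nat \<Rightarrow> nat) \<Rightarrow> bool" where
  "dominates H H' \<longleftrightarrow> (\<forall>i. H' i \<le> H i)"

definition BO_closed ::
    "('k::Fields.field \<Rightarrow> 'l::Fields.field) \<Rightarrow> nat \<Rightarrow> nat pp list \<Rightarrow> nat pp list \<Rightarrow> (nat \<Rightarrow> nat) \<Rightarrow>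
     'l mat set" where
  "BO_closed \<iota> n ts bs H = zero_locus \<iota> ts bs (closure_ideal ts bs
     {\<Gamma> \<in> zero_locus to_ac ts bs (ideal_BO n ts bs :: (nat \<times> nat, 'k) mpoly set).
        dominates H (affine_HF n (point_ideal n ts bs \<Gamma>))})"

definition BO_stratum ::
    "('k::Fields.field \<Rightarrow> 'l::Fields.field) \<Rightarrow> nat \<Rightarrow> nat pp list \<Rightarrow> nat pp list \<Rightarrow> (nat \<Rightarrow> nat) \<Rightarrow>
     'l mat set" where
  "BO_stratum \<iota> n ts bs H = BO_closed \<iota> n ts bs H - zero_locus \<iota> ts bs (closure_ideal ts bs
     {\<Gamma> \<in> zero_locus to_ac ts bs (ideal_BO n ts bs :: (nat \<times> nat, 'k) mpoly set).
        dominates H (affine_HF n (point_ideal n ts bs \<Gamma>)) \<and>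
        affine_HF n (point_ideal n ts bs \<Gamma>) \<noteq> H})"


section \<open>The ideal of the locus of schemes without the strict Cayley-Bacharach property\<close>

definition ideal_BO_df ::
    "nat \<Rightarrow> nat pp list \<Rightarrow> nat pp list \<Rightarrow> (nat \<times> nat, 'k::Fields.field) mpoly set" where
  "ideal_BO_df n ts bs = Idl\<^bsub>cring_of ts bs\<^esub> (ideal_BO n ts bs \<union>
     {mvar (\<kappa>, l) | \<kappa> l. \<kappa> < length ts \<and> l < length bs \<and> pp_deg (ts ! \<kappa>) > pp_deg (bs ! l)})"

definition hom_mult_mat ::
    "nat pp list \<Rightarrow> nat pp list \<Rightarrow> nat \<Rightarrow> (nat \<times> nat, 'k::comm_ring_1) mpoly mat" where
  "hom_mult_mat ts bs r = map_mat
     (mpoly_subst (\<lambda>(\<kappa>, l). if pp_deg (ts ! \<kappa>) = pp_deg (bs ! l) then mvar (\<kappa>, l) else 0))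
     (gen_mult_mat ts bs r)"

definition SCB_Delta :: "nat pp list \<Rightarrow> nat" where
  "SCB_Delta ts = card {i. i < length ts \<and> pp_deg (ts ! i) = pp_deg (ts ! (length ts - 1))}"

definition SCB_V ::
    "nat \<Rightarrow> nat pp list \<Rightarrow> nat pp list \<Rightarrow> nat \<Rightarrow> (nat \<times> nat, 'k::comm_ring_1) mpoly mat" where
  "SCB_V n ts bs j = mat_of_cols (length ts)
     (map (\<lambda>t. col (transpose_mat (eval_term (length ts) n (hom_mult_mat ts bs) t))
                  (length ts - SCB_Delta ts + j)) ts)"

definition SCB_Col ::
    "nat \<Rightarrow> nat pp list \<Rightarrow> nat pp list \<Rightarrow> (nat \<times> nat, 'k::comm_ring_1) mpoly mat" where
  "SCB_Col n ts bs = mat (SCB_Delta ts * length ts) (length ts)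
     (\<lambda>(a, k). SCB_V n ts bs (a div length ts) $$ (a mod length ts, k))"

definition SCBLocus ::
    "nat \<Rightarrow> nat pp list \<Rightarrow> nat pp list \<Rightarrow> (nat \<times> nat, 'k::Fields.field) mpoly set" where
  "SCBLocus n ts bs = Idl\<^bsub>cring_of ts bs\<^esub> (ideal_BO_df n ts bs \<union>
     (let A = SCB_Col n ts bs in minors (min (dim_row A) (dim_col A)) A))"

text \<open>
  The combination procedure, for the order ideal \<open>ts'\<close> with border \<open>bs'\<close>: \<open>comb_delta\<close> is
  \<open>\<delta>\<close>, \<open>comb_p\<close> is \<open>p\<^sub>\<kappa>\<^sub>\<lambda>\<close>, and \<open>comb_hat\<close> maps \<open>a\<close> to the polynomial obtained from its
  homogenization.
\<close>

definition comb_delta ::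
    "nat \<Rightarrow> nat pp list \<Rightarrow> nat pp list \<Rightarrow> nat pp list \<Rightarrow> (nat \<times> nat, 'k::comm_ring_1) mpoly" where
  "comb_delta n ts bs ts' = det (coord_mat n ts bs ts')"

definition comb_p ::
    "nat \<Rightarrow> nat pp list \<Rightarrow> nat pp list \<Rightarrow> nat pp list \<Rightarrow> nat pp list \<Rightarrow>
     nat \<times> nat \<Rightarrow> (nat \<times> nat, 'k::comm_ring_1) mpoly" where
  "comb_p n ts bs ts' bs' = (\<lambda>(\<kappa>, l).
     (adj_mat (coord_mat n ts bs ts') *\<^sub>v
      col (eval_term (length ts) n (gen_mult_mat ts bs) (bs' ! l)) 0) $ \<kappa>)"

definition comb_hat ::
    "nat \<Rightarrow> nat pp list \<Rightarrow> nat pp list \<Rightarrow> nat pp list \<Rightarrow> nat pp list \<Rightarrow>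
     (nat \<times> nat, 'k::comm_ring_1) mpoly \<Rightarrow> (nat \<times> nat, 'k) mpoly" where
  "comb_hat n ts bs ts' bs' a =
     mpoly_subst (case_option (comb_delta n ts bs ts') (comb_p n ts bs ts' bs')) (homogenize a)"

definition ideal_dfb ::
    "nat \<Rightarrow> nat pp list \<Rightarrow> nat pp list \<Rightarrow> (nat \<Rightarrow> nat) \<Rightarrow> nat pp list \<Rightarrow>
     (nat \<times> nat, 'k::Fields.field) mpoly set" where
  "ideal_dfb n ts bs H ts' =
     ideal_ZO n ts bs H \<inter> Idl\<^bsub>cring_of ts bs\<^esub> {comb_delta n ts bs ts'}"

definition ideal_J ::
    "nat \<Rightarrow> nat pp list \<Rightarrow> nat pp list \<Rightarrow> nat pp list \<Rightarrow> nat pp list \<Rightarrow>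
     (nat \<times> nat, 'k::Fields.field) mpoly list \<Rightarrow> (nat \<times> nat, 'k) mpoly set" where
  "ideal_J n ts bs ts' bs' as = Idl\<^bsub>cring_of ts bs\<^esub> (comb_hat n ts bs ts' bs' ` set as)"

text \<open>
  The order ideals \<open>\<O>'\<^sub>1,\<dots>,\<O>'\<^sub>\<ell>\<close>, their borders, and the generators of the ideals
  \<open>J\<^sub>\<O>\<^sub>'\<^sub>i\<close> to which the combination procedure is applied are given as families.
\<close>

definition ideal_NSCB ::
    "nat \<Rightarrow> nat pp list \<Rightarrow> nat pp list \<Rightarrow> (nat \<Rightarrow> nat) \<Rightarrow> nat \<Rightarrow>
     (nat \<Rightarrow> nat pp list) \<Rightarrow> (nat \<Rightarrow> nat pp list) \<Rightarrow>
     (nat \<Rightarrow> (nat \<times> nat, 'k::Fields.field) mpoly list) \<Rightarrow> (nat \<times> nat, 'k) mpoly set" where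
  "ideal_NSCB n ts bs H l ts' bs' as = Idl\<^bsub>cring_of ts bs\<^esub> (\<Union>i<l.
     (ideal_dfb n ts bs H (ts' i) <+>\<^bsub>cring_of ts bs\<^esub> ideal_BO_closed n ts bs H) \<inter>
     (ideal_J n ts bs (ts' i) (bs' i) (as i) <+>\<^bsub>cring_of ts bs\<^esub> ideal_BO_closed n ts bs H))"

end

theory Submission
  imports Defs "Jordan_Normal_Form.Char_Poly"
begin

text \<open>
  Let \<open>\<Gamma>\<close> be a point of the border basis scheme. Because the multiplication matrices commute, the
  order ideal is a basis of the residue class ring \<open>R\<^sub>\<Gamma>\<close> (\<open>point_ideal_iff\<close>), and the first column of
  \<open>u(A\<^sub>1,\<dots>,A\<^sub>n)\<close> is the coordinate vector of the term \<open>u\<close>. Rank conditions on these columns therefore describe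
  the Hilbert function (\<open>nonzero_coord_minor_iff\<close>). In particular a bound for the Hilbert function is a
  closed condition, and at a point with Hilbert function exactly \<open>H\<close> a product of non-zero minors of sizes
  \<open>H i\<close> vanishes at all points with a smaller one (\<open>separating_polynomial\<close>). This computes the zeros of the
  ideal \<open>I(Z(H))\<close> (\<open>zero_locus_ZO_iff\<close>). The strata are defined by closures of sets of geometric points,
  while \<open>\<Gamma>\<close> may be a point over any extension field; Hilbert's Nullstellensatz, in the form that \<open>\<Gamma>\<close>
  specializes to a geometric point at which a given polynomial stays non-zero (\<open>point_specialization\<close>), mediates
  between the two (\<open>BO_stratum_iff\<close>).

  Now let \<open>\<Gamma>\<close> have the Hilbert function \<open>H\<close>. By Macaulay's basis theorem some order ideal \<open>\<O>'\<close> with Hilbert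
  function \<open>H\<close> is also a basis of \<open>R\<^sub>\<Gamma>\<close> (\<open>ex_basis_order_ideal\<close>), which means that its determinant \<open>\<delta>\<close>
  does not vanish at \<open>\<Gamma>\<close>. Wherever \<open>\<delta> \<noteq> 0\<close>, Cramer's rule gives the coordinates \<open>\<Gamma>'\<close> of the scheme
  with respect to \<open>\<O>'\<close> (\<open>comb_point_represents\<close>), and the homogenization in the combination procedure clears
  the denominators (\<open>ev_comb_hat\<close>). As \<open>\<O>'\<close> has the right Hilbert function, no border term is reduced to
  terms of larger degree (\<open>border_coeff_degree\<close>); the associated graded ring is then represented by the
  homogeneous part of \<open>\<Gamma>'\<close> (\<open>degree_form_ideal_eq_point_ideal\<close>).

  The associated graded ring is local, with zero-dimensional homogeneous ideal and top degree \<open>D\<close>. Its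
  minimal divisors are the lines in the socle, so that the Cayley-Bacharach property says that the socle lies
  in degree \<open>D\<close> (\<open>cayley_bacharach_iff_Soc\<close>). Equivalently, no non-zero \<open>f\<close> has the property that all
  multiples of \<open>f\<close> have zero component in degree \<open>D\<close> (\<open>cayley_bacharach_iff_pairing\<close>), and the matrix of
  this linear condition on \<open>f\<close> is the block matrix of \<open>SCBLocus\<close>: the property holds if and only if one
  of its maximal minors is non-zero (\<open>strict_cayley_bacharach_iff_minor\<close>). Thus the summand of
  \<open>\<O>'\<close> in the ideal of the theorem has a non-zero value at \<open>\<Gamma>\<close> precisely if \<open>\<Gamma>\<close> has Hilbert function
  \<open>H\<close>, \<open>\<delta>\<close> does not vanish at \<open>\<Gamma>\<close>, and the scheme has the strict Cayley-Bacharach property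
  (\<open>summand_nonzero_iff\<close>), and at least one \<open>\<O>'\<close> is available for every such \<open>\<Gamma>\<close>.
\<close>

section \<open>Polynomials as finitely supported functions\<close>

abbreviation supp :: "('a \<Rightarrow>\<^sub>0 'b::zero) \<Rightarrow> 'a set" where "supp \<equiv> Poly_Mapping.keys"
abbreviation coef :: "('a \<Rightarrow>\<^sub>0 'b::zero) \<Rightarrow> 'a \<Rightarrow> 'b" where "coef \<equiv> poly_mapping.lookup"
abbreviation mterm :: "'a \<Rightarrow> 'b \<Rightarrow> ('a \<Rightarrow>\<^sub>0 'b::zero)" where "mterm \<equiv> Poly_Mapping.single"

lemma mpoly_eq_sum_mterm: "p = (\<Sum>t\<in>supp p. mterm t (coef p t))"
  by (rule poly_mapping_eqI)
     (auto simp: lookup_sum lookup_single when_def in_keys_iff sum.delta' if_distrib cong: if_cong)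

lemma coef_times_mterm: "coef (mterm t c * p) (t + u) = c * coef (p :: ('v, 'k::comm_ring_1) mpoly) u"
proof -
  have "mterm t c * p = (\<Sum>v\<in>supp p. mterm (t + v) (c * coef p v))"
    by (subst mpoly_eq_sum_mterm[of p]) (simp add: sum_distrib_left mult_single)
  then show ?thesis
    by (simp add: lookup_sum lookup_single when_def in_keys_iff sum.delta' if_distrib cong: if_cong)
qed

lemma supp_mterm_times: "supp (mterm t c * p) \<subseteq> (+) t ` supp (p :: ('v, 'k::comm_ring_1) mpoly)"
proof -
  have "supp (mterm t c * p) \<subseteq> {a + b | a b. a \<in> supp (mterm t c) \<and> b \<in> supp p}"
    by (rule keys_mult)
  then show ?thesis by (auto split: if_splits)
qed

lemma supp_diff: "supp (p - q :: 'a \<Rightarrow>\<^sub>0 'b::ab_group_add) \<subseteq> supp p \<union> supp q"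
  by (auto simp: in_keys_iff lookup_minus)

lemma supp_sum_subset: "(\<And>i. i \<in> A \<Longrightarrow> supp (f i) \<subseteq> B) \<Longrightarrow> supp (sum f A) \<subseteq> B"
  for f :: "'i \<Rightarrow> 'a \<Rightarrow>\<^sub>0 'b::comm_monoid_add"
proof (induction A rule: infinite_finite_induct)
  case (insert x F)
  then show ?case using keys_add[of "f x" "sum f F"] by force
qed auto

lemma supp_mult_subset:
  "(\<And>t u. t \<in> supp p \<Longrightarrow> u \<in> supp q \<Longrightarrow> t + u \<in> B) \<Longrightarrow> supp (p * q) \<subseteq> B"
  for p q :: "('v, 'k::comm_ring_1) mpoly"
  using keys_mult[of p q] by blast

lemma supp_add_pp: "supp (t + u :: 'v pp) = supp t \<union> supp u"
  by (auto simp: in_keys_iff lookup_add)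

lemma pp_deg_superset: "finite A \<Longrightarrow> supp t \<subseteq> A \<Longrightarrow> pp_deg t = (\<Sum>v\<in>A. coef t v)"
  unfolding pp_deg_def by (rule sum.mono_neutral_left) (auto simp: in_keys_iff)

lemma pp_deg_add: "pp_deg (t + u) = pp_deg t + pp_deg u"
  using pp_deg_superset[of "supp t \<union> supp u" t] pp_deg_superset[of "supp t \<union> supp u" u]
    pp_deg_superset[of "supp t \<union> supp u" "t + u"]
  by (simp add: supp_add_pp lookup_add sum.distrib)

lemma pp_deg_zero [simp]: "pp_deg 0 = 0"
  by (simp add: pp_deg_def)

lemma pp_deg_single [simp]: "pp_deg (Poly_Mapping.single v k) = k"
  by (simp add: pp_deg_def)

lemma pp_deg_eq_0_iff: "pp_deg t = 0 \<longleftrightarrow> t = 0"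
proof
  assume "pp_deg t = 0"
  then have "\<forall>v. coef t v = 0"
    unfolding pp_deg_def by (auto simp: in_keys_iff)
  then show "t = 0" by (simp add: poly_mapping_eqI)
qed auto

lemma pp_split_var:
  fixes t :: "'v pp"
  assumes "v \<in> supp t"
  obtains u where "t = Poly_Mapping.single v 1 + u"
proof
  show "t = Poly_Mapping.single v 1 + (t - Poly_Mapping.single v 1)"
    using assms by (intro poly_mapping_eqI) (auto simp: lookup_add lookup_minus lookup_single when_def in_keys_iff)
qed

lemma pp_var_induct [consumes 1, case_names zero add]:
  fixes t :: "'v pp"
  assumes "supp t \<subseteq> V" and "P 0"
    and step: "\<And>v t. v \<in> V \<Longrightarrow> supp t \<subseteq> V \<Longrightarrow> P t \<Longrightarrow> P (Poly_Mapping.single v 1 + t)"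
  shows "P t"
  using assms(1)
proof (induction "pp_deg t" arbitrary: t)
  case 0
  then show ?case using assms(2) by (simp add: pp_deg_eq_0_iff)
next
  case (Suc d)
  then have "supp t \<noteq> {}"
    by (metis pp_deg_zero keys_eq_empty nat.distinct(1) pp_deg_def sum.empty)
  then obtain v where v: "v \<in> supp t" by blast
  then obtain u where u: "t = Poly_Mapping.single v 1 + u" by (rule pp_split_var)
  have "P u"
    using Suc(2,3) u by (intro Suc(1)) (auto simp: pp_deg_add supp_add_pp)
  then show ?case using step[of v u] u Suc(3) v by (auto simp: supp_add_pp)
qed

subsection \<open>Evaluation\<close>

definition pp_eval :: "('v \<Rightarrow> 'r::comm_ring_1) \<Rightarrow> 'v pp \<Rightarrow> 'r" where
  "pp_eval s t = (\<Prod>v\<in>supp t. s v ^ coef t v)"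

lemma pp_eval_superset: "finite A \<Longrightarrow> supp t \<subseteq> A \<Longrightarrow> pp_eval s t = (\<Prod>v\<in>A. s v ^ coef t v)"
  unfolding pp_eval_def by (rule prod.mono_neutral_left) (auto simp: in_keys_iff)

lemma pp_eval_add: "pp_eval s (t + u) = pp_eval s t * pp_eval s u"
  using pp_eval_superset[of "supp t \<union> supp u" t s] pp_eval_superset[of "supp t \<union> supp u" u s]
    pp_eval_superset[of "supp t \<union> supp u" "t + u" s]
  by (simp add: supp_add_pp lookup_add power_add prod.distrib)

lemma pp_eval_0 [simp]: "pp_eval s 0 = 1"
  by (simp add: pp_eval_def)

lemma pp_eval_single [simp]: "pp_eval s (Poly_Mapping.single v k) = s v ^ k"
  by (cases "k = 0") (simp_all add: pp_eval_def)

lemma mpoly_eval_alt: "mpoly_eval h s p = (\<Sum>t\<in>supp p. h (coef p t) * pp_eval s t)"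
  by (simp add: mpoly_eval_def pp_eval_def)

lemma mpoly_eval_superset:
  assumes "h 0 = 0" "finite A" "supp p \<subseteq> A"
  shows "mpoly_eval h s p = (\<Sum>t\<in>A. h (coef p t) * pp_eval s t)"
  unfolding mpoly_eval_alt using assms by (intro sum.mono_neutral_left) (auto simp: in_keys_iff)

lemma mpoly_eval_cong:
  assumes "\<And>t v. t \<in> supp p \<Longrightarrow> v \<in> supp t \<Longrightarrow> s v = s' v"
  shows "mpoly_eval h s p = mpoly_eval h s' p"
  unfolding mpoly_eval_def using assms by (intro sum.cong refl) (simp cong: prod.cong)

lemma mpoly_eval_mterm: "h 0 = 0 \<Longrightarrow> mpoly_eval h s (mterm t c) = h c * pp_eval s t"
  by (simp add: mpoly_eval_alt)

lemma mpoly_eval_mconst: "h 0 = 0 \<Longrightarrow> mpoly_eval h s (mconst c) = h c"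
  by (simp add: mconst_def mpoly_eval_mterm)

lemma mpoly_eval_mvar: "h 0 = 0 \<Longrightarrow> h 1 = 1 \<Longrightarrow> mpoly_eval h s (mvar v) = s v"
  by (simp add: mvar_def mpoly_eval_mterm)

lemma mpoly_eval_hom:
  fixes h :: "'k::comm_ring_1 \<Rightarrow> 'r::comm_ring_1" and s :: "'v \<Rightarrow> 'r"
  assumes "comm_ring_hom h"
  shows "comm_ring_hom (mpoly_eval h s)"
proof -
  interpret h: comm_ring_hom h by fact
  let ?e = "mpoly_eval h s"
  have add: "?e (p + q) = ?e p + ?e q" for p q
    using keys_add[of p q]
    by (simp add: mpoly_eval_superset[of h "supp p \<union> supp q"] lookup_add h.hom_add
        sum.distrib algebra_simps)
  have zero: "?e 0 = 0" by (simp add: mpoly_eval_def)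
  have sum: "?e (sum f A) = (\<Sum>i\<in>A. ?e (f i))" for f and A :: "'v pp set"
    by (induction A rule: infinite_finite_induct) (simp_all add: add zero)
  have mult1: "?e (mterm t c * q) = ?e (mterm t c) * ?e q" for t c q
  proof -
    have "?e (mterm t c * q) = (\<Sum>u\<in>supp q. ?e (mterm t c * mterm u (coef q u)))"
      by (subst mpoly_eq_sum_mterm[of q]) (simp add: sum_distrib_left sum)
    also have "\<dots> = (\<Sum>u\<in>supp q. ?e (mterm t c) * (h (coef q u) * pp_eval s u))"
      by (simp add: mult_single mpoly_eval_mterm pp_eval_add h.hom_mult mult_ac)
    finally show ?thesis by (simp add: mpoly_eval_alt sum_distrib_left)
  qed
  have mult: "?e (p * q) = ?e p * ?e q" for p q
  proof -
    have "?e (p * q) = (\<Sum>u\<in>supp p. ?e (mterm u (coef p u) * q))"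
      by (subst mpoly_eq_sum_mterm[of p]) (simp add: sum_distrib_right sum)
    also have "\<dots> = (\<Sum>u\<in>supp p. h (coef p u) * pp_eval s u) * ?e q"
      by (simp add: mult1 mpoly_eval_mterm sum_distrib_right)
    finally show ?thesis by (simp add: mpoly_eval_alt)
  qed
  have one: "?e 1 = 1"
    by (simp add: mpoly_eval_mterm flip: single_one)
  show ?thesis
    by unfold_locales (fact add zero mult one)+
qed

lemma mconst_hom: "comm_ring_hom (mconst :: 'k::comm_ring_1 \<Rightarrow> ('v, 'k) mpoly)"
  by unfold_locales (simp_all add: mconst_def single_add mult_single)

lemma field_hom_comm_ring_hom: "field_hom h \<Longrightarrow> comm_ring_hom h"
  by (simp add: field_hom_def idom_hom_def)

lemma mpoly_eval_hom_comp:
  assumes "comm_ring_hom g" "h 0 = 0"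
  shows "g (mpoly_eval h s p) = mpoly_eval (\<lambda>c. g (h c)) (\<lambda>v. g (s v)) p"
proof -
  interpret g: comm_ring_hom g by fact
  show ?thesis
    by (simp add: mpoly_eval_def g.hom_sum g.hom_mult g.hom_prod g.hom_power)
qed

lemma mpoly_eval_subst:
  assumes "comm_ring_hom h"
  shows "mpoly_eval h s (mpoly_subst \<sigma> p) = mpoly_eval h (\<lambda>v. mpoly_eval h s (\<sigma> v)) p"
proof -
  interpret h: comm_ring_hom h by fact
  show ?thesis
    by (subst mpoly_eval_hom_comp[OF mpoly_eval_hom[OF assms]])
       (simp_all add: mconst_def mpoly_eval_mterm)
qed

subsection \<open>The polynomial ring in a set of indeterminates\<close>

lemma mpoly_ring_sel [simp]:
  "x \<otimes>\<^bsub>mpoly_ring V\<^esub> y = x * y" "x \<oplus>\<^bsub>mpoly_ring V\<^esub> y = x + y"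
  "\<one>\<^bsub>mpoly_ring V\<^esub> = 1" "\<zero>\<^bsub>mpoly_ring V\<^esub> = 0"
  by (simp_all add: mpoly_ring_def ring_of_type_algebra_def)

abbreviation Pol :: "'v set \<Rightarrow> ('v, 'k::comm_ring_1) mpoly set" where
  "Pol V \<equiv> carrier (mpoly_ring V)"

lemma Pol_iff: "p \<in> Pol V \<longleftrightarrow> (\<forall>t\<in>supp p. supp t \<subseteq> V)"
  by (simp add: mpoly_ring_def)

lemma Pol_closed [simp]:
  fixes p q :: "('v, 'k::comm_ring_1) mpoly"
  shows "p \<in> Pol V \<Longrightarrow> q \<in> Pol V \<Longrightarrow> p + q \<in> Pol V"
    and "p \<in> Pol V \<Longrightarrow> q \<in> Pol V \<Longrightarrow> p - q \<in> Pol V"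
    and "p \<in> Pol V \<Longrightarrow> - p \<in> Pol V"
    and "p \<in> Pol V \<Longrightarrow> q \<in> Pol V \<Longrightarrow> p * q \<in> Pol V"
    and "supp t \<subseteq> V \<Longrightarrow> mterm t c \<in> Pol V"
    and "mconst c \<in> Pol V" and "v \<in> V \<Longrightarrow> mvar v \<in> Pol V" and "0 \<in> Pol V" and "1 \<in> Pol V"
proof -
  show "p \<in> Pol V \<Longrightarrow> q \<in> Pol V \<Longrightarrow> p + q \<in> Pol V"
    using keys_add[of p q] by (auto simp: Pol_iff)
  show "p \<in> Pol V \<Longrightarrow> q \<in> Pol V \<Longrightarrow> p - q \<in> Pol V"
    using supp_diff[of p q] by (auto simp: Pol_iff)
  show "p \<in> Pol V \<Longrightarrow> - p \<in> Pol V" by (auto simp: Pol_iff in_keys_iff)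
  show "p \<in> Pol V \<Longrightarrow> q \<in> Pol V \<Longrightarrow> p * q \<in> Pol V"
    using supp_mult_subset[of p q "{t. supp t \<subseteq> V}"] by (fastforce simp: Pol_iff supp_add_pp)
qed (auto simp: Pol_iff mconst_def mvar_def split: if_splits)

lemma Pol_sum: "(\<And>i. i \<in> A \<Longrightarrow> f i \<in> Pol V) \<Longrightarrow> sum f A \<in> Pol V"
  by (induction A rule: infinite_finite_induct) simp_all

lemma Pol_prod: "(\<And>i. i \<in> A \<Longrightarrow> f i \<in> Pol V) \<Longrightarrow> prod f A \<in> Pol V"
  by (induction A rule: infinite_finite_induct) simp_all

lemma Pol_power: "f \<in> Pol V \<Longrightarrow> f ^ k \<in> Pol V"
  by (induction k) simp_all

lemma mpoly_ring_cring: "cring (mpoly_ring V :: ('v, 'k::comm_ring_1) mpoly ring)"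
proof (rule cringI)
  show "abelian_group (mpoly_ring V :: ('v, 'k) mpoly ring)"
  proof (rule abelian_groupI)
    fix x :: "('v, 'k) mpoly" assume "x \<in> Pol V"
    then show "\<exists>y\<in>Pol V. y \<oplus>\<^bsub>mpoly_ring V\<^esub> x = \<zero>\<^bsub>mpoly_ring V\<^esub>"
      by (intro bexI[of _ "- x"]) simp_all
  qed (simp_all add: add_ac)
  show "comm_monoid (mpoly_ring V :: ('v, 'k) mpoly ring)"
    by (rule comm_monoidI) (simp_all add: mult_ac)
qed (simp add: distrib_right)

lemma mpoly_ring_a_inv:
  fixes x :: "('v, 'k::comm_ring_1) mpoly"
  assumes x: "x \<in> Pol V"
  shows "\<ominus>\<^bsub>mpoly_ring V\<^esub> x = - x"
proof -
  interpret cring "mpoly_ring V :: ('v, 'k) mpoly ring" by (rule mpoly_ring_cring)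
  have "- x \<oplus>\<^bsub>mpoly_ring V\<^esub> x = \<zero>\<^bsub>mpoly_ring V\<^esub>" by simp
  then show ?thesis using x by (intro minus_equality) simp_all
qed

lemma mpoly_ring_pow: "x [^]\<^bsub>mpoly_ring V\<^esub> (k::nat) = (x :: ('v, 'k::comm_ring_1) mpoly) ^ k"
  by (induction k) (simp_all add: nat_pow_def mult.commute)

text \<open>
  Setting the indeterminates outside \<open>V\<close> to zero is a ring endomorphism whose fixed points are the
  polynomials in \<open>V\<close>. As determinants and matrix products commute with ring homomorphisms, this
  turns membership of their entries in \<open>K[V]\<close> into a calculation.
\<close>

definition restrict_vars :: "'v set \<Rightarrow> ('v, 'k::comm_ring_1) mpoly \<Rightarrow> ('v, 'k) mpoly" where
  "restrict_vars V = mpoly_subst (\<lambda>v. if v \<in> V then mvar v else 0)"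

lemma restrict_vars_hom: "comm_ring_hom (restrict_vars V)"
  unfolding restrict_vars_def by (rule mpoly_eval_hom[OF mconst_hom])

lemma pp_eval_restrict:
  "pp_eval (\<lambda>v. if v \<in> V then mvar v else 0) t = (if supp t \<subseteq> V then mterm t 1 else 0)"
  using subset_UNIV[of "supp t"]
proof (induction t rule: pp_var_induct)
  case (add v t)
  then show ?case by (auto simp: pp_eval_add supp_add_pp mult_single mvar_def)
qed (auto)

lemma restrict_vars_eq:
  "restrict_vars V p = (\<Sum>t\<in>supp p. if supp t \<subseteq> V then mterm t (coef p t) else 0)"
  unfolding restrict_vars_def mpoly_eval_alt pp_eval_restrict
  by (intro sum.cong) (auto simp: mconst_def mult_single)

lemma restrict_vars_in_Pol: "restrict_vars V p \<in> Pol V"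
  unfolding restrict_vars_eq by (rule Pol_sum) simp

lemma restrict_vars_eq_iff: "restrict_vars V p = p \<longleftrightarrow> p \<in> Pol V"
proof
  assume "p \<in> Pol V"
  then have "restrict_vars V p = (\<Sum>t\<in>supp p. mterm t (coef p t))"
    unfolding restrict_vars_eq Pol_iff by (intro sum.cong) auto
  then show "restrict_vars V p = p" by (simp flip: mpoly_eq_sum_mterm)
qed (metis restrict_vars_in_Pol)

subsection \<open>Ideals and residue classes\<close>

lemma ideal_mpolyD:
  fixes I :: "('v, 'k::comm_ring_1) mpoly set"
  assumes "ideal I (mpoly_ring V)"
  shows "I \<subseteq> Pol V" "0 \<in> I" "\<And>a b. a \<in> I \<Longrightarrow> b \<in> I \<Longrightarrow> a + b \<in> I"
    "\<And>a. a \<in> I \<Longrightarrow> - a \<in> I" "\<And>a b. a \<in> I \<Longrightarrow> b \<in> I \<Longrightarrow> a - b \<in> I"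
    "\<And>a b. a \<in> Pol V \<Longrightarrow> b \<in> I \<Longrightarrow> a * b \<in> I"
    "\<And>A f. (\<And>i. i \<in> A \<Longrightarrow> f i \<in> I) \<Longrightarrow> sum f A \<in> I"
proof -
  interpret I: ideal I "mpoly_ring V" by fact
  show sub: "I \<subseteq> Pol V" using I.Icarr by blast
  show 0: "0 \<in> I" using additive_subgroup.zero_closed[OF I.is_additive_subgroup] by simp
  show add: "a + b \<in> I" if "a \<in> I" "b \<in> I" for a b
    using additive_subgroup.a_closed[OF I.is_additive_subgroup that] by simp
  show neg: "- a \<in> I" if "a \<in> I" for a
    using additive_subgroup.a_inv_closed[OF I.is_additive_subgroup that] mpoly_ring_a_inv[of a V] sub that by auto
  show "a - b \<in> I" if "a \<in> I" "b \<in> I" for a b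
    using add[OF that(1) neg[OF that(2)]] by simp
  show "a * b \<in> I" if "a \<in> Pol V" "b \<in> I" for a b
    using I.I_l_closed[OF that(2,1)] by simp
  show "sum f A \<in> I" if "\<And>i. i \<in> A \<Longrightarrow> f i \<in> I" for A and f :: "'i \<Rightarrow> _"
    using that by (induction A rule: infinite_finite_induct) (simp_all add: 0 add)
qed

lemma ideal_mpolyI:
  fixes I :: "('v, 'k::comm_ring_1) mpoly set"
  assumes "I \<subseteq> Pol V" "0 \<in> I" "\<And>a b. a \<in> I \<Longrightarrow> b \<in> I \<Longrightarrow> a + b \<in> I"
    "\<And>a b. a \<in> Pol V \<Longrightarrow> b \<in> I \<Longrightarrow> a * b \<in> I"
  shows "ideal I (mpoly_ring V)"
proof (rule idealI)
  interpret cring "mpoly_ring V :: ('v, 'k) mpoly ring" by (rule mpoly_ring_cring)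
  show "ring (mpoly_ring V :: ('v, 'k) mpoly ring)" by (rule ring_axioms)
  have "- x \<in> I" if "x \<in> I" for x
    using assms(4)[OF Pol_closed(6)[of "-1"] that] by (simp add: mconst_def single_uminus)
  then have "inv\<^bsub>add_monoid (mpoly_ring V)\<^esub> x \<in> I" if "x \<in> I" for x
    using mpoly_ring_a_inv[of x V] assms(1) that unfolding a_inv_def by auto
  then show "subgroup I (add_monoid (mpoly_ring V))"
    using assms(1-3) by (intro subgroup.intro) simp_all
  show "x \<otimes>\<^bsub>mpoly_ring V\<^esub> a \<in> I" "a \<otimes>\<^bsub>mpoly_ring V\<^esub> x \<in> I" if "a \<in> I" "x \<in> Pol V" for a x
    using assms(4)[OF that(2,1)] by (simp_all add: mult.commute)
qed

text \<open>The closure properties need only be checked for the indeterminates and the constants.\<close>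

lemma ideal_mpolyI_var:
  fixes I :: "('v, 'k::comm_ring_1) mpoly set"
  assumes "I \<subseteq> Pol V" "0 \<in> I" "\<And>a b. a \<in> I \<Longrightarrow> b \<in> I \<Longrightarrow> a + b \<in> I"
    "\<And>c b. b \<in> I \<Longrightarrow> mconst c * b \<in> I" "\<And>v b. v \<in> V \<Longrightarrow> b \<in> I \<Longrightarrow> mvar v * b \<in> I"
  shows "ideal I (mpoly_ring V)"
proof (rule ideal_mpolyI)
  have mono: "mterm t 1 * b \<in> I" if "supp t \<subseteq> V" "b \<in> I" for t b
    using that(1)
  proof (induction t rule: pp_var_induct)
    case (add v t)
    then have "mvar v * (mterm t 1 * b) \<in> I" using assms(5) by blast
    then show ?case by (simp add: mvar_def mult_single flip: mult.assoc)
  qed (use that in simp)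
  show "a * b \<in> I" if "a \<in> Pol V" "b \<in> I" for a b
  proof -
    have "a * b = (\<Sum>t\<in>supp a. mconst (coef a t) * (mterm t 1 * b))"
      by (subst mpoly_eq_sum_mterm[of a])
         (simp add: mconst_def sum_distrib_right mult_single flip: mult.assoc)
    moreover have "(\<Sum>t\<in>A. mconst (coef a t) * (mterm t 1 * b)) \<in> I" if "A \<subseteq> supp a" for A
      using finite_subset[OF that finite_keys] that
    proof (induction A rule: finite_induct)
      case (insert t A)
      then show ?case
        using \<open>a \<in> Pol V\<close> by (auto intro!: assms(3,4) mono \<open>b \<in> I\<close> simp: Pol_iff)
    qed (simp add: assms)
    ultimately show ?thesis by simp
  qed
qed fact+

lemma Idl_mpoly:
  fixes S :: "('v, 'k::comm_ring_1) mpoly set"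
  assumes "S \<subseteq> Pol V"
  shows "ideal (Idl\<^bsub>mpoly_ring V\<^esub> S) (mpoly_ring V)" "S \<subseteq> Idl\<^bsub>mpoly_ring V\<^esub> S"
    "\<And>I. ideal I (mpoly_ring V) \<Longrightarrow> S \<subseteq> I \<Longrightarrow> Idl\<^bsub>mpoly_ring V\<^esub> S \<subseteq> I"
proof -
  interpret cring "mpoly_ring V :: ('v, 'k) mpoly ring" by (rule mpoly_ring_cring)
  show "ideal (Idl\<^bsub>mpoly_ring V\<^esub> S) (mpoly_ring V)" using assms by (rule genideal_ideal)
  show "S \<subseteq> Idl\<^bsub>mpoly_ring V\<^esub> S" using assms by (rule genideal_self)
  show "\<And>I. ideal I (mpoly_ring V) \<Longrightarrow> S \<subseteq> I \<Longrightarrow> Idl\<^bsub>mpoly_ring V\<^esub> S \<subseteq> I"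
    by (rule genideal_minimal)
qed

lemma mpoly_coset: "I +>\<^bsub>mpoly_ring V\<^esub> f = (\<lambda>i. i + f) ` I"
  by (auto simp: a_r_coset_def' image_iff)

lemma mpoly_coset_eq_iff:
  fixes I :: "('v, 'k::comm_ring_1) mpoly set"
  assumes "ideal I (mpoly_ring V)"
  shows "I +>\<^bsub>mpoly_ring V\<^esub> f = I +>\<^bsub>mpoly_ring V\<^esub> g \<longleftrightarrow> f - g \<in> I"
proof
  note I = ideal_mpolyD[OF assms]
  assume "I +>\<^bsub>mpoly_ring V\<^esub> f = I +>\<^bsub>mpoly_ring V\<^esub> g"
  then have "f \<in> (\<lambda>i. i + g) ` I" unfolding mpoly_coset using I(2) by (metis add_0 image_eqI)
  then show "f - g \<in> I" by auto
next
  note I = ideal_mpolyD[OF assms]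
  assume fg: "f - g \<in> I"
  have "i + f \<in> (\<lambda>i. i + g) ` I" if "i \<in> I" for i
    using I(3)[OF that fg] by (intro image_eqI[of _ _ "i + (f - g)"]) simp_all
  moreover have "i + g \<in> (\<lambda>i. i + f) ` I" if "i \<in> I" for i
    using I(5)[OF that fg] by (intro image_eqI[of _ _ "i - (f - g)"]) simp_all
  ultimately show "I +>\<^bsub>mpoly_ring V\<^esub> f = I +>\<^bsub>mpoly_ring V\<^esub> g"
    unfolding mpoly_coset by blast
qed

section \<open>Specialization of points over a field extension\<close>

lemma map_poly_hom:
  assumes "comm_ring_hom \<alpha>"
  shows "comm_ring_hom (map_poly \<alpha>)"
proof -
  interpret \<alpha>: comm_ring_hom \<alpha> by fact
  interpret m: map_poly_comm_ring_hom \<alpha> ..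
  show ?thesis by (rule m.comm_ring_hom_axioms)
qed

lemma map_poly_eval_hom:
  assumes "comm_ring_hom \<alpha>"
  shows "comm_ring_hom (\<lambda>F. poly (map_poly \<alpha> F) x)"
proof -
  interpret m: comm_ring_hom "map_poly \<alpha>" by (rule map_poly_hom) fact
  show ?thesis by unfold_locales (simp_all add: m.hom_add m.hom_mult)
qed

text \<open>
  The leading coefficient of a polynomial may lie in the kernel of the coefficient homomorphism; for degree
  arguments such coefficients are discarded.
\<close>

lemma truncate_to_image_degree:
  fixes F :: "'r::comm_ring_1 poly"
  assumes "\<alpha> 0 = 0"
  shows "\<exists>F'. map_poly \<alpha> F' = map_poly \<alpha> F \<and> degree F' = degree (map_poly \<alpha> F)"
proof -
  let ?d = "degree (map_poly \<alpha> F)"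
  let ?F = "\<Sum>i\<le>?d. Polynomial.monom (coeff F i) i"
  have co: "coeff ?F i = (if i \<le> ?d then coeff F i else 0)" for i
    by (simp add: coeff_sum)
  have eq: "map_poly \<alpha> ?F = map_poly \<alpha> F"
    using coeff_eq_0[of "map_poly \<alpha> F"]
    by (intro poly_eqI) (simp add: coeff_map_poly assms co not_le)
  have "degree ?F \<le> ?d" by (rule degree_le) (simp add: co)
  moreover have "degree (map_poly \<alpha> ?F) \<le> degree ?F" by (rule degree_map_poly_le)
  ultimately show ?thesis using eq by (intro exI[of _ ?F]) simp
qed

lemma map_poly_0_transfer:
  assumes "\<alpha> 0 = 0" "\<phi> 0 = 0" "\<And>r. \<alpha> r = 0 \<Longrightarrow> \<phi> r = 0" "map_poly \<alpha> F = 0"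
  shows "map_poly \<phi> F = 0"
proof (rule poly_eqI)
  fix i
  have "\<alpha> (coeff F i) = 0" using assms(1,4) by (metis coeff_0 coeff_map_poly)
  then show "coeff (map_poly \<phi> F) i = coeff 0 i" using assms(2,3) by (simp add: coeff_map_poly)
qed

lemma pseudo_division:
  fixes f g :: "'r::comm_ring_1 poly"
  assumes "g \<noteq> 0"
  obtains k q r where "smult (lead_coeff g ^ k) f = g * q + r" "r = 0 \<or> degree r < degree g"
  using pseudo_divmod[OF assms, of f] by (metis surj_pair)

text \<open>
  One step of the extension: \<open>\<alpha>\<close> embeds the ring of coefficients modulo its kernel into a field, and
  \<open>a\<close> is an element of that field. If \<open>a\<close> is transcendental over the image of \<open>\<alpha>\<close>, the image of
  \<open>a\<close> only has to avoid the roots of \<open>g\<close>. Otherwise let \<open>p\<close> be a polynomial of minimal degree with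
  root \<open>a\<close>: by pseudo-division it divides, up to a power of its leading coefficient, every polynomial
  with root \<open>a\<close>, so that \<open>a\<close> may be sent to any root of the image of \<open>p\<close>; and a Bezout relation
  \<open>s p + t g = b \<noteq> 0\<close> keeps the value of \<open>g\<close> non-zero. In both cases only a single element \<open>u\<close> has
  to stay non-zero.
\<close>

lemma specialize_one_step:
  fixes \<alpha> :: "'r::comm_ring_1 \<Rightarrow> 'l::Fields.field" and g :: "'r poly"
  assumes "comm_ring_hom \<alpha>" and g: "poly (map_poly \<alpha> g) a \<noteq> 0"
  obtains u where "\<alpha> u \<noteq> 0"
    and "\<And>\<phi> :: 'r \<Rightarrow> 'm::alg_closed_field.
      \<lbrakk>comm_ring_hom \<phi>; \<And>r. \<alpha> r = 0 \<Longrightarrow> \<phi> r = 0; \<phi> u \<noteq> 0\<rbrakk> \<Longrightarrow>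
      \<exists>\<xi>. poly (map_poly \<phi> g) \<xi> \<noteq> 0 \<and>
          (\<forall>f. poly (map_poly \<alpha> f) a = 0 \<longrightarrow> poly (map_poly \<phi> f) \<xi> = 0)"
proof -
  interpret \<alpha>: comm_ring_hom \<alpha> by fact
  let ?m = "map_poly \<alpha>"
  interpret m: comm_ring_hom ?m by (rule map_poly_hom) fact
  interpret e: comm_ring_hom "\<lambda>F. poly (?m F) a" by (rule map_poly_eval_hom) fact
  have m_const: "?m [:b:] = [:\<alpha> b:]" for b
    by (cases "b = 0") (simp_all add: map_poly_pCons)
  show ?thesis
  proof (cases "\<exists>p. poly (?m p) a = 0 \<and> ?m p \<noteq> 0")
    case False
    define u where "u = coeff g (degree (?m g))"
    have mg: "?m g \<noteq> 0" using g by auto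
    show ?thesis
    proof (rule that)
      show "\<alpha> u \<noteq> 0" using mg by (metis \<alpha>.coeff_map_poly_hom leading_coeff_0_iff u_def)
      fix \<phi> :: "'r \<Rightarrow> 'm"
      assume \<phi>: "comm_ring_hom \<phi>" "\<And>r. \<alpha> r = 0 \<Longrightarrow> \<phi> r = 0" "\<phi> u \<noteq> 0"
      interpret \<phi>: comm_ring_hom \<phi> by fact
      let ?G = "map_poly \<phi> g"
      have "?G \<noteq> 0" using \<phi>(3) by (metis \<phi>.coeff_map_poly_hom coeff_0 u_def)
      have "\<exists>\<xi>. poly ?G \<xi> \<noteq> 0"
      proof (cases "degree ?G = 0")
        case True
        then show ?thesis using \<open>?G \<noteq> 0\<close> by (metis degree_eq_zeroE mult_zero_right pCons_0_0 poly_const_conv)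
      next
        case False
        have "degree (?G - 1) = degree ?G"
          using False degree_add_eq_left[of "- 1" ?G] by simp
        then obtain \<xi> where "poly (?G - 1) \<xi> = 0"
          using False alg_closed_imp_poly_has_root[of "?G - 1"] by auto
        then show ?thesis by (intro exI[of _ \<xi>]) auto
      qed
      moreover have "map_poly \<phi> f = 0" if "poly (?m f) a = 0" for f
        using False that by (intro map_poly_0_transfer[of \<alpha> \<phi> f] \<phi>(2)) auto
      ultimately show "\<exists>\<xi>. poly ?G \<xi> \<noteq> 0 \<and>
          (\<forall>f. poly (?m f) a = 0 \<longrightarrow> poly (map_poly \<phi> f) \<xi> = 0)" by auto
    qed
  next
    case True
    define d where "d = (LEAST d. \<exists>p. poly (?m p) a = 0 \<and> ?m p \<noteq> 0 \<and> degree (?m p) = d)"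
    have "\<exists>p. poly (?m p) a = 0 \<and> ?m p \<noteq> 0 \<and> degree (?m p) = d"
      unfolding d_def by (rule LeastI_ex) (use True in auto)
    then obtain p0 where p0: "poly (?m p0) a = 0" "?m p0 \<noteq> 0" "degree (?m p0) = d" by blast
    obtain p where p': "?m p = ?m p0" "degree p = degree (?m p0)"
      using truncate_to_image_degree[of \<alpha> p0] by auto
    have p: "poly (?m p) a = 0" "?m p \<noteq> 0" "degree (?m p) = d" "degree p = d" "p \<noteq> 0"
      using p0 p' by auto
    have p_min: "?m q = 0" if "poly (?m q) a = 0" "degree (?m q) < d" for q
      using not_less_Least[of "degree (?m q)", folded d_def] that d_def by (metis (mono_tags, lifting) not_less_Least)
    have "\<alpha> (lead_coeff p) = lead_coeff (?m p)" by (simp add: p)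
    then have c: "\<alpha> (lead_coeff p) \<noteq> 0" using p leading_coeff_neq_0 by metis
    have d0: "d > 0"
    proof (rule ccontr)
      assume "\<not> d > 0"
      then obtain b where "?m p = [:b:]" using p(3) degree_eq_zeroE by blast
      then show False using p(1,2) by simp
    qed
    \<comment> \<open>The Bezout relation comes from an element of minimal degree in the ideal of \<open>p\<close> and \<open>g\<close>.\<close>
    define B where "B = {D. \<exists>s t. ?m D = ?m (s * p + t * g)}"
    define e where "e = (LEAST e. \<exists>D\<in>B. ?m D \<noteq> 0 \<and> degree (?m D) = e)"
    have pB: "p \<in> B" unfolding B_def by (rule CollectI, rule exI[of _ 1], rule exI[of _ 0]) simp
    have gB: "g \<in> B" unfolding B_def by (rule CollectI, rule exI[of _ 0], rule exI[of _ 1]) simp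
    have "\<exists>D\<in>B. ?m D \<noteq> 0 \<and> degree (?m D) = e"
      unfolding e_def by (rule LeastI_ex) (use pB p in auto)
    then obtain D0 where D0: "D0 \<in> B" "?m D0 \<noteq> 0" "degree (?m D0) = e" by blast
    obtain D where D': "?m D = ?m D0" "degree D = degree (?m D0)"
      using truncate_to_image_degree[of \<alpha> D0] by auto
    have D: "?m D \<noteq> 0" "degree (?m D) = e" "degree D = e" "D \<noteq> 0"
      using D0 D' by auto
    obtain s t where st: "?m D = ?m (s * p + t * g)" using D0(1) D'(1) by (auto simp: B_def)
    have "\<alpha> (lead_coeff D) = lead_coeff (?m D)" by (simp add: D)
    then have lD: "\<alpha> (lead_coeff D) \<noteq> 0" using D leading_coeff_neq_0 by metis
    have D_min: "?m q = 0" if "q \<in> B" "degree (?m q) < e" for q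
      using not_less_Least[of "degree (?m q)" "\<lambda>e. \<exists>D\<in>B. ?m D \<noteq> 0 \<and> degree (?m D) = e"] that
      unfolding e_def by blast
    have div: "\<exists>k q. smult (\<alpha> (lead_coeff D) ^ k) (?m f) = ?m D * ?m q" if fB: "f \<in> B" for f
    proof -
      obtain k q r where kqr: "smult (lead_coeff D ^ k) f = D * q + r" "r = 0 \<or> degree r < degree D"
        using pseudo_division[OF D(4)] by metis
      obtain s' t' where st': "?m f = ?m (s' * p + t' * g)" using fB by (auto simp: B_def)
      let ?c = "[:lead_coeff D ^ k:]"
      have r: "r = ?c * f - D * q" using kqr(1) by simp
      have "?m r = ?m ((?c * s' - s * q) * p + (?c * t' - t * q) * g)"
        unfolding r m.hom_minus m.hom_mult m.hom_add st st' by (simp add: algebra_simps)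
      then have "r \<in> B" by (auto simp: B_def)
      moreover have "?m r = 0 \<or> degree (?m r) < e"
        using kqr(2) D(3) degree_map_poly_le[of \<alpha> r] by auto
      ultimately have "?m r = 0" using D_min by auto
      then have "?m (?c * f) = ?m D * ?m q" unfolding r m.hom_minus m.hom_mult by simp
      then have "smult (\<alpha> (lead_coeff D) ^ k) (?m f) = ?m D * ?m q"
        by (simp add: m.hom_mult m_const \<alpha>.hom_power del: mult_pCons_left) simp
      then show ?thesis by blast
    qed
    have Da: "poly (?m D) a \<noteq> 0"
    proof
      assume 0: "poly (?m D) a = 0"
      obtain k q where "smult (\<alpha> (lead_coeff D) ^ k) (?m g) = ?m D * ?m q" using div[OF gB] by auto
      then have "poly (smult (\<alpha> (lead_coeff D) ^ k) (?m g)) a = 0" using 0 by simp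
      then show False using g lD by simp
    qed
    obtain k q where kq: "smult (\<alpha> (lead_coeff D) ^ k) (?m p) = ?m D * ?m q" using div[OF pB] by auto
    have mq: "?m q \<noteq> 0" using kq p(2) lD by auto
    have "poly (smult (\<alpha> (lead_coeff D) ^ k) (?m p)) a = 0" using p(1) by simp
    then have "poly (?m q) a = 0" unfolding kq using Da by simp
    then have "degree (?m q) \<ge> d" using p_min[of q] mq by force
    moreover have "degree (?m D * ?m q) = d" unfolding kq[symmetric] using lD p(3) by simp
    ultimately have "degree (?m D) = 0" using D(1) mq degree_mult_eq[of "?m D" "?m q"] by simp
    then have "degree D = 0" using D by simp
    then obtain b where b: "D = [:b:]" by (rule degree_eq_zeroE)
    have \<alpha>b: "\<alpha> b \<noteq> 0" using D(1) unfolding b m_const by auto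
    show ?thesis
    proof (rule that)
      show "\<alpha> (lead_coeff p * b) \<noteq> 0" using c \<alpha>b by (simp add: \<alpha>.hom_mult)
      fix \<phi> :: "'r \<Rightarrow> 'm"
      assume \<phi>: "comm_ring_hom \<phi>" "\<And>r. \<alpha> r = 0 \<Longrightarrow> \<phi> r = 0" "\<phi> (lead_coeff p * b) \<noteq> 0"
      interpret \<phi>: comm_ring_hom \<phi> by fact
      have nz: "\<phi> (lead_coeff p) \<noteq> 0" "\<phi> b \<noteq> 0" using \<phi>(3) by (auto simp: \<phi>.hom_mult)
      let ?n = "map_poly \<phi>"
      have "coeff (?n p) d \<noteq> 0" using nz(1) p(4) by simp
      then have "degree (?n p) > 0" using d0 le_degree[of "?n p" d] by linarith
      then obtain \<xi> where \<xi>: "poly (?n p) \<xi> = 0" using alg_closed_imp_poly_has_root by blast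
      interpret x: comm_ring_hom "\<lambda>F. poly (?n F) \<xi>" by (rule map_poly_eval_hom) fact
      have n0: "poly (?n F) \<xi> = 0" if "?m F = 0" for F
        using map_poly_0_transfer[of \<alpha> \<phi> F] \<phi>(2) that by simp
      have "?m (s * p + t * g - [:b:]) = 0" using st unfolding b by (simp add: m.hom_minus)
      from n0[OF this] have "poly (?n t) \<xi> * poly (?n g) \<xi> = poly (?n [:b:]) \<xi>"
        using \<xi> by (simp only: x.hom_minus x.hom_add x.hom_mult) simp
      moreover have "poly (?n [:b:]) \<xi> = \<phi> b" by (cases "b = 0") (simp_all add: map_poly_pCons)
      ultimately have "poly (?n g) \<xi> \<noteq> 0" using nz by auto
      moreover have "poly (?n f) \<xi> = 0" if fa: "poly (?m f) a = 0" for f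
      proof -
        obtain k q r where kqr: "smult (lead_coeff p ^ k) f = p * q + r" "r = 0 \<or> degree r < degree p"
          using pseudo_division[OF p(5)] by metis
        let ?c = "[:lead_coeff p ^ k:]"
        have r: "?c * f = p * q + r" using kqr(1) by simp
        have "poly (?m (?c * f)) a = 0" using fa by (simp only: e.hom_mult) simp
        then have "poly (?m r) a = 0" using p(1) unfolding r by (simp only: e.hom_add e.hom_mult) simp
        moreover have "?m r = 0 \<or> degree (?m r) < d"
          using kqr(2) p(4) degree_map_poly_le[of \<alpha> r] by auto
        ultimately have "?m r = 0" using p_min by auto
        then have "poly (?n (?c * f)) \<xi> = 0"
          unfolding r using n0[of r] \<xi> by (simp only: x.hom_add x.hom_mult) simp
        moreover have "poly (?n ?c) \<xi> = \<phi> (lead_coeff p) ^ k"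
          by (cases "lead_coeff p ^ k = 0") (simp_all add: map_poly_pCons \<phi>.hom_power flip: \<phi>.hom_power)
        ultimately show ?thesis using nz(1) by (simp only: x.hom_mult) simp
      qed
      ultimately show "\<exists>\<xi>. poly (?n g) \<xi> \<noteq> 0 \<and>
          (\<forall>f. poly (?m f) a = 0 \<longrightarrow> poly (?n f) \<xi> = 0)" by blast
    qed
  qed
qed

text \<open>
  Hilbert's Nullstellensatz in the form of a specialization: every point over a field extension of
  \<open>K\<close> specializes, keeping one inequality, to a point over a given algebraically closed extension.
  One coordinate is adjoined at a time; the inequality at the new coordinate holds as soon as the element \<open>u\<close>
  of the previous lemma stays non-zero at the others.
\<close>

theorem point_specialization:
  fixes h :: "'k::Fields.field \<Rightarrow> 'l::Fields.field" and h' :: "'k \<Rightarrow> 'm::alg_closed_field"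
    and f :: "('v, 'k) mpoly"
  assumes h: "field_hom h" and h': "field_hom h'"
    and "finite V" and "f \<in> Pol V" and "mpoly_eval h s f \<noteq> 0"
  shows "\<exists>\<xi>. mpoly_eval h' \<xi> f \<noteq> 0 \<and> (\<forall>g\<in>Pol V. mpoly_eval h s g = 0 \<longrightarrow> mpoly_eval h' \<xi> g = 0)"
  using assms(3-)
proof (induction V arbitrary: f rule: finite_induct)
  case empty
  interpret h: field_hom h by fact
  interpret h': field_hom h' by fact
  have ev: "mpoly_eval h s g = h (coef g 0)" "mpoly_eval h' s' g = h' (coef g 0)" if "g \<in> Pol {}" for g s'
  proof -
    have "supp g \<subseteq> {0}" using that by (auto simp: Pol_iff)
    then show "mpoly_eval h s g = h (coef g 0)" "mpoly_eval h' s' g = h' (coef g 0)"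
      by (simp_all add: mpoly_eval_superset[of _ "{0}"])
  qed
  have inj: "h c = 0 \<longleftrightarrow> c = 0" "h' c = 0 \<longleftrightarrow> c = 0" for c
    by (metis h.hom_inverse h.hom_mult h.hom_one h.hom_zero mult_zero_left right_inverse zero_neq_one)
       (metis h'.hom_inverse h'.hom_mult h'.hom_one h'.hom_zero mult_zero_left right_inverse zero_neq_one)
  show ?case using empty by (auto simp: ev inj intro!: exI[of _ "\<lambda>_. 0"])
next
  case (insert v V)
  note hh = field_hom_comm_ring_hom[OF h] field_hom_comm_ring_hom[OF h']
  interpret h: comm_ring_hom h by (rule hh)
  interpret h': comm_ring_hom h' by (rule hh)
  define U :: "('v, 'k) mpoly \<Rightarrow> ('v, 'k) mpoly poly" where
    "U = mpoly_eval (\<lambda>c. [:mconst c:]) (\<lambda>w. if w = v then [:0, 1:] else [:mvar w:])"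
  define \<alpha> where "\<alpha> = (\<lambda>r. mpoly_eval h s (restrict_vars V r))"
  have comp: "comm_ring_hom (\<lambda>r. mpoly_eval k s' (restrict_vars V r))"
    if "comm_ring_hom k" for k :: "'k \<Rightarrow> 'x::comm_ring_1" and s'
  proof -
    interpret k: comm_ring_hom "mpoly_eval k s'" by (rule mpoly_eval_hom) fact
    interpret r: comm_ring_hom "restrict_vars V :: ('v, 'k) mpoly \<Rightarrow> _" by (rule restrict_vars_hom)
    show ?thesis by unfold_locales (simp_all add: r.hom_add k.hom_add r.hom_mult k.hom_mult)
  qed
  have restr: "mpoly_eval k s' (restrict_vars V (mconst c)) = k c"
    "mpoly_eval k s' (restrict_vars V (mvar w)) = (if w \<in> V then s' w else 0)"
    if "comm_ring_hom k" for k :: "'k \<Rightarrow> 'x::comm_ring_1" and s' c w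
  proof -
    interpret k: comm_ring_hom k by fact
    interpret k': comm_ring_hom "mpoly_eval k s'" by (rule mpoly_eval_hom) fact
    show "mpoly_eval k s' (restrict_vars V (mconst c)) = k c"
      "mpoly_eval k s' (restrict_vars V (mvar w)) = (if w \<in> V then s' w else 0)"
      by (simp_all add: restrict_vars_def mpoly_eval_mconst mpoly_eval_mvar mconst_def[of 0] mconst_def[of 1])
  qed
  have U: "poly (map_poly (\<lambda>r. mpoly_eval k s' (restrict_vars V r)) (U g)) x = mpoly_eval k (s'(v := x)) g"
    if k: "comm_ring_hom k" and g: "g \<in> Pol (insert v V)" for k :: "'k \<Rightarrow> 'x::comm_ring_1" and s' x g
  proof -
    interpret k: comm_ring_hom k by fact
    let ?\<alpha> = "\<lambda>r. mpoly_eval k s' (restrict_vars V r)"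
    interpret a: comm_ring_hom ?\<alpha> by (rule comp[OF k])
    have const: "poly (map_poly ?\<alpha> [:r:]) x = ?\<alpha> r" for r
      by (simp add: a.map_poly_pCons_hom)
    have "poly (map_poly ?\<alpha> (U g)) x = mpoly_eval k (\<lambda>w. if w = v then x else if w \<in> V then s' w else 0) g"
      unfolding U_def
      by (subst mpoly_eval_hom_comp[OF map_poly_eval_hom[OF comp[OF k]]])
         (simp_all add: a.map_poly_pCons_hom restr[OF k] mconst_def[of 0] if_distrib[of "map_poly _"]
           if_distrib[of "\<lambda>p. poly p x"] cong: if_cong)
    also have "\<dots> = mpoly_eval k (s'(v := x)) g"
      using g by (intro mpoly_eval_cong) (auto simp: Pol_iff)
    finally show ?thesis .
  qed
  have "poly (map_poly \<alpha> (U f)) (s v) \<noteq> 0"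
    using U[OF hh(1) insert.prems(1), of s "s v"] insert.prems(2) by (simp add: \<alpha>_def)
  then obtain u where u: "\<alpha> u \<noteq> 0" and ext: "\<And>\<phi> :: ('v, 'k) mpoly \<Rightarrow> 'm.
      \<lbrakk>comm_ring_hom \<phi>; \<And>r. \<alpha> r = 0 \<Longrightarrow> \<phi> r = 0; \<phi> u \<noteq> 0\<rbrakk> \<Longrightarrow>
      \<exists>\<xi>. poly (map_poly \<phi> (U f)) \<xi> \<noteq> 0 \<and>
          (\<forall>g. poly (map_poly \<alpha> g) (s v) = 0 \<longrightarrow> poly (map_poly \<phi> g) \<xi> = 0)"
    using specialize_one_step[of \<alpha> "U f" "s v"] comp[OF hh(1)] unfolding \<alpha>_def by metis
  have in_Pol: "restrict_vars V r \<in> Pol V" for r :: "('v, 'k) mpoly"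
    by (rule restrict_vars_in_Pol)
  obtain \<xi> where \<xi>: "mpoly_eval h' \<xi> (restrict_vars V u) \<noteq> 0"
    "\<And>g. g \<in> Pol V \<Longrightarrow> mpoly_eval h s g = 0 \<Longrightarrow> mpoly_eval h' \<xi> g = 0"
    using insert.IH[OF in_Pol, of u] u by (auto simp: \<alpha>_def)
  obtain x where x: "poly (map_poly (\<lambda>r. mpoly_eval h' \<xi> (restrict_vars V r)) (U f)) x \<noteq> 0"
    "\<And>g. poly (map_poly \<alpha> g) (s v) = 0 \<Longrightarrow>
      poly (map_poly (\<lambda>r. mpoly_eval h' \<xi> (restrict_vars V r)) g) x = 0"
    using ext[OF comp[OF hh(2)]] \<xi> in_Pol unfolding \<alpha>_def by metis
  show ?case
  proof (intro exI[of _ "\<xi>(v := x)"] conjI ballI impI)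
    show "mpoly_eval h' (\<xi>(v := x)) f \<noteq> 0"
      using x(1) U[OF hh(2) insert.prems(1)] by simp
    fix g :: "('v, 'k) mpoly" assume g: "g \<in> Pol (insert v V)" "mpoly_eval h s g = 0"
    then have "poly (map_poly \<alpha> (U g)) (s v) = 0"
      unfolding \<alpha>_def using U[OF hh(1) g(1), of s "s v"] by simp
    from x(2)[OF this] show "mpoly_eval h' (\<xi>(v := x)) g = 0"
      using U[OF hh(2) g(1)] by simp
  qed
qed

section \<open>Minors and linear independence of columns\<close>

lemma underdetermined_system:
  fixes a :: "'e \<Rightarrow> 'x \<Rightarrow> 'f::Fields.field"
  assumes "finite E" "finite Y" "card E < card Y"
  shows "\<exists>v. (\<exists>x\<in>Y. v x \<noteq> 0) \<and> (\<forall>e\<in>E. (\<Sum>x\<in>Y. a e x * v x) = 0)"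
  using assms
proof (induction E arbitrary: Y a rule: finite_induct)
  case empty
  then obtain x where "x \<in> Y" by fastforce
  then show ?case by (intro exI[of _ "\<lambda>_. 1"]) auto
next
  case (insert e E)
  show ?case
  proof (cases "\<forall>x\<in>Y. a e x = 0")
    case True
    have "\<exists>v. (\<exists>x\<in>Y. v x \<noteq> 0) \<and> (\<forall>e\<in>E. (\<Sum>x\<in>Y. a e x * v x) = 0)"
      using insert.prems insert.hyps by (intro insert.IH) auto
    then show ?thesis using True by (auto intro!: exI)
  next
    case False
    then obtain x0 where x0: "x0 \<in> Y" "a e x0 \<noteq> 0" by auto
    let ?Y = "Y - {x0}"
    let ?a = "\<lambda>e' x. a e' x - a e' x0 * a e x / a e x0"
    have "\<exists>v. (\<exists>x\<in>?Y. v x \<noteq> 0) \<and> (\<forall>e\<in>E. (\<Sum>x\<in>?Y. ?a e x * v x) = 0)"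
      using insert.prems insert.hyps x0 by (intro insert.IH) auto
    then obtain v where v: "\<exists>x\<in>?Y. v x \<noteq> 0" "\<And>e. e \<in> E \<Longrightarrow> (\<Sum>x\<in>?Y. ?a e x * v x) = 0" by blast
    define S where "S = (\<Sum>x\<in>?Y. a e x * v x)"
    let ?v = "v(x0 := - S / a e x0)"
    have sum: "(\<Sum>x\<in>Y. a e' x * ?v x) = a e' x0 * (- S / a e x0) + (\<Sum>x\<in>?Y. a e' x * v x)" for e'
      using insert.prems(1) x0(1) by (subst sum.remove[of Y x0]) (auto intro!: sum.cong)
    have "(\<Sum>x\<in>Y. a e x * ?v x) = 0"
      unfolding sum using x0 by (simp add: S_def)
    moreover have "(\<Sum>x\<in>Y. a e' x * ?v x) = 0" if "e' \<in> E" for e'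
    proof -
      have "(\<Sum>x\<in>?Y. ?a e' x * v x) = (\<Sum>x\<in>?Y. a e' x * v x) - a e' x0 / a e x0 * S"
        unfolding S_def sum_distrib_left sum_subtractf[symmetric]
        by (intro sum.cong) (auto simp: algebra_simps)
      then show ?thesis unfolding sum using v(2)[OF that] by simp
    qed
    ultimately show ?thesis using v(1) by (intro exI[of _ ?v]) auto
  qed
qed

definition cols_indep :: "'f::Fields.field mat \<Rightarrow> nat set \<Rightarrow> nat set \<Rightarrow> bool" where
  "cols_indep A I J \<longleftrightarrow> (\<forall>v. (\<forall>i\<in>I. (\<Sum>j\<in>J. A $$ (i, j) * v j) = 0) \<longrightarrow> (\<forall>j\<in>J. v j = 0))"

lemma cols_indep_mono: "cols_indep A I J \<Longrightarrow> I \<subseteq> I' \<Longrightarrow> cols_indep A I' J"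
  unfolding cols_indep_def by blast

lemma bij_betw_pick:
  assumes "finite I"
  shows "bij_betw (pick I) {..<card I} I"
proof -
  have "inj_on (pick I) {..<card I}"
    by (rule inj_onI) (metis lessThan_iff linorder_neqE_nat order_less_irrefl pick_mono_le)
  moreover have "pick I ` {..<card I} \<subseteq> I"
    using pick_in_set_le by auto
  ultimately show ?thesis
    using assms by (simp add: bij_betw_def card_image card_subset_eq)
qed

lemma submatrix_dim:
  assumes "I \<subseteq> {..<dim_row A}" "J \<subseteq> {..<dim_col A}"
  shows "submatrix A I J \<in> carrier_mat (card I) (card J)"
    "i < card I \<Longrightarrow> j < card J \<Longrightarrow> submatrix A I J $$ (i, j) = A $$ (pick I i, pick J j)"
proof -
  have *: "{i. i < dim_row A \<and> i \<in> I} = I" "{j. j < dim_col A \<and> j \<in> J} = J" using assms by auto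
  show "submatrix A I J \<in> carrier_mat (card I) (card J)"
    by (simp add: submatrix_def *)
  show "i < card I \<Longrightarrow> j < card J \<Longrightarrow> submatrix A I J $$ (i, j) = A $$ (pick I i, pick J j)"
    using * by (simp add: submatrix_index)
qed

text \<open>
  After renumbering rows and columns this is the criterion that a square matrix is invertible if and
  only if its kernel is trivial.
\<close>

lemma det_submatrix_nonzero_iff:
  fixes A :: "'f::Fields.field mat"
  assumes I: "I \<subseteq> {..<dim_row A}" and J: "J \<subseteq> {..<dim_col A}" and card: "card I = card J"
  shows "det (submatrix A I J) \<noteq> 0 \<longleftrightarrow> cols_indep A I J"
proof -
  let ?k = "card J" and ?M = "submatrix A I J"
  have fin: "finite I" "finite J" using I J finite_subset by blast+
  have M: "?M \<in> carrier_mat ?k ?k" using submatrix_dim(1)[OF I J] card by simp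
  note bI = bij_betw_pick[OF fin(1), unfolded card] and bJ = bij_betw_pick[OF fin(2)]
  have prod: "(?M *\<^sub>v w) $ i = (\<Sum>j\<in>J. A $$ (pick I i, j) * w $ (the_inv_into {..<?k} (pick J) j))"
    if "w \<in> carrier_vec ?k" "i < ?k" for w i
  proof -
    have "(?M *\<^sub>v w) $ i = (\<Sum>j<?k. ?M $$ (i, j) * w $ j)"
      using that M by (simp add: scalar_prod_def atLeast0LessThan)
    also have "\<dots> = (\<Sum>j<?k. A $$ (pick I i, pick J j) * w $ the_inv_into {..<?k} (pick J) (pick J j))"
      using that bJ by (intro sum.cong) (auto simp: submatrix_dim(2)[OF I J] card the_inv_into_f_f bij_betw_def)
    also have "\<dots> = (\<Sum>j\<in>J. A $$ (pick I i, j) * w $ (the_inv_into {..<?k} (pick J) j))"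
      by (rule sum.reindex_bij_betw[OF bJ])
    finally show ?thesis .
  qed
  have M0: "?M *\<^sub>v w = 0\<^sub>v ?k \<longleftrightarrow> (\<forall>i\<in>I. (\<Sum>j\<in>J. A $$ (i, j) * w $ (the_inv_into {..<?k} (pick J) j)) = 0)"
    if "w \<in> carrier_vec ?k" for w
  proof -
    have "?M *\<^sub>v w = 0\<^sub>v ?k \<longleftrightarrow> (\<forall>i<?k. (?M *\<^sub>v w) $ i = 0)"
      using M by (auto simp: vec_eq_iff)
    also have "\<dots> \<longleftrightarrow> (\<forall>i\<in>pick I ` {..<?k}. (\<Sum>j\<in>J. A $$ (i, j) * w $ (the_inv_into {..<?k} (pick J) j)) = 0)"
      using prod[OF that] by auto
    also have "pick I ` {..<?k} = I" using bI by (simp add: bij_betw_def)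
    finally show ?thesis .
  qed
  show ?thesis
  proof
    assume det: "det ?M \<noteq> 0"
    show "cols_indep A I J" unfolding cols_indep_def
    proof (intro allI impI ballI)
      fix v j assume v: "\<forall>i\<in>I. (\<Sum>j\<in>J. A $$ (i, j) * v j) = 0" and j: "j \<in> J"
      let ?w = "vec ?k (\<lambda>i. v (pick J i))"
      have inv: "the_inv_into {..<?k} (pick J) j < ?k" "pick J (the_inv_into {..<?k} (pick J) j) = j" if "j \<in> J" for j
        using that bJ bij_betw_the_inv_into[OF bJ]
        by (auto simp: bij_betw_def f_the_inv_into_f)
      have w: "?w $ (the_inv_into {..<?k} (pick J) j) = v j" if "j \<in> J" for j
        using inv[OF that] by simp
      have "?M *\<^sub>v ?w = 0\<^sub>v ?k"
        by (subst M0) (use v w in auto)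
      then have "?w = 0\<^sub>v ?k" using det det_0_iff_vec_prod_zero_field[OF M] by (metis vec_carrier)
      then show "v j = 0" using w[OF j] inv[OF j] by (metis index_zero_vec(1))
    qed
  next
    assume ind: "cols_indep A I J"
    show "det ?M \<noteq> 0"
    proof
      assume "det ?M = 0"
      then obtain w where w: "w \<in> carrier_vec ?k" "w \<noteq> 0\<^sub>v ?k" "?M *\<^sub>v w = 0\<^sub>v ?k"
        using det_0_iff_vec_prod_zero_field[OF M] by blast
      have "\<forall>j\<in>J. w $ (the_inv_into {..<?k} (pick J) j) = 0"
        using ind w(3) M0[OF w(1)] unfolding cols_indep_def by auto
      then have "w $ i = 0" if "i < ?k" for i
        using that bJ by (metis (no_types, lifting) bij_betw_def image_eqI lessThan_iff the_inv_into_f_f)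
      then show False using w(1,2) by (auto simp: vec_eq_iff)
    qed
  qed
qed

text \<open>
  A minimal set of rows on which the columns are still independent has the right size: were it larger,
  the rows would be dependent, and a row that depends on the others could be dropped.
\<close>

lemma cols_indep_square:
  assumes "finite I" "finite J" "cols_indep A I J"
  shows "\<exists>I'\<subseteq>I. card I' = card J \<and> cols_indep A I' J"
proof -
  let ?P = "\<lambda>m. \<exists>I'\<subseteq>I. cols_indep A I' J \<and> card I' = m"
  define m where "m = (LEAST m. ?P m)"
  have "?P m" unfolding m_def by (rule LeastI_ex) (use assms in auto)
  then obtain I' where I': "I' \<subseteq> I" "cols_indep A I' J" "card I' = m" by auto
  have fin: "finite I'" using I' assms finite_subset by auto
  have "\<not> card I' < card J"
  proof
    assume "card I' < card J"
    from underdetermined_system[OF fin assms(2) this, of "\<lambda>i j. A $$ (i, j)"]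
    show False using I'(2) unfolding cols_indep_def by blast
  qed
  moreover have "\<not> card J < card I'"
  proof
    assume "card J < card I'"
    from underdetermined_system[OF assms(2) fin this, of "\<lambda>j i. A $$ (i, j)"]
    obtain v i0 where v: "i0 \<in> I'" "v i0 \<noteq> 0" "\<And>j. j \<in> J \<Longrightarrow> (\<Sum>i\<in>I'. A $$ (i, j) * v i) = 0" by auto
    have "cols_indep A (I' - {i0}) J" unfolding cols_indep_def
    proof (intro allI impI)
      fix w assume w: "\<forall>i\<in>I' - {i0}. (\<Sum>j\<in>J. A $$ (i, j) * w j) = 0"
      have "(\<Sum>i\<in>I'. v i * (\<Sum>j\<in>J. A $$ (i, j) * w j)) = (\<Sum>j\<in>J. w j * (\<Sum>i\<in>I'. A $$ (i, j) * v i))"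
        unfolding sum_distrib_left by (subst sum.swap) (simp add: mult_ac)
      also have "\<dots> = 0" using v(3) by simp
      finally have "v i0 * (\<Sum>j\<in>J. A $$ (i0, j) * w j) = 0"
        using w fin v(1) by (subst (asm) sum.remove[of _ i0]) auto
      then have "\<forall>i\<in>I'. (\<Sum>j\<in>J. A $$ (i, j) * w j) = 0" using w v(2) by auto
      then show "\<forall>j\<in>J. w j = 0" using I'(2) unfolding cols_indep_def by blast
    qed
    then have "?P (m - 1)" using I' v(1) fin by (intro exI[of _ "I' - {i0}"]) auto
    moreover have "m > 0" using I'(3) v(1) fin by (auto simp: card_gt_0_iff)
    then have "m - 1 < m" by simp
    ultimately show False using not_less_Least[of "m - 1" ?P] unfolding m_def by blast
  qed
  ultimately show ?thesis using I' by (intro exI[of _ I']) auto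
qed

lemma nonzero_minor_iff:
  fixes A :: "'f::Fields.field mat"
  shows "(\<exists>m\<in>minors k A. m \<noteq> 0) \<longleftrightarrow>
    (\<exists>J\<subseteq>{..<dim_col A}. card J = k \<and> cols_indep A {..<dim_row A} J)"
proof
  assume "\<exists>m\<in>minors k A. m \<noteq> 0"
  then obtain I J where "I \<subseteq> {..<dim_row A}" "J \<subseteq> {..<dim_col A}" "card I = k" "card J = k"
    "det (submatrix A I J) \<noteq> 0"
    unfolding minors_def by auto
  then show "\<exists>J\<subseteq>{..<dim_col A}. card J = k \<and> cols_indep A {..<dim_row A} J"
    using det_submatrix_nonzero_iff cols_indep_mono by metis
next
  assume "\<exists>J\<subseteq>{..<dim_col A}. card J = k \<and> cols_indep A {..<dim_row A} J"
  then obtain J where J: "J \<subseteq> {..<dim_col A}" "card J = k" "cols_indep A {..<dim_row A} J" by auto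
  obtain I where I: "I \<subseteq> {..<dim_row A}" "card I = card J" "cols_indep A I J"
    using cols_indep_square[of "{..<dim_row A}" J A] J finite_subset by blast
  then have "det (submatrix A I J) \<noteq> 0" using J det_submatrix_nonzero_iff by blast
  then show "\<exists>m\<in>minors k A. m \<noteq> 0" using I J unfolding minors_def by blast
qed

lemma det_nonzero_iff_cols_indep:
  fixes A :: "'f::Fields.field mat"
  assumes A: "A \<in> carrier_mat k k"
  shows "det A \<noteq> 0 \<longleftrightarrow> cols_indep A {..<k} {..<k}"
proof -
  have "pick {..<k} i = i" if "i < k" for i
  proof -
    have "{a \<in> {..<k}. a < i} = {..<i}" using that by auto
    then show ?thesis using pick_card_in_set[of i "{..<k}"] that by simp
  qed
  then have "submatrix A {..<k} {..<k} = A"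
    using A submatrix_dim[of "{..<k}" A "{..<k}"] by (intro eq_matI) auto
  then show ?thesis using det_submatrix_nonzero_iff[of "{..<k}" A "{..<k}"] A by auto
qed

lemma minors_map_mat:
  assumes "comm_ring_hom h"
  shows "minors k (map_mat h A) = h ` minors k A"
proof -
  interpret h: comm_ring_hom h by fact
  have *: "det (submatrix (map_mat h A) I J) = h (det (submatrix A I J))"
    if "I \<subseteq> {..<dim_row A}" "J \<subseteq> {..<dim_col A}" for I J
  proof -
    have fin: "finite I" "finite J" using that finite_subset by blast+
    have "submatrix (map_mat h A) I J = map_mat h (submatrix A I J)"
    proof (rule eq_matI)
      fix i j assume "i < dim_row (map_mat h (submatrix A I J))" "j < dim_col (map_mat h (submatrix A I J))"
      then have ij: "i < card I" "j < card J" using submatrix_dim(1)[OF that] by auto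
      moreover have "pick I i \<in> I" "pick J j \<in> J" using ij pick_in_set_le by auto
      moreover have "submatrix (map_mat h A) I J $$ (i, j) = map_mat h A $$ (pick I i, pick J j)"
        using that ij by (intro submatrix_dim(2)) auto
      ultimately show "submatrix (map_mat h A) I J $$ (i, j) = map_mat h (submatrix A I J) $$ (i, j)"
        using that submatrix_dim[OF that] by (auto simp: subset_iff)
    qed (auto simp: submatrix_def)
    then show ?thesis by simp
  qed
  have "minors k (map_mat h A) = {h (det (submatrix A I J)) | I J.
      I \<subseteq> {..<dim_row A} \<and> J \<subseteq> {..<dim_col A} \<and> card I = k \<and> card J = k}"
    unfolding minors_def index_map_mat(2,3) by (intro Collect_cong ex_cong1) (auto simp: *)
  also have "\<dots> = h ` minors k A" unfolding minors_def by blast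
  finally show ?thesis .
qed

section \<open>Standard terms and the affine Hilbert function\<close>

lemma terms_iff: "t \<in> terms n \<longleftrightarrow> supp t \<subseteq> {..<n}"
  by (simp add: terms_def)

lemma terms_add_iff: "t + u \<in> terms n \<longleftrightarrow> t \<in> terms n \<and> u \<in> terms n"
  by (simp add: terms_iff supp_add_pp)

lemma terms_zero [simp]: "0 \<in> terms n"
  by (simp add: terms_iff)

lemma terms_single [simp]: "r < n \<Longrightarrow> Poly_Mapping.single r k \<in> terms n"
  by (simp add: terms_iff)

lemma xring_iff: "p \<in> carrier (xring n) \<longleftrightarrow> supp p \<subseteq> terms n"
  by (auto simp: Pol_iff terms_def)

lemma mterm_in_xring [simp]: "t \<in> terms n \<Longrightarrow> mterm t c \<in> carrier (xring n)"
  by (simp add: terms_iff)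

lemma mdeg_le_iff: "mdeg f \<le> d \<longleftrightarrow> (\<forall>t\<in>supp f. pp_deg t \<le> d)"
  by (simp add: mdeg_def)

lemma finite_terms_le: "finite {t\<in>terms n. pp_deg t \<le> d}"
proof (induction d)
  case 0
  have "{t\<in>terms n. pp_deg t \<le> 0} \<subseteq> {0}" by (auto simp: pp_deg_eq_0_iff)
  then show ?case using finite_subset by blast
next
  case (Suc d)
  have "{t\<in>terms n. pp_deg t \<le> Suc d} \<subseteq>
    insert 0 (\<Union>v<n. (+) (Poly_Mapping.single v 1) ` {t\<in>terms n. pp_deg t \<le> d})"
  proof
    fix t assume t: "t \<in> {t\<in>terms n. pp_deg t \<le> Suc d}"
    show "t \<in> insert 0 (\<Union>v<n. (+) (Poly_Mapping.single v 1) ` {t\<in>terms n. pp_deg t \<le> d})"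
    proof (cases "t = 0")
      case False
      then obtain v where v: "v \<in> supp t" using keys_eq_empty by blast
      then obtain u where u: "t = Poly_Mapping.single v 1 + u" by (rule pp_split_var)
      then have "u \<in> {t\<in>terms n. pp_deg t \<le> d}" "v < n"
        using t v by (auto simp: terms_add_iff pp_deg_add) (auto simp: terms_iff)
      then show ?thesis using u by auto
    qed simp
  qed
  then show ?case using Suc finite_subset by blast
qed

subsection \<open>Independence and normal forms modulo an ideal\<close>

definition indep_mod :: "('a, 'k::comm_ring_1) mpoly set \<Rightarrow> 'a pp set \<Rightarrow> bool" where
  "indep_mod J B \<longleftrightarrow> (\<forall>f. supp f \<subseteq> B \<and> f \<in> J \<longrightarrow> f = 0)"

lemma indep_modD: "indep_mod J B \<Longrightarrow> supp f \<subseteq> B \<Longrightarrow> f \<in> J \<Longrightarrow> f = 0"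
  by (simp add: indep_mod_def)

lemma indep_mod_mono: "indep_mod J B \<Longrightarrow> A \<subseteq> B \<Longrightarrow> indep_mod J A"
  by (auto simp: indep_mod_def)

lemma supp_mconst_times: "supp (mconst c * f) \<subseteq> supp (f :: ('v, 'k::comm_ring_1) mpoly)"
  using supp_mterm_times[of 0 c f] by (auto simp: mconst_def)

lemma coef_mconst_times: "coef (mconst c * f) t = c * coef f t"
  using coef_times_mterm[of 0 c f t] by (simp add: mconst_def)

lemma span_mod_extend:
  fixes J :: "(nat, 'k::Fields.field) mpoly set"
  assumes J: "ideal J (xring n)"
    and T: "\<And>t. t \<in> T \<Longrightarrow> \<exists>g. supp g \<subseteq> B \<and> mterm t 1 - g \<in> J"
    and f: "supp f \<subseteq> T"
  shows "\<exists>g. supp g \<subseteq> B \<and> f - g \<in> J"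
proof -
  note JD = ideal_mpolyD[OF J]
  obtain g where g: "\<And>t. t \<in> T \<Longrightarrow> supp (g t) \<subseteq> B" "\<And>t. t \<in> T \<Longrightarrow> mterm t 1 - g t \<in> J"
    using T by metis
  let ?g = "\<Sum>t\<in>supp f. mconst (coef f t) * g t"
  have "supp ?g \<subseteq> B"
    using f g(1) supp_mconst_times by (intro supp_sum_subset) blast
  moreover have "f - ?g = (\<Sum>t\<in>supp f. mconst (coef f t) * (mterm t 1 - g t))"
    by (subst (1) mpoly_eq_sum_mterm)
       (simp add: sum_subtractf right_diff_distrib mconst_def mult_single)
  moreover have "\<dots> \<in> J"
    using f g(2) by (intro JD(7) JD(6)) auto
  ultimately show ?thesis by auto
qed

text \<open>
  Among linearly independent terms there are at most as many as in a generating set: otherwise the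
  coefficients of their normal forms satisfy an underdetermined system of equations.
\<close>

lemma indep_mod_card_le:
  fixes J :: "(nat, 'k::Fields.field) mpoly set"
  assumes J: "ideal J (xring n)" and U: "finite U" "indep_mod J U"
    and vs: "\<And>u. u \<in> U \<Longrightarrow> \<exists>c. mterm u 1 - (\<Sum>j\<in>D. mconst (c j) * vs j) \<in> J" and D: "finite D"
  shows "card U \<le> card D"
proof (rule ccontr)
  note JD = ideal_mpolyD[OF J]
  assume "\<not> card U \<le> card D"
  then have less: "card D < card U" by simp
  obtain c where c: "\<And>u. u \<in> U \<Longrightarrow> mterm u 1 - (\<Sum>j\<in>D. mconst (c u j) * vs j) \<in> J"
    using vs by metis
  from underdetermined_system[OF D U(1) less, of "\<lambda>j u. c u j"]
  obtain v where v: "\<exists>u\<in>U. v u \<noteq> 0" "\<And>j. j \<in> D \<Longrightarrow> (\<Sum>u\<in>U. c u j * v u) = 0" by blast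
  let ?f = "\<Sum>u\<in>U. mterm u (v u)"
  interpret mc: comm_ring_hom "mconst :: 'k \<Rightarrow> (nat, 'k) mpoly" by (rule mconst_hom)
  let ?S = "\<lambda>u. \<Sum>j\<in>D. mconst (c u j) * vs j"
  have S: "mterm u (v u) = mconst (v u) * (mterm u 1 - ?S u) + (\<Sum>j\<in>D. mconst (c u j * v u) * vs j)" for u
  proof -
    have eq: "mconst (v u) * (mconst (c u j) * vs j) = mconst (c u j * v u) * vs j" for j
      by (simp only: mc.hom_mult mult.assoc mult.left_commute)
    have "(\<Sum>j\<in>D. mconst (c u j * v u) * vs j) = mconst (v u) * ?S u"
      by (simp only: sum_distrib_left eq)
    moreover have "mterm u (v u) = mconst (v u) * mterm u 1" by (simp add: mconst_def mult_single)
    ultimately show ?thesis by (simp add: right_diff_distrib)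
  qed
  have "?f = (\<Sum>u\<in>U. mconst (v u) * (mterm u 1 - ?S u)) + (\<Sum>u\<in>U. \<Sum>j\<in>D. mconst (c u j * v u) * vs j)"
    unfolding sum.distrib[symmetric] by (rule sum.cong[OF refl S])
  also have "(\<Sum>u\<in>U. \<Sum>j\<in>D. mconst (c u j * v u) * vs j) = (\<Sum>j\<in>D. mconst (\<Sum>u\<in>U. c u j * v u) * vs j)"
    by (subst sum.swap) (simp only: mc.hom_sum sum_distrib_right)
  also have "\<dots> = 0" using v(2) by simp
  finally have "?f \<in> J" using c by (auto intro!: JD(6,7))
  moreover have "supp ?f \<subseteq> U" by (intro supp_sum_subset) auto
  ultimately have "?f = 0" using indep_modD[OF U(2)] by blast
  moreover have "coef ?f u = v u" if "u \<in> U" for u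
    using that U(1) by (simp add: lookup_sum lookup_single when_def sum.delta')
  ultimately show False using v(1) by auto
qed

subsection \<open>Standard terms\<close>

text \<open>
  The degree-compatible term ordering that breaks ties by the order of exponent functions. By
  Macaulay's argument the terms that are not leading terms of elements of \<open>J\<close> form a basis of \<open>P/J\<close>
  that is compatible with the degree filtration.
\<close>

definition term_less :: "nat pp \<Rightarrow> nat pp \<Rightarrow> bool" where
  "term_less s t \<longleftrightarrow> pp_deg s < pp_deg t \<or> pp_deg s = pp_deg t \<and> s < t"

definition std_terms :: "nat \<Rightarrow> (nat, 'k::zero) mpoly set \<Rightarrow> nat pp set" where
  "std_terms n J = {t\<in>terms n. \<not> (\<exists>f\<in>J. t \<in> supp f \<and> (\<forall>s\<in>supp f. s = t \<or> term_less s t))}"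

lemma term_less_add: "term_less s t \<Longrightarrow> term_less (u + s) (u + t)"
  by (auto simp: term_less_def pp_deg_add)

lemma term_less_trans: "term_less s t \<Longrightarrow> term_less t u \<Longrightarrow> term_less s u"
  by (auto simp: term_less_def)

lemma term_less_irrefl: "\<not> term_less t t"
  by (auto simp: term_less_def)

lemma ex_leading_term:
  assumes "f \<noteq> 0"
  shows "\<exists>t\<in>supp f. \<forall>s\<in>supp f. s = t \<or> term_less s t"
proof -
  have ne: "supp f \<noteq> {}" using assms by simp
  define d where "d = Max (pp_deg ` supp f)"
  have "d \<in> pp_deg ` supp f" unfolding d_def using ne by (intro Max_in) auto
  then have d: "\<And>s. s \<in> supp f \<Longrightarrow> pp_deg s \<le> d" "\<exists>s\<in>supp f. pp_deg s = d"
    by (auto simp: d_def)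
  define t where "t = Max {s\<in>supp f. pp_deg s = d}"
  have t: "t \<in> {s\<in>supp f. pp_deg s = d}" unfolding t_def using d(2) by (intro Max_in) auto
  have "s = t \<or> term_less s t" if s: "s \<in> supp f" for s
  proof (cases "pp_deg s = d")
    case True
    have "finite {s\<in>supp f. pp_deg s = d}" by simp
    moreover have "s \<in> {s\<in>supp f. pp_deg s = d}" using s True by simp
    ultimately have "s \<le> t" unfolding t_def by (rule Max_ge)
    moreover have "pp_deg t = pp_deg s" using t True by simp
    ultimately show ?thesis unfolding term_less_def using order_le_imp_less_or_eq by metis
  next
    case False
    then show ?thesis using t d(1)[OF s] by (auto simp: term_less_def)
  qed
  then show ?thesis using t by blast
qed

lemma std_terms_indep:
  fixes J :: "(nat, 'k::Fields.field) mpoly set"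
  shows "indep_mod J (std_terms n J)"
  unfolding indep_mod_def
proof (intro allI impI)
  fix f assume f: "supp f \<subseteq> std_terms n J \<and> f \<in> J"
  show "f = 0"
  proof (rule ccontr)
    assume "f \<noteq> 0"
    then obtain t where "t \<in> supp f" "\<forall>s\<in>supp f. s = t \<or> term_less s t"
      using ex_leading_term by blast
    then show False using f unfolding std_terms_def by blast
  qed
qed

text \<open>
  Reduction: a term that is not standard is the leading term of an element of \<open>J\<close>, hence congruent to a
  combination of smaller terms. It terminates because only finitely many terms are smaller than a given one.
\<close>

lemma std_terms_span_term:
  fixes J :: "(nat, 'k::Fields.field) mpoly set"
  assumes J: "ideal J (xring n)" and t: "t \<in> terms n"
  shows "\<exists>g. supp g \<subseteq> {s\<in>std_terms n J. s = t \<or> term_less s t} \<and> mterm t 1 - g \<in> J"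
  using t
proof (induction "card {s\<in>terms n. term_less s t}" arbitrary: t rule: less_induct)
  case less
  note JD = ideal_mpolyD[OF J]
  have fin: "finite {s\<in>terms n. term_less s t}" for t
    by (rule finite_subset[OF _ finite_terms_le[of n "pp_deg t"]]) (auto simp: term_less_def)
  show ?case
  proof (cases "t \<in> std_terms n J")
    case True
    then show ?thesis using JD(2) by (intro exI[of _ "mterm t 1"]) auto
  next
    case False
    then obtain f where f: "f \<in> J" "t \<in> supp f" "\<And>s. s \<in> supp f \<Longrightarrow> s = t \<or> term_less s t"
      using less.prems by (auto simp: std_terms_def)
    have fT: "supp f \<subseteq> terms n" using f(1) JD(1) xring_iff by blast
    define c where "c = coef f t"
    have c: "c \<noteq> 0" using f(2) by (simp add: c_def in_keys_iff)
    let ?r = "mterm t 1 - mconst (inverse c) * f"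
    have "coef ?r t = 0" using c by (simp add: lookup_minus coef_mconst_times c_def)
    then have tr: "t \<notin> supp ?r" by (simp add: in_keys_iff)
    have r: "supp ?r \<subseteq> {s\<in>terms n. term_less s t}"
    proof
      fix s assume s: "s \<in> supp ?r"
      then have "s \<in> supp f"
        using supp_diff[of "mterm t 1" "mconst (inverse c) * f"] supp_mconst_times[of "inverse c" f] tr
        by (auto split: if_splits)
      then show "s \<in> {s\<in>terms n. term_less s t}" using f(3)[of s] fT s tr by auto
    qed
    have "\<exists>g. supp g \<subseteq> {s\<in>std_terms n J. s = t \<or> term_less s t} \<and> ?r - g \<in> J"
    proof (rule span_mod_extend[OF J _ r])
      fix u assume u: "u \<in> {s\<in>terms n. term_less s t}"
      have "{s\<in>terms n. term_less s u} \<subset> {s\<in>terms n. term_less s t}"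
        using u term_less_trans[of _ u t] term_less_irrefl by auto
      then have "\<exists>g. supp g \<subseteq> {s\<in>std_terms n J. s = u \<or> term_less s u} \<and> mterm u 1 - g \<in> J"
        using fin u by (intro less.hyps psubset_card_mono) auto
      then show "\<exists>g. supp g \<subseteq> {s\<in>std_terms n J. s = t \<or> term_less s t} \<and> mterm u 1 - g \<in> J"
        using u term_less_trans[of _ u t] by auto
    qed
    then obtain g where g: "supp g \<subseteq> {s\<in>std_terms n J. s = t \<or> term_less s t}" "?r - g \<in> J" by blast
    have "mterm t 1 - g = mconst (inverse c) * f + (?r - g)" by simp
    also have "\<dots> \<in> J" using g(2) f(1) by (intro JD(3,6)) auto
    finally show ?thesis using g(1) by blast
  qed
qed

lemma std_terms_span:
  fixes J :: "(nat, 'k::Fields.field) mpoly set"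
  assumes J: "ideal J (xring n)" and f: "supp f \<subseteq> {t\<in>terms n. pp_deg t \<le> d}"
  shows "\<exists>g. supp g \<subseteq> {t\<in>std_terms n J. pp_deg t \<le> d} \<and> f - g \<in> J"
proof (rule span_mod_extend[OF J _ f])
  fix t assume t: "t \<in> {t\<in>terms n. pp_deg t \<le> d}"
  then obtain g where "supp g \<subseteq> {s\<in>std_terms n J. s = t \<or> term_less s t}" "mterm t 1 - g \<in> J"
    using std_terms_span_term[OF J, of t] by blast
  moreover have "{s\<in>std_terms n J. s = t \<or> term_less s t} \<subseteq> {t\<in>std_terms n J. pp_deg t \<le> d}"
    using t by (auto simp: term_less_def)
  ultimately show "\<exists>g. supp g \<subseteq> {t\<in>std_terms n J. pp_deg t \<le> d} \<and> mterm t 1 - g \<in> J"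
    by blast
qed

lemma std_terms_divisor:
  fixes J :: "(nat, 'k::Fields.field) mpoly set"
  assumes J: "ideal J (xring n)" and uv: "u + v \<in> std_terms n J"
  shows "u \<in> std_terms n J"
proof (rule ccontr)
  have n: "u \<in> terms n" "v \<in> terms n" using uv by (auto simp: std_terms_def terms_add_iff)
  assume "u \<notin> std_terms n J"
  then obtain f where f: "f \<in> J" "u \<in> supp f" "\<And>s. s \<in> supp f \<Longrightarrow> s = u \<or> term_less s u"
    using n by (auto simp: std_terms_def)
  have "mterm v 1 * f \<in> J" using ideal_mpolyD(6)[OF J] f(1) n by simp
  moreover have "u + v \<in> supp (mterm v 1 * f)"
    using f(2) coef_times_mterm[of v 1 f u] by (simp add: in_keys_iff add.commute)
  moreover have "s = u + v \<or> term_less s (u + v)" if s: "s \<in> supp (mterm v 1 * f)" for s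
  proof -
    obtain w where "w \<in> supp f" "s = v + w" using s supp_mterm_times[of v 1 f] by auto
    then show ?thesis using f(3)[of w] term_less_add[of w u v] by (auto simp: add.commute)
  qed
  ultimately show False using uv unfolding std_terms_def by blast
qed

lemma finite_std_terms_le: "finite {t\<in>std_terms n J. pp_deg t \<le> d}"
  by (rule finite_subset[OF _ finite_terms_le[of n d]]) (auto simp: std_terms_def)

subsection \<open>Dimensions of residue class spaces\<close>

abbreviation qconsts :: "nat \<Rightarrow> (nat, 'k::Fields.field) mpoly set \<Rightarrow> (nat, 'k) mpoly set set" where
  "qconsts n J \<equiv> (\<lambda>c. J +>\<^bsub>xring n\<^esub> mconst c) ` UNIV"

lemma quot_ops:
  assumes J: "ideal J (mpoly_ring V)"
  shows "carrier (mpoly_ring V Quot J) = (\<lambda>f. J +>\<^bsub>mpoly_ring V\<^esub> f) ` Pol V"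
    "f \<in> Pol V \<Longrightarrow> g \<in> Pol V \<Longrightarrow>
      (J +>\<^bsub>mpoly_ring V\<^esub> f) \<oplus>\<^bsub>mpoly_ring V Quot J\<^esub> (J +>\<^bsub>mpoly_ring V\<^esub> g) = J +>\<^bsub>mpoly_ring V\<^esub> (f + g)"
    "f \<in> Pol V \<Longrightarrow> g \<in> Pol V \<Longrightarrow>
      (J +>\<^bsub>mpoly_ring V\<^esub> f) \<otimes>\<^bsub>mpoly_ring V Quot J\<^esub> (J +>\<^bsub>mpoly_ring V\<^esub> g) = J +>\<^bsub>mpoly_ring V\<^esub> (f * g)"
    "\<zero>\<^bsub>mpoly_ring V Quot J\<^esub> = J +>\<^bsub>mpoly_ring V\<^esub> 0"
    "\<one>\<^bsub>mpoly_ring V Quot J\<^esub> = J +>\<^bsub>mpoly_ring V\<^esub> 1"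
proof -
  interpret J: ideal J "mpoly_ring V" by fact
  show "carrier (mpoly_ring V Quot J) = (\<lambda>f. J +>\<^bsub>mpoly_ring V\<^esub> f) ` Pol V"
    by (auto simp: FactRing_def A_RCOSETS_def')
  show "f \<in> Pol V \<Longrightarrow> g \<in> Pol V \<Longrightarrow>
      (J +>\<^bsub>mpoly_ring V\<^esub> f) \<oplus>\<^bsub>mpoly_ring V Quot J\<^esub> (J +>\<^bsub>mpoly_ring V\<^esub> g) = J +>\<^bsub>mpoly_ring V\<^esub> (f + g)"
    using J.a_rcos_sum[of f g] by (simp add: FactRing_def)
  show "f \<in> Pol V \<Longrightarrow> g \<in> Pol V \<Longrightarrow>
      (J +>\<^bsub>mpoly_ring V\<^esub> f) \<otimes>\<^bsub>mpoly_ring V Quot J\<^esub> (J +>\<^bsub>mpoly_ring V\<^esub> g) = J +>\<^bsub>mpoly_ring V\<^esub> (f * g)"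
    using J.rcoset_mult_add[of f g] by (simp add: FactRing_def)
  show "\<zero>\<^bsub>mpoly_ring V Quot J\<^esub> = J +>\<^bsub>mpoly_ring V\<^esub> 0"
    by (simp add: FactRing_def mpoly_coset)
  show "\<one>\<^bsub>mpoly_ring V Quot J\<^esub> = J +>\<^bsub>mpoly_ring V\<^esub> 1"
    by (simp add: FactRing_def)
qed

lemma line_extension_quot:
  fixes J :: "(nat, 'k::Fields.field) mpoly set"
  assumes J: "ideal J (xring n)" and w: "w \<in> carrier (xring n)" and F: "F \<subseteq> carrier (xring n)"
  shows "ring.line_extension (xring n Quot J) (qconsts n J) (J +>\<^bsub>xring n\<^esub> w) ((\<lambda>f. J +>\<^bsub>xring n\<^esub> f) ` F)
    = (\<lambda>f. J +>\<^bsub>xring n\<^esub> f) ` {mconst c * w + f | c f. f \<in> F}"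
proof -
  interpret J: ideal J "xring n" by fact
  interpret Q: ring "xring n Quot J" by (rule J.quotient_is_ring)
  have eq: "(J +>\<^bsub>xring n\<^esub> mconst c) \<otimes>\<^bsub>xring n Quot J\<^esub> (J +>\<^bsub>xring n\<^esub> w) \<oplus>\<^bsub>xring n Quot J\<^esub> (J +>\<^bsub>xring n\<^esub> f)
      = J +>\<^bsub>xring n\<^esub> (mconst c * w + f)" if "f \<in> F" for c f
    using w F that by (subst quot_ops(3)[OF J]) (auto simp: quot_ops(2)[OF J] subset_iff)
  have "ring.line_extension (xring n Quot J) (qconsts n J) (J +>\<^bsub>xring n\<^esub> w) ((\<lambda>f. J +>\<^bsub>xring n\<^esub> f) ` F)
    = {(J +>\<^bsub>xring n\<^esub> mconst c) \<otimes>\<^bsub>xring n Quot J\<^esub> (J +>\<^bsub>xring n\<^esub> w) \<oplus>\<^bsub>xring n Quot J\<^esub> (J +>\<^bsub>xring n\<^esub> f) | c f. f \<in> F}"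
    unfolding Q.line_extension_def set_add_def' r_coset_def by blast
  also have "\<dots> = {J +>\<^bsub>xring n\<^esub> (mconst c * w + f) | c f. f \<in> F}"
    by (intro Collect_cong ex_cong1 rev_conj_cong refl) (simp add: eq)
  also have "\<dots> = (\<lambda>f. J +>\<^bsub>xring n\<^esub> f) ` {mconst c * w + f | c f. f \<in> F}" by blast
  finally show ?thesis .
qed

lemma dimension_span_terms:
  fixes J :: "(nat, 'k::Fields.field) mpoly set"
  assumes J: "ideal J (xring n)" and "finite B" "indep_mod J B" "B \<subseteq> terms n"
  shows "ring.dimension (xring n Quot J) (card B) (qconsts n J) ((\<lambda>f. J +>\<^bsub>xring n\<^esub> f) ` {g. supp g \<subseteq> B})"
  using assms(2-)
proof (induction B rule: finite_induct)
  interpret J: ideal J "xring n" by fact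
  interpret Q: ring "xring n Quot J" by (rule J.quotient_is_ring)
  note JD = ideal_mpolyD[OF J]
  case empty
  have "(\<lambda>f. J +>\<^bsub>xring n\<^esub> f) ` {g. supp g \<subseteq> {}} = {\<zero>\<^bsub>xring n Quot J\<^esub>}"
    by (auto simp: quot_ops[OF J] image_iff)
  then show ?case by simp
next
  case (insert b B)
  interpret J: ideal J "xring n" by fact
  interpret Q: ring "xring n Quot J" by (rule J.quotient_is_ring)
  let ?v = "J +>\<^bsub>xring n\<^esub> mterm b 1"
  let ?E = "(\<lambda>f. J +>\<^bsub>xring n\<^esub> f) ` {g. supp g \<subseteq> B}"
  have E: "ring.dimension (xring n Quot J) (card B) (qconsts n J) ?E"
    using insert by (auto intro: indep_mod_mono)
  have v: "?v \<notin> ?E"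
  proof
    assume "?v \<in> ?E"
    then obtain g where g: "supp g \<subseteq> B" "mterm b 1 - g \<in> J"
      by (auto simp: mpoly_coset_eq_iff[OF J])
    have "mterm b 1 - g = 0"
      by (rule indep_modD[OF insert.prems(1) _ g(2)]) (use g(1) supp_diff[of "mterm b 1" g] in auto)
    then have "coef g b = 1" by (metis eq_iff_diff_eq_0 lookup_single_eq)
    then show False using g(1) insert.hyps by (metis in_keys_iff subsetD zero_neq_one)
  qed
  have "?v \<in> carrier (xring n Quot J)"
    using insert.prems by (simp add: quot_ops[OF J])
  from Q.Suc_dim[OF this v E]
  have "ring.dimension (xring n Quot J) (Suc (card B)) (qconsts n J)
      ((\<lambda>f. J +>\<^bsub>xring n\<^esub> f) ` {mconst c * mterm b 1 + f | c f. f \<in> {g. supp g \<subseteq> B}})"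
    using insert.prems by (subst (asm) line_extension_quot[OF J]) (auto simp: xring_iff)
  also have "{mconst c * mterm b 1 + f | c f. f \<in> {g. supp g \<subseteq> B}} =
      {g :: (nat, 'k) mpoly. supp g \<subseteq> insert b B}" (is "?L = ?R")
  proof
    show "?L \<subseteq> ?R"
    proof clarify
      fix c f t assume "supp f \<subseteq> B" "t \<in> supp (mconst c * mterm b 1 + f)" "t \<notin> B"
      then show "t = b" using keys_add[of "mconst c * mterm b 1" f]
        by (auto simp: mconst_def mult_single split: if_splits)
    qed
    show "?R \<subseteq> ?L"
    proof
      fix g :: "(nat, 'k) mpoly" assume "g \<in> ?R"
      then have g: "supp g \<subseteq> insert b B" by simp
      have "g = mconst (coef g b) * mterm b 1 + (g - mterm b (coef g b))"
        by (simp add: mconst_def mult_single)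
      moreover have "supp (g - mterm b (coef g b)) \<subseteq> B"
        using g by (auto simp: in_keys_iff lookup_minus lookup_single when_def split: if_splits)
      ultimately show "g \<in> ?L" by blast
    qed
  qed
  finally show ?case using insert.hyps by simp
qed

lemma qconsts_subfield:
  fixes J :: "(nat, 'k::Fields.field) mpoly set"
  assumes J: "ideal J (xring n)" and "1 \<notin> J"
  shows "subfield (qconsts n J) (xring n Quot J)"
proof -
  interpret J: ideal J "xring n" by fact
  interpret Q: ring "xring n Quot J" by (rule J.quotient_is_ring)
  interpret F: field "ring_of_type_algebra :: 'k ring" by (rule field_from_type_algebra)
  have [simp]: "carrier (ring_of_type_algebra :: 'k ring) = UNIV"
    "x \<otimes>\<^bsub>ring_of_type_algebra\<^esub> y = x * y" "x \<oplus>\<^bsub>ring_of_type_algebra\<^esub> y = x + y"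
    "\<one>\<^bsub>ring_of_type_algebra\<^esub> = (1 :: 'k)" for x y :: 'k
    by (simp_all add: ring_of_type_algebra_def)
  interpret c: comm_ring_hom "mconst :: 'k \<Rightarrow> (nat, 'k) mpoly" by (rule mconst_hom)
  interpret h: ring_hom_ring "ring_of_type_algebra :: 'k ring" "xring n Quot J" "\<lambda>c. J +>\<^bsub>xring n\<^esub> mconst c"
    by (rule ring_hom_ringI[OF F.ring_axioms Q.ring_axioms])
       (auto simp: quot_ops[OF J] c.hom_add c.hom_mult)
  have "J +>\<^bsub>xring n\<^esub> 1 \<noteq> J +>\<^bsub>xring n\<^esub> 0"
    using assms(2) by (simp add: mpoly_coset_eq_iff[OF J])
  then show ?thesis
    using h.img_is_subfield(2)[OF F.carrier_is_subfield] by (simp add: quot_ops[OF J])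
qed

lemma ring_dim_eq:
  fixes J :: "(nat, 'k::Fields.field) mpoly set"
  assumes J: "ideal J (xring n)" and "1 \<notin> J"
    and dim: "ring.dimension (xring n Quot J) d (qconsts n J) E"
  shows "ring.dim (xring n Quot J) (qconsts n J) E = d"
    and "ring.dimension (xring n Quot J) e (qconsts n J) E \<Longrightarrow> e = d"
proof -
  interpret J: ideal J "xring n" by fact
  interpret Q: ring "xring n Quot J" by (rule J.quotient_is_ring)
  note inj = Q.dimension_is_inj[OF qconsts_subfield[OF assms(1,2)]]
  show "ring.dim (xring n Quot J) (qconsts n J) E = d"
    unfolding Q.dim_def using dim inj by blast
  show "ring.dimension (xring n Quot J) e (qconsts n J) E \<Longrightarrow> e = d"
    using dim inj by blast
qed

text \<open>
  As the ordering is compatible with the degree, reduction does not raise the degree. The standard terms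
  of degree at most \<open>d\<close> therefore span the \<open>d\<close>-th part of the filtration.
\<close>

lemma affine_HF_std_terms:
  fixes J :: "(nat, 'k::Fields.field) mpoly set"
  assumes J: "ideal J (xring n)" and "1 \<notin> J"
  shows "affine_HF n J d = card {t\<in>std_terms n J. pp_deg t \<le> d}"
proof -
  let ?B = "{t\<in>std_terms n J. pp_deg t \<le> d}"
  have "deg_filt n J d = (\<lambda>f. J +>\<^bsub>xring n\<^esub> f) ` {g. supp g \<subseteq> ?B}"
  proof
    show "deg_filt n J d \<subseteq> (\<lambda>f. J +>\<^bsub>xring n\<^esub> f) ` {g. supp g \<subseteq> ?B}"
      unfolding deg_filt_def
    proof clarify
      fix f :: "(nat, 'k) mpoly" assume f: "f \<in> carrier (xring n)" "mdeg f \<le> d"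
      then obtain g where "supp g \<subseteq> ?B" "f - g \<in> J"
        using std_terms_span[OF J, of f d] by (auto simp: xring_iff mdeg_le_iff)
      then show "J +>\<^bsub>xring n\<^esub> f \<in> (\<lambda>f. J +>\<^bsub>xring n\<^esub> f) ` {g. supp g \<subseteq> ?B}"
        by (auto simp: mpoly_coset_eq_iff[OF J] intro!: image_eqI[of _ _ g])
    qed
    show "(\<lambda>f. J +>\<^bsub>xring n\<^esub> f) ` {g. supp g \<subseteq> ?B} \<subseteq> deg_filt n J d"
    proof clarify
      fix g :: "(nat, 'k) mpoly" assume "supp g \<subseteq> ?B"
      then have "g \<in> carrier (xring n)" "mdeg g \<le> d"
        unfolding xring_iff mdeg_le_iff std_terms_def by blast+
      then show "J +>\<^bsub>xring n\<^esub> g \<in> deg_filt n J d" unfolding deg_filt_def by blast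
    qed
  qed
  moreover have "ring.dimension (xring n Quot J) (card ?B) (qconsts n J) ((\<lambda>f. J +>\<^bsub>xring n\<^esub> f) ` {g. supp g \<subseteq> ?B})"
    by (rule dimension_span_terms[OF J finite_std_terms_le indep_mod_mono[OF std_terms_indep]])
       (auto simp: std_terms_def)
  ultimately show ?thesis
    unfolding affine_HF_def using ring_dim_eq(1)[OF assms] by simp
qed

lemma card_indep_le_affine_HF:
  fixes J :: "(nat, 'k::Fields.field) mpoly set"
  assumes J: "ideal J (xring n)" "1 \<notin> J" and U: "indep_mod J U" "U \<subseteq> {t\<in>terms n. pp_deg t \<le> d}"
  shows "card U \<le> affine_HF n J d"
  unfolding affine_HF_std_terms[OF J]
proof (rule indep_mod_card_le[OF J(1) _ U(1), where vs = "\<lambda>t. mterm t 1"])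
  show "finite U" using U(2) finite_terms_le finite_subset by blast
  fix u assume "u \<in> U"
  then have "supp (mterm u (1::'k)) \<subseteq> {t\<in>terms n. pp_deg t \<le> d}" using U(2) by auto
  then obtain g where g: "supp g \<subseteq> {t\<in>std_terms n J. pp_deg t \<le> d}" "mterm u 1 - g \<in> J"
    using std_terms_span[OF J(1)] by blast
  have "g = (\<Sum>t\<in>supp g. mterm t (coef g t))" by (rule mpoly_eq_sum_mterm)
  also have "\<dots> = (\<Sum>t | t \<in> std_terms n J \<and> pp_deg t \<le> d. mconst (coef g t) * mterm t 1)"
    using g(1) finite_std_terms_le by (intro sum.mono_neutral_cong_left) (auto simp: in_keys_iff mconst_def mult_single)
  finally have eq: "g = \<dots>" .
  show "\<exists>c. mterm u 1 - (\<Sum>t | t \<in> std_terms n J \<and> pp_deg t \<le> d. mconst (c t) * mterm t 1) \<in> J"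
    by (rule exI[of _ "coef g"], subst eq[symmetric], rule g(2))
qed (rule finite_std_terms_le)

text \<open>
  The standard terms of degree at most \<open>d\<close> are independent and lie in the span of \<open>B\<close> modulo \<open>J\<close>, so
  that they are not more numerous than \<open>B\<close>.
\<close>

lemma affine_HF_le_card:
  fixes J :: "(nat, 'k::Fields.field) mpoly set"
  assumes J: "ideal J (xring n)" "1 \<notin> J" and B: "finite B"
    and span: "\<And>t. t \<in> terms n \<Longrightarrow> pp_deg t \<le> d \<Longrightarrow> \<exists>g. supp g \<subseteq> B \<and> mterm t 1 - g \<in> J"
  shows "affine_HF n J d \<le> card B"
  unfolding affine_HF_std_terms[OF J]
proof (rule indep_mod_card_le[OF J(1) finite_std_terms_le, where vs = "\<lambda>t. mterm t 1"])
  show "indep_mod J {t \<in> std_terms n J. pp_deg t \<le> d}"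
    by (rule indep_mod_mono[OF std_terms_indep]) auto
  fix u assume "u \<in> {t \<in> std_terms n J. pp_deg t \<le> d}"
  then obtain g where g: "supp g \<subseteq> B" "mterm u 1 - g \<in> J"
    using span[of u] by (auto simp: std_terms_def)
  have "g = (\<Sum>t\<in>supp g. mterm t (coef g t))" by (rule mpoly_eq_sum_mterm)
  also have "\<dots> = (\<Sum>t\<in>B. mconst (coef g t) * mterm t 1)"
    using g(1) B by (intro sum.mono_neutral_cong_left) (auto simp: in_keys_iff mconst_def mult_single)
  finally have eq: "g = \<dots>" .
  show "\<exists>c. mterm u 1 - (\<Sum>t\<in>B. mconst (c t) * mterm t 1) \<in> J"
    by (rule exI[of _ "coef g"], subst eq[symmetric], rule g(2))
qed (rule B)

lemma affine_HF_mono: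
  fixes J :: "(nat, 'k::Fields.field) mpoly set"
  assumes "ideal J (xring n)" "1 \<notin> J" and "i \<le> j"
  shows "affine_HF n J i \<le> affine_HF n J j"
  unfolding affine_HF_std_terms[OF assms(1,2)] using assms(3)
  by (intro card_mono finite_std_terms_le) auto

lemma affine_HF_0_le:
  fixes J :: "(nat, 'k::Fields.field) mpoly set"
  assumes J: "ideal J (xring n)" "1 \<notin> J"
  shows "affine_HF n J 0 \<le> 1"
proof -
  have "{t\<in>std_terms n J. pp_deg t \<le> 0} \<subseteq> {0}" by (auto simp: pp_deg_eq_0_iff)
  from card_mono[OF _ this] show ?thesis by (simp add: affine_HF_std_terms[OF J])
qed

lemma dimension_generators:
  fixes J :: "(nat, 'k::Fields.field) mpoly set"
  assumes J: "ideal J (xring n)"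
    and "ring.dimension (xring n Quot J) d (qconsts n J) E"
  shows "\<exists>vs. (\<forall>j<d. vs j \<in> carrier (xring n)) \<and>
    E = {J +>\<^bsub>xring n\<^esub> (\<Sum>j<d. mconst (c j) * vs j) | c. True}"
proof -
  interpret J: ideal J "xring n" by fact
  interpret Q: ring "xring n Quot J" by (rule J.quotient_is_ring)
  define K0 where "K0 = qconsts n J"
  have "Q.dimension d K0 E" using assms(2) by (simp add: K0_def)
  then show ?thesis using K0_def
  proof (induction d K0 E rule: Q.dimension.induct)
    case (zero_dim K)
    then show ?case by (auto simp: quot_ops[OF J])
  next
    case (Suc_dim v E d K)
    then obtain vs where vs: "\<forall>j<d. vs j \<in> carrier (xring n)"
      "E = {J +>\<^bsub>xring n\<^esub> (\<Sum>j<d. mconst (c j) * vs j) | c. True}" by auto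
    obtain w where w: "w \<in> carrier (xring n)" "v = J +>\<^bsub>xring n\<^esub> w"
      using Suc_dim(1) by (auto simp: quot_ops[OF J])
    let ?F = "{\<Sum>j<d. mconst (c j) * vs j | c. True}"
    have F: "?F \<subseteq> carrier (xring n)"
      using vs(1) by (auto intro!: Pol_sum simp: Pol_closed)
    have "E = (\<lambda>f. J +>\<^bsub>xring n\<^esub> f) ` ?F" unfolding vs(2) by blast
    then have "Q.line_extension K v E = (\<lambda>f. J +>\<^bsub>xring n\<^esub> f) ` {mconst c * w + f | c f. f \<in> ?F}"
      unfolding Suc_dim(5) w(2) by (simp only: line_extension_quot[OF J w(1) F])
    also have "\<dots> = {J +>\<^bsub>xring n\<^esub> (\<Sum>j<Suc d. mconst (c j) * (vs(d := w)) j) | c. True}" (is "?L = ?R")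
    proof
      show "?L \<subseteq> ?R"
      proof clarify
        fix a c
        show "\<exists>c'. J +>\<^bsub>xring n\<^esub> (mconst a * w + (\<Sum>j<d. mconst (c j) * vs j)) =
            J +>\<^bsub>xring n\<^esub> (\<Sum>j<Suc d. mconst (c' j) * (vs(d := w)) j) \<and> True"
          by (intro exI[of _ "c(d := a)"]) (simp add: add.commute)
      qed
      show "?R \<subseteq> ?L"
      proof clarify
        fix c
        show "J +>\<^bsub>xring n\<^esub> (\<Sum>j<Suc d. mconst (c j) * (vs(d := w)) j) \<in> ?L"
        proof (rule image_eqI)
          show "mconst (c d) * w + (\<Sum>j<d. mconst (c j) * vs j) \<in> {mconst c * w + f | c f. f \<in> ?F}" by blast
        qed (simp add: add.commute)
      qed
    qed
    finally show ?case using vs(1) w(1) by (intro exI[of _ "vs(d := w)"]) auto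
  qed
qed

lemma affine_HF_le_dimension:
  fixes J :: "(nat, 'k::Fields.field) mpoly set"
  assumes "zero_dim_ideal n \<mu> J"
  shows "1 \<notin> J" "affine_HF n J d \<le> \<mu>"
proof -
  have J: "ideal J (xring n)" and \<mu>: "\<mu> \<ge> 1"
    and dim: "ring.dimension (xring n Quot J) \<mu> (qconsts n J) (carrier (xring n Quot J))"
    using assms by (auto simp: zero_dim_ideal_def)
  note JD = ideal_mpolyD[OF J]
  interpret J: ideal J "xring n" by fact
  interpret Q: ring "xring n Quot J" by (rule J.quotient_is_ring)
  show 1: "1 \<notin> J"
  proof
    assume 1: "1 \<in> J"
    then have J_all: "f \<in> J" if "f \<in> carrier (xring n)" for f
      using JD(6)[OF that 1] by simp
    then have one_class: "e = J +>\<^bsub>xring n\<^esub> 0" if "e \<in> carrier (xring n Quot J)" for e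
    proof -
      have "e \<in> (\<lambda>f. J +>\<^bsub>xring n\<^esub> f) ` carrier (xring n)"
        using that by (simp only: quot_ops(1)[OF J])
      then obtain f where "e = J +>\<^bsub>xring n\<^esub> f" "f \<in> carrier (xring n)" by (rule imageE)
      then show ?thesis using J_all by (simp add: mpoly_coset_eq_iff[OF J])
    qed
    from dim show False
    proof (cases rule: Q.dimension.cases)
      case (Suc_dim v E d)
      obtain vs where E: "E = {J +>\<^bsub>xring n\<^esub> (\<Sum>j<d. mconst (c j) * vs j) | c. True}"
        using dimension_generators[OF J Suc_dim(5)] by blast
      have "J +>\<^bsub>xring n\<^esub> 0 \<in> E" unfolding E
        by (rule CollectI, rule exI[of _ "\<lambda>_. 0"]) (simp add: mconst_def)
      then show False using Suc_dim(3,4) one_class by simp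
    qed (use \<mu> in simp)
  qed
  obtain vs where vs: "carrier (xring n Quot J) = {J +>\<^bsub>xring n\<^esub> (\<Sum>j<\<mu>. mconst (c j) * vs j) | c. True}"
    using dimension_generators[OF J dim] by blast
  have "card {t\<in>std_terms n J. pp_deg t \<le> d} \<le> card {..<\<mu>}"
  proof (rule indep_mod_card_le[OF J finite_std_terms_le, where vs = vs])
    show "indep_mod J {t \<in> std_terms n J. pp_deg t \<le> d}"
      by (rule indep_mod_mono[OF std_terms_indep]) auto
    fix u assume "u \<in> {t \<in> std_terms n J. pp_deg t \<le> d}"
    then have "J +>\<^bsub>xring n\<^esub> mterm u 1 \<in> carrier (xring n Quot J)"
      by (auto simp: quot_ops[OF J] std_terms_def)
    then obtain c where "J +>\<^bsub>xring n\<^esub> mterm u 1 = J +>\<^bsub>xring n\<^esub> (\<Sum>j<\<mu>. mconst (c j) * vs j)"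
      using vs by blast
    then show "\<exists>c. mterm u 1 - (\<Sum>j\<in>{..<\<mu>}. mconst (c j) * vs j) \<in> J"
      by (auto simp: mpoly_coset_eq_iff[OF J])
  qed simp
  then show "affine_HF n J d \<le> \<mu>" by (simp add: affine_HF_std_terms[OF J 1])
qed

no_notation fps_nth (infixl \<open>$\<close> 75)

section \<open>Border bases and multiplication matrices\<close>

subsection \<open>Linear extension of functions on terms\<close>

definition lext :: "('a pp \<Rightarrow> 'k::comm_ring_1) \<Rightarrow> ('a, 'k) mpoly \<Rightarrow> 'k" where
  "lext g f = (\<Sum>t\<in>supp f. coef f t * g t)"

lemma lext_superset: "finite A \<Longrightarrow> supp f \<subseteq> A \<Longrightarrow> lext g f = (\<Sum>t\<in>A. coef f t * g t)"
  unfolding lext_def by (rule sum.mono_neutral_left) (auto simp: in_keys_iff)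

lemma lext_add: "lext g (f + f') = lext g f + lext g f'"
  using lext_superset[of "supp f \<union> supp f'" f g] lext_superset[of "supp f \<union> supp f'" f' g]
    lext_superset[of "supp f \<union> supp f'" "f + f'" g] keys_add[of f f']
  by (simp add: lookup_add sum.distrib algebra_simps)

lemma lext_0 [simp]: "lext g 0 = 0"
  by (simp add: lext_def)

lemma lext_diff: "lext g (f - f') = lext g f - lext g f'"
  using lext_add[of g "f - f'" f'] by simp

lemma lext_mconst: "lext g (mconst c * f) = c * lext g f"
  using lext_superset[of "supp f" "mconst c * f" g] supp_mconst_times[of c f]
  by (simp add: coef_mconst_times lext_def sum_distrib_left mult.assoc)

lemma lext_mterm [simp]: "lext g (mterm t c) = c * g t"
  using lext_superset[of "{t}" "mterm t c" g] by simp

lemma lext_sum: "lext g (sum f A) = (\<Sum>i\<in>A. lext g (f i))"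
  by (induction A rule: infinite_finite_induct) (simp_all add: lext_add)

lemma lext_mvar: "lext g (mvar v * f) = lext (\<lambda>t. g (Poly_Mapping.single v 1 + t)) f"
proof -
  have "mvar v * f = (\<Sum>t\<in>supp f. mterm (Poly_Mapping.single v 1 + t) (coef f t))"
    by (subst mpoly_eq_sum_mterm[of f]) (simp add: mvar_def sum_distrib_left mult_single)
  then show ?thesis by (simp add: lext_sum) (simp add: lext_def)
qed

lemma lext_linear_fun: "lext (\<lambda>t. \<Sum>k\<in>A. c k * g k t) f = (\<Sum>k\<in>A. c k * lext (g k) f)"
  unfolding lext_def sum_distrib_left by (subst sum.swap) (simp add: mult_ac)

lemma mterm_times_times:
  "mterm a c * (mterm b d * f) = mterm (a + b) (c * d) * (f :: ('v, 'k::comm_ring_1) mpoly)"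
  by (simp add: mult_single flip: mult.assoc)

lemma mterm_sum: "mterm t (sum f A) = (\<Sum>i\<in>A. mterm t (f i))"
  by (induction A rule: infinite_finite_induct) (simp_all add: single_add)

subsection \<open>Enumerated order ideals\<close>

lemma enum_order_idealD:
  assumes "enum_order_ideal n ts bs"
  shows "length ts > 0" "ts ! 0 = 0" "set ts \<subseteq> terms n" "set bs \<subseteq> terms n"
    "distinct ts" "distinct bs" "set ts \<inter> set bs = {}"
    "\<And>u v. u + v \<in> set ts \<Longrightarrow> u \<in> set ts \<and> v \<in> set ts"
    "\<And>r t. r < n \<Longrightarrow> t \<in> set ts \<Longrightarrow> Poly_Mapping.single r 1 + t \<in> set ts \<union> set bs"
    "\<And>b. b \<in> set bs \<Longrightarrow> \<exists>r<n. \<exists>t\<in>set ts. b = Poly_Mapping.single r 1 + t"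
    "\<And>i j. i \<le> j \<Longrightarrow> j < length ts \<Longrightarrow> pp_deg (ts ! i) \<le> pp_deg (ts ! j)"
proof -
  have O: "order_ideal n (set ts)" and srt: "sorted (map pp_deg ts)" and B: "set bs = border n (set ts)"
    and "distinct ts" "distinct bs"
    using assms by (auto simp: enum_order_ideal_def)
  show "distinct ts" "distinct bs" by fact+
  show T: "set ts \<subseteq> terms n" using O by (simp add: order_ideal_def)
  show div: "u \<in> set ts \<and> v \<in> set ts" if "u + v \<in> set ts" for u v
  proof -
    have "u \<in> terms n" "v \<in> terms n" using that T terms_add_iff by blast+
    then show ?thesis using O that unfolding order_ideal_def by (metis add.commute)
  qed
  show len: "length ts > 0" using O by (auto simp: order_ideal_def)
  show mono: "pp_deg (ts ! i) \<le> pp_deg (ts ! j)" if "i \<le> j" "j < length ts" for i j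
    using srt that by (auto simp: sorted_iff_nth_mono)
  have "0 \<in> set ts" using div[of 0 "ts ! 0"] len by simp
  then obtain k where k: "k < length ts" "ts ! k = 0" by (auto simp: in_set_conv_nth)
  then have "pp_deg (ts ! 0) = 0" using mono[of 0 k] by simp
  then show "ts ! 0 = 0" by (simp add: pp_deg_eq_0_iff)
  show "set bs \<subseteq> terms n" "set ts \<inter> set bs = {}"
    using T unfolding B border_def by (auto simp: terms_add_iff subset_iff)
  show "Poly_Mapping.single r 1 + t \<in> set ts \<union> set bs" if "r < n" "t \<in> set ts" for r t
    using that unfolding B border_def by auto
  show "\<exists>r<n. \<exists>t\<in>set ts. b = Poly_Mapping.single r 1 + t" if "b \<in> set bs" for b
    using that unfolding B border_def by auto
qed

lemma the_index:
  assumes "distinct xs" "m < length xs"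
  shows "(THE m'. m' < length xs \<and> xs ! m' = xs ! m) = m"
  using assms by (intro the_equality) (auto simp: nth_eq_iff_index_eq)

subsection \<open>Matrices of a point\<close>

definition pt_mat :: "nat pp list \<Rightarrow> nat pp list \<Rightarrow> 'l::comm_ring_1 mat \<Rightarrow> nat \<Rightarrow> 'l mat" where
  "pt_mat ts bs \<Gamma> r = mat (length ts) (length ts) (\<lambda>(i, j).
     let t = Poly_Mapping.single r 1 + ts ! j in
     if t \<in> set ts then (if t = ts ! i then 1 else 0)
     else \<Gamma> $$ (i, THE m. m < length bs \<and> bs ! m = t))"

lemma pt_mat_dim [simp]: "pt_mat ts bs \<Gamma> r \<in> carrier_mat (length ts) (length ts)"
  "dim_row (pt_mat ts bs \<Gamma> r) = length ts" "dim_col (pt_mat ts bs \<Gamma> r) = length ts"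
  by (simp_all add: pt_mat_def)

lemma pt_mat_in:
  "i < length ts \<Longrightarrow> k < length ts \<Longrightarrow> Poly_Mapping.single r 1 + ts ! k \<in> set ts \<Longrightarrow>
   pt_mat ts bs \<Gamma> r $$ (i, k) = (if Poly_Mapping.single r 1 + ts ! k = ts ! i then 1 else 0)"
  by (simp add: pt_mat_def)

lemma pt_mat_border:
  assumes "enum_order_ideal n ts bs" "i < length ts" "k < length ts" "m < length bs"
    "Poly_Mapping.single r 1 + ts ! k = bs ! m"
  shows "pt_mat ts bs \<Gamma> r $$ (i, k) = \<Gamma> $$ (i, m)"
proof -
  have "bs ! m \<notin> set ts" using enum_order_idealD(7)[OF assms(1)] nth_mem[OF assms(4)] by blast
  then show ?thesis
    using assms the_index[OF enum_order_idealD(6)[OF assms(1)] assms(4)] by (simp add: pt_mat_def)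
qed

lemma eval_gen_mult_mat:
  assumes "comm_ring_hom h"
  shows "map_mat (mpoly_eval h (\<lambda>ij. \<Gamma> $$ ij)) (gen_mult_mat ts bs r) = pt_mat ts bs \<Gamma> r"
proof -
  interpret h: comm_ring_hom h by fact
  interpret e: comm_ring_hom "mpoly_eval h (\<lambda>ij. \<Gamma> $$ ij)" by (rule mpoly_eval_hom) fact
  show ?thesis
    by (intro eq_matI) (auto simp: gen_mult_mat_def pt_mat_def Let_def mpoly_eval_mvar)
qed

lemma gen_mult_mat_dim [simp]: "gen_mult_mat ts bs r \<in> carrier_mat (length ts) (length ts)"
  "dim_row (gen_mult_mat ts bs r) = length ts" "dim_col (gen_mult_mat ts bs r) = length ts"
  by (simp_all add: gen_mult_mat_def)

lemma eval_term_carrier: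
  assumes "\<And>r. r < n \<Longrightarrow> M r \<in> carrier_mat \<mu> \<mu>"
  shows "eval_term \<mu> n M t \<in> carrier_mat \<mu> \<mu>"
proof -
  have "foldr (\<lambda>r N. (M r ^\<^sub>m coef t r) * N) rs (1\<^sub>m \<mu>) \<in> carrier_mat \<mu> \<mu>" if "set rs \<subseteq> {..<n}" for rs
    using that assms by (induction rs) (auto intro: mult_carrier_mat pow_carrier_mat)
  from this[of "[0..<n]"] show ?thesis unfolding eval_term_def by force
qed

lemma eval_term_zero: "(\<And>r. r < n \<Longrightarrow> M r \<in> carrier_mat \<mu> \<mu>) \<Longrightarrow> eval_term \<mu> n M 0 = 1\<^sub>m \<mu>"
proof -
  assume M: "\<And>r. r < n \<Longrightarrow> M r \<in> carrier_mat \<mu> \<mu>"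
  have "foldr (\<lambda>r N. (M r ^\<^sub>m coef 0 r) * N) rs (1\<^sub>m \<mu>) = 1\<^sub>m \<mu>" if "set rs \<subseteq> {..<n}" for rs
    using that
  proof (induction rs)
    case (Cons r rs)
    then have "dim_row (M r) = \<mu>" using M by auto
    then show ?case using Cons by simp
  qed simp
  from this[of "[0..<n]"] show ?thesis unfolding eval_term_def by force
qed

lemma map_mat_eval_term:
  assumes "comm_ring_hom h" and M: "\<And>r. r < n \<Longrightarrow> M r \<in> carrier_mat \<mu> \<mu>"
    and N: "\<And>r. r < n \<Longrightarrow> map_mat h (M r) = N r"
  shows "map_mat h (eval_term \<mu> n M t) = eval_term \<mu> n N t"
proof -
  interpret h: comm_ring_hom h by fact
  have "foldr (\<lambda>r N. (M r ^\<^sub>m coef t r) * N) rs (1\<^sub>m \<mu>) \<in> carrier_mat \<mu> \<mu> \<and>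
    map_mat h (foldr (\<lambda>r N. (M r ^\<^sub>m coef t r) * N) rs (1\<^sub>m \<mu>)) =
      foldr (\<lambda>r N'. (N r ^\<^sub>m coef t r) * N') rs (1\<^sub>m \<mu>)" if "set rs \<subseteq> {..<n}" for rs
    using that
  proof (induction rs)
    case (Cons r rs)
    then have r: "r < n" by simp
    have P: "M r ^\<^sub>m coef t r \<in> carrier_mat \<mu> \<mu>" using M[OF r] by (rule pow_carrier_mat)
    show ?case
      using Cons P by (auto simp: h.mat_hom_mult[OF P] h.mat_hom_pow[OF M[OF r]] N[OF r] intro: mult_carrier_mat)
  qed (simp add: h.mat_hom_one)
  from this[of "[0..<n]"] show ?thesis unfolding eval_term_def by force
qed

text \<open>The new factor is moved past the powers of the preceding matrices, which is where commutation enters.\<close>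

lemma eval_term_mult_var:
  assumes M: "\<And>r. r < n \<Longrightarrow> M r \<in> carrier_mat \<mu> \<mu>"
    and comm: "\<And>r s. r < n \<Longrightarrow> s < n \<Longrightarrow> M r * M s = M s * M r"
    and r: "r < n"
  shows "eval_term \<mu> n M (Poly_Mapping.single r 1 + t) = M r * eval_term \<mu> n M t"
proof -
  let ?F = "\<lambda>t rs. foldr (\<lambda>r N. (M r ^\<^sub>m coef t r) * N) rs (1\<^sub>m \<mu>)"
  have F: "?F t rs \<in> carrier_mat \<mu> \<mu>" if "set rs \<subseteq> {..<n}" for rs t
    using that M by (induction rs) (auto intro: mult_carrier_mat pow_carrier_mat)
  have pow: "M s ^\<^sub>m k * M r = M r * M s ^\<^sub>m k" if "s < n" for s k
  proof (induction k)
    case (Suc k)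
    have P: "M s ^\<^sub>m k \<in> carrier_mat \<mu> \<mu>" using M[OF that] by (rule pow_carrier_mat)
    have "M s ^\<^sub>m Suc k * M r = M s ^\<^sub>m k * (M r * M s)"
      using P M[OF that] M[OF r] comm[OF that r] by (simp add: assoc_mult_mat[of _ \<mu> \<mu> _ \<mu> _ \<mu>])
    also have "\<dots> = M r * M s ^\<^sub>m Suc k"
      using P M[OF that] M[OF r] Suc by (simp add: assoc_mult_mat[of _ \<mu> \<mu> _ \<mu> _ \<mu>, symmetric])
    finally show ?case .
  qed (use M[OF r] M[OF that] in simp)
  have notin: "?F (Poly_Mapping.single r 1 + t) rs = ?F t rs" if "r \<notin> set rs" for rs
    using that by (induction rs) (auto simp: lookup_add lookup_single)
  have "?F (Poly_Mapping.single r 1 + t) rs = M r * ?F t rs"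
    if "set rs \<subseteq> {..<n}" "distinct rs" "r \<in> set rs" for rs
    using that
  proof (induction rs)
    case (Cons s rs)
    have s: "s < n" and rs: "set rs \<subseteq> {..<n}" using Cons.prems by auto
    have P: "M s ^\<^sub>m k \<in> carrier_mat \<mu> \<mu>" for k using M[OF s] by (rule pow_carrier_mat)
    show ?case
    proof (cases "s = r")
      case True
      have "coef (Poly_Mapping.single r 1 + t) r = Suc (coef t r)" by (simp add: lookup_add)
      moreover have "r \<notin> set rs" using Cons.prems True by auto
      ultimately have "?F (Poly_Mapping.single r 1 + t) (s # rs) = (M r ^\<^sub>m coef t r * M r) * ?F t rs"
        using True notin by simp
      also have "\<dots> = M r * (M r ^\<^sub>m coef t r * ?F t rs)"
        using pow[OF r, of "coef t r"] P M[OF r] F[OF rs] True by (simp add: assoc_mult_mat[of _ \<mu> \<mu> _ \<mu> _ \<mu>])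
      finally show ?thesis using True by simp
    next
      case False
      then have "?F (Poly_Mapping.single r 1 + t) (s # rs) = M s ^\<^sub>m coef t s * (M r * ?F t rs)"
        using Cons by (simp add: lookup_add lookup_single)
      also have "\<dots> = (M r * M s ^\<^sub>m coef t s) * ?F t rs"
        using P M[OF r] F[OF rs] pow[OF s] by (simp add: assoc_mult_mat[of _ \<mu> \<mu> _ \<mu> _ \<mu>, symmetric])
      also have "\<dots> = M r * (M s ^\<^sub>m coef t s * ?F t rs)"
        using P M[OF r] F[OF rs] by (simp add: assoc_mult_mat[of _ \<mu> \<mu> _ \<mu> _ \<mu>])
      finally show ?thesis by simp
    qed
  qed simp
  from this[of "[0..<n]"] show ?thesis unfolding eval_term_def using r by (simp add: atLeast0LessThan del: One_nat_def)
qed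

subsection \<open>Coordinates of residue classes\<close>

definition vpoly :: "nat pp list \<Rightarrow> 'l::comm_ring_1 vec \<Rightarrow> (nat, 'l) mpoly" where
  "vpoly ts v = (\<Sum>i<length ts. mterm (ts ! i) (v $ i))"

definition border_poly :: "nat pp list \<Rightarrow> nat pp list \<Rightarrow> 'l::comm_ring_1 mat \<Rightarrow> nat \<Rightarrow> (nat, 'l) mpoly" where
  "border_poly ts bs \<Gamma> j = mterm (bs ! j) 1 - (\<Sum>i<length ts. mterm (ts ! i) (\<Gamma> $$ (i, j)))"

definition is_coords :: "(nat, 'l::comm_ring_1) mpoly set \<Rightarrow> nat pp list \<Rightarrow> 'l vec \<Rightarrow> (nat, 'l) mpoly \<Rightarrow> bool" where
  "is_coords J ts v f \<longleftrightarrow> v \<in> carrier_vec (length ts) \<and> f - vpoly ts v \<in> J"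

lemma supp_vpoly: "supp (vpoly ts v) \<subseteq> set ts"
  unfolding vpoly_def by (rule supp_sum_subset) auto

lemma coef_vpoly:
  assumes "distinct ts" "i < length ts"
  shows "coef (vpoly ts v) (ts ! i) = v $ i"
proof -
  have "coef (vpoly ts v) (ts ! i) = (\<Sum>j<length ts. if j = i then v $ j else 0)"
    unfolding vpoly_def lookup_sum
    using nth_eq_iff_index_eq[OF assms(1) _ assms(2)]
    by (intro sum.cong) (simp_all add: lookup_single when_def)
  then show ?thesis using assms(2) by simp
qed

lemma vpoly_of_supp:
  assumes "distinct ts" "supp g \<subseteq> set ts"
  shows "g = vpoly ts (vec (length ts) (\<lambda>i. coef g (ts ! i)))"
proof (rule poly_mapping_eqI)
  fix t
  let ?v = "vec (length ts) (\<lambda>i. coef g (ts ! i))"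
  show "coef g t = coef (vpoly ts ?v) t"
  proof (cases "t \<in> set ts")
    case True
    then obtain i where "i < length ts" "ts ! i = t" by (auto simp: in_set_conv_nth)
    then show ?thesis using coef_vpoly[OF assms(1), of i ?v] by simp
  next
    case False
    then have "t \<notin> supp g" "t \<notin> supp (vpoly ts ?v)" using assms(2) supp_vpoly[of ts ?v] by blast+
    then show ?thesis by (simp add: in_keys_iff)
  qed
qed

lemma vpoly_unit: "k < length ts \<Longrightarrow> vpoly ts (unit_vec (length ts) k) = mterm (ts ! k) 1"
proof -
  assume k: "k < length ts"
  have "vpoly ts (unit_vec (length ts) k) = (\<Sum>i<length ts. if k = i then mterm (ts ! i) 1 else 0)"
    unfolding vpoly_def by (intro sum.cong) (use k in auto)
  then show ?thesis using k by simp
qed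

lemma vpoly_mult_vec:
  assumes A: "A \<in> carrier_mat (length ts) (length ts)" and v: "v \<in> carrier_vec (length ts)"
  shows "vpoly ts (A *\<^sub>v v) = (\<Sum>k<length ts. mconst (v $ k) * vpoly ts (col A k))"
proof -
  have "vpoly ts (A *\<^sub>v v) = (\<Sum>i<length ts. \<Sum>k<length ts. mterm (ts ! i) (v $ k * A $$ (i, k)))"
    unfolding vpoly_def using A v
    by (intro sum.cong refl, subst mterm_sum[symmetric], intro arg_cong2[of _ _ _ _ mterm] refl)
       (auto simp: scalar_prod_def atLeast0LessThan mult.commute intro: sum.cong)
  then show ?thesis unfolding vpoly_def using A
    by (subst (asm) sum.swap) (simp add: sum_distrib_left mconst_def mult_single)
qed

text \<open>
  Modulo the border polynomials, \<open>x\<^sub>r t\<^sub>k\<close> is the combination of the terms \<open>t\<^sub>i\<close> whose coefficients form the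
  \<open>k\<close>-th column of the multiplication matrix. Coordinates need not be unique here, so that the statement
  can also be used to prove that they exist.
\<close>

lemma is_coords_mult_var:
  fixes J :: "(nat, 'l::Fields.field) mpoly set"
  assumes enum: "enum_order_ideal n ts bs" and J: "ideal J (xring n)"
    and B: "\<And>j. j < length bs \<Longrightarrow> border_poly ts bs \<Gamma> j \<in> J"
    and r: "r < n" and v: "is_coords J ts v f"
  shows "is_coords J ts (pt_mat ts bs \<Gamma> r *\<^sub>v v) (mvar r * f)"
proof -
  note JD = ideal_mpolyD[OF J] and E = enum_order_idealD[OF enum]
  let ?A = "pt_mat ts bs \<Gamma> r"
  have vc: "v \<in> carrier_vec (length ts)" using v by (simp add: is_coords_def)
  have col: "mvar r * mterm (ts ! k) 1 - vpoly ts (col ?A k) \<in> J" if k: "k < length ts" for k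
  proof -
    let ?t = "Poly_Mapping.single r 1 + ts ! k"
    have t: "mvar r * mterm (ts ! k) 1 = (mterm ?t 1 :: (nat, 'l) mpoly)" by (simp add: mvar_def mult_single)
    show ?thesis
    proof (cases "?t \<in> set ts")
      case True
      then obtain m where m: "m < length ts" "ts ! m = ?t" by (auto simp: in_set_conv_nth)
      have "col ?A k = unit_vec (length ts) m"
        using k m True E(5) by (intro eq_vecI) (auto simp: pt_mat_in nth_eq_iff_index_eq)
      then show ?thesis using vpoly_unit[OF m(1), where ?'a = 'l] m t JD(2) by simp
    next
      case False
      then have "?t \<in> set bs" using E(9)[OF r, of "ts ! k"] k by auto
      then obtain m where m: "m < length bs" "bs ! m = ?t" by (auto simp: in_set_conv_nth)
      have "vpoly ts (col ?A k) = (\<Sum>i<length ts. mterm (ts ! i) (\<Gamma> $$ (i, m)))"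
        unfolding vpoly_def using pt_mat_border[OF enum _ k m(1), of _ r \<Gamma>] m k by (intro sum.cong) auto
      then show ?thesis using B[OF m(1)] m t by (simp add: border_poly_def)
    qed
  qed
  have "mvar r * f - vpoly ts (?A *\<^sub>v v) = mvar r * (f - vpoly ts v) +
      (\<Sum>k<length ts. mconst (v $ k) * (mvar r * mterm (ts ! k) 1 - vpoly ts (col ?A k)))"
  proof -
    have "mvar r * vpoly ts v = (\<Sum>k<length ts. mconst (v $ k) * (mvar r * mterm (ts ! k) 1))"
      unfolding vpoly_def sum_distrib_left by (simp add: mconst_def mvar_def mult_single)
    then show ?thesis using vpoly_mult_vec[OF pt_mat_dim(1) vc, of bs \<Gamma> r]
      by (simp add: right_diff_distrib sum_subtractf)
  qed
  also have "\<dots> \<in> J"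
    using v col r by (intro JD(3) JD(6) JD(7)) (auto simp: is_coords_def)
  finally show ?thesis
    using mult_mat_vec_carrier[OF pt_mat_dim(1) vc] by (simp add: is_coords_def)
qed

lemma is_coords_eval_term:
  fixes J :: "(nat, 'l::Fields.field) mpoly set"
  assumes enum: "enum_order_ideal n ts bs" and J: "ideal J (xring n)"
    and B: "\<And>j. j < length bs \<Longrightarrow> border_poly ts bs \<Gamma> j \<in> J"
    and t: "t \<in> terms n" and v: "is_coords J ts v f"
  shows "is_coords J ts (eval_term (length ts) n (pt_mat ts bs \<Gamma>) t *\<^sub>v v) (mterm t 1 * f)"
proof -
  let ?\<mu> = "length ts" and ?A = "pt_mat ts bs \<Gamma>"
  have pow: "is_coords J ts ((?A r ^\<^sub>m k) *\<^sub>v w) (mterm (Poly_Mapping.single r k) 1 * g)"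
    if r: "r < n" and w: "is_coords J ts w g" for r k w g
    using w
  proof (induction k arbitrary: w g)
    case 0
    then show ?case by (simp add: is_coords_def)
  next
    case (Suc k)
    have wc: "w \<in> carrier_vec ?\<mu>" using Suc.prems by (simp add: is_coords_def)
    have P: "?A r ^\<^sub>m k \<in> carrier_mat ?\<mu> ?\<mu>" by (rule pow_carrier_mat) simp
    have "is_coords J ts ((?A r ^\<^sub>m k) *\<^sub>v (?A r *\<^sub>v w)) (mterm (Poly_Mapping.single r k) 1 * (mvar r * g))"
      by (intro Suc.IH is_coords_mult_var[OF enum J B r] Suc.prems)
    moreover have "mterm (Poly_Mapping.single r k) 1 * (mvar r * g) = mterm (Poly_Mapping.single r (Suc k)) 1 * g"
      by (simp add: mvar_def mterm_times_times single_add[symmetric])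
    moreover have "(?A r ^\<^sub>m Suc k) *\<^sub>v w = (?A r ^\<^sub>m k) *\<^sub>v (?A r *\<^sub>v w)"
      using assoc_mult_mat_vec[OF P pt_mat_dim(1) wc] by simp
    ultimately show ?case by simp
  qed
  have list: "is_coords J ts (foldr (\<lambda>r N. (?A r ^\<^sub>m coef t r) * N) rs (1\<^sub>m ?\<mu>) *\<^sub>v v)
      (mterm (\<Sum>r\<leftarrow>rs. Poly_Mapping.single r (coef t r)) 1 * f)" if "set rs \<subseteq> {..<n}" for rs
    using that
  proof (induction rs)
    case Nil
    then show ?case using v by (simp add: is_coords_def)
  next
    case (Cons r rs)
    let ?N = "foldr (\<lambda>r N. (?A r ^\<^sub>m coef t r) * N) rs (1\<^sub>m ?\<mu>)"
    have P: "?A r ^\<^sub>m coef t r \<in> carrier_mat ?\<mu> ?\<mu>" by (rule pow_carrier_mat) simp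
    have N: "?N \<in> carrier_mat ?\<mu> ?\<mu>" by (induction rs) (auto intro!: mult_carrier_mat pow_carrier_mat)
    have "is_coords J ts ((?A r ^\<^sub>m coef t r) *\<^sub>v (?N *\<^sub>v v))
        (mterm (Poly_Mapping.single r (coef t r)) 1 * (mterm (\<Sum>r\<leftarrow>rs. Poly_Mapping.single r (coef t r)) 1 * f))"
      using Cons by (intro pow) auto
    then have step: "is_coords J ts ((?A r ^\<^sub>m coef t r) *\<^sub>v (?N *\<^sub>v v))
        (mterm (Poly_Mapping.single r (coef t r) + (\<Sum>r\<leftarrow>rs. Poly_Mapping.single r (coef t r))) 1 * f)"
      by (simp only: mterm_times_times mult_1)
    have v': "v \<in> carrier_vec ?\<mu>" using v by (simp add: is_coords_def)
    have eqv: "(?A r ^\<^sub>m coef t r * ?N) *\<^sub>v v = (?A r ^\<^sub>m coef t r) *\<^sub>v (?N *\<^sub>v v)"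
      by (rule assoc_mult_mat_vec[OF P N v'])
    have eq1: "foldr (\<lambda>r N. (?A r ^\<^sub>m coef t r) * N) (r # rs) (1\<^sub>m ?\<mu>) = ?A r ^\<^sub>m coef t r * ?N" by simp
    have eq2: "(\<Sum>r\<leftarrow>r # rs. Poly_Mapping.single r (coef t r)) =
      Poly_Mapping.single r (coef t r) + (\<Sum>r\<leftarrow>rs. Poly_Mapping.single r (coef t r))" by simp
    show ?case by (subst eq1, subst eq2, subst eqv, rule step)
  qed
  have "(\<Sum>r\<leftarrow>[0..<n]. Poly_Mapping.single r (coef t r)) = (\<Sum>r<n. Poly_Mapping.single r (coef t r))"
    by (simp add: interv_sum_list_conv_sum_set_nat atLeast0LessThan)
  also have "\<dots> = t"
  proof (rule poly_mapping_eqI)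
    fix s
    have "coef (\<Sum>r<n. Poly_Mapping.single r (coef t r)) s = (\<Sum>r<n. if r = s then coef t r else 0)"
      by (simp only: lookup_sum lookup_single when_def)
    also have "\<dots> = (if s < n then coef t s else 0)" by simp
    also have "\<dots> = coef t s" using t in_keys_iff[of s t] by (auto simp: terms_iff)
    finally show "coef (\<Sum>r<n. Poly_Mapping.single r (coef t r)) s = coef t s" .
  qed
  finally have sum: "(\<Sum>r\<leftarrow>[0..<n]. Poly_Mapping.single r (coef t r)) = t" .
  have "set [0..<n] \<subseteq> {..<n}" by auto
  from list[OF this] show ?thesis unfolding eval_term_def sum .
qed

lemma is_coords_unit:
  fixes J :: "(nat, 'l::Fields.field) mpoly set"
  assumes "ideal J (xring n)" "k < length ts"
  shows "is_coords J ts (unit_vec (length ts) k) (mterm (ts ! k) 1)"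
  using assms ideal_mpolyD(2)[OF assms(1)] by (simp add: is_coords_def vpoly_unit)

lemma mat_mult_unit_vec:
  fixes A :: "'a::comm_ring_1 mat"
  assumes "A \<in> carrier_mat m k" "j < k"
  shows "A *\<^sub>v unit_vec k j = col A j"
  using assms by (intro eq_vecI) (auto simp: scalar_prod_right_unit)

lemma is_coords_col_eval_term:
  fixes J :: "(nat, 'l::Fields.field) mpoly set"
  assumes enum: "enum_order_ideal n ts bs" and J: "ideal J (xring n)"
    and B: "\<And>j. j < length bs \<Longrightarrow> border_poly ts bs \<Gamma> j \<in> J"
    and t: "t \<in> terms n" and k: "k < length ts"
  shows "is_coords J ts (col (eval_term (length ts) n (pt_mat ts bs \<Gamma>) t) k) (mterm (t + ts ! k) 1)"
  using is_coords_eval_term[OF enum J B t is_coords_unit[OF J k]]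
    mat_mult_unit_vec[OF eval_term_carrier k, of n "pt_mat ts bs \<Gamma>" t]
  by (simp add: mult_single)

lemma is_coords_unique:
  fixes J :: "(nat, 'l::Fields.field) mpoly set"
  assumes J: "ideal J (xring n)" and ts: "distinct ts" "indep_mod J (set ts)"
    and "is_coords J ts v f" "is_coords J ts w f'" "f - f' \<in> J"
  shows "v = w"
proof -
  note JD = ideal_mpolyD[OF J]
  have c: "v \<in> carrier_vec (length ts)" "w \<in> carrier_vec (length ts)" "f - vpoly ts v \<in> J" "f' - vpoly ts w \<in> J"
    using assms by (auto simp: is_coords_def)
  have "vpoly ts v - vpoly ts w = (f' - vpoly ts w) - (f - vpoly ts v) + (f - f')" by simp
  also have "\<dots> \<in> J" by (rule JD(3)[OF JD(5)[OF c(4,3)] assms(6)])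
  finally have "vpoly ts v - vpoly ts w = 0"
    using supp_diff[of "vpoly ts v" "vpoly ts w"] supp_vpoly[of ts v] supp_vpoly[of ts w]
    by (intro indep_modD[OF ts(2)]) auto
  then show ?thesis
    using c by (intro eq_vecI) (auto simp flip: coef_vpoly[OF ts(1)])
qed

lemma is_coords_lext:
  fixes J :: "(nat, 'l::Fields.field) mpoly set"
  assumes J: "ideal J (xring n)" and f: "supp f \<subseteq> T"
    and v: "\<And>t. t \<in> T \<Longrightarrow> is_coords J ts (v t) (mterm t 1)"
  shows "is_coords J ts (vec (length ts) (\<lambda>i. lext (\<lambda>t. v t $ i) f)) f"
proof -
  note JD = ideal_mpolyD[OF J]
  have "vpoly ts (vec (length ts) (\<lambda>i. lext (\<lambda>t. v t $ i) f)) =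
      (\<Sum>i<length ts. \<Sum>t\<in>supp f. mterm (ts ! i) (coef f t * v t $ i))"
    unfolding vpoly_def lext_def by (simp add: mterm_sum)
  also have "\<dots> = (\<Sum>t\<in>supp f. mconst (coef f t) * vpoly ts (v t))"
    unfolding vpoly_def by (subst sum.swap) (simp add: sum_distrib_left mconst_def mult_single)
  finally have "f - vpoly ts (vec (length ts) (\<lambda>i. lext (\<lambda>t. v t $ i) f)) =
      (\<Sum>t\<in>supp f. mterm t (coef f t)) - (\<Sum>t\<in>supp f. mconst (coef f t) * vpoly ts (v t))"
    by (simp flip: mpoly_eq_sum_mterm)
  also have "\<dots> = (\<Sum>t\<in>supp f. mconst (coef f t) * (mterm t 1 - vpoly ts (v t)))"
    by (simp add: right_diff_distrib sum_subtractf mconst_def mult_single)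
  also have "\<dots> \<in> J"
    using v f by (intro JD(7) JD(6)) (auto simp: is_coords_def)
  finally show ?thesis by (simp add: is_coords_def)
qed

subsection \<open>The ideal of a point\<close>

definition mats_commute :: "nat \<Rightarrow> nat pp list \<Rightarrow> nat pp list \<Rightarrow> 'l::comm_ring_1 mat \<Rightarrow> bool" where
  "mats_commute n ts bs \<Gamma> \<longleftrightarrow> (\<forall>r<n. \<forall>s<n. pt_mat ts bs \<Gamma> r * pt_mat ts bs \<Gamma> s = pt_mat ts bs \<Gamma> s * pt_mat ts bs \<Gamma> r)"

lemma border_poly_in_xring:
  assumes "enum_order_ideal n ts bs" "j < length bs"
  shows "border_poly ts bs \<Gamma> j \<in> carrier (xring n)"
proof -
  have "bs ! j \<in> terms n" "\<And>i. i < length ts \<Longrightarrow> ts ! i \<in> terms n"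
    using enum_order_idealD(3,4)[OF assms(1)] assms(2) by auto
  then show ?thesis
    unfolding border_poly_def by (intro Pol_closed(2) Pol_sum mterm_in_xring) auto
qed

lemma point_ideal_props:
  fixes \<Gamma> :: "'l::Fields.field mat"
  assumes enum: "enum_order_ideal n ts bs"
  shows "ideal (point_ideal n ts bs \<Gamma>) (xring n)"
    "j < length bs \<Longrightarrow> border_poly ts bs \<Gamma> j \<in> point_ideal n ts bs \<Gamma>"
    "ideal J (xring n) \<Longrightarrow> (\<And>j. j < length bs \<Longrightarrow> border_poly ts bs \<Gamma> j \<in> J) \<Longrightarrow> point_ideal n ts bs \<Gamma> \<subseteq> J"
proof -
  have eq: "point_ideal n ts bs \<Gamma> = Idl\<^bsub>xring n\<^esub> {border_poly ts bs \<Gamma> j | j. j < length bs}"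
    by (simp add: point_ideal_def border_poly_def)
  have sub: "{border_poly ts bs \<Gamma> j | j. j < length bs} \<subseteq> carrier (xring n)"
    using border_poly_in_xring[OF enum] by blast
  show "ideal (point_ideal n ts bs \<Gamma>) (xring n)" unfolding eq by (rule Idl_mpoly(1)[OF sub])
  show "j < length bs \<Longrightarrow> border_poly ts bs \<Gamma> j \<in> point_ideal n ts bs \<Gamma>"
    unfolding eq using Idl_mpoly(2)[OF sub] by blast
  show "ideal J (xring n) \<Longrightarrow> (\<And>j. j < length bs \<Longrightarrow> border_poly ts bs \<Gamma> j \<in> J) \<Longrightarrow> point_ideal n ts bs \<Gamma> \<subseteq> J"
    unfolding eq by (rule Idl_mpoly(3)[OF sub]) auto
qed

text \<open>
  Each term of the order ideal is reached from \<open>1\<close> by multiplication with indeterminates inside the order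
  ideal, where the columns of the multiplication matrices are unit vectors.
\<close>

lemma eval_term_order_ideal:
  fixes \<Gamma> :: "'l::Fields.field mat"
  assumes enum: "enum_order_ideal n ts bs" and comm: "mats_commute n ts bs \<Gamma>"
    and t: "t \<in> set ts" and i: "i < length ts"
  shows "eval_term (length ts) n (pt_mat ts bs \<Gamma>) t $$ (i, 0) = (if ts ! i = t then 1 else 0)"
proof -
  note E = enum_order_idealD[OF enum]
  let ?\<mu> = "length ts" and ?A = "pt_mat ts bs \<Gamma>"
  have "supp t \<subseteq> {..<n}" using t E(3) terms_iff by blast
  then have "t \<in> set ts \<longrightarrow> (\<forall>i<?\<mu>. eval_term ?\<mu> n ?A t $$ (i, 0) = (if ts ! i = t then 1 else 0))"
  proof (induction t rule: pp_var_induct)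
    case zero
    have "(ts ! i = 0) = (i = 0)" if "i < ?\<mu>" for i
      using nth_eq_iff_index_eq[OF E(5) that E(1)] E(2) by simp
    then show ?case using E(1) by (auto simp: eval_term_zero)
  next
    case (add r t)
    show ?case
    proof (intro impI allI)
      fix i assume T: "Poly_Mapping.single r 1 + t \<in> set ts" and i: "i < ?\<mu>"
      have r: "r < n" using add by simp
      have t: "t \<in> set ts" using E(8)[OF T] by simp
      then obtain k where k: "k < ?\<mu>" "ts ! k = t" by (auto simp: in_set_conv_nth)
      have C: "eval_term ?\<mu> n ?A t \<in> carrier_mat ?\<mu> ?\<mu>" by (rule eval_term_carrier) simp
      have "eval_term ?\<mu> n ?A (Poly_Mapping.single r 1 + t) = ?A r * eval_term ?\<mu> n ?A t"
        using comm by (intro eval_term_mult_var r) (auto simp: mats_commute_def)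
      then have "eval_term ?\<mu> n ?A (Poly_Mapping.single r 1 + t) $$ (i, 0) =
          (\<Sum>m<?\<mu>. ?A r $$ (i, m) * eval_term ?\<mu> n ?A t $$ (m, 0))"
        using i E(1) C by (auto simp: scalar_prod_def atLeast0LessThan)
      also have "\<dots> = (\<Sum>m<?\<mu>. if m = k then ?A r $$ (i, m) else 0)"
        using add.IH t k nth_eq_iff_index_eq[OF E(5) _ k(1)] by (intro sum.cong) auto
      also have "\<dots> = ?A r $$ (i, k)" using k by simp
      also have "\<dots> = (if ts ! i = Poly_Mapping.single r 1 + t then 1 else 0)"
        using i k T by (auto simp: pt_mat_in)
      finally show "eval_term ?\<mu> n ?A (Poly_Mapping.single r 1 + t) $$ (i, 0) =
        (if ts ! i = Poly_Mapping.single r 1 + t then 1 else 0)" .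
    qed
  qed
  then show ?thesis using t i by simp
qed

text \<open>
  If the matrices commute, then \<open>t \<mapsto> t(A\<^sub>1,\<dots>,A\<^sub>n) e\<^sub>1\<close> makes the coordinate space a module over the
  polynomial ring that is annihilated by the border polynomials. Hence the ideal of the point consists
  of the polynomials whose coordinates vanish, and the order ideal is a basis of the residue class ring.
\<close>

lemma point_ideal_iff:
  fixes \<Gamma> :: "'l::Fields.field mat"
  assumes enum: "enum_order_ideal n ts bs" and comm: "mats_commute n ts bs \<Gamma>"
  shows "f \<in> point_ideal n ts bs \<Gamma> \<longleftrightarrow> f \<in> carrier (xring n) \<and>
    (\<forall>i<length ts. lext (\<lambda>t. eval_term (length ts) n (pt_mat ts bs \<Gamma>) t $$ (i, 0)) f = 0)"
proof -
  note E = enum_order_idealD[OF enum]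
  let ?\<mu> = "length ts" and ?A = "pt_mat ts bs \<Gamma>"
  let ?M = "eval_term ?\<mu> n ?A" and ?I = "point_ideal n ts bs \<Gamma>"
  have C: "?M t \<in> carrier_mat ?\<mu> ?\<mu>" for t by (rule eval_term_carrier) simp
  have Mr: "?M (Poly_Mapping.single r 1 + t) $$ (i, 0) = (\<Sum>k<?\<mu>. ?A r $$ (i, k) * ?M t $$ (k, 0))"
    if "r < n" "i < ?\<mu>" for r t i
  proof -
    have "?M (Poly_Mapping.single r 1 + t) = ?A r * ?M t"
      using comm by (intro eval_term_mult_var that) (auto simp: mats_commute_def)
    then show ?thesis using that C[of t] E(1) by (auto simp: scalar_prod_def atLeast0LessThan)
  qed
  define N where "N = {f \<in> carrier (xring n). \<forall>i<?\<mu>. lext (\<lambda>t. ?M t $$ (i, 0)) f = 0}"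
  have N: "ideal N (xring n)"
  proof (rule ideal_mpolyI_var)
    fix r and f assume r: "r \<in> {..<n}" and f: "f \<in> N"
    have "lext (\<lambda>t. ?M t $$ (i, 0)) (mvar r * f) = 0" if i: "i < ?\<mu>" for i
    proof -
      have "lext (\<lambda>t. ?M t $$ (i, 0)) (mvar r * f) = (\<Sum>k<?\<mu>. ?A r $$ (i, k) * lext (\<lambda>t. ?M t $$ (k, 0)) f)"
        unfolding lext_mvar using r i by (subst lext_linear_fun[symmetric]) (simp add: Mr del: One_nat_def)
      then show ?thesis using f by (simp add: N_def)
    qed
    then show "mvar r * f \<in> N" using f r by (auto simp: N_def)
  qed (auto simp: N_def lext_add lext_mconst)
  have "border_poly ts bs \<Gamma> j \<in> N" if j: "j < length bs" for j
  proof -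
    obtain r t where rt: "r < n" "t \<in> set ts" "bs ! j = Poly_Mapping.single r 1 + t"
      using E(10)[OF nth_mem[OF j]] by auto
    then obtain k where k: "k < ?\<mu>" "ts ! k = t" by (auto simp: in_set_conv_nth)
    have "lext (\<lambda>t. ?M t $$ (i, 0)) (border_poly ts bs \<Gamma> j) = 0" if i: "i < ?\<mu>" for i
    proof -
      have "?M (bs ! j) $$ (i, 0) = (\<Sum>m<?\<mu>. ?A r $$ (i, m) * ?M t $$ (m, 0))"
        unfolding rt(3) by (rule Mr[OF rt(1) i])
      also have "\<dots> = (\<Sum>m<?\<mu>. if m = k then ?A r $$ (i, m) else 0)"
        using eval_term_order_ideal[OF enum comm rt(2)] k nth_eq_iff_index_eq[OF E(5) _ k(1)]
        by (intro sum.cong) auto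
      also have "\<dots> = \<Gamma> $$ (i, j)"
        using k pt_mat_border[OF enum i k(1) j, of r \<Gamma>] rt by simp
      finally have 1: "?M (bs ! j) $$ (i, 0) = \<Gamma> $$ (i, j)" .
      have "(\<Sum>k<?\<mu>. \<Gamma> $$ (k, j) * ?M (ts ! k) $$ (i, 0)) = (\<Sum>k<?\<mu>. if k = i then \<Gamma> $$ (k, j) else 0)"
        using eval_term_order_ideal[OF enum comm nth_mem i] nth_eq_iff_index_eq[OF E(5) i]
        by (intro sum.cong) auto
      then show ?thesis using i 1 by (simp add: border_poly_def lext_diff lext_sum)
    qed
    then show ?thesis using border_poly_in_xring[OF enum j] by (simp add: N_def)
  qed
  then have sub: "?I \<subseteq> N" by (rule point_ideal_props(3)[OF enum N])
  have I: "ideal ?I (xring n)" "\<And>j. j < length bs \<Longrightarrow> border_poly ts bs \<Gamma> j \<in> ?I"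
    using point_ideal_props[OF enum] by blast+
  have "f \<in> ?I" if f: "f \<in> N" for f
  proof -
    have "is_coords ?I ts (vec ?\<mu> (\<lambda>i. lext (\<lambda>t. col (?M t) 0 $ i) f)) f"
    proof (rule is_coords_lext[OF I(1)])
      show "supp f \<subseteq> terms n" using f by (simp add: N_def xring_iff)
      show "is_coords ?I ts (col (?M t) 0) (mterm t 1)" if "t \<in> terms n" for t
        using is_coords_col_eval_term[OF enum I(1) I(2) that E(1)] E(2) by simp
    qed
    moreover have "col (?M t) 0 $ i = ?M t $$ (i, 0)" if "i < ?\<mu>" for t i
      using C[of t] E(1) that by (intro index_col) auto
    then have "vec ?\<mu> (\<lambda>i. lext (\<lambda>t. col (?M t) 0 $ i) f) = 0\<^sub>v ?\<mu>"
      using f by (intro eq_vecI) (auto simp: N_def)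
    moreover have "vpoly ts (0\<^sub>v ?\<mu>) = (0 :: (nat, 'l) mpoly)" by (simp add: vpoly_def)
    ultimately show ?thesis by (simp add: is_coords_def)
  qed
  then show ?thesis using sub by (auto simp: N_def)
qed

lemma point_ideal_indep:
  fixes \<Gamma> :: "'l::Fields.field mat"
  assumes enum: "enum_order_ideal n ts bs" and comm: "mats_commute n ts bs \<Gamma>"
  shows "indep_mod (point_ideal n ts bs \<Gamma>) (set ts)"
  unfolding indep_mod_def
proof (intro allI impI)
  note E = enum_order_idealD[OF enum]
  fix f assume f: "supp f \<subseteq> set ts \<and> f \<in> point_ideal n ts bs \<Gamma>"
  show "f = 0"
  proof (rule poly_mapping_eqI)
    fix t
    show "coef f t = coef 0 t"
    proof (cases "t \<in> set ts")
      case True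
      then obtain i where i: "i < length ts" "ts ! i = t" by (auto simp: in_set_conv_nth)
      have "0 = lext (\<lambda>t. eval_term (length ts) n (pt_mat ts bs \<Gamma>) t $$ (i, 0)) f"
        using f i point_ideal_iff[OF enum comm] by simp
      also have "\<dots> = (\<Sum>s\<in>set ts. coef f s * (if ts ! i = s then 1 else 0))"
        using f i eval_term_order_ideal[OF enum comm] by (subst lext_superset[of "set ts"]) auto
      also have "\<dots> = (\<Sum>s\<in>set ts. if t = s then coef f s else 0)" using i by (intro sum.cong) auto
      also have "\<dots> = coef f t" using True by simp
      finally show ?thesis by simp
    qed (use f in \<open>auto simp: in_keys_iff\<close>)
  qed
qed

lemma point_ideal_span:
  fixes \<Gamma> :: "'l::Fields.field mat"
  assumes enum: "enum_order_ideal n ts bs" and J: "ideal J (xring n)"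
    and B: "\<And>j. j < length bs \<Longrightarrow> border_poly ts bs \<Gamma> j \<in> J" and f: "f \<in> carrier (xring n)"
  shows "\<exists>v. is_coords J ts v f"
  using is_coords_lext[OF J, of f "terms n" ts "\<lambda>t. col (eval_term (length ts) n (pt_mat ts bs \<Gamma>) t) 0"]
    is_coords_col_eval_term[OF enum J B _ enum_order_idealD(1)[OF enum]] f enum_order_idealD(2)[OF enum]
  by (auto simp: xring_iff)

text \<open>
  Conversely, whenever an order ideal is independent modulo an ideal that contains the border
  polynomials of \<open>\<Gamma>\<close>, that ideal is the ideal of the point, and the matrices commute since both products
  describe multiplication by \<open>x\<^sub>r x\<^sub>s\<close>.
\<close>

lemma border_basis_point:
  fixes \<Gamma> :: "'l::Fields.field mat"
  assumes enum: "enum_order_ideal n ts bs" and J: "ideal J (xring n)"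
    and B: "\<And>j. j < length bs \<Longrightarrow> border_poly ts bs \<Gamma> j \<in> J" and ind: "indep_mod J (set ts)"
  shows "mats_commute n ts bs \<Gamma>" "point_ideal n ts bs \<Gamma> = J"
proof -
  note E = enum_order_idealD[OF enum] and JD = ideal_mpolyD[OF J]
  let ?\<mu> = "length ts" and ?A = "pt_mat ts bs \<Gamma>"
  show "mats_commute n ts bs \<Gamma>"
    unfolding mats_commute_def
  proof (intro allI impI)
    fix r s assume rs: "r < n" "s < n"
    have "col (?A r * ?A s) k = col (?A s * ?A r) k" if k: "k < ?\<mu>" for k
    proof -
      have *: "is_coords J ts (col (?A r * ?A s) k) (mvar r * (mvar s * mterm (ts ! k) 1))"
        if "r < n" "s < n" for r s
      proof -
        have "is_coords J ts (?A r *\<^sub>v (?A s *\<^sub>v unit_vec ?\<mu> k)) (mvar r * (mvar s * mterm (ts ! k) 1))"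
          by (intro is_coords_mult_var[OF enum J B] that is_coords_unit[OF J k])
        moreover have "?A r *\<^sub>v (?A s *\<^sub>v unit_vec ?\<mu> k) = (?A r * ?A s) *\<^sub>v unit_vec ?\<mu> k"
          by (rule assoc_mult_mat_vec[symmetric]) auto
        moreover have "(?A r * ?A s) *\<^sub>v unit_vec ?\<mu> k = col (?A r * ?A s) k"
          using k by (intro mat_mult_unit_vec mult_carrier_mat) auto
        ultimately show ?thesis by simp
      qed
      show ?thesis
        by (rule is_coords_unique[OF J E(5) ind *[OF rs] *[OF rs(2,1)]])
           (use JD(2) in \<open>simp add: mult.left_commute\<close>)
    qed
    then show "?A r * ?A s = ?A s * ?A r"
      by (intro mat_col_eqI) auto
  qed
  show "point_ideal n ts bs \<Gamma> = J"
  proof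
    show sub: "point_ideal n ts bs \<Gamma> \<subseteq> J" by (rule point_ideal_props(3)[OF enum J B])
    show "J \<subseteq> point_ideal n ts bs \<Gamma>"
    proof
      fix f assume f: "f \<in> J"
      then have "f \<in> carrier (xring n)" using JD(1) by blast
      then obtain v where v: "is_coords (point_ideal n ts bs \<Gamma>) ts v f"
        using point_ideal_span[OF enum point_ideal_props(1)[OF enum] point_ideal_props(2)[OF enum]] by blast
      then have "f - vpoly ts v \<in> J" using sub by (auto simp: is_coords_def)
      then have "vpoly ts v \<in> J" using JD(5)[OF f, of "f - vpoly ts v"] by simp
      then have "vpoly ts v = 0" using indep_modD[OF ind supp_vpoly] by blast
      then show "f \<in> point_ideal n ts bs \<Gamma>" using v by (simp add: is_coords_def)
    qed
  qed
qed

section \<open>Degree forms\<close>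

lemma one_notin_of_indep:
  assumes "indep_mod J B" "0 \<in> B"
  shows "(1 :: ('v, 'k::comm_ring_1) mpoly) \<notin> J"
proof
  assume "1 \<in> J"
  moreover have "supp (1 :: ('v, 'k) mpoly) \<subseteq> B" using assms(2) by simp
  ultimately have "(1 :: ('v, 'k) mpoly) = 0" using indep_modD[OF assms(1)] by blast
  then show False by simp
qed

lemma coef_border_poly:
  assumes enum: "enum_order_ideal n ts bs" and j: "j < length bs"
  shows "coef (border_poly ts bs \<Gamma> j) (bs ! j) = 1"
    and "i < length ts \<Longrightarrow> coef (border_poly ts bs \<Gamma> j) (ts ! i) = - \<Gamma> $$ (i, j)"
    and "supp (border_poly ts bs \<Gamma> j) \<subseteq> insert (bs ! j) (set ts)"
proof -
  note E = enum_order_idealD[OF enum]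
  have b: "bs ! j \<notin> set ts" using E(7) nth_mem[OF j] by blast
  have eq: "border_poly ts bs \<Gamma> j = mterm (bs ! j) 1 - vpoly ts (vec (length ts) (\<lambda>i. \<Gamma> $$ (i, j)))"
    by (simp add: border_poly_def vpoly_def)
  have "bs ! j \<notin> supp (vpoly ts (vec (length ts) (\<lambda>i. \<Gamma> $$ (i, j))))"
    using b supp_vpoly by blast
  then show "coef (border_poly ts bs \<Gamma> j) (bs ! j) = 1"
    unfolding eq by (simp add: lookup_minus in_keys_iff)
  show "coef (border_poly ts bs \<Gamma> j) (ts ! i) = - \<Gamma> $$ (i, j)" if i: "i < length ts"
  proof -
    have "bs ! j \<noteq> ts ! i" using b i by auto
    then show ?thesis unfolding eq lookup_minus coef_vpoly[OF E(5) i] using i by (simp add: lookup_single)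
  qed
  show "supp (border_poly ts bs \<Gamma> j) \<subseteq> insert (bs ! j) (set ts)"
    unfolding eq
    using supp_diff[of "mterm (bs ! j) 1" "vpoly ts (vec (length ts) (\<lambda>i. \<Gamma> $$ (i, j)))"]
      supp_vpoly[of ts "vec (length ts) (\<lambda>i. \<Gamma> $$ (i, j))"] by auto
qed

text \<open>
  If the residue class ring has the same Hilbert function as the order ideal, the terms of degree at most
  \<open>d\<close> in the order ideal already exhaust the dimension in degree \<open>d\<close>, so that a border term is a linear
  combination of terms of no larger degree.
\<close>

lemma border_coeff_degree:
  fixes \<Gamma> :: "'l::Fields.field mat"
  assumes enum: "enum_order_ideal n ts bs" and comm: "mats_commute n ts bs \<Gamma>"
    and HF: "affine_HF n (point_ideal n ts bs \<Gamma>) = order_ideal_HF (set ts)"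
    and ij: "i < length ts" "j < length bs" "pp_deg (bs ! j) < pp_deg (ts ! i)"
  shows "\<Gamma> $$ (i, j) = 0"
proof (rule ccontr)
  assume nz: "\<Gamma> $$ (i, j) \<noteq> 0"
  note E = enum_order_idealD[OF enum]
  let ?I = "point_ideal n ts bs \<Gamma>" and ?b = "bs ! j" and ?bp = "border_poly ts bs \<Gamma> j"
  have I: "ideal ?I (xring n)" "?bp \<in> ?I" using point_ideal_props[OF enum] ij(2) by blast+
  note ID = ideal_mpolyD[OF I(1)]
  note ind = point_ideal_indep[OF enum comm]
  have b: "?b \<notin> set ts" using E(7) nth_mem[OF ij(2)] by blast
  let ?T = "{t\<in>set ts. pp_deg t \<le> pp_deg ?b}"
  have "indep_mod ?I (insert ?b ?T)" unfolding indep_mod_def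
  proof (intro allI impI)
    fix f assume f: "supp f \<subseteq> insert ?b ?T \<and> f \<in> ?I"
    define c where "c = coef f ?b"
    let ?g = "f - mconst c * ?bp"
    have g: "?g \<in> ?I" using f I(2) ID(5,6) by auto
    have gb: "?b \<notin> supp ?g"
      using coef_border_poly(1)[OF enum ij(2), of \<Gamma>]
      by (simp add: c_def in_keys_iff lookup_minus coef_mconst_times)
    have "supp ?g \<subseteq> insert ?b (set ts)"
      using supp_diff[of f "mconst c * ?bp"] supp_mconst_times[of c ?bp] f
        coef_border_poly(3)[OF enum ij(2), of \<Gamma>] by blast
    then have "supp ?g \<subseteq> set ts" using gb by blast
    then have g0: "?g = 0" using indep_modD[OF ind] g by blast
    have "ts ! i \<notin> supp f"
    proof
      assume "ts ! i \<in> supp f"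
      then have "ts ! i = ?b \<or> pp_deg (ts ! i) \<le> pp_deg ?b" using f by blast
      then show False using ij(3) by auto
    qed
    then have "c * \<Gamma> $$ (i, j) = 0"
      using arg_cong[OF g0, of "\<lambda>p. coef p (ts ! i)"] coef_border_poly(2)[OF enum ij(2,1), of \<Gamma>]
      by (simp add: lookup_minus coef_mconst_times in_keys_iff)
    then have "c = 0" using nz by simp
    then show "f = 0" using g0 by (simp add: mconst_def)
  qed
  moreover have "insert ?b ?T \<subseteq> {t\<in>terms n. pp_deg t \<le> pp_deg ?b}"
    using E(3,4) nth_mem[OF ij(2)] by auto
  moreover have "0 \<in> set ts" using E(1,2) nth_mem[of 0 ts] by simp
  ultimately have "card (insert ?b ?T) \<le> affine_HF n ?I (pp_deg ?b)"
    using card_indep_le_affine_HF[OF I(1) one_notin_of_indep[OF ind]] by blast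
  also have "\<dots> = card ?T" by (simp add: HF order_ideal_HF_def)
  finally show False using b by simp
qed

text \<open>
  The relation \<open>R\<close> is either \<open>\<le>\<close> or \<open>=\<close>: in the first case normal forms do not increase the degree, in
  the second case they are homogeneous.
\<close>

lemma coords_degree_bound:
  fixes \<Gamma> :: "'l::Fields.field mat" and R :: "nat \<Rightarrow> nat \<Rightarrow> bool"
  assumes enum: "enum_order_ideal n ts bs" and J: "ideal J (xring n)"
    and B: "\<And>j. j < length bs \<Longrightarrow> border_poly ts bs \<Gamma> j \<in> J"
    and R: "\<And>a. R a a" "\<And>a b c. R a b \<Longrightarrow> R b c \<Longrightarrow> R a c" "\<And>a b. R a b \<Longrightarrow> R (Suc a) (Suc b)"
    and \<Gamma>: "\<And>i j. i < length ts \<Longrightarrow> j < length bs \<Longrightarrow> \<Gamma> $$ (i, j) \<noteq> 0 \<Longrightarrow> R (pp_deg (ts ! i)) (pp_deg (bs ! j))"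
    and t: "t \<in> terms n"
  shows "\<exists>v. is_coords J ts v (mterm t 1) \<and> (\<forall>i<length ts. v $ i \<noteq> 0 \<longrightarrow> R (pp_deg (ts ! i)) (pp_deg t))"
proof -
  note E = enum_order_idealD[OF enum]
  have "supp t \<subseteq> {..<n}" using t by (simp add: terms_iff)
  then show ?thesis
  proof (induction t rule: pp_var_induct)
    case zero
    have "is_coords J ts (unit_vec (length ts) 0) (mterm 0 1)"
      using is_coords_unit[OF J E(1)] E(2) by simp
    then show ?case using E(1,2) R(1)[of 0]
      by (intro exI[of _ "unit_vec (length ts) 0"]) auto
  next
    case (add r t)
    then obtain v where v: "is_coords J ts v (mterm t 1)"
      "\<And>i. i < length ts \<Longrightarrow> v $ i \<noteq> 0 \<Longrightarrow> R (pp_deg (ts ! i)) (pp_deg t)" by auto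
    have r: "r < n" using add by simp
    let ?A = "pt_mat ts bs \<Gamma> r"
    have vc: "v \<in> carrier_vec (length ts)" using v by (simp add: is_coords_def)
    have A: "R (pp_deg (ts ! i)) (Suc (pp_deg (ts ! k)))"
      if i: "i < length ts" and k: "k < length ts" and nz: "?A $$ (i, k) \<noteq> 0" for i k
    proof (cases "Poly_Mapping.single r 1 + ts ! k \<in> set ts")
      case True
      then have "ts ! i = Poly_Mapping.single r 1 + ts ! k"
        using pt_mat_in[OF i k True, of bs \<Gamma>] nz by (auto split: if_splits)
      then show ?thesis using R(1) by (simp add: pp_deg_add)
    next
      case False
      then have "Poly_Mapping.single r 1 + ts ! k \<in> set bs" using E(9)[OF r, of "ts ! k"] k by auto
      then obtain m where m: "m < length bs" "bs ! m = Poly_Mapping.single r 1 + ts ! k"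
        by (auto simp: in_set_conv_nth)
      have "\<Gamma> $$ (i, m) \<noteq> 0" using pt_mat_border[OF enum i k m(1) m(2)[symmetric], of \<Gamma>] nz by simp
      then have "R (pp_deg (ts ! i)) (pp_deg (bs ! m))" by (rule \<Gamma>[OF i m(1)])
      then show ?thesis using m(2) by (simp add: pp_deg_add)
    qed
    have "is_coords J ts (?A *\<^sub>v v) (mvar r * mterm t 1)"
      by (rule is_coords_mult_var[OF enum J B r v(1)])
    moreover have "mvar r * mterm t 1 = (mterm (Poly_Mapping.single r 1 + t) 1 :: (nat, 'l) mpoly)"
      by (simp add: mvar_def mult_single)
    moreover have "R (pp_deg (ts ! i)) (pp_deg (Poly_Mapping.single r 1 + t))"
      if i: "i < length ts" and nz: "(?A *\<^sub>v v) $ i \<noteq> 0" for i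
    proof -
      have "(?A *\<^sub>v v) $ i = (\<Sum>k<length ts. ?A $$ (i, k) * v $ k)"
        using i vc by (simp add: scalar_prod_def atLeast0LessThan)
      with nz have "(\<Sum>k<length ts. ?A $$ (i, k) * v $ k) \<noteq> 0" by simp
      then obtain k where "k \<in> {..<length ts}" "?A $$ (i, k) * v $ k \<noteq> 0" by (rule sum.not_neutral_contains_not_neutral)
      then have k: "k < length ts" "?A $$ (i, k) \<noteq> 0" "v $ k \<noteq> 0" by auto
      show ?thesis using R(2)[OF A[OF i k(1,2)] R(3)[OF v(2)[OF k(1,3)]]] by (simp add: pp_deg_add)
    qed
    ultimately show ?case by (intro exI[of _ "?A *\<^sub>v v"]) simp
  qed
qed

lemma coef_hom_component: "coef (hom_component d p) t = (if pp_deg t = d then coef p t else 0)"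
proof -
  have "coef (hom_component d p) t = (\<Sum>s\<in>{s\<in>supp p. pp_deg s = d}. if s = t then coef p s else 0)"
    unfolding hom_component_def lookup_sum by (simp only: lookup_single when_def)
  then show ?thesis by (auto simp: in_keys_iff)
qed

lemma supp_hom_component: "supp (hom_component d p) \<subseteq> supp p"
  by (auto simp: in_keys_iff coef_hom_component split: if_splits)

text \<open>
  Every homogeneous component of an element of the degree form ideal is zero or a degree form itself:
  the polynomials with this property form an ideal.
\<close>

lemma degree_form_ideal_props:
  fixes I :: "(nat, 'l::Fields.field) mpoly set"
  assumes I: "ideal I (xring n)"
  shows "ideal (degree_form_ideal n I) (xring n)"
    "g \<in> I \<Longrightarrow> g \<noteq> 0 \<Longrightarrow> hom_component (mdeg g) g \<in> degree_form_ideal n I"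
    "f \<in> degree_form_ideal n I \<Longrightarrow>
      \<exists>g\<in>I. (\<forall>t\<in>supp g. pp_deg t \<le> d) \<and> (\<forall>t. pp_deg t = d \<longrightarrow> coef g t = coef f t)"
proof -
  note ID = ideal_mpolyD[OF I]
  let ?G = "{hom_component (mdeg f) f | f. f \<in> I \<and> f \<noteq> 0}"
  have sub: "?G \<subseteq> carrier (xring n)"
    using ID(1) supp_hom_component by (fastforce simp: xring_iff)
  show "ideal (degree_form_ideal n I) (xring n)"
    unfolding degree_form_ideal_def by (rule Idl_mpoly(1)[OF sub])
  show "g \<in> I \<Longrightarrow> g \<noteq> 0 \<Longrightarrow> hom_component (mdeg g) g \<in> degree_form_ideal n I"
    unfolding degree_form_ideal_def using Idl_mpoly(2)[OF sub] by blast
  let ?P = "\<lambda>f d g. g \<in> I \<and> (\<forall>t\<in>supp g. pp_deg t \<le> d) \<and> (\<forall>t. pp_deg t = d \<longrightarrow> coef g t = coef f t)"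
  define S where "S = {f \<in> carrier (xring n). \<forall>d. \<exists>g. ?P f d g}"
  have S: "ideal S (xring n)"
  proof (rule ideal_mpolyI_var)
    show "S \<subseteq> carrier (xring n)" by (auto simp: S_def)
    show "0 \<in> S" unfolding S_def
    proof (intro CollectI conjI allI)
      fix d
      have "?P 0 d 0" using ID(2) by simp
      then show "\<exists>g. ?P 0 d g" ..
    qed simp
    fix a b assume ab: "a \<in> S" "b \<in> S"
    show "a + b \<in> S" unfolding S_def
    proof (intro CollectI conjI allI)
      show "a + b \<in> carrier (xring n)" using ab by (simp add: S_def)
      fix d
      obtain g where "?P a d g" using ab(1) unfolding S_def by blast
      moreover obtain h where "?P b d h" using ab(2) unfolding S_def by blast
      ultimately have "?P (a + b) d (g + h)"
        using ID(3) keys_add[of g h] by (auto simp: lookup_add)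
      then show "\<exists>g. ?P (a + b) d g" ..
    qed
  next
    fix c b assume b: "b \<in> S"
    show "mconst c * b \<in> S" unfolding S_def
    proof (intro CollectI conjI allI)
      show "mconst c * b \<in> carrier (xring n)" using b by (simp add: S_def)
      fix d
      obtain g where "?P b d g" using b unfolding S_def by blast
      then have "?P (mconst c * b) d (mconst c * g)"
        using ID(6)[of "mconst c" g] supp_mconst_times[of c g] by (auto simp: coef_mconst_times)
      then show "\<exists>g. ?P (mconst c * b) d g" ..
    qed
  next
    fix r and b assume r: "r \<in> {..<n}" and b: "b \<in> S"
    have mv: "mvar r * f = mterm (Poly_Mapping.single r 1) 1 * f" for f :: "(nat, 'l) mpoly"
      by (simp add: mvar_def)
    have coef_mv: "coef (mvar r * f) t = (if r \<in> supp t then coef f (t - Poly_Mapping.single r 1) else 0)"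
      for f :: "(nat, 'l) mpoly" and t
    proof (cases "r \<in> supp t")
      case True
      then obtain u where u: "t = Poly_Mapping.single r 1 + u" by (rule pp_split_var)
      then show ?thesis using True coef_times_mterm[of "Poly_Mapping.single r 1" 1 f u] by (simp add: mv)
    next
      case False
      have "t \<notin> supp (mvar r * f)"
      proof
        assume "t \<in> supp (mvar r * f)"
        then obtain u where "t = Poly_Mapping.single r 1 + u"
          using supp_mterm_times[of "Poly_Mapping.single r 1" 1 f] unfolding mv by blast
        then show False using False by (simp add: supp_add_pp)
      qed
      then show ?thesis using False by (simp add: in_keys_iff)
    qed
    show "mvar r * b \<in> S" unfolding S_def
    proof (intro CollectI conjI allI)
      show "mvar r * b \<in> carrier (xring n)" using b r by (simp add: S_def)
      fix d
      show "\<exists>g. ?P (mvar r * b) d g"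
      proof (cases d)
        case 0
        then have "?P (mvar r * b) d 0" using ID(2) by (auto simp: pp_deg_eq_0_iff coef_mv)
        then show ?thesis ..
      next
        case (Suc d')
        obtain g where g: "?P b d' g" using b unfolding S_def by blast
        have "mvar r * g \<in> I" using g r ID(6)[of "mvar r" g] by simp
        moreover have "pp_deg t \<le> d" if tg: "t \<in> supp (mvar r * g)" for t
        proof -
          obtain u where "u \<in> supp g" "t = Poly_Mapping.single r 1 + u"
            using tg supp_mterm_times[of "Poly_Mapping.single r 1" 1 g] unfolding mv by blast
          then show ?thesis using g Suc by (auto simp: pp_deg_add)
        qed
        moreover have "coef (mvar r * g) t = coef (mvar r * b) t" if t: "pp_deg t = d" for t
        proof (cases "r \<in> supp t")
          case True
          then obtain u where u: "t = Poly_Mapping.single r 1 + u" by (rule pp_split_var)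
          then have "pp_deg u = d'" using t Suc by (simp add: pp_deg_add)
          then show ?thesis using g u True by (simp add: coef_mv)
        qed (simp add: coef_mv)
        ultimately have "?P (mvar r * b) d (mvar r * g)" by blast
        then show ?thesis ..
      qed
    qed
  qed
  have "?G \<subseteq> S"
  proof clarify
    fix f assume f: "f \<in> I" "f \<noteq> 0"
    show "hom_component (mdeg f) f \<in> S" unfolding S_def
    proof (intro CollectI conjI allI)
      show "hom_component (mdeg f) f \<in> carrier (xring n)" using sub f by blast
      fix d
      show "\<exists>g. ?P (hom_component (mdeg f) f) d g"
      proof (cases "d = mdeg f")
        case True
        then have "?P (hom_component (mdeg f) f) d f"
          using f mdeg_le_iff[of f d] by (auto simp: coef_hom_component)
        then show ?thesis ..
      next
        case False
        then have "?P (hom_component (mdeg f) f) d 0" using ID(2) by (auto simp: coef_hom_component)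
        then show ?thesis ..
      qed
    qed
  qed
  then have "degree_form_ideal n I \<subseteq> S"
    unfolding degree_form_ideal_def by (rule Idl_mpoly(3)[OF sub S])
  then show "f \<in> degree_form_ideal n I \<Longrightarrow>
      \<exists>g\<in>I. (\<forall>t\<in>supp g. pp_deg t \<le> d) \<and> (\<forall>t. pp_deg t = d \<longrightarrow> coef g t = coef f t)"
    unfolding S_def by blast
qed

text \<open>
  The homogeneous part of a point: it represents the associated graded ring whenever normal forms with
  respect to the point do not increase the degree.
\<close>

definition hom_point :: "nat pp list \<Rightarrow> nat pp list \<Rightarrow> 'l::comm_ring_1 mat \<Rightarrow> 'l mat" where
  "hom_point ts bs \<Gamma> = mat (length ts) (length bs)
     (\<lambda>(i, j). if pp_deg (ts ! i) = pp_deg (bs ! j) then \<Gamma> $$ (i, j) else 0)"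

text \<open>
  The homogeneous component of highest degree of the polynomial
  \<open>b\<^sub>j - \<Sum>\<^sub>i \<gamma>\<^sub>i\<^sub>j t\<^sub>i\<close> is the border polynomial of the homogeneous part. The order ideal stays independent modulo
  the degree form ideal: a degree form supported in it belongs to an element of \<open>I\<^sub>\<Gamma>\<close> whose normal form has the
  same component of that degree, and this normal form is zero. So the order ideal is a basis modulo both ideals.
\<close>

lemma degree_form_ideal_eq_point_ideal:
  fixes \<Gamma> :: "'l::Fields.field mat"
  assumes enum: "enum_order_ideal n ts bs" and comm: "mats_commute n ts bs \<Gamma>"
    and df: "\<And>i j. i < length ts \<Longrightarrow> j < length bs \<Longrightarrow> pp_deg (bs ! j) < pp_deg (ts ! i) \<Longrightarrow> \<Gamma> $$ (i, j) = 0"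
  shows "mats_commute n ts bs (hom_point ts bs \<Gamma>)"
    "point_ideal n ts bs (hom_point ts bs \<Gamma>) = degree_form_ideal n (point_ideal n ts bs \<Gamma>)"
proof -
  note E = enum_order_idealD[OF enum]
  let ?I = "point_ideal n ts bs \<Gamma>" and ?h = "hom_point ts bs \<Gamma>"
  have I: "ideal ?I (xring n)" "\<And>j. j < length bs \<Longrightarrow> border_poly ts bs \<Gamma> j \<in> ?I"
    using point_ideal_props[OF enum] by blast+
  note ID = ideal_mpolyD[OF I(1)] and D = degree_form_ideal_props[OF I(1)]
  have "border_poly ts bs ?h j \<in> degree_form_ideal n ?I" if j: "j < length bs" for j
  proof -
    let ?bp = "border_poly ts bs \<Gamma> j" and ?hp = "border_poly ts bs ?h j"
    have b: "bs ! j \<notin> set ts" using E(7) nth_mem[OF j] by blast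
    have 1: "coef ?bp (bs ! j) = 1" by (rule coef_border_poly(1)[OF enum j])
    have deg: "pp_deg t \<le> pp_deg (bs ! j)" if "t \<in> supp ?bp" for t
    proof (cases "t = bs ! j")
      case False
      then have "t \<in> set ts" using coef_border_poly(3)[OF enum j] that by blast
      then obtain i where "i < length ts" "ts ! i = t" by (auto simp: in_set_conv_nth)
      then show ?thesis using df[of i j] j that coef_border_poly(2)[OF enum j, of i \<Gamma>]
        by (auto simp: in_keys_iff intro: ccontr)
    qed simp
    have "mdeg ?bp \<le> pp_deg (bs ! j)" using deg by (simp add: mdeg_le_iff)
    moreover have "pp_deg (bs ! j) \<le> mdeg ?bp" using 1 mdeg_le_iff[of ?bp "mdeg ?bp"] by (simp add: in_keys_iff)
    ultimately have mdeg: "mdeg ?bp = pp_deg (bs ! j)" by simp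
    have "hom_component (mdeg ?bp) ?bp = ?hp"
    proof (rule poly_mapping_eqI)
      fix t
      show "coef (hom_component (mdeg ?bp) ?bp) t = coef ?hp t"
      proof (cases "t \<in> set ts")
        case True
        then obtain i where "i < length ts" "ts ! i = t" by (auto simp: in_set_conv_nth)
        then show ?thesis
          using j coef_border_poly(2)[OF enum j, of i \<Gamma>] coef_border_poly(2)[OF enum j, of i ?h]
          by (auto simp: coef_hom_component mdeg hom_point_def)
      next
        case False
        show ?thesis
        proof (cases "t = bs ! j")
          case True
          then show ?thesis using 1 coef_border_poly(1)[OF enum j, of ?h] by (simp add: coef_hom_component mdeg)
        next
          case False
          then have "t \<notin> supp ?bp" "t \<notin> supp ?hp"
            using \<open>t \<notin> set ts\<close> coef_border_poly(3)[OF enum j] by blast+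
          then show ?thesis by (simp add: coef_hom_component in_keys_iff)
        qed
      qed
    qed
    moreover have "?bp \<noteq> 0" using 1 by auto
    ultimately show ?thesis using D(2)[OF I(2)[OF j]] by simp
  qed
  moreover have "indep_mod (degree_form_ideal n ?I) (set ts)" unfolding indep_mod_def
  proof (intro allI impI)
    fix f assume f: "supp f \<subseteq> set ts \<and> f \<in> degree_form_ideal n ?I"
    show "f = 0"
    proof (rule ccontr)
      assume "f \<noteq> 0"
      then obtain t where t: "t \<in> supp f" using keys_eq_empty by blast
      define d where "d = pp_deg t"
      obtain g where g: "g \<in> ?I" "\<And>u. u \<in> supp g \<Longrightarrow> pp_deg u \<le> d" "\<And>u. pp_deg u = d \<Longrightarrow> coef g u = coef f u"
        using D(3)[of f d] f by auto
      let ?fd = "hom_component d f" and ?T = "{t\<in>set ts. pp_deg t < d}"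
      have low: "supp (g - ?fd) \<subseteq> {u\<in>terms n. pp_deg u < d}"
      proof
        fix u assume u: "u \<in> supp (g - ?fd)"
        have "coef g u \<noteq> coef ?fd u" using u by (auto simp: in_keys_iff lookup_minus)
        then have du: "pp_deg u \<noteq> d" using g(3)[of u] by (auto simp: coef_hom_component)
        then have "u \<in> supp g" using u by (simp add: in_keys_iff lookup_minus coef_hom_component)
        then show "u \<in> {u\<in>terms n. pp_deg u < d}"
          using g(1) ID(1) g(2)[of u] du xring_iff by fastforce
      qed
      have "\<exists>h. supp h \<subseteq> ?T \<and> (g - ?fd) - h \<in> ?I"
      proof (rule span_mod_extend[OF I(1) _ low])
        fix u assume u: "u \<in> {u\<in>terms n. pp_deg u < d}"
        have "\<exists>v. is_coords ?I ts v (mterm u 1) \<and> (\<forall>i<length ts. v $ i \<noteq> 0 \<longrightarrow> pp_deg (ts ! i) \<le> pp_deg u)"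
          by (rule coords_degree_bound[OF enum I]) (use df u in \<open>auto simp: not_le intro: ccontr\<close>)
        then obtain v where v: "is_coords ?I ts v (mterm u 1)"
          "\<And>i. i < length ts \<Longrightarrow> v $ i \<noteq> 0 \<Longrightarrow> pp_deg (ts ! i) \<le> pp_deg u" by auto
        have "supp (vpoly ts v) \<subseteq> ?T"
        proof
          fix s assume s: "s \<in> supp (vpoly ts v)"
          then have "s \<in> set ts" using supp_vpoly by blast
          then obtain i where i: "i < length ts" "ts ! i = s" by (auto simp: in_set_conv_nth)
          then have "v $ i \<noteq> 0" using s coef_vpoly[OF E(5) i(1), of v] by (simp add: in_keys_iff)
          then show "s \<in> ?T" using v(2)[OF i(1)] i u \<open>s \<in> set ts\<close> by auto
        qed
        then show "\<exists>h. supp h \<subseteq> ?T \<and> mterm u 1 - h \<in> ?I" using v(1) by (auto simp: is_coords_def)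
      qed
      then obtain h where h: "supp h \<subseteq> ?T" "(g - ?fd) - h \<in> ?I" by blast
      have "?fd + h = g - ((g - ?fd) - h)" by simp
      also have "\<dots> \<in> ?I" by (rule ID(5)[OF g(1) h(2)])
      finally have "?fd + h \<in> ?I" .
      moreover have "supp (?fd + h) \<subseteq> set ts"
        using keys_add[of ?fd h] h(1) supp_hom_component[of d f] f by blast
      ultimately have "?fd + h = 0" using indep_modD[OF point_ideal_indep[OF enum comm]] by blast
      moreover have "coef h t = 0" using h(1) by (auto simp: d_def in_keys_iff)
      moreover have "coef (?fd + h) t = coef f t + coef h t"
        by (simp add: lookup_add coef_hom_component d_def)
      ultimately have "coef f t = 0" by simp
      then show False using t by (simp add: in_keys_iff)
    qed
  qed
  ultimately show "mats_commute n ts bs ?h" "point_ideal n ts bs ?h = degree_form_ideal n ?I"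
    using border_basis_point[OF enum D(1)] by blast+
qed

section \<open>The Cayley-Bacharach property of a homogeneous point\<close>

text \<open>
  The ideal of a homogeneous point is homogeneous with a residue class ring of finite dimension. The
  residue class ring is therefore local with the nilpotent maximal ideal generated by the indeterminates, and
  the order of an element is the degree of its normal form.
\<close>

locale homogeneous_point =
  fixes n :: nat and ts bs :: "nat pp list" and \<Gamma> :: "'l::Fields.field mat"
  assumes enum: "enum_order_ideal n ts bs" and comm: "mats_commute n ts bs \<Gamma>"
    and homog: "\<And>i j. i < length ts \<Longrightarrow> j < length bs \<Longrightarrow> \<Gamma> $$ (i, j) \<noteq> 0 \<Longrightarrow> pp_deg (ts ! i) = pp_deg (bs ! j)"
begin

abbreviation (input) P :: "(nat, 'l) mpoly ring" where "P \<equiv> xring n"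
definition I :: "(nat, 'l) mpoly set" where "I = point_ideal n ts bs \<Gamma>"
definition D :: nat where "D = pp_deg (ts ! (length ts - 1))"

lemmas E = enum_order_idealD[OF enum]

lemma I_ideal: "ideal I P"
  unfolding I_def by (rule point_ideal_props(1)[OF enum])

lemmas ID = ideal_mpolyD[OF I_ideal]

lemma I_border: "j < length bs \<Longrightarrow> border_poly ts bs \<Gamma> j \<in> I"
  unfolding I_def by (rule point_ideal_props(2)[OF enum])

lemma I_indep: "indep_mod I (set ts)"
  unfolding I_def by (rule point_ideal_indep[OF enum comm])

lemma zero_in_ts: "0 \<in> set ts"
  using E(1,2) nth_mem[of 0 ts] by simp

lemma one_notin_I: "1 \<notin> I"
  by (rule one_notin_of_indep[OF I_indep zero_in_ts])

lemma deg_le_D: "t \<in> set ts \<Longrightarrow> pp_deg t \<le> D"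
  unfolding D_def using E(11)[of _ "length ts - 1"] by (auto simp: in_set_conv_nth)

lemma last_in_ts: "ts ! (length ts - 1) \<in> set ts"
  using E(1) by auto

subsection \<open>Normal forms\<close>

definition nf :: "(nat, 'l) mpoly \<Rightarrow> (nat, 'l) mpoly" where
  "nf f = (THE g. supp g \<subseteq> set ts \<and> f - g \<in> I)"

lemma nf_eq:
  assumes "supp g \<subseteq> set ts" "f - g \<in> I"
  shows "nf f = g"
  unfolding nf_def
proof (rule the_equality)
  show "supp g \<subseteq> set ts \<and> f - g \<in> I" using assms by simp
  fix h assume h: "supp h \<subseteq> set ts \<and> f - h \<in> I"
  have "(f - g) - (f - h) \<in> I" using ID(5) assms h by blast
  then have "h - g \<in> I" by simp
  moreover have "supp (h - g) \<subseteq> set ts" using supp_diff[of h g] assms h by blast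
  ultimately have "h - g = 0" using indep_modD[OF I_indep] by blast
  then show "h = g" by simp
qed

lemma nf_props:
  assumes "f \<in> Pol {..<n}"
  shows "supp (nf f) \<subseteq> set ts" "f - nf f \<in> I"
proof -
  obtain v where "is_coords I ts v f" using point_ideal_span[OF enum I_ideal I_border assms] by blast
  then have "f - vpoly ts v \<in> I" by (simp add: is_coords_def)
  with supp_vpoly[of ts v] have "nf f = vpoly ts v" by (rule nf_eq)
  with supp_vpoly[of ts v] \<open>f - vpoly ts v \<in> I\<close> show "supp (nf f) \<subseteq> set ts" "f - nf f \<in> I" by simp_all
qed

lemma nf_in_Pol: "f \<in> Pol {..<n} \<Longrightarrow> nf f \<in> Pol {..<n}"
  using nf_props(1) E(3) xring_iff by blast

lemma nf_cong:
  assumes "f \<in> Pol {..<n}" "g - f \<in> I"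
  shows "nf g = nf f"
proof (rule nf_eq)
  show "supp (nf f) \<subseteq> set ts" by (rule nf_props) fact
  have "(g - f) + (f - nf f) \<in> I" using ID(3) assms(2) nf_props(2)[OF assms(1)] by blast
  then show "g - nf f \<in> I" by simp
qed

lemma nf_add: "f \<in> Pol {..<n} \<Longrightarrow> g \<in> Pol {..<n} \<Longrightarrow> nf (f + g) = nf f + nf g"
proof (rule nf_eq)
  assume fg: "f \<in> Pol {..<n}" "g \<in> Pol {..<n}"
  show "supp (nf f + nf g) \<subseteq> set ts" using keys_add[of "nf f" "nf g"] nf_props(1) fg by blast
  have "(f - nf f) + (g - nf g) \<in> I" using ID(3) nf_props(2) fg by blast
  then show "f + g - (nf f + nf g) \<in> I" by (simp add: algebra_simps)
qed

lemma nf_scale: "f \<in> Pol {..<n} \<Longrightarrow> nf (mconst c * f) = mconst c * nf f"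
proof (rule nf_eq)
  assume f: "f \<in> Pol {..<n}"
  show "supp (mconst c * nf f) \<subseteq> set ts" using supp_mconst_times nf_props(1)[OF f] by blast
  have "mconst c * (f - nf f) \<in> I" by (rule ID(6)) (simp_all add: nf_props(2) f)
  then show "mconst c * f - mconst c * nf f \<in> I" by (simp add: right_diff_distrib)
qed

lemma nf_0 [simp]: "nf 0 = 0"
  by (rule nf_eq) (simp_all add: ID(2))

lemma nf_sum: "(\<And>i. i \<in> A \<Longrightarrow> f i \<in> Pol {..<n}) \<Longrightarrow> nf (sum f A) = (\<Sum>i\<in>A. nf (f i))"
  by (induction A rule: infinite_finite_induct) (simp_all add: nf_add Pol_sum)

lemma nf_eq_0_iff: "f \<in> Pol {..<n} \<Longrightarrow> nf f = 0 \<longleftrightarrow> f \<in> I"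
  using nf_props(2)[of f] nf_eq[of 0 f] by auto

lemma nf_id: "supp f \<subseteq> set ts \<Longrightarrow> nf f = f"
  by (rule nf_eq) (simp_all add: ID(2))

lemma nf_expand:
  assumes f: "f \<in> Pol {..<n}"
  shows "nf f = (\<Sum>t\<in>supp f. mconst (coef f t) * nf (mterm t 1))"
proof -
  have fT: "supp f \<subseteq> terms n" using f xring_iff by blast
  have "nf f = nf (\<Sum>t\<in>supp f. mconst (coef f t) * mterm t 1)"
    by (subst (1) mpoly_eq_sum_mterm[of f]) (simp add: mconst_def mult_single)
  also have "\<dots> = (\<Sum>t\<in>supp f. nf (mconst (coef f t) * mterm t 1))"
    using fT by (intro nf_sum) auto
  also have "\<dots> = (\<Sum>t\<in>supp f. mconst (coef f t) * nf (mterm t 1))"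
    using fT by (intro sum.cong refl nf_scale) auto
  finally show ?thesis .
qed

lemma nf_term_homogeneous:
  assumes t: "t \<in> terms n" and s: "s \<in> supp (nf (mterm t 1))"
  shows "pp_deg s = pp_deg t"
proof -
  have "\<exists>v. is_coords I ts v (mterm t 1) \<and> (\<forall>i<length ts. v $ i \<noteq> 0 \<longrightarrow> pp_deg (ts ! i) = pp_deg t)"
    by (rule coords_degree_bound[OF enum I_ideal I_border]) (use homog t in auto)
  then obtain v where v: "is_coords I ts v (mterm t 1)"
    "\<And>i. i < length ts \<Longrightarrow> v $ i \<noteq> 0 \<Longrightarrow> pp_deg (ts ! i) = pp_deg t" by auto
  have nf: "nf (mterm t 1) = vpoly ts v"
    using v(1) by (intro nf_eq supp_vpoly) (simp add: is_coords_def)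
  have "s \<in> supp (vpoly ts v)" using s nf by simp
  then have "s \<in> set ts" using supp_vpoly[of ts v] by blast
  then obtain i where i: "i < length ts" "ts ! i = s" by (auto simp: in_set_conv_nth)
  have "v $ i \<noteq> 0" using s coef_vpoly[OF E(5) i(1), of v] i(2) unfolding nf by (simp add: in_keys_iff)
  then show ?thesis using v(2)[OF i(1)] i(2) by simp
qed

lemma supp_nf_degree:
  assumes f: "f \<in> Pol {..<n}" and s: "s \<in> supp (nf f)"
  shows "\<exists>t\<in>supp f. pp_deg s = pp_deg t"
proof (rule ccontr)
  have fT: "supp f \<subseteq> terms n" using f xring_iff by blast
  assume no: "\<not> ?thesis"
  have "coef (nf f) s = (\<Sum>t\<in>supp f. coef f t * coef (nf (mterm t 1)) s)"
    by (subst nf_expand[OF f]) (simp add: lookup_sum coef_mconst_times)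
  also have "\<dots> = 0"
    using no nf_term_homogeneous fT by (intro sum.neutral) (auto simp: in_keys_iff)
  finally show False using s by (simp add: in_keys_iff)
qed

lemma high_degree_in_I:
  assumes "f \<in> Pol {..<n}" "\<And>t. t \<in> supp f \<Longrightarrow> D < pp_deg t"
  shows "f \<in> I"
proof -
  have "supp (nf f) = {}"
  proof (rule ccontr)
    assume "supp (nf f) \<noteq> {}"
    then obtain s where s: "s \<in> supp (nf f)" by blast
    then obtain t where "t \<in> supp f" "pp_deg s = pp_deg t" using supp_nf_degree[OF assms(1)] by blast
    moreover have "pp_deg s \<le> D" using s nf_props(1)[OF assms(1)] deg_le_D by blast
    ultimately show False using assms(2) by fastforce
  qed
  then show ?thesis using nf_eq_0_iff[OF assms(1)] by simp
qed

subsection \<open>The maximal ideal of the origin\<close>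

definition M :: "(nat, 'l) mpoly set" where
  "M = {f \<in> Pol {..<n}. coef f 0 = 0}"

lemma coef_0_eval: "coef f 0 = mpoly_eval id (\<lambda>_. 0) (f :: (nat, 'l) mpoly)"
proof -
  have 0: "pp_eval (\<lambda>_. 0 :: 'l) t = (if t = 0 then 1 else 0)" for t :: "nat pp"
  proof (cases "t = 0")
    case False
    then obtain v where v: "v \<in> supp t" using keys_eq_empty by blast
    then have "(0 :: 'l) ^ coef t v = 0" by (simp add: in_keys_iff)
    then show ?thesis using False v unfolding pp_eval_def
      by (simp add: prod_zero_iff) (metis v in_keys_iff)
  qed simp
  have "mpoly_eval id (\<lambda>_. 0) f = (\<Sum>t\<in>supp f. if t = 0 then coef f t else 0)"
    unfolding mpoly_eval_alt 0 by (intro sum.cong) auto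
  then show ?thesis by (simp add: in_keys_iff)
qed

lemma id_hom: "comm_ring_hom (id :: 'l \<Rightarrow> 'l)"
  by unfold_locales simp_all

lemma coef_0_mult: "coef (f * g) 0 = coef f 0 * coef (g :: (nat, 'l) mpoly) 0"
  using mpoly_eval_hom[OF id_hom, of "\<lambda>_ :: nat. 0 :: 'l"]
  by (simp only: coef_0_eval comm_ring_hom_def ring_hom_def semiring_hom_def monoid_mult_hom_def
      semigroup_mult_hom_def times_hom_def)

lemma coef_0_power: "coef (f ^ k) 0 = coef (f :: (nat, 'l) mpoly) 0 ^ k"
  by (induction k) (simp_all add: coef_0_mult)

lemma M_ideal: "ideal M P"
  by (rule ideal_mpolyI) (auto simp: M_def lookup_add coef_0_mult)

lemma one_notin_M: "1 \<notin> M"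
  by (simp add: M_def)

lemma I_subset_M: "I \<subseteq> M"
proof
  fix f assume f: "f \<in> I"
  then have fP: "f \<in> Pol {..<n}" using ID(1) by blast
  have fT: "supp f \<subseteq> terms n" using fP xring_iff by blast
  have "0 = coef (nf f) 0" using f nf_eq_0_iff[OF fP] by simp
  also have "\<dots> = (\<Sum>t\<in>supp f. coef f t * coef (nf (mterm t 1)) 0)"
    by (subst nf_expand[OF fP]) (simp add: lookup_sum coef_mconst_times)
  also have "\<dots> = (\<Sum>t\<in>supp f. if t = 0 then coef f t else 0)"
  proof (intro sum.cong refl)
    fix t assume t: "t \<in> supp f"
    show "coef f t * coef (nf (mterm t 1)) 0 = (if t = 0 then coef f t else 0)"
    proof (cases "t = 0")
      case True
      then show ?thesis using nf_id[of "mterm 0 1"] zero_in_ts by simp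
    next
      case False
      then have "0 \<notin> supp (nf (mterm t 1))"
        using nf_term_homogeneous[of t 0] t fT pp_deg_eq_0_iff[of t] by auto
      then show ?thesis using False by (simp add: in_keys_iff)
    qed
  qed
  also have "\<dots> = coef f 0" by (simp add: in_keys_iff)
  finally show "f \<in> M" using fP by (simp add: M_def)
qed

lemma power_in_I:
  assumes f: "f \<in> M"
  shows "f ^ Suc D \<in> I"
proof (rule high_degree_in_I)
  show "f ^ Suc D \<in> Pol {..<n}" using f by (intro Pol_power) (simp add: M_def)
  have pos: "1 \<le> pp_deg t" if "t \<in> supp f" for t
    using that f pp_deg_eq_0_iff[of t] by (cases "t = 0") (auto simp: M_def in_keys_iff)
  have "supp (f ^ k) \<subseteq> {t. k \<le> pp_deg t}" for k
  proof (induction k)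
    case (Suc k)
    show ?case unfolding power_Suc
    proof (rule supp_mult_subset)
      fix t u assume "t \<in> supp f" "u \<in> supp (f ^ k)"
      then show "t + u \<in> {t. Suc k \<le> pp_deg t}" using pos[of t] Suc by (auto simp: pp_deg_add)
    qed
  qed auto
  then show "\<And>t. t \<in> supp (f ^ Suc D) \<Longrightarrow> D < pp_deg t" by fastforce
qed

text \<open>Polynomials with non-zero constant term are units modulo \<open>I\<close>.\<close>

lemma cancel_unit:
  assumes a: "a \<in> Pol {..<n}" and b: "b \<in> Pol {..<n}" "b \<notin> M" and ab: "a * b \<in> I"
  shows "a \<in> I"
proof -
  interpret mc: comm_ring_hom "mconst :: 'l \<Rightarrow> (nat, 'l) mpoly" by (rule mconst_hom)
  define c where "c = coef b 0"
  have c: "c \<noteq> 0" using b by (simp add: M_def c_def)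
  let ?m = "mconst c - b" and ?k = "Suc D"
  have "?m \<in> M" using b by (simp add: M_def lookup_minus c_def mconst_def)
  then have m: "?m ^ ?k \<in> I" by (rule power_in_I)
  define q where "q = (\<Sum>i<?k. ?m ^ (?k - Suc i) * mconst c ^ i)"
  have q: "q \<in> Pol {..<n}"
    unfolding q_def using b by (intro Pol_sum Pol_closed(4) Pol_power) simp_all
  have "mconst c ^ ?k - ?m ^ ?k = b * q"
    unfolding q_def by (subst power_diff_sumr2) simp
  then have "a * mconst c ^ ?k = q * (a * b) + a * ?m ^ ?k"
    by (simp add: algebra_simps eq_diff_eq[symmetric] del: power_Suc)
  moreover have "q * (a * b) + a * ?m ^ ?k \<in> I" using ID(3,6) q a ab m by blast
  ultimately have "a * mconst c ^ ?k \<in> I" by simp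
  moreover define e where "e = c ^ ?k"
  moreover have "mconst c ^ ?k = (mconst e :: (nat, 'l) mpoly)" unfolding e_def by (rule mc.hom_power[symmetric])
  ultimately have "mconst (inverse e) * (a * mconst e) \<in> I" using ID(6) by simp
  moreover have "mconst (inverse e) * (a * mconst e) = a * mconst (inverse e * e)"
    by (simp only: mc.hom_mult mult_ac)
  moreover have "e \<noteq> 0" using c by (simp add: e_def)
  ultimately show ?thesis by simp
qed

lemma radical_I: "ideal_radical P I = M"
proof
  show "ideal_radical P I \<subseteq> M"
  proof
    fix f assume "f \<in> ideal_radical P I"
    then obtain k where f: "f \<in> Pol {..<n}" "f ^ k \<in> I"
      by (auto simp: ideal_radical_def mpoly_ring_pow)
    then have "coef f 0 ^ k = 0" using I_subset_M coef_0_power[of f k] by (auto simp: M_def)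
    then show "f \<in> M" using f by (simp add: M_def)
  qed
  show "M \<subseteq> ideal_radical P I"
  proof
    fix f assume "f \<in> M"
    then show "f \<in> ideal_radical P I" using power_in_I[of f] unfolding ideal_radical_def mpoly_ring_pow M_def by blast
  qed
qed

lemma M_maximal_subset:
  assumes J: "ideal J P" and "M \<subseteq> J" "J \<noteq> M"
  shows "J = Pol {..<n}"
proof -
  note JD = ideal_mpolyD[OF J]
  obtain f where f: "f \<in> J" "f \<notin> M" using assms by blast
  then have fP: "f \<in> Pol {..<n}" using JD(1) by blast
  define c where "c = coef f 0"
  have c: "c \<noteq> 0" using f fP by (simp add: M_def c_def)
  have "f - mconst c \<in> M" using fP by (simp add: M_def lookup_minus mconst_def c_def)
  then have "f - (f - mconst c) \<in> J" using f assms(2) JD(5) by blast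
  then have "mconst c \<in> J" by simp
  then have "mconst (inverse c) * mconst c \<in> J" using JD(6) by simp
  moreover have "mconst (inverse c) * mconst c = (1 :: (nat, 'l) mpoly)" using c by (simp add: mconst_def mult_single)
  ultimately have "1 \<in> J" by simp
  then have "f * 1 \<in> J" if "f \<in> Pol {..<n}" for f using JD(6) that by blast
  then show ?thesis using JD(1) by auto
qed

lemma M_maximal: "maximalideal M P"
proof (rule maximalidealI[OF M_ideal])
  show "carrier P \<noteq> M" using one_notin_M Pol_closed(9) by metis
  show "J = M \<or> J = carrier P" if "ideal J P" "M \<subseteq> J" "J \<subseteq> carrier P" for J
    using M_maximal_subset[OF that(1,2)] by blast
qed

text \<open>
  Some power of \<open>M\<close> is contained in \<open>I\<close>, so every component has the radical \<open>M\<close>; as the radicals of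
  distinct components differ, there is one component only.
\<close>

lemma primary_decomposition_iff: "primary_decomposition P I \<Q> \<longleftrightarrow> \<Q> = {I}"
proof
  assume "\<Q> = {I}"
  moreover have "primary_ideal P I"
    unfolding primary_ideal_def
  proof (intro conjI ballI impI)
    show "ideal I P" by (rule I_ideal)
    show "I \<noteq> carrier P" using one_notin_I Pol_closed(9) by metis
    fix a b assume "a \<in> carrier P" "b \<in> carrier P" "a \<otimes>\<^bsub>P\<^esub> b \<in> I"
    then show "a \<in> I \<or> b \<in> ideal_radical P I" using cancel_unit[of a b] by (auto simp: radical_I)
  qed
  ultimately show "primary_decomposition P I \<Q>"
    by (simp add: primary_decomposition_def radical_I M_maximal)
next
  assume pd: "primary_decomposition P I \<Q>"
  have "ideal_radical P Q = M" if Q: "Q \<in> \<Q>" for Q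
  proof -
    have "maximalideal (ideal_radical P Q) P" using pd Q by (simp add: primary_decomposition_def)
    then interpret R: maximalideal "ideal_radical P Q" P .
    have "I \<subseteq> Q" using pd Q by (auto simp: primary_decomposition_def)
    then have "M \<subseteq> ideal_radical P Q" unfolding radical_I[symmetric] ideal_radical_def by blast
    then show ?thesis using M_maximal_subset[OF R.is_ideal] R.I_notcarr by metis
  qed
  moreover have "inj_on (ideal_radical P) \<Q>" "\<Q> \<noteq> {}" "I = \<Inter>\<Q>"
    using pd by (auto simp: primary_decomposition_def)
  ultimately obtain Q where "\<Q> = {Q}"
    by (metis (no_types, opaque_lifting) inj_onD is_singletonI' is_singletonE)
  then show "\<Q> = {I}" using \<open>I = \<Inter>\<Q>\<close> by simp
qed

subsection \<open>Minimal divisors and the socle\<close>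

text \<open>
  Zero is excluded because the socle elements serve as generators of minimal divisors.
\<close>

definition Soc :: "(nat, 'l) mpoly set" where
  "Soc = {f \<in> Pol {..<n}. f \<notin> I \<and> (\<forall>r<n. mvar r * f \<in> I)}"

definition I_plus :: "(nat, 'l) mpoly \<Rightarrow> (nat, 'l) mpoly set" where
  "I_plus f = {mconst c * f + g | c g. g \<in> I}"

lemma Soc_M: "f \<in> Soc \<Longrightarrow> m \<in> M \<Longrightarrow> m * f \<in> I"
proof -
  assume f: "f \<in> Soc" and m: "m \<in> M"
  have "mterm t c * f \<in> I" if t: "t \<in> terms n" "t \<noteq> 0" for t c
  proof -
    obtain r where r: "r \<in> supp t" using t(2) keys_eq_empty by blast
    then obtain u where u: "t = Poly_Mapping.single r 1 + u" by (rule pp_split_var)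
    have "r < n" "u \<in> terms n" using t(1) r u by (auto simp: terms_add_iff) (auto simp: terms_iff)
    then have "mterm u c * (mvar r * f) \<in> I" using f ID(6)[of "mterm u c"] by (simp add: Soc_def)
    moreover have "mterm u c * (mvar r * f) = mterm t c * f"
      by (simp add: mvar_def mterm_times_times u add.commute)
    ultimately show ?thesis by simp
  qed
  moreover have "supp m \<subseteq> terms n" "0 \<notin> supp m" using m xring_iff[of m n] by (auto simp: M_def in_keys_iff)
  ultimately have "(\<Sum>t\<in>supp m. mterm t (coef m t) * f) \<in> I" by (intro ID(7)) blast
  then show ?thesis by (simp flip: sum_distrib_right mpoly_eq_sum_mterm)
qed

lemma I_plus_ideal:
  assumes f: "f \<in> Soc"
  shows "ideal (I_plus f) P"
proof (rule ideal_mpolyI_var)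
  interpret mc: comm_ring_hom "mconst :: 'l \<Rightarrow> (nat, 'l) mpoly" by (rule mconst_hom)
  have fP: "f \<in> Pol {..<n}" using f by (simp add: Soc_def)
  show "I_plus f \<subseteq> Pol {..<n}" unfolding I_plus_def using fP ID(1) by (auto intro!: Pol_closed)
  show "0 \<in> I_plus f" unfolding I_plus_def using ID(2)
    by (intro CollectI exI[of _ 0]) simp
  fix a b assume "a \<in> I_plus f" "b \<in> I_plus f"
  then obtain c g d h where ab: "a = mconst c * f + g" "g \<in> I" "b = mconst d * f + h" "h \<in> I"
    by (auto simp: I_plus_def)
  have "a + b = mconst (c + d) * f + (g + h)" using ab by (simp add: mc.hom_add distrib_right)
  then show "a + b \<in> I_plus f" unfolding I_plus_def using ID(3)[OF ab(2,4)] by blast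
next
  interpret mc: comm_ring_hom "mconst :: 'l \<Rightarrow> (nat, 'l) mpoly" by (rule mconst_hom)
  fix c b assume "b \<in> I_plus f"
  then obtain d g where b: "b = mconst d * f + g" "g \<in> I" by (auto simp: I_plus_def)
  have "mconst c * b = mconst (c * d) * f + mconst c * g"
    using b by (simp add: mc.hom_mult distrib_left mult.assoc)
  then show "mconst c * b \<in> I_plus f" unfolding I_plus_def using ID(6)[OF _ b(2), of "mconst c"] by auto
next
  interpret mc: comm_ring_hom "mconst :: 'l \<Rightarrow> (nat, 'l) mpoly" by (rule mconst_hom)
  fix r b assume r: "r \<in> {..<n}" and "b \<in> I_plus f"
  then obtain d g where b: "b = mconst d * f + g" "g \<in> I" by (auto simp: I_plus_def)
  have "mvar r * b = mconst 0 * f + (mconst d * (mvar r * f) + mvar r * g)"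
    using b by (simp add: distrib_left mult.left_commute)
  moreover have "mconst d * (mvar r * f) \<in> I" using f r ID(6)[of "mconst d" "mvar r * f"] by (simp add: Soc_def)
  moreover have "mvar r * g \<in> I" using r b(2) ID(6)[of "mvar r" g] by simp
  ultimately show "mvar r * b \<in> I_plus f" unfolding I_plus_def using ID(3) by blast
qed

lemma I_plus_self: "f \<in> I_plus f" "I \<subseteq> I_plus f"
proof -
  have "f = mconst 1 * f + 0" by (simp add: mconst_def)
  then show "f \<in> I_plus f" unfolding I_plus_def using ID(2) by blast
  have "g = mconst 0 * f + g" for g by (simp add: mconst_def)
  then show "I \<subseteq> I_plus f" unfolding I_plus_def by blast
qed

lemma I_plus_cosets:
  "(\<lambda>g. I +>\<^bsub>P\<^esub> g) ` I_plus f = (\<lambda>g. I +>\<^bsub>P\<^esub> g) ` {mconst c * f | c. True}" (is "?L = ?R")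
proof
  have eq: "I +>\<^bsub>P\<^esub> (mconst c * f + g) = I +>\<^bsub>P\<^esub> (mconst c * f)" if "g \<in> I" for c g
    using that by (simp add: mpoly_coset_eq_iff[OF I_ideal])
  show "?L \<subseteq> ?R" unfolding I_plus_def using eq by blast
  have "mconst c * f \<in> I_plus f" for c
  proof -
    have "mconst c * f = mconst c * f + 0" by simp
    then show ?thesis unfolding I_plus_def using ID(2) by blast
  qed
  then show "?R \<subseteq> ?L" by blast
qed

lemma dimension_residue_field:
  "ring.dimension (P Quot M) d (qconsts n M) (carrier (P Quot M)) \<longleftrightarrow> d = 1"
proof -
  have ind: "indep_mod M {0}"
    unfolding indep_mod_def
  proof (intro allI impI)
    fix f assume f: "supp f \<subseteq> {0} \<and> f \<in> M"
    show "f = 0"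
    proof (rule poly_mapping_eqI)
      fix t show "coef f t = coef 0 t" using f by (cases "t = 0") (auto simp: M_def in_keys_iff)
    qed
  qed
  have "(\<lambda>f. M +>\<^bsub>P\<^esub> f) ` {g. supp g \<subseteq> {0}} = carrier (P Quot M)" (is "?L = ?R")
  proof
    have "{g :: (nat, 'l) mpoly. supp g \<subseteq> {0}} \<subseteq> Pol {..<n}"
    proof
      fix g :: "(nat, 'l) mpoly" assume "g \<in> {g. supp g \<subseteq> {0}}"
      then show "g \<in> Pol {..<n}" using terms_zero[of n] unfolding xring_iff by blast
    qed
    then show "?L \<subseteq> ?R" unfolding quot_ops(1)[OF M_ideal] by (rule image_mono)
    show "?R \<subseteq> ?L" unfolding quot_ops(1)[OF M_ideal]
    proof clarify
      fix f :: "(nat, 'l) mpoly" assume f: "f \<in> Pol {..<n}"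
      have "f - mconst (coef f 0) \<in> M" using f by (simp add: M_def lookup_minus mconst_def)
      then have "M +>\<^bsub>P\<^esub> f = M +>\<^bsub>P\<^esub> mconst (coef f 0)" by (simp add: mpoly_coset_eq_iff[OF M_ideal])
      moreover have "supp (mconst (coef f 0)) \<subseteq> {0}" by (simp add: mconst_def)
      ultimately show "M +>\<^bsub>P\<^esub> f \<in> ?L" by blast
    qed
  qed
  with dimension_span_terms[OF M_ideal _ ind] have dim: "ring.dimension (P Quot M) 1 (qconsts n M) (carrier (P Quot M))"
    by simp
  show ?thesis using ring_dim_eq(2)[OF M_ideal one_notin_M dim] dim by blast
qed

lemma dimension_I_plus:
  assumes f: "f \<in> Soc"
  shows "ring.dimension (P Quot I) 1 (qconsts n I) ((\<lambda>g. I +>\<^bsub>P\<^esub> g) ` I_plus f)"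
proof -
  interpret I: ideal I P by (rule I_ideal)
  interpret Q: ring "P Quot I" by (rule I.quotient_is_ring)
  have fP: "f \<in> Pol {..<n}" and fI: "f \<notin> I" using f by (simp_all add: Soc_def)
  have "I +>\<^bsub>P\<^esub> f \<in> carrier (P Quot I)" using fP by (simp add: quot_ops[OF I_ideal])
  moreover have "I +>\<^bsub>P\<^esub> f \<notin> {\<zero>\<^bsub>P Quot I\<^esub>}"
    using fI by (simp add: quot_ops[OF I_ideal] mpoly_coset_eq_iff[OF I_ideal])
  ultimately have "Q.dimension (Suc 0) (qconsts n I) (Q.line_extension (qconsts n I) (I +>\<^bsub>P\<^esub> f) {\<zero>\<^bsub>P Quot I\<^esub>})"
    by (rule Q.Suc_dim[OF _ _ Q.zero_dim])
  also have "{\<zero>\<^bsub>P Quot I\<^esub>} = (\<lambda>g. I +>\<^bsub>P\<^esub> g) ` {0}" by (simp add: quot_ops[OF I_ideal])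
  also have "Q.line_extension (qconsts n I) (I +>\<^bsub>P\<^esub> f) ((\<lambda>g. I +>\<^bsub>P\<^esub> g) ` {0}) = (\<lambda>g. I +>\<^bsub>P\<^esub> g) ` I_plus f"
    by (subst line_extension_quot[OF I_ideal fP]) (simp_all add: I_plus_cosets)
  finally show ?thesis by simp
qed

text \<open>
  An ideal \<open>Q'\<close> with \<open>dim Q'/I = 1\<close> is spanned over \<open>I\<close> by one element \<open>f\<close>; as \<open>x\<^sub>r f = c f\<close> with
  \<open>c \<noteq> 0\<close> would make the unit \<open>x\<^sub>r - c\<close> annihilate \<open>f\<close>, this element lies in the socle. If \<open>I = M\<close>,
  the only element of the socle up to scalars is \<open>1\<close>, in agreement with the convention \<open>Q' = P\<close>.
\<close>

lemma minimal_divisors_eq: "minimal_divisors n {I} I = I_plus ` Soc"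
proof -
  let ?c1 = "\<lambda>Q'. if I = M then Q' = carrier P else I \<subset> Q' \<and> Q' \<subseteq> M"
  let ?c2 = "\<lambda>Q'. \<exists>d. ring.dimension (P Quot I) d (qconsts n I) ((\<lambda>f. I +>\<^bsub>P\<^esub> f) ` Q') \<and>
              ring.dimension (P Quot M) d (qconsts n M) (carrier (P Quot M))"
  define R where "R Q' \<longleftrightarrow> ideal Q' P \<and> ?c1 Q' \<and> ?c2 Q'" for Q'
  have 1: "minimal_divisors n {I} I = {Q'. R Q'}"
  proof -
    let ?F = "\<lambda>Q'. carrier P \<inter> Q' \<inter> \<Inter>({I} - {I})"
    have "minimal_divisors n {I} I = {?F Q' | Q'. R Q'}"
      unfolding minimal_divisors_def Let_def radical_I R_def by (rule refl)
    also have "\<dots> = ?F ` {Q'. R Q'}" by blast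
    also have "\<dots> = (\<lambda>Q'. Q') ` {Q'. R Q'}"
    proof (rule image_cong[OF refl])
      fix Q' assume "Q' \<in> {Q'. R Q'}"
      then have "Q' \<subseteq> carrier P" using ideal_mpolyD(1)[of Q'] by (simp add: R_def)
      then show "?F Q' = Q'" by auto
    qed
    finally show ?thesis by simp
  qed
  have only: "Q' \<in> I_plus ` Soc" if Q': "ideal Q' P" and c1: "?c1 Q'" and c2: "?c2 Q'" for Q'
  proof -
    note QD = ideal_mpolyD[OF Q']
    have IQ: "I \<subseteq> Q'" "Q' \<noteq> I"
      using c1 ID(1) one_notin_I Pol_closed(9)[of "{..<n}"] by (auto split: if_splits)
    have dim: "ring.dimension (P Quot I) 1 (qconsts n I) ((\<lambda>f. I +>\<^bsub>P\<^esub> f) ` Q')"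
      using c2 by (simp add: dimension_residue_field)
    obtain vs where vs: "vs 0 \<in> Pol {..<n}"
      "(\<lambda>f. I +>\<^bsub>P\<^esub> f) ` Q' = {I +>\<^bsub>P\<^esub> (\<Sum>j<1::nat. mconst (c j) * vs j) | c. True}"
      using dimension_generators[OF I_ideal dim] by auto
    define w where "w = vs 0"
    have w: "w \<in> Pol {..<n}" and cos: "(\<lambda>f. I +>\<^bsub>P\<^esub> f) ` Q' = {I +>\<^bsub>P\<^esub> (mconst c * w) | c. True}"
    proof -
      have sum1: "(\<Sum>j<1::nat. mconst (c j) * vs j) = mconst (c 0) * w" for c by (simp add: w_def)
      then have "(\<lambda>f. I +>\<^bsub>P\<^esub> f) ` Q' = {I +>\<^bsub>P\<^esub> (mconst (c (0::nat)) * w) | c. True}" by (simp only: vs(2) sum1)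
      also have "\<dots> = {I +>\<^bsub>P\<^esub> (mconst c * w) | c. True}" by (auto intro: exI[of _ "\<lambda>_. c" for c])
      finally show "(\<lambda>f. I +>\<^bsub>P\<^esub> f) ` Q' = {I +>\<^bsub>P\<^esub> (mconst c * w) | c. True}" .
    qed (simp add: w_def vs)
    have eq: "Q' = I_plus w"
    proof
      show "Q' \<subseteq> I_plus w"
      proof
        fix x assume "x \<in> Q'"
        then have "I +>\<^bsub>P\<^esub> x \<in> {I +>\<^bsub>P\<^esub> (mconst c * w) | c. True}" unfolding cos[symmetric] by blast
        then obtain c where "I +>\<^bsub>P\<^esub> x = I +>\<^bsub>P\<^esub> (mconst c * w)" by blast
        then have "x - mconst c * w \<in> I" by (simp add: mpoly_coset_eq_iff[OF I_ideal])
        moreover have "x = mconst c * w + (x - mconst c * w)" by simp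
        ultimately show "x \<in> I_plus w" unfolding I_plus_def by blast
      qed
      show "I_plus w \<subseteq> Q'"
      proof
        fix x assume "x \<in> I_plus w"
        then obtain c g where x: "x = mconst c * w + g" "g \<in> I" by (auto simp: I_plus_def)
        have "I +>\<^bsub>P\<^esub> (mconst c * w) \<in> (\<lambda>f. I +>\<^bsub>P\<^esub> f) ` Q'" unfolding cos by blast
        then obtain y where y: "y \<in> Q'" "I +>\<^bsub>P\<^esub> (mconst c * w) = I +>\<^bsub>P\<^esub> y" by blast
        then have "mconst c * w - y \<in> Q'" using IQ by (auto simp: mpoly_coset_eq_iff[OF I_ideal])
        then have "(mconst c * w - y) + (y + g) \<in> Q'" using QD(3) y(1) x(2) IQ(1) by blast
        then show "x \<in> Q'" using x(1) by simp
      qed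
    qed
    have wI: "w \<notin> I"
    proof
      assume "w \<in> I"
      then have "I_plus w \<subseteq> I" unfolding I_plus_def using ID(3,6) by auto
      then show False using IQ eq by blast
    qed
    have "mvar r * w \<in> I" if r: "r < n" for r
    proof -
      have "mvar r * w \<in> I_plus w" using QD(6)[of "mvar r" w] I_plus_self(1)[of w] r unfolding eq by simp
      then obtain c g where cg: "mvar r * w = mconst c * w + g" "g \<in> I" by (auto simp: I_plus_def)
      have "c = 0"
      proof (rule ccontr)
        assume c: "c \<noteq> 0"
        have "w * (mvar r - mconst c) \<in> I" using cg by (simp add: algebra_simps)
        moreover have "mvar r - mconst c \<in> Pol {..<n}" using r by simp
        moreover have "Poly_Mapping.single r (1 :: nat) \<noteq> 0"
          by (metis pp_deg_single pp_deg_zero zero_neq_one)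
        then have "coef (mvar r - mconst c) 0 = - c"
          by (simp add: lookup_minus mvar_def mconst_def lookup_single when_def del: One_nat_def)
        then have "mvar r - mconst c \<notin> M" using c by (simp add: M_def)
        ultimately show False using cancel_unit[OF w] wI by blast
      qed
      then show ?thesis using cg by (simp add: mconst_def)
    qed
    then show ?thesis using w wI eq unfolding Soc_def by blast
  qed
  have "R (I_plus f)" if f: "f \<in> Soc" for f
    unfolding R_def
  proof (intro conjI)
    have fP: "f \<in> Pol {..<n}" and fI: "f \<notin> I" using f by (simp_all add: Soc_def)
    show idl: "ideal (I_plus f) P" by (rule I_plus_ideal[OF f])
    show "?c2 (I_plus f)" using dimension_I_plus[OF f] dimension_residue_field by blast
    show "?c1 (I_plus f)"
    proof (cases "I = M")
      case True
      then show ?thesis using M_maximal_subset[OF idl] I_plus_self[of f] fI by auto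
    next
      case False
      then obtain m where m: "m \<in> M" "m \<notin> I" using I_subset_M by blast
      have "f \<in> M"
      proof (rule ccontr)
        assume "f \<notin> M"
        then show False using cancel_unit[of m f] Soc_M[OF f m(1)] m fP by (auto simp: M_def)
      qed
      then have "I_plus f \<subseteq> M"
        unfolding I_plus_def using ideal_mpolyD(3,6)[OF M_ideal] I_subset_M by auto
      then show ?thesis using False I_plus_self[of f] fI by auto
    qed
  qed
  moreover have "Q' \<in> I_plus ` Soc" if "R Q'" for Q'
    using that unfolding R_def by (elim conjE) (rule only)
  ultimately show ?thesis unfolding 1 by blast
qed

lemma coset_in_deg_filt_iff:
  assumes f: "f \<in> Pol {..<n}"
  shows "I +>\<^bsub>P\<^esub> f \<in> deg_filt n I i \<longleftrightarrow> mdeg (nf f) \<le> i"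
proof
  assume "I +>\<^bsub>P\<^esub> f \<in> deg_filt n I i"
  then obtain g where g: "g \<in> Pol {..<n}" "mdeg g \<le> i" "I +>\<^bsub>P\<^esub> f = I +>\<^bsub>P\<^esub> g"
    unfolding deg_filt_def by blast
  then have "nf f = nf g" by (intro nf_cong) (simp_all add: mpoly_coset_eq_iff[OF I_ideal])
  then show "mdeg (nf f) \<le> i" using supp_nf_degree[OF g(1)] g(2) unfolding mdeg_le_iff by metis
next
  assume "mdeg (nf f) \<le> i"
  moreover have "I +>\<^bsub>P\<^esub> f = I +>\<^bsub>P\<^esub> nf f" using nf_props(2)[OF f] by (simp add: mpoly_coset_eq_iff[OF I_ideal])
  ultimately show "I +>\<^bsub>P\<^esub> f \<in> deg_filt n I i" unfolding deg_filt_def using nf_in_Pol[OF f] by blast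
qed

lemma filt_ord_eq: "f \<in> Pol {..<n} \<Longrightarrow> filt_ord n I (I +>\<^bsub>P\<^esub> f) = mdeg (nf f)"
  unfolding filt_ord_def by (rule Least_equality) (simp_all add: coset_in_deg_filt_iff)

lemma mdeg_nf_le: "f \<in> Pol {..<n} \<Longrightarrow> mdeg (nf f) \<le> D"
  using nf_props(1) deg_le_D unfolding mdeg_le_iff by blast

lemma divisor_ri_eq:
  assumes f: "f \<in> Soc"
  shows "divisor_ri n I (I_plus f) = mdeg (nf f)"
proof -
  have fP: "f \<in> Pol {..<n}" and fI: "f \<notin> I" using f by (simp_all add: Soc_def)
  have nz: "mconst c * f \<in> I \<longleftrightarrow> c = 0" for c
  proof
    assume cf: "mconst c * f \<in> I"
    show "c = 0"
    proof (rule ccontr)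
      assume "c \<noteq> 0"
      then have "mconst (inverse c) * (mconst c * f) = f"
        unfolding mconst_def mterm_times_times by simp
      then show False using fI ID(6)[OF Pol_closed(6) cf, of "inverse c"] by metis
    qed
  qed (use ID(2) in \<open>simp add: mconst_def\<close>)
  have ord: "filt_ord n I (I +>\<^bsub>P\<^esub> (mconst c * f)) = mdeg (nf f)" if "c \<noteq> 0" for c
  proof -
    have "supp (mconst c * nf f) = supp (nf f)" using that by (auto simp: in_keys_iff coef_mconst_times)
    then show ?thesis using fP filt_ord_eq[of "mconst c * f"] by (simp add: nf_scale mdeg_def)
  qed
  have "(\<lambda>g. I +>\<^bsub>P\<^esub> g) ` I_plus f - {\<zero>\<^bsub>P Quot I\<^esub>} = {I +>\<^bsub>P\<^esub> (mconst c * f) | c. c \<noteq> 0}"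
  proof -
    have "I +>\<^bsub>P\<^esub> (mconst c * f) = I +>\<^bsub>P\<^esub> 0 \<longleftrightarrow> c = 0" for c
      using nz by (simp add: mpoly_coset_eq_iff[OF I_ideal])
    then show ?thesis unfolding I_plus_cosets quot_ops(4)[OF I_ideal] by blast
  qed
  then have "filt_ord n I ` ((\<lambda>g. I +>\<^bsub>P\<^esub> g) ` I_plus f - {\<zero>\<^bsub>P Quot I\<^esub>}) =
      {filt_ord n I (I +>\<^bsub>P\<^esub> (mconst c * f)) | c. c \<noteq> 0}" by auto
  also have "\<dots> = {mdeg (nf f)}" using ord by (auto intro: exI[of _ 1])
  finally show ?thesis unfolding divisor_ri_def by simp
qed

text \<open>
  A product with an indeterminate has degree \<open>D + 1\<close>, where the residue class ring is zero.
\<close>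

lemma top_term_Soc: "mterm (ts ! (length ts - 1)) 1 \<in> Soc"
proof -
  let ?t = "ts ! (length ts - 1)"
  have t: "?t \<in> terms n" using E(3) last_in_ts by blast
  have "nf (mterm ?t 1) = mterm ?t 1" by (rule nf_id) (use last_in_ts in simp)
  moreover have "mterm ?t (1 :: 'l) \<noteq> 0" by (metis lookup_single_eq lookup_zero zero_neq_one)
  ultimately have "mterm ?t 1 \<notin> I" using nf_eq_0_iff[of "mterm ?t 1"] t by simp
  moreover have "mvar r * mterm ?t 1 \<in> I" if "r < n" for r
    by (rule high_degree_in_I) (use t that in \<open>auto simp: mvar_def mult_single pp_deg_add D_def terms_add_iff split: if_splits\<close>)
  ultimately show ?thesis using t by (simp add: Soc_def)
qed

lemma reg_index_eq: "reg_index n I = D"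
proof -
  have all: "deg_filt n I j = carrier (P Quot I)" if "D \<le> j" for j
  proof
    show "deg_filt n I j \<subseteq> carrier (P Quot I)"
      unfolding deg_filt_def quot_ops(1)[OF I_ideal] by blast
    show "carrier (P Quot I) \<subseteq> deg_filt n I j"
      unfolding quot_ops(1)[OF I_ideal] using coset_in_deg_filt_iff mdeg_nf_le that by (meson image_subsetI order_trans)
  qed
  have "D \<le> j" if "deg_filt n I j = carrier (P Quot I)" for j
  proof -
    let ?t = "ts ! (length ts - 1)"
    have t: "?t \<in> terms n" using E(3) last_in_ts by blast
    have "I +>\<^bsub>P\<^esub> mterm ?t 1 \<in> deg_filt n I j" unfolding that quot_ops(1)[OF I_ideal] using t by simp
    then have "mdeg (nf (mterm ?t 1)) \<le> j" using coset_in_deg_filt_iff t by simp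
    moreover have "nf (mterm ?t 1) = mterm ?t 1" by (rule nf_id) (use last_in_ts in simp)
    ultimately show ?thesis by (simp add: mdeg_le_iff D_def)
  qed
  then show ?thesis unfolding reg_index_def using all by (intro Least_equality) auto
qed

text \<open>
  The minimal divisors are the ideals spanned over \<open>I\<close> by one socle element, so the separator degree is
  the least order of a socle element. It is at most \<open>D\<close>, with equality if and only if no socle element has
  smaller order.
\<close>

lemma cayley_bacharach_iff_Soc:
  "cayley_bacharach n I \<longleftrightarrow> (\<forall>f\<in>Soc. mdeg (nf f) = D)"
proof -
  let ?S = "(\<lambda>f. mdeg (nf f)) ` Soc"
  have SP: "f \<in> Pol {..<n}" if "f \<in> Soc" for f using that by (simp add: Soc_def)
  have "sepdeg n I {I} I = Min (divisor_ri n I ` I_plus ` Soc)"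
    by (simp add: sepdeg_def minimal_divisors_eq)
  also have "divisor_ri n I ` I_plus ` Soc = ?S"
    unfolding image_image using divisor_ri_eq by (intro image_cong) auto
  finally have sep: "sepdeg n I {I} I = Min ?S" .
  have fin: "finite ?S" by (rule finite_subset[of _ "{..D}"]) (use mdeg_nf_le SP in auto)
  have ne: "?S \<noteq> {}" using top_term_Soc by auto
  have "Min ?S = D \<longleftrightarrow> (\<forall>f\<in>Soc. mdeg (nf f) = D)"
  proof
    assume "Min ?S = D"
    then have "D \<le> mdeg (nf f)" if "f \<in> Soc" for f using Min_le[OF fin, of "mdeg (nf f)"] that by simp
    then show "\<forall>f\<in>Soc. mdeg (nf f) = D" using mdeg_nf_le SP by (simp add: le_antisym)
  next
    assume "\<forall>f\<in>Soc. mdeg (nf f) = D"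
    then have "?S = {D}" using top_term_Soc by auto
    then show "Min ?S = D" by simp
  qed
  then show ?thesis unfolding cayley_bacharach_def primary_decomposition_iff reg_index_eq by (simp add: sep)
qed

text \<open>
  A socle element of order less than \<open>D\<close> multiplies every term into something without component of
  degree \<open>D\<close>. Conversely, from such a multiplier one reaches the socle by multiplication with a term
  of maximal degree that does not annihilate it.
\<close>

lemma cayley_bacharach_iff_pairing:
  "cayley_bacharach n I \<longleftrightarrow>
   (\<forall>f. supp f \<subseteq> set ts \<longrightarrow>
     (\<forall>t\<in>set ts. \<forall>s\<in>set ts. pp_deg s = D \<longrightarrow> coef (nf (mterm t 1 * f)) s = 0) \<longrightarrow> f = 0)"
  unfolding cayley_bacharach_iff_Soc
proof (intro iffI allI impI ballI)
  fix f assume soc: "\<forall>f\<in>Soc. mdeg (nf f) = D" and f: "supp f \<subseteq> set ts"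
    and zero: "\<forall>t\<in>set ts. \<forall>s\<in>set ts. pp_deg s = D \<longrightarrow> coef (nf (mterm t 1 * f)) s = 0"
  have fP: "f \<in> Pol {..<n}" using f E(3) xring_iff by blast
  have zero': "coef (nf (g * f)) s = 0" if g: "g \<in> Pol {..<n}" and s: "s \<in> set ts" "pp_deg s = D" for g s
  proof -
    have ng: "supp (nf g) \<subseteq> set ts" by (rule nf_props(1)[OF g])
    have "f * (g - nf g) \<in> I" using ID(6)[OF fP nf_props(2)[OF g]] .
    then have "nf (g * f) = nf (nf g * f)"
      using fP nf_in_Pol[OF g] by (intro nf_cong) (simp_all add: algebra_simps)
    also have "nf g * f = (\<Sum>t\<in>supp (nf g). mconst (coef (nf g) t) * (mterm t 1 * f))"
    proof -
      have "(\<Sum>t\<in>supp (nf g). mconst (coef (nf g) t) * (mterm t 1 * f)) =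
          (\<Sum>t\<in>supp (nf g). mterm t (coef (nf g) t) * f)"
        by (simp only: mconst_def mterm_times_times add_0 mult_1_right)
      then show ?thesis by (simp flip: sum_distrib_right mpoly_eq_sum_mterm)
    qed
    also have "nf \<dots> = (\<Sum>t\<in>supp (nf g). mconst (coef (nf g) t) * nf (mterm t 1 * f))"
    proof -
      have "mterm t 1 * f \<in> Pol {..<n}" if "t \<in> supp (nf g)" for t
        using that ng E(3) fP by (intro Pol_closed(4) mterm_in_xring) auto
      then show ?thesis by (subst nf_sum) (auto simp: nf_scale)
    qed
    finally have "coef (nf (g * f)) s = (\<Sum>t\<in>supp (nf g). coef (nf g) t * coef (nf (mterm t 1 * f)) s)"
      by (simp add: lookup_sum coef_mconst_times)
    also have "\<dots> = 0" using zero s ng by (intro sum.neutral) auto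
    finally show ?thesis .
  qed
  show "f = 0"
  proof (rule ccontr)
    assume "f \<noteq> 0"
    then have fI: "f \<notin> I" using indep_modD[OF I_indep f] by blast
    let ?A = "{d. \<exists>u\<in>terms n. pp_deg u = d \<and> mterm u 1 * f \<notin> I}"
    have bound: "d \<le> D" if dA: "d \<in> ?A" for d
    proof (rule ccontr)
      assume "\<not> d \<le> D"
      moreover obtain u where u: "u \<in> terms n" "pp_deg u = d" "mterm u 1 * f \<notin> I" using dA by blast
      ultimately have "mterm u 1 \<in> I" by (intro high_degree_in_I) (auto split: if_splits)
      then have "f * mterm u 1 \<in> I" using ID(6) fP by blast
      then show False using u by (simp add: mult.commute)
    qed
    then have fin: "finite ?A" using finite_subset[of ?A "{..D}"] by blast
    have "mterm 0 1 * f \<notin> I" using fI by simp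
    then have "0 \<in> ?A" using terms_zero[of n] pp_deg_zero by blast
    then have "Max ?A \<in> ?A" using fin by (intro Max_in) auto
    then obtain u where u: "u \<in> terms n" "pp_deg u = Max ?A" "mterm u 1 * f \<notin> I" by blast
    let ?h = "mterm u 1 * f"
    have hP: "?h \<in> Pol {..<n}" using u fP by simp
    have "mvar r * ?h \<in> I" if r: "r < n" for r
    proof (rule ccontr)
      let ?u = "Poly_Mapping.single r 1 + u"
      assume "mvar r * ?h \<notin> I"
      moreover have "mvar r * ?h = mterm ?u 1 * f" by (simp add: mvar_def mterm_times_times)
      moreover have "?u \<in> terms n" using r u by (simp add: terms_add_iff)
      ultimately have "pp_deg ?u \<in> ?A" by auto
      then have "pp_deg ?u \<le> Max ?A" using fin by simp
      then show False using u(2) by (simp add: pp_deg_add)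
    qed
    then have "?h \<in> Soc" using hP u(3) by (simp add: Soc_def)
    then have "mdeg (nf ?h) = D" using soc by blast
    moreover have nz: "nf ?h \<noteq> 0" using nf_eq_0_iff[OF hP] u(3) by simp
    moreover have "mdeg (nf ?h) \<in> pp_deg ` supp (nf ?h)"
    proof -
      have "supp (nf ?h) \<noteq> {}" using nz by simp
      then have "mdeg (nf ?h) = Max (pp_deg ` supp (nf ?h))" by (simp add: mdeg_def)
      also have "\<dots> \<in> pp_deg ` supp (nf ?h)" using \<open>supp (nf ?h) \<noteq> {}\<close> by (intro Max_in) auto
      finally show ?thesis .
    qed
    ultimately obtain s where "s \<in> supp (nf ?h)" "pp_deg s = D" by auto
    then show False using zero'[of "mterm u 1" s] u(1) nf_props(1)[OF hP] by (auto simp: in_keys_iff)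
  qed
next
  fix f assume inj: "\<forall>f. supp f \<subseteq> set ts \<longrightarrow>
     (\<forall>t\<in>set ts. \<forall>s\<in>set ts. pp_deg s = D \<longrightarrow> coef (nf (mterm t 1 * f)) s = 0) \<longrightarrow> f = 0"
    and f: "f \<in> Soc"
  have fP: "f \<in> Pol {..<n}" and fI: "f \<notin> I" using f by (simp_all add: Soc_def)
  let ?f = "nf f"
  show "mdeg (nf f) = D"
  proof (rule ccontr)
    assume "mdeg (nf f) \<noteq> D"
    then have less: "mdeg ?f < D" using mdeg_nf_le[OF fP] by simp
    have "coef (nf (mterm t 1 * ?f)) s = 0" if t: "t \<in> set ts" and s: "s \<in> set ts" "pp_deg s = D" for t s
    proof -
      have tn: "t \<in> terms n" using t E(3) by blast
      have "mterm t 1 * (f - ?f) \<in> I" using ID(6)[OF _ nf_props(2)[OF fP], of "mterm t 1"] tn by simp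
      then have eq: "nf (mterm t 1 * f) = nf (mterm t 1 * ?f)"
        using tn nf_in_Pol[OF fP] by (intro nf_cong) (simp_all add: algebra_simps)
      show ?thesis
      proof (cases "t = 0")
        case True
        have "s \<notin> supp ?f" using less s mdeg_le_iff[of ?f "mdeg ?f"] by auto
        then show ?thesis using True nf_id[OF nf_props(1)[OF fP]] by (simp add: in_keys_iff)
      next
        case False
        then have "mterm t 1 \<in> M" using tn by (simp add: M_def lookup_single when_def)
        then have "mterm t 1 * f \<in> I" using Soc_M[OF f] by blast
        then show ?thesis using nf_eq_0_iff[of "mterm t 1 * f"] eq fP tn by simp
      qed
    qed
    then have "?f = 0" using inj nf_props(1)[OF fP] by blast
    then show False using nf_eq_0_iff[OF fP] fI by simp
  qed
qed

end

section \<open>Points and ideals of the coordinate ring\<close>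

abbreviation (input) cvars :: "nat pp list \<Rightarrow> nat pp list \<Rightarrow> (nat \<times> nat) set" where
  "cvars ts bs \<equiv> {..<length ts} \<times> {..<length bs}"

abbreviation ev :: "('k \<Rightarrow> 'l) \<Rightarrow> 'l mat \<Rightarrow> (nat \<times> nat, 'k::comm_ring_1) mpoly \<Rightarrow> 'l::comm_ring_1" where
  "ev \<iota> \<Gamma> \<equiv> mpoly_eval \<iota> (\<lambda>ij. \<Gamma> $$ ij)"

lemma zero_locus_Idl:
  fixes \<iota> :: "'k::Fields.field \<Rightarrow> 'l::Fields.field"
  assumes \<iota>: "comm_ring_hom \<iota>" and S: "S \<subseteq> Pol (cvars ts bs)"
  shows "\<Gamma> \<in> zero_locus \<iota> ts bs (Idl\<^bsub>cring_of ts bs\<^esub> S) \<longleftrightarrow>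
    \<Gamma> \<in> carrier_mat (length ts) (length bs) \<and> (\<forall>f\<in>S. ev \<iota> \<Gamma> f = 0)"
proof -
  interpret e: comm_ring_hom "ev \<iota> \<Gamma>" by (rule mpoly_eval_hom[OF \<iota>])
  let ?N = "{f \<in> Pol (cvars ts bs). ev \<iota> \<Gamma> f = 0}"
  have "ideal ?N (cring_of ts bs)"
    by (rule ideal_mpolyI) (auto simp: e.hom_add e.hom_mult)
  then have "(\<forall>f\<in>S. ev \<iota> \<Gamma> f = 0) \<Longrightarrow> Idl\<^bsub>cring_of ts bs\<^esub> S \<subseteq> ?N"
    using S by (intro Idl_mpoly(3)[OF S]) auto
  then show ?thesis unfolding zero_locus_def using Idl_mpoly(2)[OF S] by blast
qed

lemma zero_locus_carrier: "\<Gamma> \<in> zero_locus \<iota> ts bs S \<Longrightarrow> \<Gamma> \<in> carrier_mat (length ts) (length bs)"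
  unfolding zero_locus_def by blast

subsection \<open>Matrices with entries in a polynomial ring\<close>

definition mat_Pol :: "'v set \<Rightarrow> ('v, 'k::comm_ring_1) mpoly mat \<Rightarrow> bool" where
  "mat_Pol V A \<longleftrightarrow> (\<forall>i<dim_row A. \<forall>j<dim_col A. A $$ (i, j) \<in> Pol V)"

lemma mat_Pol_iff: "mat_Pol V A \<longleftrightarrow> map_mat (restrict_vars V) A = A"
proof
  assume "map_mat (restrict_vars V) A = A"
  then have "A $$ (i, j) = restrict_vars V (A $$ (i, j))" if "i < dim_row A" "j < dim_col A" for i j
    using that by (metis index_map_mat(1))
  then show "mat_Pol V A" unfolding mat_Pol_def using restrict_vars_in_Pol by metis
next
  assume "mat_Pol V A"
  then show "map_mat (restrict_vars V) A = A"
    unfolding mat_Pol_def by (intro eq_matI) (auto simp: restrict_vars_eq_iff)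
qed

lemma det_in_Pol: "mat_Pol V A \<Longrightarrow> det A \<in> Pol V"
proof -
  interpret r: comm_ring_hom "restrict_vars V" by (rule restrict_vars_hom)
  assume "mat_Pol V A"
  then have "det A = restrict_vars V (det A)" unfolding mat_Pol_iff using r.hom_det[of A] by simp
  then show ?thesis using restrict_vars_in_Pol by metis
qed

lemma minors_in_Pol: "mat_Pol V A \<Longrightarrow> minors k A \<subseteq> Pol V"
  unfolding mat_Pol_iff
  by (metis (no_types, lifting) image_subsetI minors_map_mat restrict_vars_hom restrict_vars_in_Pol)

lemma gen_mult_mat_Pol:
  assumes "enum_order_ideal n ts bs" "r < n"
  shows "mat_Pol (cvars ts bs) (gen_mult_mat ts bs r :: (nat \<times> nat, 'k::comm_ring_1) mpoly mat)"
  unfolding mat_Pol_def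
proof (intro allI impI)
  note E = enum_order_idealD[OF assms(1)]
  fix i k assume "i < dim_row (gen_mult_mat ts bs r :: (nat \<times> nat, 'k) mpoly mat)"
    "k < dim_col (gen_mult_mat ts bs r :: (nat \<times> nat, 'k) mpoly mat)"
  then have ik: "i < length ts" "k < length ts" by simp_all
  let ?t = "Poly_Mapping.single r 1 + ts ! k"
  show "gen_mult_mat ts bs r $$ (i, k) \<in> Pol (cvars ts bs)"
  proof (cases "?t \<in> set ts")
    case True
    then show ?thesis using ik by (simp add: gen_mult_mat_def Let_def)
  next
    case False
    then have "?t \<in> set bs" using E(9)[OF assms(2), of "ts ! k"] ik by auto
    then obtain m where m: "m < length bs" "bs ! m = ?t" by (auto simp: in_set_conv_nth)
    then have "(THE m. m < length bs \<and> bs ! m = ?t) = m" using the_index[OF E(6) m(1)] by simp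
    then show ?thesis using ik m False by (simp add: gen_mult_mat_def Let_def)
  qed
qed

lemma eval_term_Pol:
  fixes A :: "nat \<Rightarrow> ('v, 'k::comm_ring_1) mpoly mat"
  assumes "\<And>r. r < n \<Longrightarrow> A r \<in> carrier_mat \<mu> \<mu>" "\<And>r. r < n \<Longrightarrow> mat_Pol V (A r)"
  shows "mat_Pol V (eval_term \<mu> n A t)"
  using map_mat_eval_term[OF restrict_vars_hom, of n A \<mu> V A] assms unfolding mat_Pol_iff by blast

lemma coord_mat_dim [simp]:
  "coord_mat n ts bs us \<in> carrier_mat (length ts) (length us)"
  "dim_row (coord_mat n ts bs us) = length ts" "dim_col (coord_mat n ts bs us) = length us"
  by (auto simp: coord_mat_def intro: carrier_matI)

lemma gen_eval_term_carrier:
  "eval_term (length ts) n (gen_mult_mat ts bs) u \<in> carrier_mat (length ts) (length ts)"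
  by (rule eval_term_carrier) simp

lemma gen_eval_term_dim [simp]:
  "dim_row (eval_term (length ts) n (gen_mult_mat ts bs) u) = length ts"
  "dim_col (eval_term (length ts) n (gen_mult_mat ts bs) u) = length ts"
  using gen_eval_term_carrier[of ts n bs u] by auto

lemma coord_mat_entry:
  assumes "length ts > 0" "i < length ts" "j < length us"
  shows "coord_mat n ts bs us $$ (i, j) = eval_term (length ts) n (gen_mult_mat ts bs) (us ! j) $$ (i, 0)"
  using assms unfolding coord_mat_def mat_of_cols_def by simp

lemma coord_mat_Pol:
  assumes enum: "enum_order_ideal n ts bs"
  shows "mat_Pol (cvars ts bs) (coord_mat n ts bs us :: (nat \<times> nat, 'k::comm_ring_1) mpoly mat)"
  unfolding mat_Pol_def
proof (intro allI impI)
  fix i j assume "i < dim_row (coord_mat n ts bs us :: (nat \<times> nat, 'k) mpoly mat)"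
    "j < dim_col (coord_mat n ts bs us :: (nat \<times> nat, 'k) mpoly mat)"
  then have ij: "i < length ts" "j < length us" by simp_all
  have "mat_Pol (cvars ts bs) (eval_term (length ts) n (gen_mult_mat ts bs) (us ! j) :: (nat \<times> nat, 'k) mpoly mat)"
    by (rule eval_term_Pol) (simp_all add: gen_mult_mat_Pol[OF enum])
  then have "eval_term (length ts) n (gen_mult_mat ts bs) (us ! j) $$ (i, 0) \<in> (Pol (cvars ts bs) :: (nat \<times> nat, 'k) mpoly set)"
    using ij(1) enum_order_idealD(1)[OF enum] unfolding mat_Pol_def gen_eval_term_dim by blast
  then show "(coord_mat n ts bs us $$ (i, j) :: (nat \<times> nat, 'k) mpoly) \<in> Pol (cvars ts bs)"
    unfolding coord_mat_entry[OF enum_order_idealD(1)[OF enum] ij] .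
qed

lemma ev_eval_term:
  assumes "comm_ring_hom \<iota>"
  shows "map_mat (ev \<iota> \<Gamma>) (eval_term (length ts) n (gen_mult_mat ts bs) t) =
    eval_term (length ts) n (pt_mat ts bs \<Gamma>) t"
  by (rule map_mat_eval_term[OF mpoly_eval_hom[OF assms]]) (simp_all add: eval_gen_mult_mat[OF assms])

lemma ev_coord_mat_entry:
  assumes "comm_ring_hom \<iota>" "length ts > 0" "i < length ts" "j < length us"
  shows "ev \<iota> \<Gamma> (coord_mat n ts bs us $$ (i, j)) = eval_term (length ts) n (pt_mat ts bs \<Gamma>) (us ! j) $$ (i, 0)"
  using assms(2-)
  by (simp add: coord_mat_entry flip: ev_eval_term[OF assms(1)])

subsection \<open>The ideal of the border basis scheme\<close>

lemma ideal_BO_generators_Pol: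
  assumes enum: "enum_order_ideal n ts bs"
  shows "{(gen_mult_mat ts bs r * gen_mult_mat ts bs s - gen_mult_mat ts bs s * gen_mult_mat ts bs r)
        $$ (i, j) | r s i j. r < n \<and> s < n \<and> i < length ts \<and> j < length ts} \<subseteq>
    (Pol (cvars ts bs) :: (nat \<times> nat, 'k::comm_ring_1) mpoly set)"
proof clarify
  fix r s i j assume *: "r < n" "s < n" "i < length ts" "j < length ts"
  let ?A = "\<lambda>r. gen_mult_mat ts bs r :: (nat \<times> nat, 'k) mpoly mat"
  interpret h: comm_ring_hom "restrict_vars (cvars ts bs) :: (nat \<times> nat, 'k) mpoly \<Rightarrow> _" by (rule restrict_vars_hom)
  have "restrict_vars (cvars ts bs) ((?A r * ?A s) $$ (i, j)) = (?A r * ?A s) $$ (i, j)"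
    if "r < n" "s < n" for r s
  proof -
    have "map_mat (restrict_vars (cvars ts bs)) (?A r * ?A s) = ?A r * ?A s"
      using gen_mult_mat_Pol[OF enum, where ?'k = 'k] that unfolding mat_Pol_iff
      by (subst h.mat_hom_mult[of _ "length ts" "length ts" _ "length ts"]) simp_all
    then show ?thesis using *(3,4) by (metis index_map_mat(1) index_mult_mat(2,3) gen_mult_mat_dim(2,3))
  qed
  then have "(?A r * ?A s) $$ (i, j) \<in> Pol (cvars ts bs)" "(?A s * ?A r) $$ (i, j) \<in> Pol (cvars ts bs)"
    using * restrict_vars_eq_iff by blast+
  then show "(?A r * ?A s - ?A s * ?A r) $$ (i, j) \<in> Pol (cvars ts bs)" using * by simp
qed

lemma ideal_BO_Pol:
  "enum_order_ideal n ts bs \<Longrightarrow> ideal_BO n ts bs \<subseteq> (Pol (cvars ts bs) :: (nat \<times> nat, 'k::Fields.field) mpoly set)"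
  unfolding ideal_BO_def by (rule ideal_mpolyD(1)[OF Idl_mpoly(1)[OF ideal_BO_generators_Pol]])

lemma zero_locus_BO_iff:
  fixes \<iota> :: "'k::Fields.field \<Rightarrow> 'l::Fields.field"
  assumes \<iota>: "comm_ring_hom \<iota>" and enum: "enum_order_ideal n ts bs"
  shows "\<Gamma> \<in> zero_locus \<iota> ts bs (ideal_BO n ts bs) \<longleftrightarrow>
    \<Gamma> \<in> carrier_mat (length ts) (length bs) \<and> mats_commute n ts bs \<Gamma>"
proof -
  interpret e: comm_ring_hom "ev \<iota> \<Gamma>" by (rule mpoly_eval_hom[OF \<iota>])
  let ?A = "\<lambda>r. gen_mult_mat ts bs r :: (nat \<times> nat, 'k) mpoly mat" and ?\<mu> = "length ts"
  have prod: "ev \<iota> \<Gamma> ((?A r * ?A s) $$ (i, j)) = (pt_mat ts bs \<Gamma> r * pt_mat ts bs \<Gamma> s) $$ (i, j)"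
    if "i < ?\<mu>" "j < ?\<mu>" for r s i j
  proof -
    have "map_mat (ev \<iota> \<Gamma>) (?A r * ?A s) = pt_mat ts bs \<Gamma> r * pt_mat ts bs \<Gamma> s"
      by (subst e.mat_hom_mult[of _ ?\<mu> ?\<mu> _ ?\<mu>]) (simp_all add: eval_gen_mult_mat[OF \<iota>])
    then show ?thesis using that by (metis index_map_mat(1) index_mult_mat(2,3) gen_mult_mat_dim(2,3))
  qed
  have diff: "ev \<iota> \<Gamma> ((?A r * ?A s - ?A s * ?A r) $$ (i, j)) =
      (pt_mat ts bs \<Gamma> r * pt_mat ts bs \<Gamma> s) $$ (i, j) - (pt_mat ts bs \<Gamma> s * pt_mat ts bs \<Gamma> r) $$ (i, j)"
    if "i < ?\<mu>" "j < ?\<mu>" for r s i j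
  proof -
    have "(?A r * ?A s - ?A s * ?A r) $$ (i, j) = (?A r * ?A s) $$ (i, j) - (?A s * ?A r) $$ (i, j)"
      using that by simp
    then show ?thesis using prod[OF that] by (simp only: e.hom_minus)
  qed
  have "(\<forall>f\<in>{(?A r * ?A s - ?A s * ?A r) $$ (i, j) | r s i j. r < n \<and> s < n \<and> i < ?\<mu> \<and> j < ?\<mu>}. ev \<iota> \<Gamma> f = 0)
    \<longleftrightarrow> (\<forall>r<n. \<forall>s<n. \<forall>i<?\<mu>. \<forall>j<?\<mu>. ev \<iota> \<Gamma> ((?A r * ?A s - ?A s * ?A r) $$ (i, j)) = 0)"
    by blast
  also have "\<dots> \<longleftrightarrow> (\<forall>r<n. \<forall>s<n. \<forall>i<?\<mu>. \<forall>j<?\<mu>.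
      (pt_mat ts bs \<Gamma> r * pt_mat ts bs \<Gamma> s) $$ (i, j) = (pt_mat ts bs \<Gamma> s * pt_mat ts bs \<Gamma> r) $$ (i, j))"
    using diff by simp
  also have "\<dots> \<longleftrightarrow> mats_commute n ts bs \<Gamma>"
    unfolding mats_commute_def mat_eq_iff by simp
  finally show ?thesis
    unfolding ideal_BO_def zero_locus_Idl[OF \<iota> ideal_BO_generators_Pol[OF enum]] by simp
qed

subsection \<open>Minors of coordinate matrices and the Hilbert function\<close>

text \<open>
  The first column of \<open>u(A\<^sub>1,\<dots>,A\<^sub>n)\<close> is the coordinate vector of the residue class of \<open>u\<close>.
\<close>

lemma cols_indep_coord_mat:
  fixes \<iota> :: "'k::Fields.field \<Rightarrow> 'l::Fields.field"
  assumes \<iota>: "comm_ring_hom \<iota>" and enum: "enum_order_ideal n ts bs" and comm: "mats_commute n ts bs \<Gamma>"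
    and us: "distinct us" "set us \<subseteq> terms n" and J: "J \<subseteq> {..<length us}"
  shows "cols_indep (map_mat (ev \<iota> \<Gamma>) (coord_mat n ts bs us)) {..<length ts} J \<longleftrightarrow>
    indep_mod (point_ideal n ts bs \<Gamma>) ((!) us ` J)"
proof -
  note E = enum_order_idealD[OF enum]
  let ?A = "map_mat (ev \<iota> \<Gamma>) (coord_mat n ts bs us)"
  let ?M = "eval_term (length ts) n (pt_mat ts bs \<Gamma>)" and ?I = "point_ideal n ts bs \<Gamma>"
  have A: "?A $$ (i, j) = ?M (us ! j) $$ (i, 0)" if "i < length ts" "j \<in> J" for i j
    using that J E(1) by (auto simp: ev_coord_mat_entry[OF \<iota> E(1)])
  have inj: "inj_on ((!) us) J" using us(1) J by (auto simp: inj_on_def nth_eq_iff_index_eq subset_iff)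
  have fin: "finite J" using J finite_subset by blast
  have "(!) us ` J \<subseteq> set us" using J nth_mem[of _ us] by auto
  with us(2) have UT: "(!) us ` J \<subseteq> terms n" by blast
  show ?thesis
  proof
    assume ind: "cols_indep ?A {..<length ts} J"
    show "indep_mod ?I ((!) us ` J)" unfolding indep_mod_def
    proof (intro allI impI)
      fix f assume f: "supp f \<subseteq> (!) us ` J \<and> f \<in> ?I"
      have "(\<Sum>j\<in>J. ?A $$ (i, j) * coef f (us ! j)) = 0" if i: "i < length ts" for i
      proof -
        have "0 = lext (\<lambda>t. ?M t $$ (i, 0)) f" using f i point_ideal_iff[OF enum comm] by simp
        also have "\<dots> = (\<Sum>t\<in>(!) us ` J. coef f t * ?M t $$ (i, 0))"
          using f fin by (intro lext_superset) auto
        also have "\<dots> = (\<Sum>j\<in>J. ?A $$ (i, j) * coef f (us ! j))"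
          using inj A[OF i] by (subst sum.reindex) (auto simp: mult.commute intro!: sum.cong)
        finally show ?thesis by simp
      qed
      then have "\<forall>j\<in>J. coef f (us ! j) = 0"
        using ind[unfolded cols_indep_def, THEN spec, of "\<lambda>j. coef f (us ! j)"] by simp
      then have "coef f t = 0" for t using f by (cases "t \<in> (!) us ` J") (auto simp: in_keys_iff)
      then show "f = 0" by (simp add: poly_mapping_eqI)
    qed
  next
    assume ind: "indep_mod ?I ((!) us ` J)"
    show "cols_indep ?A {..<length ts} J" unfolding cols_indep_def
    proof (intro allI impI)
      fix v assume v: "\<forall>i\<in>{..<length ts}. (\<Sum>j\<in>J. ?A $$ (i, j) * v j) = 0"
      let ?f = "\<Sum>j\<in>J. mterm (us ! j) (v j)"
      have "lext (\<lambda>t. ?M t $$ (i, 0)) ?f = 0" if i: "i < length ts" for i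
      proof -
        have "lext (\<lambda>t. ?M t $$ (i, 0)) ?f = (\<Sum>j\<in>J. ?A $$ (i, j) * v j)"
          using A[OF i] by (simp add: lext_sum mult.commute)
        then show ?thesis using v i by simp
      qed
      moreover have "?f \<in> carrier (xring n)" using UT by (intro Pol_sum mterm_in_xring) auto
      ultimately have "?f \<in> ?I" using point_ideal_iff[OF enum comm] by blast
      moreover have "supp ?f \<subseteq> (!) us ` J" by (intro supp_sum_subset) auto
      ultimately have f0: "?f = 0" using indep_modD[OF ind] by blast
      show "\<forall>j\<in>J. v j = 0"
      proof
        fix j assume j: "j \<in> J"
        have "coef ?f (us ! j) = (\<Sum>k\<in>J. if k = j then v k else 0)"
          unfolding lookup_sum using inj j
          by (intro sum.cong refl) (auto simp: lookup_single when_def inj_on_eq_iff)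
        then show "v j = 0" using f0 j fin by simp
      qed
    qed
  qed
qed

abbreviation (input) terms_upto :: "nat \<Rightarrow> nat \<Rightarrow> nat pp list" where
  "terms_upto n i \<equiv> sorted_list_of_set {u \<in> terms n. pp_deg u \<le> i}"

text \<open>
  The rank of the matrix of the coordinate vectors of all terms of degree at most \<open>i\<close> is the dimension of
  the \<open>i\<close>-th part of the filtration. Large Hilbert functions are thus an open condition.
\<close>

lemma nonzero_coord_minor_iff:
  fixes \<iota> :: "'k::Fields.field \<Rightarrow> 'l::Fields.field"
  assumes \<iota>: "comm_ring_hom \<iota>" and enum: "enum_order_ideal n ts bs" and comm: "mats_commute n ts bs \<Gamma>"
  shows "(\<exists>m\<in>minors k (coord_mat n ts bs (terms_upto n i)). ev \<iota> \<Gamma> m \<noteq> 0) \<longleftrightarrow>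
    k \<le> affine_HF n (point_ideal n ts bs \<Gamma>) i"
proof -
  note E = enum_order_idealD[OF enum]
  define us where "us = terms_upto n i"
  let ?I = "point_ideal n ts bs \<Gamma>"
  let ?A = "map_mat (ev \<iota> \<Gamma>) (coord_mat n ts bs us)"
  have us: "distinct us" "set us = {u \<in> terms n. pp_deg u \<le> i}"
    using finite_terms_le[of n i] by (simp_all add: us_def)
  have I: "ideal ?I (xring n)" by (rule point_ideal_props(1)[OF enum])
  have "0 \<in> set ts" using E(1,2) nth_mem[of 0 ts] by simp
  then have 1: "1 \<notin> ?I" using one_notin_of_indep[OF point_ideal_indep[OF enum comm]] by blast
  have "(\<exists>m\<in>minors k (coord_mat n ts bs us). ev \<iota> \<Gamma> m \<noteq> 0) \<longleftrightarrow> (\<exists>m\<in>minors k ?A. m \<noteq> 0)"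
    unfolding minors_map_mat[OF mpoly_eval_hom[OF \<iota>]] by blast
  also have "\<dots> \<longleftrightarrow> (\<exists>J\<subseteq>{..<length us}. card J = k \<and> cols_indep ?A {..<length ts} J)"
    unfolding nonzero_minor_iff by simp
  also have "\<dots> \<longleftrightarrow> (\<exists>J\<subseteq>{..<length us}. card J = k \<and> indep_mod ?I ((!) us ` J))"
  proof -
    have "set us \<subseteq> terms n" using us(2) by blast
    then show ?thesis using cols_indep_coord_mat[OF \<iota> enum comm us(1)] by (metis (no_types, lifting))
  qed
  also have "\<dots> \<longleftrightarrow> k \<le> affine_HF n ?I i"
  proof
    assume "\<exists>J\<subseteq>{..<length us}. card J = k \<and> indep_mod ?I ((!) us ` J)"
    then obtain J where J: "J \<subseteq> {..<length us}" "card J = k" "indep_mod ?I ((!) us ` J)" by blast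
    have "inj_on ((!) us) J" using J(1) by (intro inj_on_nth[OF us(1)]) auto
    then have "card ((!) us ` J) = k" using J(2) by (simp add: card_image)
    moreover have "(!) us ` J \<subseteq> {u \<in> terms n. pp_deg u \<le> i}"
    proof
      fix u assume "u \<in> (!) us ` J"
      then have "u \<in> set us" using J(1) by auto
      then show "u \<in> {u \<in> terms n. pp_deg u \<le> i}" by (simp only: us(2))
    qed
    ultimately show "k \<le> affine_HF n ?I i" using card_indep_le_affine_HF[OF I 1 J(3)] by simp
  next
    assume "k \<le> affine_HF n ?I i"
    then have "k \<le> card {t\<in>std_terms n ?I. pp_deg t \<le> i}" by (simp add: affine_HF_std_terms[OF I 1])
    then obtain U where U: "U \<subseteq> {t\<in>std_terms n ?I. pp_deg t \<le> i}" "card U = k" "finite U"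
      by (rule obtain_subset_with_card_n)
    let ?J = "{j. j < length us \<and> us ! j \<in> U}"
    have UT: "U \<subseteq> set us" using U(1) unfolding us(2) std_terms_def by auto
    have im: "(!) us ` ?J = U"
    proof
      show "U \<subseteq> (!) us ` ?J"
      proof
        fix u assume u: "u \<in> U"
        then have "u \<in> set us" using UT by blast
        then obtain j where "j < length us" "us ! j = u" by (auto simp: in_set_conv_nth)
        then show "u \<in> (!) us ` ?J" using u by blast
      qed
    qed blast
    moreover have "inj_on ((!) us) ?J" by (intro inj_on_nth[OF us(1)]) auto
    then have "card ((!) us ` ?J) = card ?J" by (rule card_image)
    ultimately have "card ?J = k" using U(2) by simp
    moreover have "indep_mod ?I ((!) us ` ?J)"
      unfolding im using U(1) by (intro indep_mod_mono[OF std_terms_indep]) auto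
    ultimately show "\<exists>J\<subseteq>{..<length us}. card J = k \<and> indep_mod ?I ((!) us ` J)" by (intro exI[of _ ?J]) auto
  qed
  finally show ?thesis unfolding us_def .
qed

section \<open>Change of the order ideal\<close>

lemma comb_delta_nonzero_iff:
  fixes \<iota> :: "'k::Fields.field \<Rightarrow> 'l::Fields.field"
  assumes \<iota>: "comm_ring_hom \<iota>" and enum: "enum_order_ideal n ts bs" and comm: "mats_commute n ts bs \<Gamma>"
    and us: "distinct us" "set us \<subseteq> terms n" "length us = length ts"
  shows "ev \<iota> \<Gamma> (comb_delta n ts bs us) \<noteq> 0 \<longleftrightarrow> indep_mod (point_ideal n ts bs \<Gamma>) (set us)"
proof -
  interpret e: comm_ring_hom "ev \<iota> \<Gamma>" by (rule mpoly_eval_hom[OF \<iota>])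
  let ?A = "map_mat (ev \<iota> \<Gamma>) (coord_mat n ts bs us)"
  have A: "?A \<in> carrier_mat (length ts) (length ts)" using us(3) by (intro carrier_matI) simp_all
  have "ev \<iota> \<Gamma> (comb_delta n ts bs us) = det ?A" by (simp add: comb_delta_def)
  moreover have "(!) us ` {..<length ts} = set us" unfolding us(3)[symmetric] by (auto simp: in_set_conv_nth)
  ultimately show ?thesis
    using det_nonzero_iff_cols_indep[OF A] cols_indep_coord_mat[OF \<iota> enum comm us(1,2), of "{..<length ts}"] us(3)
    by simp
qed

text \<open>
  The coordinates of the same scheme with respect to the order ideal \<open>ts'\<close>, meaningful only where
  \<open>\<delta>\<close> does not vanish.
\<close>

definition comb_point ::
    "('k::Fields.field \<Rightarrow> 'l::Fields.field) \<Rightarrow> nat \<Rightarrow> nat pp list \<Rightarrow> nat pp list \<Rightarrow>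
     nat pp list \<Rightarrow> nat pp list \<Rightarrow> 'l mat \<Rightarrow> 'l mat"
where
  "comb_point \<iota> n ts bs ts' bs' \<Gamma> = mat (length ts') (length bs')
     (\<lambda>ij. ev \<iota> \<Gamma> (comb_p n ts bs ts' bs' ij :: (nat \<times> nat, 'k) mpoly)
       / ev \<iota> \<Gamma> (comb_delta n ts bs ts' :: (nat \<times> nat, 'k) mpoly))"

lemma mult_mat_vec_index:
  fixes A :: "'a::comm_ring_1 mat"
  assumes "A \<in> carrier_mat m k" "v \<in> carrier_vec k" "i < m"
  shows "(A *\<^sub>v v) $ i = (\<Sum>j<k. A $$ (i, j) * v $ j)"
  using assms by (simp add: scalar_prod_def atLeast0LessThan)

lemma smult_one_mat_mult_vec:
  fixes w :: "'a::comm_ring_1 vec"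
  assumes "w \<in> carrier_vec m"
  shows "(c \<cdot>\<^sub>m 1\<^sub>m m) *\<^sub>v w = c \<cdot>\<^sub>v w"
proof (rule eq_vecI)
  fix i assume "i < dim_vec (c \<cdot>\<^sub>v w)"
  then have i: "i < m" using assms by simp
  have "((c \<cdot>\<^sub>m 1\<^sub>m m) *\<^sub>v w) $ i = (\<Sum>j<m. c * (if j = i then 1 else 0) * w $ j)"
    using i assms by (simp add: scalar_prod_def atLeast0LessThan)
  also have "\<dots> = (\<Sum>j<m. if j = i then c * w $ j else 0)" by (intro sum.cong) auto
  finally show "((c \<cdot>\<^sub>m 1\<^sub>m m) *\<^sub>v w) $ i = (c \<cdot>\<^sub>v w) $ i" using i assms by simp
qed (use assms in simp)

text \<open>Cramer's rule: the entries \<open>p\<^sub>\<kappa>\<^sub>\<lambda>\<close> are the coordinates of the border terms, multiplied by \<open>\<delta>\<close>.\<close>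

lemma comb_p_cramer:
  assumes l: "length ts' = length ts" and i: "i < length ts"
  shows "(\<Sum>\<kappa><length ts. coord_mat n ts bs ts' $$ (i, \<kappa>) * comb_p n ts bs ts' bs' (\<kappa>, j)) =
    (comb_delta n ts bs ts' :: (nat \<times> nat, 'k::comm_ring_1) mpoly) *
      col (eval_term (length ts) n (gen_mult_mat ts bs) (bs' ! j)) 0 $ i"
proof -
  let ?C = "coord_mat n ts bs ts' :: (nat \<times> nat, 'k) mpoly mat" and ?\<mu> = "length ts"
  let ?w = "col (eval_term ?\<mu> n (gen_mult_mat ts bs) (bs' ! j)) 0 :: (nat \<times> nat, 'k) mpoly vec"
  have C: "?C \<in> carrier_mat ?\<mu> ?\<mu>" using l coord_mat_dim(1)[of n ts bs ts'] by simp
  have w: "?w \<in> carrier_vec ?\<mu>" by (intro carrier_vecI) simp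
  note adj = adj_mat[OF C]
  have "?C *\<^sub>v (adj_mat ?C *\<^sub>v ?w) = (det ?C \<cdot>\<^sub>m 1\<^sub>m ?\<mu>) *\<^sub>v ?w"
    using assoc_mult_mat_vec[OF C adj(1) w] adj(2) by simp
  also have "\<dots> = det ?C \<cdot>\<^sub>v ?w"
    by (rule smult_one_mat_mult_vec[OF w])
  finally have eq: "?C *\<^sub>v (adj_mat ?C *\<^sub>v ?w) = det ?C \<cdot>\<^sub>v ?w" .
  have "adj_mat ?C *\<^sub>v ?w \<in> carrier_vec ?\<mu>" by (rule mult_mat_vec_carrier[OF adj(1) w])
  then have "(?C *\<^sub>v (adj_mat ?C *\<^sub>v ?w)) $ i = (\<Sum>\<kappa><?\<mu>. ?C $$ (i, \<kappa>) * (adj_mat ?C *\<^sub>v ?w) $ \<kappa>)"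
    by (rule mult_mat_vec_index[OF C _ i])
  then show ?thesis using i w unfolding eq by (simp add: comb_p_def comb_delta_def)
qed

text \<open>
  By Cramer's rule the border polynomials of the new point lie in the ideal of the old one, and the new
  order ideal is independent modulo that ideal because \<open>\<delta>\<close> does not vanish.
\<close>

lemma comb_point_represents:
  fixes \<iota> :: "'k::Fields.field \<Rightarrow> 'l::Fields.field"
  assumes \<iota>: "comm_ring_hom \<iota>" and enum: "enum_order_ideal n ts bs" and comm: "mats_commute n ts bs \<Gamma>"
    and enum': "enum_order_ideal n ts' bs'" and len: "length ts' = length ts"
    and delta: "ev \<iota> \<Gamma> (comb_delta n ts bs ts') \<noteq> 0"
  shows "mats_commute n ts' bs' (comb_point \<iota> n ts bs ts' bs' \<Gamma>)"
    "point_ideal n ts' bs' (comb_point \<iota> n ts bs ts' bs' \<Gamma>) = point_ideal n ts bs \<Gamma>"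
proof -
  interpret e: comm_ring_hom "ev \<iota> \<Gamma>" by (rule mpoly_eval_hom[OF \<iota>])
  note E = enum_order_idealD[OF enum] and E' = enum_order_idealD[OF enum']
  let ?I = "point_ideal n ts bs \<Gamma>" and ?\<Gamma>' = "comb_point \<iota> n ts bs ts' bs' \<Gamma>" and ?\<mu> = "length ts"
  let ?M = "eval_term ?\<mu> n (pt_mat ts bs \<Gamma>)"
  let ?d = "ev \<iota> \<Gamma> (comb_delta n ts bs ts')"
  have "border_poly ts' bs' ?\<Gamma>' j \<in> ?I" if j: "j < length bs'" for j
  proof -
    have "lext (\<lambda>t. ?M t $$ (i, 0)) (border_poly ts' bs' ?\<Gamma>' j) = 0" if i: "i < ?\<mu>" for i
    proof -
      have "(\<Sum>\<kappa><?\<mu>. ?M (ts' ! \<kappa>) $$ (i, 0) * ev \<iota> \<Gamma> (comb_p n ts bs ts' bs' (\<kappa>, j))) = ?d * ?M (bs' ! j) $$ (i, 0)"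
      proof -
        have "ev \<iota> \<Gamma> (\<Sum>\<kappa><?\<mu>. coord_mat n ts bs ts' $$ (i, \<kappa>) * comb_p n ts bs ts' bs' (\<kappa>, j)) =
            (\<Sum>\<kappa><?\<mu>. ?M (ts' ! \<kappa>) $$ (i, 0) * ev \<iota> \<Gamma> (comb_p n ts bs ts' bs' (\<kappa>, j)))"
          using i len by (simp add: e.hom_sum e.hom_mult ev_coord_mat_entry[OF \<iota> E(1)])
        moreover have "ev \<iota> \<Gamma> (col (eval_term ?\<mu> n (gen_mult_mat ts bs) (bs' ! j)) 0 $ i) = ?M (bs' ! j) $$ (i, 0)"
          using i E(1)
          by (simp flip: ev_eval_term[OF \<iota>])
        ultimately show ?thesis unfolding comb_p_cramer[OF len i] by (simp add: e.hom_mult)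
      qed
      then have "(\<Sum>\<kappa><?\<mu>. ?M (ts' ! \<kappa>) $$ (i, 0) * (ev \<iota> \<Gamma> (comb_p n ts bs ts' bs' (\<kappa>, j)) / ?d)) = ?M (bs' ! j) $$ (i, 0)"
        using delta by (simp add: sum_divide_distrib[symmetric])
      moreover have "?\<Gamma>' $$ (\<kappa>, j) = ev \<iota> \<Gamma> (comb_p n ts bs ts' bs' (\<kappa>, j)) / ?d" if "\<kappa> < ?\<mu>" for \<kappa>
        using that j len by (simp add: comb_point_def)
      ultimately show ?thesis
        using len by (simp add: border_poly_def lext_diff lext_sum mult.commute)
    qed
    then show ?thesis
      using border_poly_in_xring[OF enum' j] point_ideal_iff[OF enum comm] by blast
  qed
  moreover have "indep_mod ?I (set ts')"
    using comb_delta_nonzero_iff[OF \<iota> enum comm E'(5,3) len] delta by simp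
  ultimately show "mats_commute n ts' bs' ?\<Gamma>'" "point_ideal n ts' bs' ?\<Gamma>' = ?I"
    using border_basis_point[OF enum' point_ideal_props(1)[OF enum]] by blast+
qed

lemma pp_eval_sum: "pp_eval s (sum f A) = (\<Prod>i\<in>A. pp_eval s (f i))"
  by (induction A rule: infinite_finite_induct) (simp_all add: pp_eval_add)

text \<open>
  Evaluating the homogenization at \<open>(\<delta> \<gamma>', \<delta>)\<close> multiplies every monomial, whatever its degree, by the
  same power of \<open>\<delta>\<close>; this is how denominators are avoided.
\<close>

lemma ev_comb_hat:
  fixes \<iota> :: "'k::Fields.field \<Rightarrow> 'l::Fields.field"
  assumes \<iota>: "comm_ring_hom \<iota>" and delta: "ev \<iota> \<Gamma> (comb_delta n ts bs ts') \<noteq> 0"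
    and a: "a \<in> Pol (cvars ts' bs')"
  shows "ev \<iota> \<Gamma> (comb_hat n ts bs ts' bs' a) =
    ev \<iota> \<Gamma> (comb_delta n ts bs ts') ^ mdeg a * ev \<iota> (comb_point \<iota> n ts bs ts' bs' \<Gamma>) a"
proof -
  interpret \<iota>: comm_ring_hom \<iota> by fact
  let ?d = "ev \<iota> \<Gamma> (comb_delta n ts bs ts')" and ?p = "\<lambda>v. ev \<iota> \<Gamma> (comb_p n ts bs ts' bs' v)"
  let ?\<Gamma>' = "comb_point \<iota> n ts bs ts' bs' \<Gamma>"
  let ?s = "\<lambda>w. ev \<iota> \<Gamma> (case_option (comb_delta n ts bs ts') (comb_p n ts bs ts' bs') w)"
  interpret s: comm_ring_hom "mpoly_eval \<iota> ?s :: (_, 'k) mpoly \<Rightarrow> 'l" by (rule mpoly_eval_hom[OF \<iota>])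
  let ?T = "\<lambda>t. (\<Sum>v\<in>supp t. Poly_Mapping.single (Some v) (coef t v)) + Poly_Mapping.single None (mdeg a - pp_deg t)"
  have T: "pp_eval ?s (?T t) = ?d ^ mdeg a * pp_eval (\<lambda>ij. ?\<Gamma>' $$ ij) t" if t: "t \<in> supp a" for t
  proof -
    have v: "?s (Some v) = ?d * ?\<Gamma>' $$ v" if "v \<in> supp t" for v
    proof -
      have "v \<in> cvars ts' bs'" using a t that by (auto simp: Pol_iff)
      then show ?thesis using delta by (cases v) (simp add: comb_point_def)
    qed
    have "pp_eval ?s (?T t) = (\<Prod>v\<in>supp t. ?s (Some v) ^ coef t v) * ?d ^ (mdeg a - pp_deg t)"
      by (simp add: pp_eval_add pp_eval_sum)
    also have "(\<Prod>v\<in>supp t. ?s (Some v) ^ coef t v) = (\<Prod>v\<in>supp t. ?d ^ coef t v * (?\<Gamma>' $$ v) ^ coef t v)"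
      by (intro prod.cong refl) (simp only: v power_mult_distrib)
    also have "\<dots> = ?d ^ pp_deg t * pp_eval (\<lambda>ij. ?\<Gamma>' $$ ij) t"
      by (simp add: prod.distrib pp_deg_def power_sum pp_eval_def)
    also have "\<dots> * ?d ^ (mdeg a - pp_deg t) = ?d ^ (pp_deg t + (mdeg a - pp_deg t)) * pp_eval (\<lambda>ij. ?\<Gamma>' $$ ij) t"
      by (simp only: power_add mult_ac)
    also have "pp_deg t + (mdeg a - pp_deg t) = mdeg a"
      using t mdeg_le_iff[of a "mdeg a"] by simp
    finally show ?thesis .
  qed
  have "ev \<iota> \<Gamma> (comb_hat n ts bs ts' bs' a) = mpoly_eval \<iota> ?s (homogenize a)"
    unfolding comb_hat_def by (rule mpoly_eval_subst[OF \<iota>])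
  also have "\<dots> = (\<Sum>t\<in>supp a. \<iota> (coef a t) * pp_eval ?s (?T t))"
    unfolding homogenize_def by (simp only: s.hom_sum mpoly_eval_mterm \<iota>.hom_zero)
  also have "\<dots> = (\<Sum>t\<in>supp a. ?d ^ mdeg a * (\<iota> (coef a t) * pp_eval (\<lambda>ij. ?\<Gamma>' $$ ij) t))"
    by (intro sum.cong refl) (simp only: T mult.left_commute)
  also have "\<dots> = ?d ^ mdeg a * ev \<iota> ?\<Gamma>' a"
    by (simp only: sum_distrib_left mpoly_eval_alt)
  finally show ?thesis .
qed

lemma comb_delta_Pol:
  "enum_order_ideal n ts bs \<Longrightarrow> comb_delta n ts bs ts' \<in> Pol (cvars ts bs)"
  unfolding comb_delta_def by (intro det_in_Pol coord_mat_Pol)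

lemma comb_p_Pol:
  assumes enum: "enum_order_ideal n ts bs" and l: "length ts' = length ts" and i: "i < length ts"
  shows "(comb_p n ts bs ts' bs' (i, j) :: (nat \<times> nat, 'k::comm_ring_1) mpoly) \<in> Pol (cvars ts bs)"
proof -
  let ?C = "coord_mat n ts bs ts' :: (nat \<times> nat, 'k) mpoly mat" and ?\<mu> = "length ts"
  let ?B = "eval_term ?\<mu> n (gen_mult_mat ts bs) (bs' ! j) :: (nat \<times> nat, 'k) mpoly mat"
  note E = enum_order_idealD[OF enum]
  have C: "?C \<in> carrier_mat ?\<mu> ?\<mu>" using l coord_mat_dim(1)[of n ts bs ts'] by simp
  have B: "?B \<in> carrier_mat ?\<mu> ?\<mu>" by (rule gen_eval_term_carrier)
  have BP: "mat_Pol (cvars ts bs) ?B" by (rule eval_term_Pol) (simp_all add: gen_mult_mat_Pol[OF enum])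
  have adj: "adj_mat ?C $$ (i, k) \<in> Pol (cvars ts bs)" if k: "k < ?\<mu>" for k
  proof -
    have "mat_Pol (cvars ts bs) (mat_delete ?C k i)"
      using coord_mat_Pol[OF enum, of ts', where ?'k = 'k] l k i unfolding mat_Pol_def mat_delete_def
      by (auto simp del: coord_mat_dim(1))
    then have "det (mat_delete ?C k i) \<in> Pol (cvars ts bs)" by (rule det_in_Pol)
    then have "(- 1) ^ (k + i) * det (mat_delete ?C k i) \<in> Pol (cvars ts bs)"
      by (intro Pol_closed(4) Pol_power Pol_closed(3)) simp_all
    then show ?thesis using C i k l by (simp add: adj_mat_def cofactor_def)
  qed
  have "comb_p n ts bs ts' bs' (i, j) = (\<Sum>k<?\<mu>. adj_mat ?C $$ (i, k) * ?B $$ (k, 0))"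
    using i C B E(1) adj_mat(1)[OF C] unfolding comb_p_def by (simp add: scalar_prod_def atLeast0LessThan)
  also have "\<dots> \<in> Pol (cvars ts bs)"
    using adj BP B E(1) by (intro Pol_sum Pol_closed(4)) (auto simp: mat_Pol_def)
  finally show ?thesis .
qed

lemma comb_hat_Pol:
  assumes enum: "enum_order_ideal n ts bs" and l: "length ts' = length ts"
    and a: "a \<in> (Pol (cvars ts' bs') :: (nat \<times> nat, 'k::Fields.field) mpoly set)"
  shows "comb_hat n ts bs ts' bs' a \<in> Pol (cvars ts bs)"
proof -
  interpret mc: comm_ring_hom "mconst :: 'k \<Rightarrow> (nat \<times> nat, 'k) mpoly" by (rule mconst_hom)
  let ?s = "case_option (comb_delta n ts bs ts') (comb_p n ts bs ts' bs') :: _ \<Rightarrow> (nat \<times> nat, 'k) mpoly"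
  interpret s: comm_ring_hom "mpoly_subst ?s :: (_, 'k) mpoly \<Rightarrow> _" by (rule mpoly_eval_hom[OF mconst_hom])
  have "comb_hat n ts bs ts' bs' a = (\<Sum>t\<in>supp a. mconst (coef a t) *
      ((\<Prod>v\<in>supp t. comb_p n ts bs ts' bs' v ^ coef t v) * comb_delta n ts bs ts' ^ (mdeg a - pp_deg t)))"
    unfolding comb_hat_def homogenize_def
    by (simp add: s.hom_sum mpoly_eval_mterm pp_eval_add pp_eval_sum)
  also have "\<dots> \<in> Pol (cvars ts bs)"
  proof (intro Pol_sum Pol_closed(4,6) Pol_prod Pol_power comb_delta_Pol[OF enum])
    fix t v assume "t \<in> supp a" "v \<in> supp t"
    then have "v \<in> cvars ts' bs'" using a by (auto simp: Pol_iff)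
    then show "(comb_p n ts bs ts' bs' v :: (nat \<times> nat, 'k) mpoly) \<in> Pol (cvars ts bs)"
      using comb_p_Pol[OF enum l, where ?'k = 'k] l by (cases v) simp
  qed
  finally show ?thesis .
qed

section \<open>The matrix criterion for the strict Cayley-Bacharach property\<close>

context homogeneous_point
begin

lemma coef_nf_term_product:
  assumes u: "u \<in> terms n" and i: "i < length ts" and k: "k < length ts"
  shows "coef (nf (mterm (u + ts ! k) 1)) (ts ! i) = eval_term (length ts) n (pt_mat ts bs \<Gamma>) u $$ (i, k)"
proof -
  let ?E = "eval_term (length ts) n (pt_mat ts bs \<Gamma>) u"
  have C: "?E \<in> carrier_mat (length ts) (length ts)" by (rule eval_term_carrier) simp
  have "is_coords I ts (col ?E k) (mterm (u + ts ! k) 1)"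
    by (rule is_coords_col_eval_term[OF enum I_ideal I_border u k])
  then have "nf (mterm (u + ts ! k) 1) = vpoly ts (col ?E k)"
    by (intro nf_eq supp_vpoly) (simp add: is_coords_def)
  then show ?thesis using coef_vpoly[OF E(5) i, of "col ?E k"] C i k by simp
qed

text \<open>
  The pairing written in coordinates: the coefficient of \<open>t\<^sub>q\<close> in the normal form of \<open>t\<^sub>i t\<^sub>p\<close> is the entry
  \<open>(q, p)\<close> of \<open>t\<^sub>i(A\<^sub>1,\<dots>,A\<^sub>n)\<close>.
\<close>

lemma cayley_bacharach_iff_matrix:
  "cayley_bacharach n I \<longleftrightarrow>
   (\<forall>v. (\<forall>q<length ts. \<forall>p<length ts. pp_deg (ts ! q) = D \<longrightarrow>
       (\<Sum>i<length ts. eval_term (length ts) n (pt_mat ts bs \<Gamma>) (ts ! i) $$ (q, p) * v i) = 0) \<longrightarrow>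
     (\<forall>i<length ts. v i = 0))"
proof -
  let ?\<mu> = "length ts" and ?E = "\<lambda>u. eval_term (length ts) n (pt_mat ts bs \<Gamma>) u"
  let ?f = "\<lambda>v. \<Sum>i<?\<mu>. mterm (ts ! i) (v i :: 'l)"
  have f_supp: "supp (?f v) \<subseteq> set ts" for v by (intro supp_sum_subset) auto
  have f_coef: "coef (?f v) (ts ! i) = v i" if i: "i < ?\<mu>" for v i
  proof -
    have "?f v = vpoly ts (vec ?\<mu> v)" by (simp add: vpoly_def)
    then show ?thesis using coef_vpoly[OF E(5) i, of "vec ?\<mu> v"] i by simp
  qed
  have pair: "coef (nf (mterm (ts ! p) 1 * ?f v)) (ts ! q) = (\<Sum>i<?\<mu>. ?E (ts ! i) $$ (q, p) * v i)"
    if "p < ?\<mu>" "q < ?\<mu>" for v p q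
  proof -
    have tT: "ts ! i \<in> terms n" if "i < ?\<mu>" for i using E(3) that by auto
    have "mterm (ts ! p) 1 * ?f v = (\<Sum>i<?\<mu>. mconst (v i) * mterm (ts ! i + ts ! p) 1)"
      by (simp add: sum_distrib_left mult_single mconst_def add.commute)
    also have "nf \<dots> = (\<Sum>i<?\<mu>. mconst (v i) * nf (mterm (ts ! i + ts ! p) 1))"
    proof -
      have "mterm (ts ! i + ts ! p) (1 :: 'l) \<in> Pol {..<n}" if "i < ?\<mu>" for i
        using tT[OF that] tT[OF \<open>p < ?\<mu>\<close>] by (intro mterm_in_xring) (simp add: terms_add_iff)
      then show ?thesis by (subst nf_sum) (auto simp: nf_scale)
    qed
    finally have "coef (nf (mterm (ts ! p) 1 * ?f v)) (ts ! q) = (\<Sum>i<?\<mu>. v i * coef (nf (mterm (ts ! i + ts ! p) 1)) (ts ! q))"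
      by (simp add: lookup_sum coef_mconst_times)
    then show ?thesis using coef_nf_term_product[OF tT that(2,1)] by (simp add: mult.commute)
  qed
  show ?thesis unfolding cayley_bacharach_iff_pairing
  proof (intro iffI allI impI)
    fix v i
    assume inj: "\<forall>f. supp f \<subseteq> set ts \<longrightarrow>
        (\<forall>t\<in>set ts. \<forall>s\<in>set ts. pp_deg s = D \<longrightarrow> coef (nf (mterm t 1 * f)) s = 0) \<longrightarrow> f = 0"
      and v: "\<forall>q<?\<mu>. \<forall>p<?\<mu>. pp_deg (ts ! q) = D \<longrightarrow> (\<Sum>i<?\<mu>. ?E (ts ! i) $$ (q, p) * v i) = 0"
      and i: "i < ?\<mu>"
    have "coef (nf (mterm t 1 * ?f v)) s = 0" if t: "t \<in> set ts" and s: "s \<in> set ts" "pp_deg s = D" for t s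
    proof -
      obtain p where "p < ?\<mu>" "ts ! p = t" using t by (auto simp: in_set_conv_nth)
      moreover obtain q where "q < ?\<mu>" "ts ! q = s" using s by (auto simp: in_set_conv_nth)
      ultimately show ?thesis using pair[of p q v] v s(2) by auto
    qed
    then have "?f v = 0" using inj f_supp by blast
    then show "v i = 0" using f_coef[OF i, of v] by simp
  next
    fix f
    assume inj: "\<forall>v. (\<forall>q<?\<mu>. \<forall>p<?\<mu>. pp_deg (ts ! q) = D \<longrightarrow>
         (\<Sum>i<?\<mu>. ?E (ts ! i) $$ (q, p) * v i) = 0) \<longrightarrow> (\<forall>i<?\<mu>. v i = 0)"
      and f: "supp f \<subseteq> set ts"
      and zero: "\<forall>t\<in>set ts. \<forall>s\<in>set ts. pp_deg s = D \<longrightarrow> coef (nf (mterm t 1 * f)) s = 0"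
    define v where "v = (\<lambda>i. coef f (ts ! i))"
    have fv: "f = ?f v" using vpoly_of_supp[OF E(5) f] by (simp add: vpoly_def v_def)
    have "(\<Sum>i<?\<mu>. ?E (ts ! i) $$ (q, p) * v i) = 0" if "q < ?\<mu>" "p < ?\<mu>" "pp_deg (ts ! q) = D" for q p
      using pair[OF that(2,1), of v] zero that unfolding fv[symmetric] by simp
    then have "\<forall>i<?\<mu>. v i = 0" using inj by blast
    then show "f = 0" by (subst fv) simp
  qed
qed

end

text \<open>
  The terms of maximal degree come last since the order ideal is sorted by degree.
\<close>

lemma SCB_Delta_interval:
  assumes enum: "enum_order_ideal n ts bs"
  shows "1 \<le> SCB_Delta ts" "SCB_Delta ts \<le> length ts"
    "{i. i < length ts \<and> pp_deg (ts ! i) = pp_deg (ts ! (length ts - 1))} = {length ts - SCB_Delta ts..<length ts}"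
proof -
  note E = enum_order_idealD[OF enum]
  let ?S = "{i. i < length ts \<and> pp_deg (ts ! i) = pp_deg (ts ! (length ts - 1))}"
  have fin: "finite ?S" by simp
  have last: "length ts - 1 \<in> ?S" using E(1) by simp
  define m where "m = Min ?S"
  have m: "m \<in> ?S" unfolding m_def using last by (intro Min_in fin) blast
  have "?S = {m..<length ts}"
  proof
    show "?S \<subseteq> {m..<length ts}" unfolding m_def using Min_le[OF fin] by auto
    show "{m..<length ts} \<subseteq> ?S"
    proof
      fix i assume i: "i \<in> {m..<length ts}"
      have "pp_deg (ts ! m) \<le> pp_deg (ts ! i)" "pp_deg (ts ! i) \<le> pp_deg (ts ! (length ts - 1))"
        using i E(11)[of m i] E(11)[of i "length ts - 1"] by auto
      then show "i \<in> ?S" using m i by auto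
    qed
  qed
  moreover from this have "SCB_Delta ts = length ts - m" unfolding SCB_Delta_def by simp
  moreover have "m < length ts" using m by simp
  ultimately show "1 \<le> SCB_Delta ts" "SCB_Delta ts \<le> length ts" "?S = {length ts - SCB_Delta ts..<length ts}"
    by simp_all
qed

lemma hom_mult_mat_dim [simp]: "hom_mult_mat ts bs r \<in> carrier_mat (length ts) (length ts)"
  "dim_row (hom_mult_mat ts bs r) = length ts" "dim_col (hom_mult_mat ts bs r) = length ts"
  by (simp_all add: hom_mult_mat_def)

lemma hom_mult_mat_entry:
  assumes enum: "enum_order_ideal n ts bs" and r: "r < n" and ik: "i < length ts" "k < length ts"
  shows "Poly_Mapping.single r 1 + ts ! k \<in> set ts \<Longrightarrow>
      hom_mult_mat ts bs r $$ (i, k) =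
        (if Poly_Mapping.single r 1 + ts ! k = ts ! i then 1 else (0 :: (nat \<times> nat, 'k::comm_ring_1) mpoly))"
    "m < length bs \<Longrightarrow> Poly_Mapping.single r 1 + ts ! k = bs ! m \<Longrightarrow>
      hom_mult_mat ts bs r $$ (i, k) =
        (if pp_deg (ts ! i) = pp_deg (bs ! m) then mvar (i, m) else (0 :: (nat \<times> nat, 'k) mpoly))"
proof -
  note E = enum_order_idealD[OF enum]
  let ?\<sigma> = "\<lambda>(\<kappa>, l). if pp_deg (ts ! \<kappa>) = pp_deg (bs ! l) then mvar (\<kappa>, l) else (0 :: (nat \<times> nat, 'k) mpoly)"
  interpret s: comm_ring_hom "mpoly_subst ?\<sigma>" by (rule mpoly_eval_hom[OF mconst_hom])
  have eq: "hom_mult_mat ts bs r $$ (i, k) = mpoly_subst ?\<sigma> (gen_mult_mat ts bs r $$ (i, k))"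
    unfolding hom_mult_mat_def using ik by simp
  show "hom_mult_mat ts bs r $$ (i, k) =
      (if Poly_Mapping.single r 1 + ts ! k = ts ! i then 1 else (0 :: (nat \<times> nat, 'k) mpoly))"
    if "Poly_Mapping.single r 1 + ts ! k \<in> set ts"
    unfolding eq using that ik by (simp add: gen_mult_mat_def Let_def)
  show "hom_mult_mat ts bs r $$ (i, k) =
      (if pp_deg (ts ! i) = pp_deg (bs ! m) then mvar (i, m) else (0 :: (nat \<times> nat, 'k) mpoly))"
    if m: "m < length bs" "Poly_Mapping.single r 1 + ts ! k = bs ! m"
  proof -
    have "bs ! m \<notin> set ts" using E(7) nth_mem[OF m(1)] by blast
    then have "gen_mult_mat ts bs r $$ (i, k) = (mvar (i, m) :: (nat \<times> nat, 'k) mpoly)"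
      using ik the_index[OF E(6) m(1)] m(2) by (simp add: gen_mult_mat_def)
    then show ?thesis unfolding eq by (simp add: mpoly_eval_mvar mconst_def)
  qed
qed

lemma hom_mult_mat_Pol:
  assumes enum: "enum_order_ideal n ts bs" and r: "r < n"
  shows "mat_Pol (cvars ts bs) (hom_mult_mat ts bs r :: (nat \<times> nat, 'k::comm_ring_1) mpoly mat)"
  unfolding mat_Pol_def
proof (intro allI impI)
  note E = enum_order_idealD[OF enum]
  fix i k assume "i < dim_row (hom_mult_mat ts bs r :: (nat \<times> nat, 'k) mpoly mat)"
    "k < dim_col (hom_mult_mat ts bs r :: (nat \<times> nat, 'k) mpoly mat)"
  then have ik: "i < length ts" "k < length ts" by (simp_all add: hom_mult_mat_def)
  show "hom_mult_mat ts bs r $$ (i, k) \<in> (Pol (cvars ts bs) :: (nat \<times> nat, 'k) mpoly set)"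
  proof (cases "Poly_Mapping.single r 1 + ts ! k \<in> set ts")
    case True
    then show ?thesis by (simp add: hom_mult_mat_entry(1)[OF enum r ik])
  next
    case False
    then have "Poly_Mapping.single r 1 + ts ! k \<in> set bs" using E(9)[OF r, of "ts ! k"] ik by auto
    then obtain m where m: "m < length bs" "bs ! m = Poly_Mapping.single r 1 + ts ! k"
      by (auto simp: in_set_conv_nth)
    then show ?thesis using ik by (simp add: hom_mult_mat_entry(2)[OF enum r ik m(1) m(2)[symmetric]])
  qed
qed

lemma ev_hom_mult_mat:
  fixes \<iota> :: "'k::Fields.field \<Rightarrow> 'l::Fields.field"
  assumes \<iota>: "comm_ring_hom \<iota>" and enum: "enum_order_ideal n ts bs" and r: "r < n"
  shows "map_mat (ev \<iota> \<Gamma>) (hom_mult_mat ts bs r) = pt_mat ts bs (hom_point ts bs \<Gamma>) r"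
proof (rule eq_matI)
  interpret \<iota>: comm_ring_hom \<iota> by fact
  interpret e: comm_ring_hom "ev \<iota> \<Gamma>" by (rule mpoly_eval_hom[OF \<iota>])
  note E = enum_order_idealD[OF enum]
  fix i k assume "i < dim_row (pt_mat ts bs (hom_point ts bs \<Gamma>) r)" "k < dim_col (pt_mat ts bs (hom_point ts bs \<Gamma>) r)"
  then have ik: "i < length ts" "k < length ts" by simp_all
  have "ev \<iota> \<Gamma> (hom_mult_mat ts bs r $$ (i, k)) = pt_mat ts bs (hom_point ts bs \<Gamma>) r $$ (i, k)"
  proof (cases "Poly_Mapping.single r 1 + ts ! k \<in> set ts")
    case True
    then show ?thesis
      using hom_mult_mat_entry(1)[OF enum r ik True, where ?'k = 'k] pt_mat_in[OF ik True, of bs "hom_point ts bs \<Gamma>"]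
      by (simp split: if_splits)
  next
    case False
    then have "Poly_Mapping.single r 1 + ts ! k \<in> set bs" using E(9)[OF r, of "ts ! k"] ik by auto
    then obtain m where m: "m < length bs" "bs ! m = Poly_Mapping.single r 1 + ts ! k"
      by (auto simp: in_set_conv_nth)
    have h: "hom_point ts bs \<Gamma> $$ (i, m) = (if pp_deg (ts ! i) = pp_deg (bs ! m) then \<Gamma> $$ (i, m) else 0)"
      using ik m(1) by (simp add: hom_point_def)
    show ?thesis
      unfolding hom_mult_mat_entry(2)[OF enum r ik m(1) m(2)[symmetric]]
        pt_mat_border[OF enum ik m(1) m(2)[symmetric]] h
      by (simp add: mpoly_eval_mvar)
  qed
  then show "map_mat (ev \<iota> \<Gamma>) (hom_mult_mat ts bs r) $$ (i, k) = pt_mat ts bs (hom_point ts bs \<Gamma>) r $$ (i, k)"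
    using ik by simp
qed (simp_all add: hom_mult_mat_def)

lemma SCB_Col_entry:
  assumes enum: "enum_order_ideal n ts bs" and a: "a < SCB_Delta ts * length ts" and k: "k < length ts"
  shows "SCB_Col n ts bs $$ (a, k) =
    (eval_term (length ts) n (hom_mult_mat ts bs) (ts ! k) :: (nat \<times> nat, 'k::comm_ring_1) mpoly mat)
      $$ (length ts - SCB_Delta ts + a div length ts, a mod length ts)"
proof -
  note E = enum_order_idealD[OF enum]
  let ?\<mu> = "length ts"
  let ?M = "eval_term ?\<mu> n (hom_mult_mat ts bs) (ts ! k) :: (nat \<times> nat, 'k) mpoly mat"
  have M: "?M \<in> carrier_mat ?\<mu> ?\<mu>" by (rule eval_term_carrier) simp
  have d: "a div ?\<mu> < SCB_Delta ts" using a by (simp add: less_mult_imp_div_less)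
  then have c: "?\<mu> - SCB_Delta ts + a div ?\<mu> < ?\<mu>" using SCB_Delta_interval(2)[OF enum] by linarith
  have p: "a mod ?\<mu> < ?\<mu>" using E(1) by simp
  have "SCB_Col n ts bs $$ (a, k) = SCB_V n ts bs (a div ?\<mu>) $$ (a mod ?\<mu>, k)"
    unfolding SCB_Col_def using a k by simp
  also have "\<dots> = col (transpose_mat ?M) (?\<mu> - SCB_Delta ts + a div ?\<mu>) $ (a mod ?\<mu>)"
    unfolding SCB_V_def mat_of_cols_def using p k by simp
  also have "\<dots> = ?M $$ (?\<mu> - SCB_Delta ts + a div ?\<mu>, a mod ?\<mu>)"
    using M c p by (simp add: index_col)
  finally show ?thesis .
qed

lemma SCB_Col_dim: "dim_row (SCB_Col n ts bs) = SCB_Delta ts * length ts" "dim_col (SCB_Col n ts bs) = length ts"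
  by (simp_all add: SCB_Col_def)

lemma SCB_Col_Pol:
  assumes enum: "enum_order_ideal n ts bs"
  shows "mat_Pol (cvars ts bs) (SCB_Col n ts bs :: (nat \<times> nat, 'k::comm_ring_1) mpoly mat)"
  unfolding mat_Pol_def SCB_Col_dim
proof (intro allI impI)
  note E = enum_order_idealD[OF enum]
  fix a k assume a: "a < SCB_Delta ts * length ts" and k: "k < length ts"
  let ?M = "eval_term (length ts) n (hom_mult_mat ts bs) (ts ! k) :: (nat \<times> nat, 'k) mpoly mat"
  have M: "?M \<in> carrier_mat (length ts) (length ts)" by (rule eval_term_carrier) simp
  have MP: "mat_Pol (cvars ts bs) ?M" by (rule eval_term_Pol) (simp_all add: hom_mult_mat_Pol[OF enum])
  have "a div length ts < SCB_Delta ts" using a by (simp add: less_mult_imp_div_less)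
  then have "length ts - SCB_Delta ts + a div length ts < length ts" using SCB_Delta_interval(2)[OF enum] by linarith
  moreover have "a mod length ts < length ts" using E(1) by simp
  ultimately show "(SCB_Col n ts bs $$ (a, k) :: (nat \<times> nat, 'k) mpoly) \<in> Pol (cvars ts bs)"
    unfolding SCB_Col_entry[OF enum a k] using MP M unfolding mat_Pol_def by auto
qed

abbreviation (input) SCB_minors :: "nat \<Rightarrow> nat pp list \<Rightarrow> nat pp list \<Rightarrow> (nat \<times> nat, 'k::comm_ring_1) mpoly set" where
  "SCB_minors n ts bs \<equiv> (let A = SCB_Col n ts bs in minors (min (dim_row A) (dim_col A)) A)"

text \<open>
  For a point whose border polynomials have the border terms as terms of maximal degree, the matrix
  describes the pairing of the associated graded ring with values in its top degree part.
\<close>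

lemma strict_cayley_bacharach_iff_minor:
  fixes \<iota> :: "'k::Fields.field \<Rightarrow> 'l::Fields.field"
  assumes \<iota>: "comm_ring_hom \<iota>" and enum: "enum_order_ideal n ts bs" and comm: "mats_commute n ts bs \<Gamma>"
    and df: "\<And>i j. i < length ts \<Longrightarrow> j < length bs \<Longrightarrow> pp_deg (bs ! j) < pp_deg (ts ! i) \<Longrightarrow> \<Gamma> $$ (i, j) = 0"
  shows "strict_cayley_bacharach n (point_ideal n ts bs \<Gamma>) \<longleftrightarrow> (\<exists>m\<in>SCB_minors n ts bs. ev \<iota> \<Gamma> m \<noteq> 0)"
proof -
  note E = enum_order_idealD[OF enum] and Delta = SCB_Delta_interval[OF enum]
  let ?h = "hom_point ts bs \<Gamma>" and ?\<mu> = "length ts" and ?\<Delta> = "SCB_Delta ts"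
  note dfh = degree_form_ideal_eq_point_ideal[OF enum comm df]
  interpret h: homogeneous_point n ts bs ?h
    by unfold_locales (use enum dfh(1) in \<open>auto simp: hom_point_def split: if_splits\<close>)
  let ?E = "\<lambda>u. eval_term ?\<mu> n (pt_mat ts bs ?h) u"
  let ?C = "SCB_Col n ts bs :: (nat \<times> nat, 'k) mpoly mat"
  let ?B = "map_mat (ev \<iota> \<Gamma>) ?C"
  have size: "min (dim_row ?C) (dim_col ?C) = ?\<mu>" using Delta(1) by (simp add: SCB_Col_dim)
  have B: "?B $$ (a, k) = ?E (ts ! k) $$ (?\<mu> - ?\<Delta> + a div ?\<mu>, a mod ?\<mu>)"
    if a: "a < ?\<Delta> * ?\<mu>" and k: "k < ?\<mu>" for a k
  proof -
    let ?M = "eval_term ?\<mu> n (hom_mult_mat ts bs) (ts ! k) :: (nat \<times> nat, 'k) mpoly mat"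
    have M: "?M \<in> carrier_mat ?\<mu> ?\<mu>" by (rule eval_term_carrier) simp
    have "a div ?\<mu> < ?\<Delta>" using a by (simp add: less_mult_imp_div_less)
    then have "?\<mu> - ?\<Delta> + a div ?\<mu> < ?\<mu>" using Delta(2) by linarith
    moreover have "a mod ?\<mu> < ?\<mu>" using E(1) by simp
    moreover have "map_mat (ev \<iota> \<Gamma>) ?M = ?E (ts ! k)"
      by (rule map_mat_eval_term[OF mpoly_eval_hom[OF \<iota>]]) (simp_all add: ev_hom_mult_mat[OF \<iota> enum])
    ultimately have "ev \<iota> \<Gamma> (?M $$ (?\<mu> - ?\<Delta> + a div ?\<mu>, a mod ?\<mu>)) = ?E (ts ! k) $$ (?\<mu> - ?\<Delta> + a div ?\<mu>, a mod ?\<mu>)"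
      using M by (metis carrier_matD index_map_mat(1))
    then show ?thesis using a k SCB_Col_entry[OF enum a k, where ?'k = 'k] by (simp add: SCB_Col_dim)
  qed
  have rows: "(\<forall>a<?\<Delta> * ?\<mu>. (\<Sum>k<?\<mu>. ?B $$ (a, k) * v k) = 0) \<longleftrightarrow>
      (\<forall>q<?\<mu>. \<forall>p<?\<mu>. pp_deg (ts ! q) = h.D \<longrightarrow> (\<Sum>k<?\<mu>. ?E (ts ! k) $$ (q, p) * v k) = 0)" for v
  proof (intro iffI allI impI)
    fix q p assume z: "\<forall>a<?\<Delta> * ?\<mu>. (\<Sum>k<?\<mu>. ?B $$ (a, k) * v k) = 0"
      and q: "q < ?\<mu>" and p: "p < ?\<mu>" and "pp_deg (ts ! q) = h.D"
    then have q': "q \<in> {?\<mu> - ?\<Delta>..<?\<mu>}" unfolding Delta(3)[symmetric] by (simp add: h.D_def)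
    let ?a = "(q - (?\<mu> - ?\<Delta>)) * ?\<mu> + p"
    have dm: "?a div ?\<mu> = q - (?\<mu> - ?\<Delta>)" "?a mod ?\<mu> = p" using p E(1) by simp_all
    have "q - (?\<mu> - ?\<Delta>) < ?\<Delta>" using q' Delta(2) by auto
    then have "Suc (q - (?\<mu> - ?\<Delta>)) * ?\<mu> \<le> ?\<Delta> * ?\<mu>" by (intro mult_le_mono1) simp
    then have a: "?a < ?\<Delta> * ?\<mu>" using p by simp
    have "?\<mu> - ?\<Delta> + ?a div ?\<mu> = q" using q' unfolding dm by simp
    then have "(\<Sum>k<?\<mu>. ?E (ts ! k) $$ (q, p) * v k) = (\<Sum>k<?\<mu>. ?B $$ (?a, k) * v k)"
      using B[OF a] dm(2) by (intro sum.cong) auto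
    then show "(\<Sum>k<?\<mu>. ?E (ts ! k) $$ (q, p) * v k) = 0" using z a by simp
  next
    fix a assume z: "\<forall>q<?\<mu>. \<forall>p<?\<mu>. pp_deg (ts ! q) = h.D \<longrightarrow> (\<Sum>k<?\<mu>. ?E (ts ! k) $$ (q, p) * v k) = 0"
      and a: "a < ?\<Delta> * ?\<mu>"
    let ?q = "?\<mu> - ?\<Delta> + a div ?\<mu>"
    have "a div ?\<mu> < ?\<Delta>" using a by (simp add: less_mult_imp_div_less)
    then have "?q \<in> {?\<mu> - ?\<Delta>..<?\<mu>}" using Delta(2) by auto
    then have "?q < ?\<mu>" "pp_deg (ts ! ?q) = h.D" unfolding Delta(3)[symmetric] h.D_def by simp_all
    then have "(\<Sum>k<?\<mu>. ?E (ts ! k) $$ (?q, a mod ?\<mu>) * v k) = 0" using z E(1) by simp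
    then show "(\<Sum>k<?\<mu>. ?B $$ (a, k) * v k) = 0" using B[OF a] by simp
  qed
  have "(\<exists>m\<in>SCB_minors n ts bs. ev \<iota> \<Gamma> m \<noteq> 0) \<longleftrightarrow> (\<exists>m\<in>minors ?\<mu> ?B. m \<noteq> 0)"
    unfolding Let_def size minors_map_mat[OF mpoly_eval_hom[OF \<iota>]] by blast
  also have "\<dots> \<longleftrightarrow> (\<exists>J\<subseteq>{..<?\<mu>}. card J = ?\<mu> \<and> cols_indep ?B {..<?\<Delta> * ?\<mu>} J)"
    unfolding nonzero_minor_iff by (simp add: SCB_Col_dim)
  also have "\<dots> \<longleftrightarrow> cols_indep ?B {..<?\<Delta> * ?\<mu>} {..<?\<mu>}"
    using card_subset_eq[of "{..<?\<mu>}"] by (auto intro!: exI[of _ "{..<?\<mu>}"]) 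
  also have "\<dots> \<longleftrightarrow> cayley_bacharach n h.I"
    unfolding h.cayley_bacharach_iff_matrix cols_indep_def
    by (simp only: rows[symmetric] Ball_def lessThan_iff)
  also have "h.I = degree_form_ideal n (point_ideal n ts bs \<Gamma>)"
    by (simp add: h.I_def dfh(2))
  finally show ?thesis by (simp add: strict_cayley_bacharach_def)
qed

lemma zero_locus_SCBLocus_iff:
  fixes \<iota> :: "'k::Fields.field \<Rightarrow> 'l::Fields.field"
  assumes \<iota>: "comm_ring_hom \<iota>" and enum: "enum_order_ideal n ts bs" and comm: "mats_commute n ts bs \<Gamma>"
    and \<Gamma>: "\<Gamma> \<in> carrier_mat (length ts) (length bs)"
    and df: "\<And>i j. i < length ts \<Longrightarrow> j < length bs \<Longrightarrow> pp_deg (bs ! j) < pp_deg (ts ! i) \<Longrightarrow> \<Gamma> $$ (i, j) = 0"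
  shows "\<Gamma> \<in> zero_locus \<iota> ts bs (SCBLocus n ts bs) \<longleftrightarrow> (\<forall>m\<in>SCB_minors n ts bs. ev \<iota> \<Gamma> m = 0)"
proof -
  interpret \<iota>: comm_ring_hom \<iota> by fact
  let ?V = "{mvar (\<kappa>, l) | \<kappa> l. \<kappa> < length ts \<and> l < length bs \<and> pp_deg (ts ! \<kappa>) > pp_deg (bs ! l)}
    :: (nat \<times> nat, 'k) mpoly set"
  have S1: "ideal_BO n ts bs \<union> ?V \<subseteq> Pol (cvars ts bs)"
    using ideal_BO_Pol[OF enum] by auto
  have BO: "\<forall>f\<in>ideal_BO n ts bs. ev \<iota> \<Gamma> f = 0"
    using zero_locus_BO_iff[OF \<iota> enum, of \<Gamma>] comm \<Gamma> by (auto simp: zero_locus_def)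
  have "ev \<iota> \<Gamma> f = 0" if f: "f \<in> ?V" for f
  proof -
    obtain \<kappa> l where "f = mvar (\<kappa>, l)" "\<kappa> < length ts" "l < length bs" "pp_deg (ts ! \<kappa>) > pp_deg (bs ! l)"
      using f by blast
    then show ?thesis using df[of \<kappa> l] by (simp add: mpoly_eval_mvar)
  qed
  with BO have "\<Gamma> \<in> zero_locus \<iota> ts bs (ideal_BO_df n ts bs)"
    unfolding ideal_BO_df_def zero_locus_Idl[OF \<iota> S1] using \<Gamma> by blast
  then have dfz: "\<forall>f\<in>ideal_BO_df n ts bs. ev \<iota> \<Gamma> f = 0" by (simp add: zero_locus_def)
  have "ideal_BO_df n ts bs \<subseteq> (Pol (cvars ts bs) :: (nat \<times> nat, 'k) mpoly set)"
    unfolding ideal_BO_df_def by (rule ideal_mpolyD(1)[OF Idl_mpoly(1)[OF S1]])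
  moreover have "SCB_minors n ts bs \<subseteq> (Pol (cvars ts bs) :: (nat \<times> nat, 'k) mpoly set)"
    unfolding Let_def by (rule minors_in_Pol[OF SCB_Col_Pol[OF enum]])
  ultimately have S2: "ideal_BO_df n ts bs \<union> SCB_minors n ts bs \<subseteq> (Pol (cvars ts bs) :: (nat \<times> nat, 'k) mpoly set)"
    by blast
  show ?thesis unfolding SCBLocus_def zero_locus_Idl[OF \<iota> S2] using \<Gamma> dfz by blast
qed

section \<open>Strata of the border basis scheme\<close>

lemma to_ac_hom: "field_hom (to_ac :: 'k::Fields.field \<Rightarrow> 'k alg_closure)"
  by unfold_locales simp_all

lemma point_HF:
  fixes \<Gamma> :: "'l::Fields.field mat"
  assumes enum: "enum_order_ideal n ts bs" and comm: "mats_commute n ts bs \<Gamma>"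
  defines "F \<equiv> affine_HF n (point_ideal n ts bs \<Gamma>)"
  shows "order_ideal_HF (set ts) i \<le> F i" "F i \<le> length ts" "i \<le> j \<Longrightarrow> F i \<le> F j"
    "1 \<notin> point_ideal n ts bs \<Gamma>"
proof -
  note E = enum_order_idealD[OF enum] and ind = point_ideal_indep[OF enum comm]
  let ?I = "point_ideal n ts bs \<Gamma>"
  have I: "ideal ?I (xring n)" by (rule point_ideal_props(1)[OF enum])
  have "0 \<in> set ts" using E(1,2) nth_mem[of 0 ts] by simp
  then show 1: "1 \<notin> ?I" using one_notin_of_indep[OF ind] by blast
  show "i \<le> j \<Longrightarrow> F i \<le> F j" unfolding F_def by (rule affine_HF_mono[OF I 1])
  have "indep_mod ?I {t\<in>set ts. pp_deg t \<le> i}" by (rule indep_mod_mono[OF ind]) auto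
  then show "order_ideal_HF (set ts) i \<le> F i"
    unfolding F_def order_ideal_HF_def using E(3) by (intro card_indep_le_affine_HF[OF I 1]) auto
  have "F i \<le> card (set ts)" unfolding F_def
  proof (rule affine_HF_le_card[OF I 1])
    fix t :: "nat pp" assume "t \<in> terms n"
    then have "mterm t (1 :: 'l) \<in> carrier (xring n)" by (rule mterm_in_xring)
    then obtain v where "is_coords ?I ts v (mterm t 1)"
      using point_ideal_span[OF enum I point_ideal_props(2)[OF enum]] by blast
    then show "\<exists>g. supp g \<subseteq> set ts \<and> mterm t 1 - g \<in> ?I"
      unfolding is_coords_def using supp_vpoly by blast
  qed simp
  then show "F i \<le> length ts" using distinct_card[OF E(5)] by simp
qed

lemma order_ideal_HF_eventually:
  assumes "finite \<O>"
  shows "\<exists>d0. \<forall>d\<ge>d0. order_ideal_HF \<O> d = card \<O>"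
proof (intro exI allI impI)
  fix d assume "Max (insert 0 (pp_deg ` \<O>)) \<le> d"
  then have "{t\<in>\<O>. pp_deg t \<le> d} = \<O>" using assms by auto
  then show "order_ideal_HF \<O> d = card \<O>" by (simp add: order_ideal_HF_def)
qed

lemma zero_locus_set_add:
  fixes A B :: "(nat \<times> nat, 'k::Fields.field) mpoly set"
  assumes "comm_ring_hom \<iota>" and f: "f \<in> A <+>\<^bsub>cring_of ts bs\<^esub> B" and B: "\<forall>b\<in>B. ev \<iota> \<Gamma> b = 0"
  shows "\<exists>a\<in>A. ev \<iota> \<Gamma> f = ev \<iota> \<Gamma> a"
proof -
  interpret e: comm_ring_hom "ev \<iota> \<Gamma>" by (rule mpoly_eval_hom) fact
  obtain a b where "a \<in> A" "b \<in> B" "f = a + b" using f by (auto simp: set_add_def')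
  then show ?thesis using B by (auto simp: e.hom_add)
qed

text \<open>
  An admissible Hilbert function \<open>H\<close> enters only through a few numerical properties. Together with the
  domination of the function of the order ideal they force \<open>H 0 = 1\<close> and that \<open>H\<close> reaches \<open>\<mu>\<close>.
\<close>

locale hilbert_function =
  fixes n :: nat and ts bs :: "nat pp list" and H :: "nat \<Rightarrow> nat"
  assumes enum: "enum_order_ideal n ts bs"
    and H_mono: "\<And>i j. i \<le> j \<Longrightarrow> H i \<le> H j" and H_le: "\<And>i. H i \<le> length ts" and H_0: "H 0 \<le> 1"
    and H_dom: "\<And>i. order_ideal_HF (set ts) i \<le> H i"
begin

lemmas E = enum_order_idealD[OF enum]

definition \<rho> :: nat where "\<rho> = (LEAST i. H i = length ts)"

lemma H_eventually: "\<exists>d0. \<forall>d\<ge>d0. H d = length ts"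
  using order_ideal_HF_eventually[of "set ts"] H_dom H_le distinct_card[OF E(5)] by (metis finite_set le_antisym)

lemma H_rho: "H \<rho> = length ts"
  unfolding \<rho>_def using H_eventually by (metis (mono_tags, lifting) LeastI order_refl)

lemma H_below_rho: "i < \<rho> \<Longrightarrow> H i \<noteq> length ts"
  unfolding \<rho>_def by (rule not_less_Least)

lemma H_above_rho: "\<rho> \<le> i \<Longrightarrow> H i = length ts"
  using H_mono[of \<rho> i] H_le[of i] H_rho by simp

lemma H_pos: "1 \<le> H i"
proof -
  have "0 \<in> {t\<in>set ts. pp_deg t \<le> i}" using E(1,2) nth_mem[of 0 ts] by simp
  then have "card {t\<in>set ts. pp_deg t \<le> i} > 0" by (intro card_gt_0_iff[THEN iffD2]) auto
  then show ?thesis using H_dom[of i] by (simp add: order_ideal_HF_def)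
qed

text \<open>
  In degree \<open>0\<close> both functions have the value \<open>1\<close>, and since \<open>H\<close> is constant from \<open>\<rho>\<close> on, a smaller value
  beyond \<open>\<rho>\<close> entails a smaller value at \<open>\<rho>\<close>.
\<close>

lemma ex_strict_degree:
  fixes \<Gamma> :: "'l::Fields.field mat"
  assumes comm: "mats_commute n ts bs \<Gamma>"
    and dom: "dominates H (affine_HF n (point_ideal n ts bs \<Gamma>))" and ne: "affine_HF n (point_ideal n ts bs \<Gamma>) \<noteq> H"
  shows "\<exists>i\<in>{1..\<rho>}. affine_HF n (point_ideal n ts bs \<Gamma>) i < H i"
proof -
  let ?F = "affine_HF n (point_ideal n ts bs \<Gamma>)"
  note F = point_HF[OF enum comm]
  obtain i where "?F i \<noteq> H i" using ne by auto
  then have i: "?F i < H i" using dom by (simp add: dominates_def le_neq_implies_less)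
  have "0 \<in> {t\<in>set ts. pp_deg t \<le> 0}" using E(1,2) nth_mem[of 0 ts] by simp
  then have "card {t\<in>set ts. pp_deg t \<le> 0} > 0" by (intro card_gt_0_iff[THEN iffD2]) auto
  then have F0: "1 \<le> ?F 0" using F(1)[of 0] by (simp add: order_ideal_HF_def)
  then have i0: "i \<noteq> 0" using i F0 H_0 by (metis leD order_trans)
  show ?thesis
  proof (cases "i \<le> \<rho>")
    case True
    then show ?thesis using i i0 by (intro bexI[of _ i]) auto
  next
    case False
    then have less: "?F \<rho> < H \<rho>" using F(3)[of \<rho> i] i H_above_rho[of i] H_rho by simp
    then have "\<rho> \<noteq> 0" using F0 H_0 by (metis leD order_trans)
    then show ?thesis using less by (intro bexI[of _ \<rho>]) auto
  qed
qed

lemma ideal_D_props: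
  fixes \<iota> :: "'k::Fields.field \<Rightarrow> 'l::Fields.field"
  shows "minors k (coord_mat n ts bs us) \<subseteq> (Pol (cvars ts bs) :: (nat \<times> nat, 'k) mpoly set)"
    "ideal_D n ts bs G i \<subseteq> (Pol (cvars ts bs) :: (nat \<times> nat, 'k) mpoly set)"
    "\<lbrakk>comm_ring_hom \<iota>; mats_commute n ts bs \<Gamma>; affine_HF n (point_ideal n ts bs \<Gamma>) i \<le> G i;
      f \<in> ideal_D n ts bs G i; \<Gamma> \<in> carrier_mat (length ts) (length bs)\<rbrakk> \<Longrightarrow> ev \<iota> \<Gamma> f = 0"
proof -
  have M: "minors k (coord_mat n ts bs us) \<subseteq> (Pol (cvars ts bs) :: (nat \<times> nat, 'k) mpoly set)" for k us
    by (rule minors_in_Pol[OF coord_mat_Pol[OF enum]])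
  then show "minors k (coord_mat n ts bs us) \<subseteq> (Pol (cvars ts bs) :: (nat \<times> nat, 'k) mpoly set)" .
  show "ideal_D n ts bs G i \<subseteq> (Pol (cvars ts bs) :: (nat \<times> nat, 'k) mpoly set)"
    unfolding ideal_D_def by (rule ideal_mpolyD(1)[OF Idl_mpoly(1)[OF M]])
  assume \<iota>: "comm_ring_hom \<iota>" and comm: "mats_commute n ts bs \<Gamma>"
    and le: "affine_HF n (point_ideal n ts bs \<Gamma>) i \<le> G i"
    and f: "f \<in> ideal_D n ts bs G i" and \<Gamma>: "\<Gamma> \<in> carrier_mat (length ts) (length bs)"
  have "\<forall>m\<in>minors (G i + 1) (coord_mat n ts bs (terms_upto n i)). ev \<iota> \<Gamma> m = 0"
    using nonzero_coord_minor_iff[OF \<iota> enum comm, of "G i + 1" i] le by auto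
  then have "\<Gamma> \<in> zero_locus \<iota> ts bs (ideal_D n ts bs G i)"
    unfolding ideal_D_def zero_locus_Idl[OF \<iota> M] using \<Gamma> by blast
  then show "ev \<iota> \<Gamma> f = 0" using f by (simp add: zero_locus_def)
qed

lemma ideal_BO_closed_props:
  fixes \<iota> :: "'k::Fields.field \<Rightarrow> 'l::Fields.field"
  shows "ideal (ideal_BO_closed n ts bs G :: (nat \<times> nat, 'k) mpoly set) (cring_of ts bs)"
    "i \<in> {1..<(LEAST i. G i = length ts)} \<Longrightarrow> ideal_D n ts bs G i \<subseteq> (ideal_BO_closed n ts bs G :: (nat \<times> nat, 'k) mpoly set)"
    "\<lbrakk>comm_ring_hom \<iota>; mats_commute n ts bs \<Gamma>; \<Gamma> \<in> carrier_mat (length ts) (length bs);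
      \<And>i. affine_HF n (point_ideal n ts bs \<Gamma>) i \<le> G i; f \<in> ideal_BO_closed n ts bs G\<rbrakk> \<Longrightarrow> ev \<iota> \<Gamma> f = 0"
proof -
  let ?\<sigma> = "LEAST i. G i = length ts"
  let ?S = "ideal_BO n ts bs \<union> (\<Union>i\<in>{1..<?\<sigma>}. ideal_D n ts bs G i) :: (nat \<times> nat, 'k) mpoly set"
  have S: "?S \<subseteq> Pol (cvars ts bs)" using ideal_BO_Pol[OF enum] ideal_D_props(2) by blast
  have eq: "ideal_BO_closed n ts bs G = Idl\<^bsub>cring_of ts bs\<^esub> ?S" by (simp add: ideal_BO_closed_def Let_def)
  show "ideal (ideal_BO_closed n ts bs G :: (nat \<times> nat, 'k) mpoly set) (cring_of ts bs)"
    unfolding eq by (rule Idl_mpoly(1)[OF S])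
  show "i \<in> {1..<?\<sigma>} \<Longrightarrow> ideal_D n ts bs G i \<subseteq> (ideal_BO_closed n ts bs G :: (nat \<times> nat, 'k) mpoly set)"
    unfolding eq using Idl_mpoly(2)[OF S] by blast
  assume \<iota>: "comm_ring_hom \<iota>" and comm: "mats_commute n ts bs \<Gamma>"
    and \<Gamma>: "\<Gamma> \<in> carrier_mat (length ts) (length bs)"
    and le: "\<And>i. affine_HF n (point_ideal n ts bs \<Gamma>) i \<le> G i" and f: "f \<in> ideal_BO_closed n ts bs G"
  have "ev \<iota> \<Gamma> g = 0" if "g \<in> ideal_BO n ts bs" for g
    using zero_locus_BO_iff[OF \<iota> enum, of \<Gamma>] comm \<Gamma> that by (auto simp: zero_locus_def)
  moreover have D: "ev \<iota> \<Gamma> g = 0" if "g \<in> ideal_D n ts bs G j" for g j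
    by (rule ideal_D_props(3)[where G = G and i = j, OF \<iota> comm le that \<Gamma>])
  ultimately have "\<Gamma> \<in> zero_locus \<iota> ts bs (ideal_BO_closed n ts bs G)"
    unfolding eq zero_locus_Idl[OF \<iota> S] using \<Gamma> D by blast
  then show "ev \<iota> \<Gamma> f = 0" using f by (simp add: zero_locus_def)
qed

text \<open>
  At a point with Hilbert function \<open>H\<close> one minor of size \<open>H i\<close> survives for each degree \<open>i\<close>. The
  product of these minors separates the point from all points with a smaller Hilbert function.
\<close>

lemma separating_polynomial:
  fixes \<iota> :: "'k::Fields.field \<Rightarrow> 'l::Fields.field"
  assumes \<iota>: "field_hom \<iota>" and comm: "mats_commute n ts bs \<Gamma>"
    and HF: "affine_HF n (point_ideal n ts bs \<Gamma>) = H"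
  shows "\<exists>f :: (nat \<times> nat, 'k) mpoly. f \<in> Pol (cvars ts bs) \<and> ev \<iota> \<Gamma> f \<noteq> 0 \<and>
    (\<forall>i\<in>{1..\<rho>}. f \<in> ideal_D n ts bs (H(i := H i - 1)) i)"
proof -
  have \<iota>': "comm_ring_hom \<iota>" by (rule field_hom_comm_ring_hom[OF \<iota>])
  interpret e: comm_ring_hom "ev \<iota> \<Gamma>" by (rule mpoly_eval_hom[OF \<iota>'])
  have "\<exists>m :: (nat \<times> nat, 'k) mpoly. m \<in> minors (H i) (coord_mat n ts bs (terms_upto n i)) \<and> ev \<iota> \<Gamma> m \<noteq> 0" for i
    using nonzero_coord_minor_iff[OF \<iota>' enum comm, of "H i" i] HF by auto
  then obtain m :: "nat \<Rightarrow> (nat \<times> nat, 'k) mpoly"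
    where m: "\<And>i. m i \<in> minors (H i) (coord_mat n ts bs (terms_upto n i))" "\<And>i. ev \<iota> \<Gamma> (m i) \<noteq> 0"
    by metis
  have mP: "m i \<in> Pol (cvars ts bs)" for i using m(1) ideal_D_props(1) by blast
  let ?f = "\<Prod>i\<in>{1..\<rho>}. m i"
  have "?f \<in> ideal_D n ts bs (H(i := H i - 1)) i" if i: "i \<in> {1..\<rho>}" for i
  proof -
    have size: "(H(i := H i - 1)) i + 1 = H i" using H_pos[of i] by simp
    note S = ideal_D_props(1)[of "(H(i := H i - 1)) i + 1" "terms_upto n i", where ?'k = 'k]
    have "m i \<in> ideal_D n ts bs (H(i := H i - 1)) i"
      unfolding ideal_D_def using Idl_mpoly(2)[OF S] m(1)[of i] unfolding size by blast
    moreover have "ideal (ideal_D n ts bs (H(i := H i - 1)) i :: (nat \<times> nat, 'k) mpoly set) (cring_of ts bs)"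
      unfolding ideal_D_def by (rule Idl_mpoly(1)[OF S])
    moreover have "?f = (\<Prod>j\<in>{1..\<rho>} - {i}. m j) * m i" using i by (simp add: prod.remove mult.commute)
    ultimately show ?thesis using ideal_mpolyD(6) Pol_prod mP by metis
  qed
  moreover have "ev \<iota> \<Gamma> ?f \<noteq> 0" using m(2) by (simp add: e.hom_prod)
  moreover have "?f \<in> Pol (cvars ts bs)" using mP by (intro Pol_prod)
  ultimately show ?thesis by blast
qed

lemma ideal_ZO_Pol: "ideal_ZO n ts bs H \<subseteq> (Pol (cvars ts bs) :: (nat \<times> nat, 'k::Fields.field) mpoly set)"
  by (simp add: ideal_ZO_def Let_def)

lemma ideal_ZO_mult:
  assumes z: "z \<in> ideal_ZO n ts bs H" and p: "(p :: (nat \<times> nat, 'k::Fields.field) mpoly) \<in> Pol (cvars ts bs)"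
  shows "p * z \<in> ideal_ZO n ts bs H"
  using z p ideal_mpolyD(6)[OF ideal_BO_closed_props(1) p] unfolding ideal_ZO_def Let_def by auto

text \<open>
  A strictly smaller Hilbert function is dominated by one of the functions \<open>H(i := H i - 1)\<close>, so that the
  corresponding ideal in the intersection vanishes at the point. At a point with Hilbert function \<open>H\<close>
  the separating polynomial belongs to all of these ideals.
\<close>

lemma zero_locus_ZO_iff:
  fixes \<iota> :: "'k::Fields.field \<Rightarrow> 'l::Fields.field"
  assumes \<iota>: "field_hom \<iota>" and comm: "mats_commute n ts bs \<Gamma>"
    and \<Gamma>: "\<Gamma> \<in> carrier_mat (length ts) (length bs)"
    and dom: "dominates H (affine_HF n (point_ideal n ts bs \<Gamma>))"
  shows "(\<exists>f\<in>ideal_ZO n ts bs H. ev \<iota> \<Gamma> f \<noteq> 0) \<longleftrightarrow> affine_HF n (point_ideal n ts bs \<Gamma>) = H"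
proof
  let ?F = "affine_HF n (point_ideal n ts bs \<Gamma>)"
  assume "\<exists>f\<in>ideal_ZO n ts bs H. ev \<iota> \<Gamma> f \<noteq> 0"
  then obtain f where f: "f \<in> ideal_ZO n ts bs H" "ev \<iota> \<Gamma> f \<noteq> 0" by blast
  show "?F = H"
  proof (rule ccontr)
    assume "?F \<noteq> H"
    then obtain i where i: "i \<in> {1..\<rho>}" "?F i < H i" using ex_strict_degree[OF comm dom] by blast
    have "order_ideal_HF (set ts) i \<le> H i - 1" using point_HF(1)[OF enum comm, of i] i(2) by linarith
    then have "f \<in> ideal_BO_closed n ts bs (H(i := H i - 1))"
      using f(1) i(1) by (auto simp: ideal_ZO_def Let_def \<rho>_def)
    moreover have "?F j \<le> (H(i := H i - 1)) j" for j using i(2) dom by (auto simp: dominates_def)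
    ultimately show False
      using ideal_BO_closed_props(3)[OF field_hom_comm_ring_hom[OF \<iota>] comm \<Gamma>] f(2) by blast
  qed
next
  assume "affine_HF n (point_ideal n ts bs \<Gamma>) = H"
  then obtain f :: "(nat \<times> nat, 'k) mpoly" where f: "f \<in> Pol (cvars ts bs)" "ev \<iota> \<Gamma> f \<noteq> 0"
    "\<And>i. i \<in> {1..\<rho>} \<Longrightarrow> f \<in> ideal_D n ts bs (H(i := H i - 1)) i"
    using separating_polynomial[OF \<iota> comm] by blast
  have "f \<in> ideal_BO_closed n ts bs (H(i := H i - 1))" if i: "i \<in> {1..\<rho>}" for i
  proof -
    let ?G = "H(i := H i - 1)"
    have no: "?G j \<noteq> length ts" if "j \<le> i" for j
    proof (cases "j = i")
      case True
      then show ?thesis using H_pos[of i] H_le[of i] by simp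
    next
      case False
      then show ?thesis using H_below_rho[of j] that i by simp
    qed
    have "?G (Suc \<rho>) = length ts" using i H_above_rho[of "Suc \<rho>"] by simp
    then have "?G (LEAST j. ?G j = length ts) = length ts" by (rule LeastI)
    \<comment> \<open>So the minors of degree \<open>i\<close> are among the generators for the modified function.\<close>
    then have "i < (LEAST j. ?G j = length ts)" using no not_le by blast
    then show ?thesis using f(3)[OF i] ideal_BO_closed_props(2)[of i ?G, where ?'k = 'k] i by auto
  qed
  then have "f \<in> ideal_ZO n ts bs H" using f(1) by (auto simp: ideal_ZO_def Let_def \<rho>_def)
  then show "\<exists>f\<in>ideal_ZO n ts bs H. ev \<iota> \<Gamma> f \<noteq> 0" using f(2) by blast
qed

text \<open>
  Commutation and the bounds for the Hilbert function are given by equations, minors in the latter case.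
  These equations hold on the set whose closure is taken, hence on its closure.
\<close>

lemma BO_closed_props:
  fixes \<iota> :: "'k::Fields.field \<Rightarrow> 'l::Fields.field"
  assumes \<iota>: "field_hom \<iota>" and \<Gamma>: "\<Gamma> \<in> BO_closed \<iota> n ts bs H"
  shows "\<Gamma> \<in> carrier_mat (length ts) (length bs)" "mats_commute n ts bs \<Gamma>"
    "dominates H (affine_HF n (point_ideal n ts bs \<Gamma>))"
proof -
  have \<iota>': "comm_ring_hom \<iota>" by (rule field_hom_comm_ring_hom[OF \<iota>])
  have ac: "comm_ring_hom (to_ac :: 'k \<Rightarrow> 'k alg_closure)" by (rule field_hom_comm_ring_hom[OF to_ac_hom])
  let ?S = "{\<Gamma> \<in> zero_locus to_ac ts bs (ideal_BO n ts bs :: (nat \<times> nat, 'k) mpoly set).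
        dominates H (affine_HF n (point_ideal n ts bs \<Gamma>))}"
  have van: "ev \<iota> \<Gamma> f = 0" if "f \<in> closure_ideal ts bs ?S" for f
    using \<Gamma> that by (auto simp: BO_closed_def zero_locus_def)
  show car: "\<Gamma> \<in> carrier_mat (length ts) (length bs)"
    using \<Gamma> zero_locus_carrier unfolding BO_closed_def by blast
  have "ideal_BO n ts bs \<subseteq> closure_ideal ts bs ?S"
    using ideal_BO_Pol[OF enum] by (auto simp: closure_ideal_def zero_locus_def)
  then have "\<Gamma> \<in> zero_locus \<iota> ts bs (ideal_BO n ts bs)" using van car by (auto simp: zero_locus_def)
  then show comm: "mats_commute n ts bs \<Gamma>" using zero_locus_BO_iff[OF \<iota>' enum] by blast
  show "dominates H (affine_HF n (point_ideal n ts bs \<Gamma>))" unfolding dominates_def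
  proof (intro allI, rule ccontr)
    fix i assume "\<not> affine_HF n (point_ideal n ts bs \<Gamma>) i \<le> H i"
    then obtain m :: "(nat \<times> nat, 'k) mpoly" where
      m: "m \<in> minors (H i + 1) (coord_mat n ts bs (terms_upto n i))" "ev \<iota> \<Gamma> m \<noteq> 0"
      using nonzero_coord_minor_iff[OF \<iota>' enum comm, of "H i + 1" i] by auto
    have "ev to_ac \<Delta> m = 0" if "\<Delta> \<in> ?S" for \<Delta>
    proof -
      have comm': "mats_commute n ts bs \<Delta>" using that zero_locus_BO_iff[OF ac enum] by blast
      have "affine_HF n (point_ideal n ts bs \<Delta>) i \<le> H i" using that by (simp add: dominates_def)
      then show ?thesis using nonzero_coord_minor_iff[OF ac enum comm', of "H i + 1" i] m(1) by auto
    qed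
    then have "m \<in> closure_ideal ts bs ?S" using m(1) ideal_D_props(1) by (auto simp: closure_ideal_def)
    then show False using van m(2) by blast
  qed
qed

text \<open>
  A point with a smaller Hilbert function lies in the closure of the geometric points of this kind: it
  specializes to a geometric point at which, by semicontinuity, the Hilbert function is not larger,
  while the value of a given polynomial stays non-zero.
\<close>

lemma BO_stratum_iff:
  fixes \<iota> :: "'k::Fields.field \<Rightarrow> 'l::Fields.field"
  assumes \<iota>: "field_hom \<iota>"
  shows "\<Gamma> \<in> BO_stratum \<iota> n ts bs H \<longleftrightarrow>
    \<Gamma> \<in> BO_closed \<iota> n ts bs H \<and> affine_HF n (point_ideal n ts bs \<Gamma>) = H"
proof (cases "\<Gamma> \<in> BO_closed \<iota> n ts bs H")
  case True
  note \<Gamma> = BO_closed_props[OF \<iota> True]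
  have \<iota>': "comm_ring_hom \<iota>" by (rule field_hom_comm_ring_hom[OF \<iota>])
  have ac: "comm_ring_hom (to_ac :: 'k \<Rightarrow> 'k alg_closure)" by (rule field_hom_comm_ring_hom[OF to_ac_hom])
  let ?T = "{\<Gamma> \<in> zero_locus to_ac ts bs (ideal_BO n ts bs :: (nat \<times> nat, 'k) mpoly set).
        dominates H (affine_HF n (point_ideal n ts bs \<Gamma>)) \<and> affine_HF n (point_ideal n ts bs \<Gamma>) \<noteq> H}"
  have "(\<exists>f\<in>closure_ideal ts bs ?T. ev \<iota> \<Gamma> f \<noteq> 0) \<longleftrightarrow> affine_HF n (point_ideal n ts bs \<Gamma>) = H"
  proof
    assume "affine_HF n (point_ideal n ts bs \<Gamma>) = H"
    then obtain f :: "(nat \<times> nat, 'k) mpoly" where f: "f \<in> Pol (cvars ts bs)" "ev \<iota> \<Gamma> f \<noteq> 0"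
      "\<And>i. i \<in> {1..\<rho>} \<Longrightarrow> f \<in> ideal_D n ts bs (H(i := H i - 1)) i"
      using separating_polynomial[OF \<iota> \<Gamma>(2)] by blast
    have "ev to_ac \<Delta> f = 0" if \<Delta>: "\<Delta> \<in> ?T" for \<Delta>
    proof -
      have c: "mats_commute n ts bs \<Delta>" "\<Delta> \<in> carrier_mat (length ts) (length bs)"
        using \<Delta> zero_locus_BO_iff[OF ac enum] by blast+
      obtain i where i: "i \<in> {1..\<rho>}" "affine_HF n (point_ideal n ts bs \<Delta>) i < H i"
        using ex_strict_degree[OF c(1)] \<Delta> by blast
      then show ?thesis
        using ideal_D_props(3)[OF ac c(1), of i "H(i := H i - 1)" f] f(3)[OF i(1)] c(2) by simp
    qed
    then have "f \<in> closure_ideal ts bs ?T" using f(1) by (simp add: closure_ideal_def)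
    then show "\<exists>f\<in>closure_ideal ts bs ?T. ev \<iota> \<Gamma> f \<noteq> 0" using f(2) by blast
  next
    let ?F = "affine_HF n (point_ideal n ts bs \<Gamma>)"
    assume "\<exists>f\<in>closure_ideal ts bs ?T. ev \<iota> \<Gamma> f \<noteq> 0"
    then obtain f where f: "f \<in> closure_ideal ts bs ?T" "ev \<iota> \<Gamma> f \<noteq> 0" by blast
    then have fP: "f \<in> Pol (cvars ts bs)" by (simp add: closure_ideal_def)
    show "?F = H"
    proof (rule ccontr)
      assume ne: "?F \<noteq> H"
      obtain \<xi> :: "nat \<times> nat \<Rightarrow> 'k alg_closure" where \<xi>: "mpoly_eval to_ac \<xi> f \<noteq> 0"
        "\<And>g. g \<in> Pol (cvars ts bs) \<Longrightarrow> ev \<iota> \<Gamma> g = 0 \<Longrightarrow> mpoly_eval to_ac \<xi> g = 0"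
        using point_specialization[OF \<iota> to_ac_hom _ fP f(2)] by (metis finite_SigmaI finite_lessThan)
      define \<Delta> where "\<Delta> = mat (length ts) (length bs) \<xi>"
      have car: "\<Delta> \<in> carrier_mat (length ts) (length bs)" by (simp add: \<Delta>_def)
      have ev\<Delta>: "ev to_ac \<Delta> g = mpoly_eval to_ac \<xi> g" if "g \<in> Pol (cvars ts bs)" for g
        using that by (intro mpoly_eval_cong) (fastforce simp: Pol_iff \<Delta>_def)
      have van: "ev to_ac \<Delta> g = 0" if "g \<in> Pol (cvars ts bs)" "ev \<iota> \<Gamma> g = 0" for g
        using \<xi>(2)[OF that] ev\<Delta>[OF that(1)] by simp
      have "\<Gamma> \<in> zero_locus \<iota> ts bs (ideal_BO n ts bs)" using zero_locus_BO_iff[OF \<iota>' enum] \<Gamma>(1,2) by blast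
      then have z: "\<Delta> \<in> zero_locus to_ac ts bs (ideal_BO n ts bs :: (nat \<times> nat, 'k) mpoly set)"
        unfolding zero_locus_def using van car ideal_BO_Pol[OF enum] by blast
      then have comm: "mats_commute n ts bs \<Delta>" using zero_locus_BO_iff[OF ac enum] by blast
      have le: "affine_HF n (point_ideal n ts bs \<Delta>) i \<le> ?F i" for i
      proof (rule ccontr)
        assume "\<not> ?thesis"
        then obtain m :: "(nat \<times> nat, 'k) mpoly" where
          m: "m \<in> minors (?F i + 1) (coord_mat n ts bs (terms_upto n i))" "ev to_ac \<Delta> m \<noteq> 0"
          using nonzero_coord_minor_iff[OF ac enum comm, of "?F i + 1" i] by auto
        have "ev \<iota> \<Gamma> m = 0" using nonzero_coord_minor_iff[OF \<iota>' enum \<Gamma>(2), of "?F i + 1" i] m(1) by auto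
        then show False using van[of m] m ideal_D_props(1) by blast
      qed
      have "dominates H (affine_HF n (point_ideal n ts bs \<Delta>))"
        using le \<Gamma>(3) unfolding dominates_def by (meson order_trans)
      moreover have "affine_HF n (point_ideal n ts bs \<Delta>) \<noteq> H"
        using le \<Gamma>(3) ne unfolding dominates_def by (metis ext le_antisym)
      ultimately have "\<Delta> \<in> ?T" using z by blast
      then have "ev to_ac \<Delta> f = 0" using f(1) by (simp add: closure_ideal_def)
      then show False using \<xi>(1) ev\<Delta>[OF fP] by simp
    qed
  qed
  then show ?thesis using True \<Gamma>(1) unfolding BO_stratum_def by (auto simp: zero_locus_def)
qed (simp add: BO_stratum_def)

end

section \<open>The locus of schemes with the strict Cayley-Bacharach property\<close>

text \<open>
  Macaulay's basis theorem: the standard terms form an order ideal, and they realize the Hilbert function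
  of \<open>J\<close>.
\<close>

lemma ex_basis_order_ideal:
  fixes J :: "(nat, 'l::Fields.field) mpoly set"
  assumes J: "ideal J (xring n)" "1 \<notin> J" and le: "\<And>i. affine_HF n J i \<le> \<mu>"
  shows "\<exists>\<O>. order_ideal n \<O> \<and> order_ideal_HF \<O> = affine_HF n J \<and> indep_mod J \<O>"
proof (intro exI[of _ "std_terms n J"] conjI)
  let ?O = "std_terms n J"
  show "order_ideal_HF ?O = affine_HF n J"
    by (intro ext) (simp add: order_ideal_HF_def affine_HF_std_terms[OF J])
  show "indep_mod J ?O" by (rule std_terms_indep)
  have "finite ?O"
  proof (rule ccontr)
    assume "infinite ?O"
    then obtain B where B: "B \<subseteq> ?O" "finite B" "card B = Suc \<mu>" by (metis infinite_arbitrarily_large)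
    have "B \<subseteq> {t\<in>?O. pp_deg t \<le> Max (insert 0 (pp_deg ` B))}" using B by auto
    then have "card B \<le> card {t\<in>?O. pp_deg t \<le> Max (insert 0 (pp_deg ` B))}"
      by (intro card_mono finite_std_terms_le)
    also have "\<dots> \<le> \<mu>" unfolding affine_HF_std_terms[OF J, symmetric] by (rule le)
    finally show False using B(3) by simp
  qed
  moreover have "0 \<in> ?O"
  proof -
    have "\<not> (t \<in> supp f \<and> (\<forall>s\<in>supp f. s = t \<or> term_less s t))" if "f \<in> J" "t = 0" for f t
    proof
      assume *: "t \<in> supp f \<and> (\<forall>s\<in>supp f. s = t \<or> term_less s t)"
      have "supp f \<subseteq> {0}"
      proof
        fix s assume "s \<in> supp f"
        then have "s = 0 \<or> term_less s 0" using * that(2) by blast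
        moreover have "\<not> s < 0" if "pp_deg s = 0" using that pp_deg_eq_0_iff[of s] by auto
        ultimately show "s \<in> {0}" by (auto simp: term_less_def)
      qed
      then have "f = mterm 0 (coef f 0)"
        by (intro poly_mapping_eqI) (auto simp: lookup_single when_def in_keys_iff)
      moreover have "coef f 0 \<noteq> 0" using * that(2) by (simp add: in_keys_iff)
      moreover have "mterm 0 (inverse (coef f 0)) * f \<in> J"
        using ideal_mpolyD(6)[OF J(1) mterm_in_xring[OF terms_zero] that(1)] .
      ultimately have "mterm 0 (inverse (coef f 0) * coef f 0) \<in> J" by (metis add_0 mult_single)
      then show False using \<open>coef f 0 \<noteq> 0\<close> J(2) by simp
    qed
    then show ?thesis unfolding std_terms_def by auto
  qed
  moreover have "u \<in> ?O" if "u + v \<in> ?O" for u v by (rule std_terms_divisor[OF J(1) that])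
  moreover have "?O \<subseteq> terms n" by (auto simp: std_terms_def)
  ultimately show "order_ideal n ?O" unfolding order_ideal_def by (metis empty_iff)
qed

text \<open>
  Passing to the coordinates with respect to \<open>ts'\<close> turns the values of the substituted generators into the
  values of the generators, up to a power of \<open>\<delta>\<close>. As \<open>ts'\<close> has the Hilbert function of the point, the new
  point is one whose degree forms are visible, and there the minors decide.
\<close>

lemma ex_comb_hat_nonzero_iff:
  fixes \<iota> :: "'k::Fields.field \<Rightarrow> 'l::Fields.field" and as :: "(nat \<times> nat, 'k) mpoly list"
  assumes \<iota>: "comm_ring_hom \<iota>" and enum: "enum_order_ideal n ts bs" and comm: "mats_commute n ts bs \<Gamma>"
    and enum': "enum_order_ideal n ts' bs'" and len: "length ts' = length ts"
    and HF: "affine_HF n (point_ideal n ts bs \<Gamma>) = order_ideal_HF (set ts')"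
    and delta: "ev \<iota> \<Gamma> (comb_delta n ts bs ts') \<noteq> 0"
    and as: "set as \<subseteq> Pol (cvars ts' bs')" "SCBLocus n ts' bs' = Idl\<^bsub>cring_of ts' bs'\<^esub> set as"
  shows "(\<exists>a\<in>set as. ev \<iota> \<Gamma> (comb_hat n ts bs ts' bs' a) \<noteq> 0) \<longleftrightarrow>
    strict_cayley_bacharach n (point_ideal n ts bs \<Gamma>)"
proof -
  let ?\<Gamma>' = "comb_point \<iota> n ts bs ts' bs' \<Gamma>"
  note rep = comb_point_represents[OF \<iota> enum comm enum' len delta]
  have car: "?\<Gamma>' \<in> carrier_mat (length ts') (length bs')" by (simp add: comb_point_def)
  have df: "?\<Gamma>' $$ (i, j) = 0" if "i < length ts'" "j < length bs'" "pp_deg (bs' ! j) < pp_deg (ts' ! i)" for i j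
    using border_coeff_degree[OF enum' rep(1) _ that] HF rep(2) by simp
  have "(\<exists>a\<in>set as. ev \<iota> \<Gamma> (comb_hat n ts bs ts' bs' a) \<noteq> 0) \<longleftrightarrow> (\<exists>a\<in>set as. ev \<iota> ?\<Gamma>' a \<noteq> 0)"
  proof (intro bex_cong refl)
    fix a assume "a \<in> set as"
    then have "a \<in> Pol (cvars ts' bs')" using as(1) by blast
    then show "ev \<iota> \<Gamma> (comb_hat n ts bs ts' bs' a) \<noteq> 0 \<longleftrightarrow> ev \<iota> ?\<Gamma>' a \<noteq> 0"
      using delta by (simp add: ev_comb_hat[OF \<iota> delta])
  qed
  also have "\<dots> \<longleftrightarrow> ?\<Gamma>' \<notin> zero_locus \<iota> ts' bs' (SCBLocus n ts' bs')"
    unfolding as(2) zero_locus_Idl[OF \<iota> as(1)] using car by blast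
  also have "\<dots> \<longleftrightarrow> strict_cayley_bacharach n (point_ideal n ts bs \<Gamma>)"
    using zero_locus_SCBLocus_iff[OF \<iota> enum' rep(1) car df]
      strict_cayley_bacharach_iff_minor[OF \<iota> enum' rep(1) df] unfolding rep(2) by blast
  finally show ?thesis .
qed

lemma enum_order_ideal_terms:
  assumes "enum_order_ideal n ts bs"
  shows "distinct ts" "set ts \<subseteq> terms n"
  using enum_order_idealD(5,3)[OF assms] by blast+

lemma (in hilbert_function) length_order_ideal:
  assumes enum': "enum_order_ideal n ts' bs'" and HF': "order_ideal_HF (set ts') = H"
  shows "length ts' = length ts"
proof -
  obtain d where "\<And>i. i \<ge> d \<Longrightarrow> H i = card (set ts')"
    using order_ideal_HF_eventually[of "set ts'"] HF' by auto
  moreover obtain d' where "\<And>i. i \<ge> d' \<Longrightarrow> H i = length ts" using H_eventually by blast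
  ultimately have "card (set ts') = length ts" by (metis nat_le_linear)
  then show ?thesis using distinct_card[OF enum_order_ideal_terms(1)[OF enum']] by simp
qed

text \<open>
  At points of the closed stratum \<open>I(B(H))\<close> vanishes, so that the two summands can be tested separately:
  the first detects the Hilbert function together with \<open>\<delta> \<noteq> 0\<close>, the second the property itself.
  Conversely, the product of non-vanishing elements of the ideals in question lies in their intersection.
\<close>

lemma (in hilbert_function) summand_nonzero_iff:
  fixes \<iota> :: "'k::Fields.field \<Rightarrow> 'l::Fields.field" and as :: "(nat \<times> nat, 'k) mpoly list"
  assumes \<iota>: "field_hom \<iota>" and \<Gamma>: "\<Gamma> \<in> BO_closed \<iota> n ts bs H"
    and enum': "enum_order_ideal n ts' bs'" and HF': "order_ideal_HF (set ts') = H"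
    and as: "set as \<subseteq> Pol (cvars ts' bs')" "SCBLocus n ts' bs' = Idl\<^bsub>cring_of ts' bs'\<^esub> set as"
  shows "(\<exists>f\<in>(ideal_dfb n ts bs H ts' <+>\<^bsub>cring_of ts bs\<^esub> ideal_BO_closed n ts bs H) \<inter>
        (ideal_J n ts bs ts' bs' as <+>\<^bsub>cring_of ts bs\<^esub> ideal_BO_closed n ts bs H). ev \<iota> \<Gamma> f \<noteq> 0) \<longleftrightarrow>
    affine_HF n (point_ideal n ts bs \<Gamma>) = H \<and> ev \<iota> \<Gamma> (comb_delta n ts bs ts' :: (nat \<times> nat, 'k) mpoly) \<noteq> 0 \<and>
      strict_cayley_bacharach n (point_ideal n ts bs \<Gamma>)"
    (is "(\<exists>f\<in>(?A <+>\<^bsub>_\<^esub> ?B) \<inter> (?J <+>\<^bsub>_\<^esub> ?B). _) \<longleftrightarrow> ?HF \<and> ?D \<and> ?S")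
proof -
  have \<iota>': "comm_ring_hom \<iota>" by (rule field_hom_comm_ring_hom[OF \<iota>])
  interpret e: comm_ring_hom "ev \<iota> \<Gamma>" by (rule mpoly_eval_hom[OF \<iota>'])
  note P = BO_closed_props[OF \<iota> \<Gamma>]
  let ?\<delta> = "comb_delta n ts bs ts' :: (nat \<times> nat, 'k) mpoly"
  have len: "length ts' = length ts" by (rule length_order_ideal[OF enum' HF'])
  have van: "\<forall>b\<in>?B. ev \<iota> \<Gamma> b = 0"
    using ideal_BO_closed_props(3)[where G = H, OF \<iota>' P(2,1)] P(3) by (auto simp: dominates_def)
  have dP: "{?\<delta>} \<subseteq> Pol (cvars ts bs)" using comb_delta_Pol[OF enum] by blast
  have hP: "comb_hat n ts bs ts' bs' ` set as \<subseteq> Pol (cvars ts bs)"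
    using comb_hat_Pol[OF enum len] as(1) by blast
  have S: "?S \<longleftrightarrow> (\<exists>a\<in>set as. ev \<iota> \<Gamma> (comb_hat n ts bs ts' bs' a) \<noteq> 0)" if ?HF ?D
    using ex_comb_hat_nonzero_iff[OF \<iota>' enum P(2) enum' len _ that(2) as] that(1) HF' by simp
  show ?thesis
  proof
    assume "\<exists>f\<in>(?A <+>\<^bsub>cring_of ts bs\<^esub> ?B) \<inter> (?J <+>\<^bsub>cring_of ts bs\<^esub> ?B). ev \<iota> \<Gamma> f \<noteq> 0"
    then obtain f where f: "f \<in> ?A <+>\<^bsub>cring_of ts bs\<^esub> ?B" "f \<in> ?J <+>\<^bsub>cring_of ts bs\<^esub> ?B" "ev \<iota> \<Gamma> f \<noteq> 0"
      by blast
    obtain a where a: "a \<in> ?A" "ev \<iota> \<Gamma> a \<noteq> 0" using zero_locus_set_add[OF \<iota>' f(1) van] f(3) by auto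
    obtain j where j: "j \<in> ?J" "ev \<iota> \<Gamma> j \<noteq> 0" using zero_locus_set_add[OF \<iota>' f(2) van] f(3) by auto
    have HF: ?HF using a zero_locus_ZO_iff[OF \<iota> P(2,1,3)] unfolding ideal_dfb_def by blast
    have "\<Gamma> \<notin> zero_locus \<iota> ts bs (Idl\<^bsub>cring_of ts bs\<^esub> {?\<delta>})"
      using a unfolding ideal_dfb_def zero_locus_def by blast
    then have D: ?D unfolding zero_locus_Idl[OF \<iota>' dP] using P(1) by blast
    have "\<Gamma> \<notin> zero_locus \<iota> ts bs ?J" using j unfolding zero_locus_def by blast
    then have "\<exists>a\<in>set as. ev \<iota> \<Gamma> (comb_hat n ts bs ts' bs' a) \<noteq> 0"
      unfolding ideal_J_def zero_locus_Idl[OF \<iota>' hP] using P(1) by blast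
    then show "?HF \<and> ?D \<and> ?S" using HF D S by blast
  next
    assume *: "?HF \<and> ?D \<and> ?S"
    then obtain a where a: "a \<in> set as" "ev \<iota> \<Gamma> (comb_hat n ts bs ts' bs' a) \<noteq> 0" using S by blast
    obtain z :: "(nat \<times> nat, 'k) mpoly" where z: "z \<in> ideal_ZO n ts bs H" "ev \<iota> \<Gamma> z \<noteq> 0"
      using zero_locus_ZO_iff[OF \<iota> P(2,1,3)] * by blast
    let ?h = "comb_hat n ts bs ts' bs' a"
    define f where "f = z * ?\<delta> * ?h"
    have zP: "z \<in> Pol (cvars ts bs)" using z(1) ideal_ZO_Pol by blast
    have h: "?h \<in> Pol (cvars ts bs)" using hP a(1) by blast
    have d: "?\<delta> \<in> Pol (cvars ts bs)" using dP by blast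
    have "(?\<delta> * ?h) * z \<in> ideal_ZO n ts bs H" by (rule ideal_ZO_mult[OF z(1) Pol_closed(4)[OF d h]])
    moreover have "(z * ?h) * ?\<delta> \<in> Idl\<^bsub>cring_of ts bs\<^esub> {?\<delta>}"
      using ideal_mpolyD(6)[OF Idl_mpoly(1)[OF dP] Pol_closed(4)[OF zP h]] Idl_mpoly(2)[OF dP] by blast
    ultimately have fA: "f \<in> ?A" unfolding ideal_dfb_def f_def by (simp add: mult_ac)
    have "(z * ?\<delta>) * ?h \<in> ?J" unfolding ideal_J_def
      using ideal_mpolyD(6)[OF Idl_mpoly(1)[OF hP] Pol_closed(4)[OF zP d]] Idl_mpoly(2)[OF hP] a(1) by blast
    then have fJ: "f \<in> ?J" by (simp add: f_def)
    have "f + 0 \<in> U <+>\<^bsub>cring_of ts bs\<^esub> ?B" if "f \<in> U" for U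
      using that ideal_mpolyD(2)[OF ideal_BO_closed_props(1)[of H]] unfolding set_add_def' by force
    then have "f \<in> (?A <+>\<^bsub>cring_of ts bs\<^esub> ?B) \<inter> (?J <+>\<^bsub>cring_of ts bs\<^esub> ?B)" using fA fJ by simp
    moreover have "ev \<iota> \<Gamma> f \<noteq> 0" using z(2) a(2) * by (simp add: f_def e.hom_mult)
    ultimately show "\<exists>f\<in>(?A <+>\<^bsub>cring_of ts bs\<^esub> ?B) \<inter> (?J <+>\<^bsub>cring_of ts bs\<^esub> ?B). ev \<iota> \<Gamma> f \<noteq> 0"
      by blast
  qed
qed

theorem mainTheorem14:
  fixes \<iota> :: "'k::Fields.field \<Rightarrow> 'l::Fields.field"
    and n l :: nat
    and ts bs :: "nat pp list"
    and H :: "nat \<Rightarrow> nat"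
    and ts' bs' :: "nat \<Rightarrow> nat pp list"
    and as :: "nat \<Rightarrow> (nat \<times> nat, 'k) mpoly list"
  assumes "field_hom \<iota>"
    and "enum_order_ideal n ts bs"
    and "admissible TYPE('k) n (length ts) H"
    and "dominates H (order_ideal_HF (set ts))"
    and "bij_betw (\<lambda>i. set (ts' i)) {..<l} {\<O>'. order_ideal n \<O>' \<and> order_ideal_HF \<O>' = H}"
    and "\<And>i. i < l \<Longrightarrow> enum_order_ideal n (ts' i) (bs' i)"
    and "\<And>i. i < l \<Longrightarrow> set (as i) \<subseteq> carrier (cring_of (ts' i) (bs' i))"
    and "\<And>i. i < l \<Longrightarrow> SCBLocus n (ts' i) (bs' i) = Idl\<^bsub>cring_of (ts' i) (bs' i)\<^esub> set (as i)"
  shows "BO_closed \<iota> n ts bs H - zero_locus \<iota> ts bs (ideal_NSCB n ts bs H l ts' bs' as) =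
    {\<Gamma> \<in> BO_stratum \<iota> n ts bs H. strict_cayley_bacharach n (point_ideal n ts bs \<Gamma>)}"
proof -
  note enum = assms(2) and enum' = assms(6) and as = assms(7,8)
  have \<iota>': "comm_ring_hom \<iota>" by (rule field_hom_comm_ring_hom[OF assms(1)])
  obtain I0 :: "(nat, 'k) mpoly set" where I0: "zero_dim_ideal n (length ts) I0" "affine_HF n I0 = H"
    using assms(3) unfolding admissible_def by blast
  have idl: "ideal I0 (xring n)" using I0(1) by (simp add: zero_dim_ideal_def)
  note I0' = affine_HF_le_dimension[OF I0(1)]
  interpret hilbert_function n ts bs H
    using enum affine_HF_mono[OF idl I0'(1)] I0'(2) affine_HF_0_le[OF idl I0'(1)] assms(4)
    unfolding I0(2) by unfold_locales (auto simp: dominates_def)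
  have HF': "order_ideal_HF (set (ts' i)) = H" if "i < l" for i
    using bij_betwE[OF assms(5)] that by auto
  let ?S = "\<lambda>i. (ideal_dfb n ts bs H (ts' i) <+>\<^bsub>cring_of ts bs\<^esub> ideal_BO_closed n ts bs H) \<inter>
     (ideal_J n ts bs (ts' i) (bs' i) (as i) <+>\<^bsub>cring_of ts bs\<^esub> ideal_BO_closed n ts bs H)"
  have dfb: "ideal_dfb n ts bs H (ts' i) <+>\<^bsub>cring_of ts bs\<^esub> ideal_BO_closed n ts bs H \<subseteq> (Pol (cvars ts bs) :: (nat \<times> nat, 'k) mpoly set)" for i
    using ideal_mpolyD(1)[OF ideal_BO_closed_props(1)] ideal_ZO_Pol Pol_closed(3)
    unfolding set_add_def' ideal_dfb_def by fastforce
  then have SP: "(\<Union>i<l. ?S i) \<subseteq> Pol (cvars ts bs)" by blast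
  have "\<Gamma> \<notin> zero_locus \<iota> ts bs (ideal_NSCB n ts bs H l ts' bs' as) \<longleftrightarrow>
      \<Gamma> \<in> BO_stratum \<iota> n ts bs H \<and> strict_cayley_bacharach n (point_ideal n ts bs \<Gamma>)"
    if \<Gamma>: "\<Gamma> \<in> BO_closed \<iota> n ts bs H" for \<Gamma>
  proof -
    note P = BO_closed_props[OF assms(1) \<Gamma>]
    let ?HF = "affine_HF n (point_ideal n ts bs \<Gamma>)"
    have iff: "(\<exists>f\<in>?S i. ev \<iota> \<Gamma> f \<noteq> 0) \<longleftrightarrow> ?HF = H \<and>
        ev \<iota> \<Gamma> (comb_delta n ts bs (ts' i) :: (nat \<times> nat, 'k) mpoly) \<noteq> 0 \<and>
        strict_cayley_bacharach n (point_ideal n ts bs \<Gamma>)" if "i < l" for i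
      by (rule summand_nonzero_iff[OF assms(1) \<Gamma> enum'[OF that] HF'[OF that] as(1)[OF that, simplified] as(2)[OF that]])
    have ex: "\<exists>i<l. ev \<iota> \<Gamma> (comb_delta n ts bs (ts' i) :: (nat \<times> nat, 'k) mpoly) \<noteq> 0" if HF: "?HF = H"
    proof -
      obtain \<O> where \<O>: "order_ideal n \<O>" "order_ideal_HF \<O> = ?HF" "indep_mod (point_ideal n ts bs \<Gamma>) \<O>"
        using ex_basis_order_ideal[OF point_ideal_props(1)[OF enum] point_HF(4,2)[OF enum P(2)]] by blast
      then have "\<O> \<in> (\<lambda>i. set (ts' i)) ` {..<l}"
        using assms(5) HF unfolding bij_betw_def by blast
      then obtain i where i: "i < l" "set (ts' i) = \<O>" by blast
      note T = enum_order_ideal_terms[OF enum'[OF i(1)]]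
      show ?thesis
        using comb_delta_nonzero_iff[OF \<iota>' enum P(2) T length_order_ideal[OF enum'[OF i(1)] HF'[OF i(1)]]]
          \<O>(3) i by blast
    qed
    have "\<Gamma> \<notin> zero_locus \<iota> ts bs (ideal_NSCB n ts bs H l ts' bs' as) \<longleftrightarrow> (\<exists>i<l. \<exists>f\<in>?S i. ev \<iota> \<Gamma> f \<noteq> 0)"
      unfolding ideal_NSCB_def zero_locus_Idl[OF \<iota>' SP] using P(1) by blast
    also have "\<dots> \<longleftrightarrow> ?HF = H \<and> strict_cayley_bacharach n (point_ideal n ts bs \<Gamma>)"
      using iff ex by blast
    also have "\<dots> \<longleftrightarrow> \<Gamma> \<in> BO_stratum \<iota> n ts bs H \<and> strict_cayley_bacharach n (point_ideal n ts bs \<Gamma>)"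
      unfolding BO_stratum_iff[OF assms(1)] using \<Gamma> by blast
    finally show ?thesis .
  qed
  moreover have "BO_stratum \<iota> n ts bs H \<subseteq> BO_closed \<iota> n ts bs H" by (auto simp: BO_stratum_def)
  ultimately show ?thesis by blast
qed


end
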